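(* There exists a differentiable function $\varphi:\mathbb{R}\to\mathbb{R}$ such that for each $m\in\mathbb{R}$, $$\bar H_N(m)\to\varphi(m)\qquad\text{as }N\to\infty .$$ Moreover, there exists a positive constant $C$ such that for any $N\ge1$ and $m\in\mathbb{R}$, $$\left|\bar H_N(m)-\varphi(m)\right|\le C\,\frac{m^2+1}{N}.$$
   Context: Hamiltonian. Fix $R\in\mathbb{N}$, $\delta>0$, a function $h:\mathbb{Z}\to(-1,1)$, and a twice differentiable $\psi_b:\mathbb{R}\to\mathbb{R}$ with $|\psi_b|_\infty+|\psi_b'|_\infty+|\psi_b''|_\infty<\infty$; set $\psi(z)=\frac12z^2+\psi_b(z)$. Put $M_{ii}=1$; for $i\neq j$, $M_{ij}=M_{ji}=h(|i-j|)$, with $M_{ij}=0$ if $|i-j|>R$. Assume strict diagonal dominance: for every $N$ and $i\in[N]=\{1,\dots,N\}$, $\sum_{1\le|j-i|\le R}|M_{ij}|+\delta\le1$. For $x\in\mathbb{R}^N$ (with $x_j=0$ for $j\notin[N]$), $$H(x)=H_N(x)=\sum_{i=1}^N\Big(\psi(x_i)+\frac12\sum_{j:1\le|j-i|\le R}M_{ij}x_ix_j\Big).$$ One-dimensional coarse-grained Hamiltonian: $$\bar H_N(m)=-\frac1N\log\int_{\{\frac1N\sum_{i=1}^Nx_i=m\}}\exp(-H(x))\,\mathcal{L}^{N-1}(dx),$$ where $\mathcal{L}^{N-1}$ is the $(N-1)$-dimensional Hausdorff measure on the hyperplane. *)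

theory Defs
  imports "HOL-Analysis.Analysis"
begin

section \<open>Hausdorff measure\<close>

text \<open>
  \<open>d\<close> is a distance function on the carrier \<open>X\<close>, and \<open>n\<close> is the dimension. The normalising
  constant \<open>unit_ball_vol n / 2 ^ n\<close> is the usual one, for which the \<open>n\<close>-dimensional Hausdorff
  measure on Euclidean \<open>n\<close>-space is Lebesgue measure. For \<open>n = 0\<close> a nonempty set has weight
  \<open>1\<close> and the empty set has weight \<open>0\<close>, which gives counting measure.
\<close>

definition set_diam :: "('a \<Rightarrow> 'a \<Rightarrow> real) \<Rightarrow> 'a set \<Rightarrow> ennreal" where
  "set_diam d U = (SUP x\<in>U. SUP y\<in>U. ennreal (d x y))"

definition hausdorff_weight :: "('a \<Rightarrow> 'a \<Rightarrow> real) \<Rightarrow> nat \<Rightarrow> 'a set \<Rightarrow> ennreal" where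
  "hausdorff_weight d n U =
     (if U = {} then 0 else ennreal (unit_ball_vol (real n) / 2 ^ n) * set_diam d U ^ n)"

definition hausdorff_cover ::
    "('a \<Rightarrow> 'a \<Rightarrow> real) \<Rightarrow> 'a set \<Rightarrow> real \<Rightarrow> 'a set \<Rightarrow> (nat \<Rightarrow> 'a set) set" where
  "hausdorff_cover d X \<epsilon> A =
     {U. (\<forall>k. U k \<subseteq> X \<and> set_diam d (U k) \<le> ennreal \<epsilon>) \<and> A \<subseteq> (\<Union>k. U k)}"

definition hausdorff_outer :: "('a \<Rightarrow> 'a \<Rightarrow> real) \<Rightarrow> 'a set \<Rightarrow> nat \<Rightarrow> 'a set \<Rightarrow> ennreal" where
  "hausdorff_outer d X n A =
     (SUP \<epsilon>\<in>{0<..}. INF U\<in>hausdorff_cover d X \<epsilon> A. \<Sum>k. hausdorff_weight d n (U k))"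

text \<open>The measurable sets are those given by the Caratheodory criterion.\<close>

definition hausdorff_measure :: "('a \<Rightarrow> 'a \<Rightarrow> real) \<Rightarrow> 'a set \<Rightarrow> nat \<Rightarrow> 'a measure" where
  "hausdorff_measure d X n =
     measure_of X (lambda_system X (Pow X) (hausdorff_outer d X n)) (hausdorff_outer d X n)"

lemma set_diam_empty [simp]: "set_diam d {} = 0"
  by (simp add: set_diam_def bot_ennreal)

lemma outer_measure_space_hausdorff_outer:
  "outer_measure_space (Pow X) (hausdorff_outer d X n)"
  unfolding outer_measure_space_def
proof (intro conjI)
  have "(INF U\<in>hausdorff_cover d X \<epsilon> {}. \<Sum>k. hausdorff_weight d n (U k)) \<le> 0" for \<epsilon>
    by (rule INF_lower2[of "\<lambda>_. {}"]) (auto simp: hausdorff_cover_def hausdorff_weight_def)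
  then show "positive (Pow X) (hausdorff_outer d X n)"
    unfolding positive_def hausdorff_outer_def
    by (intro antisym SUP_least) auto
  show "increasing (Pow X) (hausdorff_outer d X n)"
    unfolding increasing_def hausdorff_outer_def
    by (intro ballI impI SUP_mono' INF_superset_mono) (auto simp: hausdorff_cover_def)
  show "countably_subadditive (Pow X) (hausdorff_outer d X n)"
    unfolding countably_subadditive_def
  proof (intro allI impI)
    fix A :: "nat \<Rightarrow> 'a set"
    let ?F = "\<lambda>U. \<Sum>k. hausdorff_weight d n (U k)"
    let ?P = "\<lambda>\<epsilon> B. INF U\<in>hausdorff_cover d X \<epsilon> B. ?F U"
    have P: "?P \<epsilon> (\<Union>i. A i) \<le> (\<Sum>i. ?P \<epsilon> (A i))" for \<epsilon>
    proof (rule ennreal_le_epsilon)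
      fix e :: real
      assume e: "0 < e" and fin: "(\<Sum>i. ?P \<epsilon> (A i)) < top"
      have "\<exists>U\<in>hausdorff_cover d X \<epsilon> (A i). ?F U < ?P \<epsilon> (A i) + ennreal (e * (1/2) ^ Suc i)" for i
      proof -
        have "?P \<epsilon> (A i) \<noteq> top"
          using fin ennreal_suminf_lessD less_irrefl by metis
        then have "?P \<epsilon> (A i) < ?P \<epsilon> (A i) + ennreal (e * (1/2) ^ Suc i)"
          using e by (simp add: ennreal_add_left_cancel_less[of _ 0, simplified] less_top)
        then show ?thesis by (simp add: INF_less_iff)
      qed
      then obtain U where U: "\<And>i. U i \<in> hausdorff_cover d X \<epsilon> (A i)"
        and lt: "\<And>i. ?F (U i) < ?P \<epsilon> (A i) + ennreal (e * (1/2) ^ Suc i)"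
        by metis
      let ?V = "\<lambda>k. case prod_decode k of (i, j) \<Rightarrow> U i j"
      have "?V \<in> hausdorff_cover d X \<epsilon> (\<Union>i. A i)"
      proof -
        have "(\<Union>i. A i) \<subseteq> (\<Union>k. ?V k)"
        proof
          fix x assume "x \<in> (\<Union>i. A i)"
          then obtain i where "x \<in> A i" by blast
          moreover have "A i \<subseteq> (\<Union>j. U i j)" using U[of i] by (simp add: hausdorff_cover_def)
          ultimately obtain j where "x \<in> U i j" by blast
          then have "x \<in> ?V (prod_encode (i, j))" by simp
          then show "x \<in> (\<Union>k. ?V k)" by (rule UN_I[OF UNIV_I])
        qed
        moreover have "?V k \<subseteq> X \<and> set_diam d (?V k) \<le> ennreal \<epsilon>" for k
          using U by (simp add: hausdorff_cover_def split: prod.split)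
        ultimately show ?thesis unfolding hausdorff_cover_def by blast
      qed
      then have "?P \<epsilon> (\<Union>i. A i) \<le> ?F ?V" by (rule INF_lower)
      also have "\<dots> = (\<Sum>i. ?F (U i))"
        by (subst suminf_ennreal_2dimen[of "\<lambda>i. ?F (U i)" "\<lambda>(i, j). hausdorff_weight d n (U i j)",
              symmetric]) (auto simp: case_prod_beta comp_def)
      also have "\<dots> \<le> (\<Sum>i. ?P \<epsilon> (A i) + ennreal (e * (1/2) ^ Suc i))"
        using lt by (intro suminf_le) (auto intro: less_imp_le)
      also have "\<dots> = (\<Sum>i. ?P \<epsilon> (A i)) + (\<Sum>i. ennreal (e * (1/2) ^ Suc i))"
        by (rule suminf_add[symmetric]) auto
      also have "(\<Sum>i. ennreal (e * (1/2) ^ Suc i)) = ennreal e"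
        using e sums_mult[OF power_half_series, of e]
        by (intro sums_unique[symmetric]) (simp add: sums_ennreal del: power_Suc)
      finally show "?P \<epsilon> (\<Union>i. A i) \<le> (\<Sum>i. ?P \<epsilon> (A i)) + ennreal e" .
    qed
    show "hausdorff_outer d X n (\<Union>i. A i) \<le> (\<Sum>i. hausdorff_outer d X n (A i))"
      unfolding hausdorff_outer_def
      by (intro SUP_least order_trans[OF P] suminf_le SUP_upper) auto
  qed
qed

lemma space_hausdorff_measure [simp]: "space (hausdorff_measure d X n) = X"
  by (auto simp: hausdorff_measure_def lambda_system_def intro!: space_measure_of)

lemma measure_space_hausdorff_outer:
  "measure_space X (lambda_system X (Pow X) (hausdorff_outer d X n)) (hausdorff_outer d X n)"
  by (rule sigma_algebra.caratheodory_lemma[OF sigma_algebra_Pow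
        outer_measure_space_hausdorff_outer])

lemma sets_hausdorff_measure:
  "sets (hausdorff_measure d X n) = lambda_system X (Pow X) (hausdorff_outer d X n)"
  unfolding hausdorff_measure_def
  using measure_space_hausdorff_outer[of X d n]
  by (intro sigma_algebra.sets_measure_of_eq) (simp add: measure_space_def)

lemma emeasure_hausdorff_measure:
  assumes "A \<in> sets (hausdorff_measure d X n)"
  shows "emeasure (hausdorff_measure d X n) A = hausdorff_outer d X n A"
  using assms measure_space_hausdorff_outer[of X d n] sets_hausdorff_measure[of d X n]
  by (intro emeasure_measure_of[OF hausdorff_measure_def])
    (auto simp: measure_space_def lambda_system_def)

section \<open>The Hamiltonian and its coarse graining\<close>

text \<open>
  A configuration \<open>x\<close> of \<open>\<real>\<^sup>N\<close> is a function on \<open>\<int>\<close> that vanishes outside \<open>{1..N}\<close>, so that the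
  neighbours \<open>j\<close> of a site \<open>i\<close> range over \<open>\<int>\<close> and sites outside \<open>{1..N}\<close> contribute nothing.
\<close>

definition configs :: "nat \<Rightarrow> (int \<Rightarrow> real) set" where
  "configs N = {x. \<forall>j. j \<notin> {1..int N} \<longrightarrow> x j = 0}"

definition eucl_dist :: "nat \<Rightarrow> (int \<Rightarrow> real) \<Rightarrow> (int \<Rightarrow> real) \<Rightarrow> real" where
  "eucl_dist N x y = sqrt (\<Sum>i\<in>{1..int N}. (x i - y i)\<^sup>2)"

definition hyperplane :: "nat \<Rightarrow> real \<Rightarrow> (int \<Rightarrow> real) set" where
  "hyperplane N m = {x \<in> configs N. (1 / real N) * (\<Sum>i\<in>{1..int N}. x i) = m}"

definition neighbours :: "nat \<Rightarrow> int \<Rightarrow> int set" where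
  "neighbours R i = {j. 1 \<le> \<bar>j - i\<bar> \<and> \<bar>j - i\<bar> \<le> int R}"

definition coupling :: "nat \<Rightarrow> (int \<Rightarrow> real) \<Rightarrow> int \<Rightarrow> int \<Rightarrow> real" where
  "coupling R h i j = (if i = j then 1 else if \<bar>i - j\<bar> > int R then 0 else h \<bar>i - j\<bar>)"

definition hamiltonian ::
    "nat \<Rightarrow> (int \<Rightarrow> real) \<Rightarrow> (real \<Rightarrow> real) \<Rightarrow> nat \<Rightarrow> (int \<Rightarrow> real) \<Rightarrow> real" where
  "hamiltonian R h \<psi> N x =
     (\<Sum>i\<in>{1..int N}. \<psi> (x i) + 1/2 * (\<Sum>j\<in>neighbours R i. coupling R h i j * x i * x j))"

definition coarse_hamiltonian ::
    "nat \<Rightarrow> (int \<Rightarrow> real) \<Rightarrow> (real \<Rightarrow> real) \<Rightarrow> nat \<Rightarrow> real \<Rightarrow> real" where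
  "coarse_hamiltonian R h \<psi> N m =
     - (1 / real N) * ln (\<integral>x. exp (- hamiltonian R h \<psi> N x)
          \<partial>hausdorff_measure (eucl_dist N) (hyperplane N m) (N - 1))"

end

theory Submission
  imports Defs
begin

text \<open>
  On a hyperplane the Hausdorff measure is a multiple of Lebesgue measure in \<open>N - 1\<close> coordinates; the
  isodiametric inequality for the induced norm, a consequence of Prekopa--Leindler, identifies the
  multiple. So \<open>exp (- N H\<^bsub>N\<^esub>(m))\<close> is, up to a factor \<open>\<surd>N\<close>, the density at \<open>N m\<close> of the total spin
  under the unnormalised Gibbs measure. Tilting by a field \<open>\<sigma>\<close> multiplies the density at \<open>s\<close> by
  \<open>exp (\<sigma> s)\<close>. Splitting the chain changes the log partition function by \<open>O(1 + \<sigma>\<^sup>2)\<close>, so it is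
  \<open>N A(\<sigma>) + O(1 + \<sigma>\<^sup>2)\<close> with \<open>A\<close> convex, and the limit is the Legendre transform of \<open>A\<close>. This reduces
  the rate to a local limit theorem without exact constant: for the field with mean spin \<open>N m\<close>, the
  tilted density at \<open>N m\<close> is of order \<open>1 / \<surd>N\<close>. The upper bound holds because shifting all spins
  gives \<open>z(s)\<^sup>2 \<le> z(s + u) z(s - u) exp (K u\<^sup>2 / N)\<close>; with Chebyshev's inequality and a variance bound
  of order \<open>N\<close> so does the lower one. The variance bound follows from exponential decay of
  correlations, obtained for two replicas by exchanging them to the right of a cut. The limit is
  convex, and semiconcave by the same shift inequality, hence differentiable.
\<close>

text \<open>The bounded part of the potential need not be convex, so convexity methods give no
  control of correlations; and the spins are unbounded, so the energy across a cut has no uniform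
  bound and one exchange of replicas gives no uniform contraction. The remedy is an exponential
  bound on tanh: each cut gains a fixed factor at the price of a small multiple of the cut energy,
  and a slight tilt of the two-replica quadratic form pays that price, at a cost controlled by
  second moments. All this is uniform in the field \<sigma>, because the field cancels in
  differences of replicas. The rate is then read off the constants: the boundary term of a splitting
  is a second moment of order 1 + \<sigma>^2, and the quadratic growth of the free energy forces the
  field belonging to mean m to be of order 1 + |m|, whence m^2 + 1. No logarithm of N is left,
  because the factor sqrt N of the hyperplane measure cancels the order 1 / sqrt N of the
  density.\<close>

abbreviation Leb :: "'i set \<Rightarrow> ('i \<Rightarrow> real) measure" where
  "Leb I \<equiv> Pi\<^sub>M I (\<lambda>_. lborel)"

interpretation Leb: product_sigma_finite "\<lambda>_::'i. lborel :: real measure"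
  by standard

section \<open>Lebesgue product measure and the Prekopa--Leindler inequality\<close>

lemma nn_integral_Leb_affine:
  fixes v :: "'i \<Rightarrow> real"
  assumes "finite I" and c: "c \<noteq> 0" and [measurable]: "f \<in> borel_measurable (Leb I)"
  shows "(\<integral>\<^sup>+x. f x \<partial>Leb I)
    = ennreal (\<bar>c\<bar> ^ card I) * (\<integral>\<^sup>+x. f (\<lambda>i\<in>I. v i + c * x i) \<partial>Leb I)"
proof -
  let ?T = "\<lambda>x. \<lambda>i\<in>I. v i + c * x i"
  let ?P = "density (distr (Leb I) (Leb I) ?T) (\<lambda>_. ennreal (\<bar>c\<bar> ^ card I))"
  have T [measurable]: "?T \<in> measurable (Leb I) (Leb I)" by measurable
  have "?P = Leb I"
  proof (rule Leb.PiM_eqI)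
    fix A :: "'i \<Rightarrow> real set" assume A [measurable]: "\<And>i. i \<in> I \<Longrightarrow> A i \<in> sets lborel"
    have m: "{t. v i + c * t \<in> A i} \<in> sets lborel" if "i \<in> I" for i
      using A[OF that] by measurable
    have box: "Pi\<^sub>E I A \<in> sets (Leb I)"
      using \<open>finite I\<close> A by (intro sets_PiM_I_finite) auto
    have "emeasure ?P (Pi\<^sub>E I A) = ennreal (\<bar>c\<bar> ^ card I) * emeasure (Leb I) (?T -` (Pi\<^sub>E I A) \<inter> space (Leb I))"
      using box by (simp add: emeasure_density nn_integral_cmult emeasure_distr)
    also have "?T -` (Pi\<^sub>E I A) \<inter> space (Leb I) = Pi\<^sub>E I (\<lambda>i. {t. v i + c * t \<in> A i})"
      by (auto simp: space_PiM PiE_iff)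
    also have "emeasure (Leb I) \<dots> = (\<Prod>i\<in>I. emeasure lborel {t. v i + c * t \<in> A i})"
      using \<open>finite I\<close> m by (intro Leb.emeasure_PiM) auto
    also have "ennreal (\<bar>c\<bar> ^ card I) * \<dots> = (\<Prod>i\<in>I. ennreal \<bar>c\<bar> * emeasure lborel {t. v i + c * t \<in> A i})"
      by (simp add: prod.distrib ennreal_power)
    also have "\<dots> = (\<Prod>i\<in>I. emeasure lborel (A i))"
    proof (rule prod.cong[OF refl])
      fix i assume i: "i \<in> I"
      note A[OF i, measurable]
      have "emeasure lborel (A i) = (\<integral>\<^sup>+t. indicator (A i) t \<partial>lborel)" using A[OF i] by simp
      also have "\<dots> = \<bar>c\<bar> * (\<integral>\<^sup>+t. indicator (A i) (v i + c * t) \<partial>lborel)"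
        using A[OF i] c by (intro nn_integral_real_affine) auto
      also have "(\<integral>\<^sup>+t. indicator (A i) (v i + c * t) \<partial>lborel) = (\<integral>\<^sup>+t. indicator {t. v i + c * t \<in> A i} t \<partial>lborel)"
        by (intro nn_integral_cong) (auto simp: indicator_def)
      also have "\<dots> = emeasure lborel {t. v i + c * t \<in> A i}" using m[OF i] by simp
      finally show "ennreal \<bar>c\<bar> * emeasure lborel {t. v i + c * t \<in> A i} = emeasure lborel (A i)" by simp
    qed
    finally show "emeasure ?P (Pi\<^sub>E I A) = (\<Prod>i\<in>I. emeasure lborel (A i))" .
  qed (use \<open>finite I\<close> in auto)
  then have "(\<integral>\<^sup>+x. f x \<partial>Leb I) = (\<integral>\<^sup>+x. f x \<partial>?P)" by simp
  also have "\<dots> = ennreal (\<bar>c\<bar> ^ card I) * (\<integral>\<^sup>+x. f (?T x) \<partial>Leb I)"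
    by (simp add: nn_integral_density nn_integral_distr nn_integral_cmult)
  finally show ?thesis .
qed

lemma emeasure_Leb_affine:
  fixes v :: "'i \<Rightarrow> real"
  assumes "finite I" and c: "c \<noteq> 0" and A [measurable]: "A \<in> sets (Leb I)"
  shows "emeasure (Leb I) A
    = ennreal (\<bar>c\<bar> ^ card I) * emeasure (Leb I) {x \<in> space (Leb I). (\<lambda>i\<in>I. v i + c * x i) \<in> A}"
proof -
  have "emeasure (Leb I) A = (\<integral>\<^sup>+x. indicator A x \<partial>Leb I)" by simp
  also have "\<dots> = ennreal (\<bar>c\<bar> ^ card I) * (\<integral>\<^sup>+x. indicator A (\<lambda>i\<in>I. v i + c * x i) \<partial>Leb I)"
    using assms by (intro nn_integral_Leb_affine) auto
  also have "(\<integral>\<^sup>+x. indicator A (\<lambda>i\<in>I. v i + c * x i) \<partial>Leb I)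
     = (\<integral>\<^sup>+x. indicator {x \<in> space (Leb I). (\<lambda>i\<in>I. v i + c * x i) \<in> A} x \<partial>Leb I)"
    by (intro nn_integral_cong) (auto simp: indicator_def)
  also have "\<dots> = emeasure (Leb I) {x \<in> space (Leb I). (\<lambda>i\<in>I. v i + c * x i) \<in> A}"
    by (intro nn_integral_indicator) measurable
  finally show ?thesis .
qed

text \<open>Cut points taken in \<open>A\<close> and increasing to its supremum exhaust
  \<open>A\<close> up to the supremum itself, and a point is null. Cutting at points of the set
  plays the part of the maximum of a compact set in the usual proof of Brunn-Minkowski.\<close>

lemma emeasure_le_SUP_below:
  fixes A :: "real set"
  assumes A [measurable]: "A \<in> sets borel" and "A \<noteq> {}"
  shows "emeasure lborel A \<le> (SUP a\<in>A. emeasure lborel (A \<inter> {..<a}))"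
proof -
  obtain f :: "nat \<Rightarrow> ereal" where f: "incseq f" "range f \<subseteq> ereal ` A" "Sup (ereal ` A) = (SUP i. f i)"
    using Sup_countable_SUP[of "ereal ` A"] \<open>A \<noteq> {}\<close> by auto
  have "\<forall>n. \<exists>x\<in>A. f n = ereal x" using f(2) by auto
  then obtain a where a: "\<And>n. a n \<in> A" "\<And>n. f n = ereal (a n)" by metis
  let ?s = "Sup (ereal ` A)"
  have inc: "incseq (\<lambda>n. A \<inter> {..<a n})"
    using f(1) a(2) by (auto simp: incseq_def le_fun_def) (metis ereal_less_eq(3) less_le_trans)
  have sub: "A \<subseteq> (\<Union>n. A \<inter> {..<a n}) \<union> {real_of_ereal ?s}"
  proof
    fix x assume x: "x \<in> A"
    then have "ereal x \<le> ?s" by (auto intro: Sup_upper)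
    then consider "ereal x < ?s" | "ereal x = ?s" by force
    then show "x \<in> (\<Union>n. A \<inter> {..<a n}) \<union> {real_of_ereal ?s}"
    proof cases
      case 1
      then obtain n where "ereal x < f n" unfolding f(3) by (auto simp: less_SUP_iff)
      then show ?thesis using x a by auto
    next
      case 2
      then show ?thesis by (metis UnI2 real_of_ereal.simps(1) singletonI)
    qed
  qed
  have "emeasure lborel A \<le> emeasure lborel ((\<Union>n. A \<inter> {..<a n}) \<union> {real_of_ereal ?s})"
    using sub by (intro emeasure_mono) auto
  also have "\<dots> \<le> emeasure lborel (\<Union>n. A \<inter> {..<a n}) + emeasure lborel {real_of_ereal ?s}"
    by (intro emeasure_subadditive) auto
  also have "\<dots> = (SUP n. emeasure lborel (A \<inter> {..<a n}))"
    using inc by (simp add: SUP_emeasure_incseq image_subset_iff)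
  also have "\<dots> \<le> (SUP a\<in>A. emeasure lborel (A \<inter> {..<a}))"
    using a(1) by (intro SUP_least SUP_upper)
  finally show ?thesis .
qed

lemma emeasure_lborel_real_affine:
  fixes A :: "real set"
  assumes A [measurable]: "A \<in> sets borel" and c: "c \<noteq> 0"
  shows "emeasure lborel A = ennreal \<bar>c\<bar> * emeasure lborel {z. t + c * z \<in> A}"
proof -
  have "emeasure lborel A = (\<integral>\<^sup>+z. indicator A z \<partial>lborel)" by simp
  also have "\<dots> = \<bar>c\<bar> * (\<integral>\<^sup>+z. indicator A (t + c * z) \<partial>lborel)"
    using c by (intro nn_integral_real_affine) auto
  also have "(\<integral>\<^sup>+z. indicator A (t + c * z) \<partial>lborel) = (\<integral>\<^sup>+z. indicator {z. t + c * z \<in> A} z \<partial>lborel)"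
    by (intro nn_integral_cong) (auto simp: indicator_def)
  also have "\<dots> = emeasure lborel {z. t + c * z \<in> A}"
    by (intro nn_integral_indicator) measurable
  finally show ?thesis .
qed

lemma emeasure_le_SUP_above:
  fixes A :: "real set"
  assumes A [measurable]: "A \<in> sets borel" and "A \<noteq> {}"
  shows "emeasure lborel A \<le> (SUP a\<in>A. emeasure lborel (A \<inter> {a<..}))"
proof -
  have 1: "emeasure lborel A = emeasure lborel {z. -z \<in> A}"
    using emeasure_lborel_real_affine[of A "-1" 0] A by simp
  have "emeasure lborel {z. -z \<in> A} \<le> (SUP a\<in>{z. -z \<in> A}. emeasure lborel ({z. -z \<in> A} \<inter> {..<a}))"
  proof (rule emeasure_le_SUP_below)
    obtain a where "a \<in> A" using \<open>A \<noteq> {}\<close> by auto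
    then have "-a \<in> {z. -z \<in> A}" by simp
    then show "{z. -z \<in> A} \<noteq> {}" by blast
  qed measurable
  also have "\<dots> \<le> (SUP a\<in>A. emeasure lborel (A \<inter> {a<..}))"
  proof (rule SUP_least)
    fix a assume a: "a \<in> {z. -z \<in> A}"
    have "emeasure lborel (A \<inter> {-a<..}) = emeasure lborel {z. -z \<in> A \<inter> {-a<..}}"
      using emeasure_lborel_real_affine[of "A \<inter> {-a<..}" "-1" 0] A by simp
    also have "{z. -z \<in> A \<inter> {-a<..}} = {z. -z \<in> A} \<inter> {..<a}" by auto
    finally have "emeasure lborel ({z. -z \<in> A} \<inter> {..<a}) = emeasure lborel (A \<inter> {-a<..})" by simp
    also have "\<dots> \<le> (SUP a\<in>A. emeasure lborel (A \<inter> {a<..}))"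
      using a by (intro SUP_upper) auto
    finally show "emeasure lborel ({z. -z \<in> A} \<inter> {..<a}) \<le> (SUP a\<in>A. emeasure lborel (A \<inter> {a<..}))" .
  qed
  finally show ?thesis using 1 by simp
qed

text \<open>For \<open>a\<close> in \<open>A\<close> and \<open>b\<close> in \<open>B\<close>, the
  midpoints of \<open>b\<close> with the part of \<open>A\<close> below \<open>a\<close>, and of
  \<open>a\<close> with the part of \<open>B\<close> above \<open>b\<close>, lie in \<open>C\<close>
  on opposite sides of (a + b) / 2. Being disjoint, they add up; then \<open>a\<close> and
  \<open>b\<close> move to the ends. \<open>C\<close> is any measurable set containing the
  midpoints, so the measurability of a Minkowski sum never arises.\<close>

lemma Brunn_Minkowski_real:
  fixes A B C :: "real set"
  assumes [measurable]: "A \<in> sets borel" "B \<in> sets borel" "C \<in> sets borel"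
    and ne: "A \<noteq> {}" "B \<noteq> {}" and mid: "\<And>a b. a \<in> A \<Longrightarrow> b \<in> B \<Longrightarrow> (a + b) / 2 \<in> C"
  shows "emeasure lborel A + emeasure lborel B \<le> 2 * emeasure lborel C"
proof -
  have *: "emeasure lborel (A \<inter> {..<a}) + emeasure lborel (B \<inter> {b<..}) \<le> 2 * emeasure lborel C"
    if ab: "a \<in> A" "b \<in> B" for a b
  proof -
    let ?A = "{z. -b + 2 * z \<in> A \<inter> {..<a}}" and ?B = "{z. -a + 2 * z \<in> B \<inter> {b<..}}"
    have [measurable]: "?A \<in> sets borel" "?B \<in> sets borel" by measurable
    have "emeasure lborel (A \<inter> {..<a}) + emeasure lborel (B \<inter> {b<..})
       = 2 * emeasure lborel ?A + 2 * emeasure lborel ?B"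
      using emeasure_lborel_real_affine[of "A \<inter> {..<a}" 2 "-b"]
        emeasure_lborel_real_affine[of "B \<inter> {b<..}" 2 "-a"] by simp
    also have "\<dots> = 2 * emeasure lborel (?A \<union> ?B)"
      by (subst plus_emeasure[symmetric]) (auto simp: distrib_left)
    also have "?A \<union> ?B \<subseteq> C"
    proof
      fix z assume "z \<in> ?A \<union> ?B"
      then consider "-b + 2 * z \<in> A" | "-a + 2 * z \<in> B" by auto
      then show "z \<in> C"
        using mid[of "-b + 2 * z" b] mid[of a "-a + 2 * z"] ab by cases auto
    qed
    then have "2 * emeasure lborel (?A \<union> ?B) \<le> 2 * emeasure lborel C"
      by (intro mult_left_mono emeasure_mono) auto
    finally show ?thesis .
  qed
  have "emeasure lborel A + emeasure lborel B
     \<le> (SUP a\<in>A. emeasure lborel (A \<inter> {..<a})) + (SUP b\<in>B. emeasure lborel (B \<inter> {b<..}))"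
    using ne by (intro add_mono emeasure_le_SUP_below emeasure_le_SUP_above) auto
  also have "\<dots> = (SUP a\<in>A. SUP b\<in>B. emeasure lborel (A \<inter> {..<a}) + emeasure lborel (B \<inter> {b<..}))"
    using ne by (simp add: ennreal_SUP_add_left[symmetric] ennreal_SUP_add_right[symmetric])
  also have "\<dots> \<le> 2 * emeasure lborel C" using * by (intro SUP_least) auto
  finally show ?thesis .
qed

text \<open>Layer cake with levels in (0, 1): after normalising the suprema to 1 these are the
  levels at which the superlevel sets of both functions are nonempty.\<close>

lemma nn_integral_superlevel:
  fixes F :: ennreal
  shows "(\<integral>\<^sup>+s. indicator {s. 0 < s \<and> s < 1 \<and> ennreal s < F} s \<partial>lborel) = min F 1"
proof -
  have "{s. 0 < s \<and> s < 1 \<and> ennreal s < F} = {0<..<enn2real (min F 1)}"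
  proof (cases "F \<le> 1")
    case True
    then obtain r where "F = ennreal r" "0 \<le> r" "r \<le> 1" by (cases F) (auto simp: top_unique)
    then show ?thesis by (auto simp: ennreal_less_iff min_def)
  next
    case False
    then have "1 < F" by simp
    moreover have "s < 1 \<Longrightarrow> ennreal s < F" for s :: real
      using \<open>1 < F\<close> by (metis ennreal_1 ennreal_leI less_imp_le order.strict_trans1)
    ultimately show ?thesis by (auto simp: min_def)
  qed
  then have "(\<integral>\<^sup>+s. indicator {s. 0 < s \<and> s < 1 \<and> ennreal s < F} s \<partial>lborel) = ennreal (enn2real (min F 1))"
    by simp
  also have "\<dots> = min F 1"
    by (rule ennreal_enn2real) (simp add: min_less_iff_disj)
  finally show ?thesis .
qed

text \<open>With both suprema equal to 1, every level s < 1 has nonempty superlevel sets for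
  \<open>f\<close> and \<open>g\<close>, and midpoints of these lie in the superlevel set of
  \<open>h\<close>. Brunn-Minkowski at each level, integrated over the levels, gives a bound on the
  arithmetic mean, stronger than the multiplicative form.\<close>

lemma Prekopa_Leindler_normalized:
  fixes f g h :: "real \<Rightarrow> ennreal"
  assumes [measurable]: "f \<in> borel_measurable borel" "g \<in> borel_measurable borel" "h \<in> borel_measurable borel"
    and sup: "(SUP x. f x) = 1" "(SUP x. g x) = 1"
    and mid: "\<And>x y. f x * g y \<le> (h ((x + y) / 2))\<^sup>2"
  shows "(\<integral>\<^sup>+x. f x \<partial>lborel) + (\<integral>\<^sup>+x. g x \<partial>lborel) \<le> 2 * (\<integral>\<^sup>+x. h x \<partial>lborel)"
proof -
  have layer: "(\<integral>\<^sup>+x. min (F x) 1 \<partial>lborel)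
      = (\<integral>\<^sup>+s. indicator {0<..<1} s * emeasure lborel {x. ennreal s < F x} \<partial>lborel)"
    if [measurable]: "F \<in> borel_measurable borel" for F :: "real \<Rightarrow> ennreal"
  proof -
    have "(\<integral>\<^sup>+x. min (F x) 1 \<partial>lborel)
       = (\<integral>\<^sup>+x. \<integral>\<^sup>+s. indicator {s. 0 < s \<and> s < 1 \<and> ennreal s < F x} s \<partial>lborel \<partial>lborel)"
      by (simp add: nn_integral_superlevel del: nn_integral_indicator)
    also have "\<dots> = (\<integral>\<^sup>+s. \<integral>\<^sup>+x. indicator {s. 0 < s \<and> s < 1 \<and> ennreal s < F x} s \<partial>lborel \<partial>lborel)"
      by (rule lborel_pair.Fubini') measurable
    also have "\<dots> = (\<integral>\<^sup>+s. \<integral>\<^sup>+x. indicator {0<..<1} s * indicator {x. ennreal s < F x} x \<partial>lborel \<partial>lborel)"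
      by (intro nn_integral_cong) (auto simp: indicator_def)
    finally show ?thesis by (simp add: nn_integral_cmult)
  qed
  have le1: "f x \<le> 1" "g x \<le> 1" for x
    using sup by (metis SUP_upper UNIV_I)+
  have "(\<integral>\<^sup>+x. f x \<partial>lborel) + (\<integral>\<^sup>+x. g x \<partial>lborel)
     = (\<integral>\<^sup>+x. min (f x) 1 \<partial>lborel) + (\<integral>\<^sup>+x. min (g x) 1 \<partial>lborel)"
    using le1 by (simp add: min_absorb1)
  also have "\<dots> = (\<integral>\<^sup>+s. indicator {0<..<1} s * emeasure lborel {x. ennreal s < f x}
        + indicator {0<..<1} s * emeasure lborel {x. ennreal s < g x} \<partial>lborel)"
    by (subst nn_integral_add) (auto simp: layer)
  also have "\<dots> \<le> (\<integral>\<^sup>+s. 2 * (indicator {0<..<1} s * emeasure lborel {x. ennreal s < h x}) \<partial>lborel)"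
  proof (rule nn_integral_mono)
    fix s :: real
    show "indicator {0<..<1} s * emeasure lborel {x. ennreal s < f x}
        + indicator {0<..<1} s * emeasure lborel {x. ennreal s < g x}
        \<le> 2 * (indicator {0<..<1} s * emeasure lborel {x. ennreal s < h x})"
    proof (cases "0 < s \<and> s < 1")
      case True
      have "ennreal s < 1" using True by simp
      then obtain x y where "ennreal s < f x" "ennreal s < g y"
        using sup by (metis less_SUP_iff)
      moreover have "ennreal s < h ((x + y) / 2)" if "ennreal s < f x" "ennreal s < g y" for x y
      proof (rule ccontr)
        assume "\<not> ennreal s < h ((x + y) / 2)"
        then have "(h ((x + y) / 2))\<^sup>2 \<le> (ennreal s)\<^sup>2" by (intro power_mono) auto
        moreover have "(ennreal s)\<^sup>2 < f x * g y"
        proof -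
          obtain a where a: "f x = ennreal a" "0 \<le> a" using le1[of x] by (cases "f x") (auto simp: top_unique)
          obtain b where b: "g y = ennreal b" "0 \<le> b" using le1[of y] by (cases "g y") (auto simp: top_unique)
          show ?thesis using that True a b
            by (auto simp: power2_eq_square ennreal_mult[symmetric] ennreal_less_iff intro!: mult_strict_mono)
        qed
        ultimately show False using mid[of x y] by (meson leD order.trans)
      qed
      ultimately have "emeasure lborel {x. ennreal s < f x} + emeasure lborel {x. ennreal s < g x}
        \<le> 2 * emeasure lborel {x. ennreal s < h x}"
        by (intro Brunn_Minkowski_real) auto
      then show ?thesis using True by simp
    qed (auto simp: indicator_def)
  qed
  also have "\<dots> = 2 * (\<integral>\<^sup>+x. min (h x) 1 \<partial>lborel)"
    by (simp add: nn_integral_cmult layer)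
  also have "\<dots> \<le> 2 * (\<integral>\<^sup>+x. h x \<partial>lborel)"
    by (intro mult_left_mono nn_integral_mono) auto
  finally show ?thesis .
qed

lemma ennreal_four_mult_le_square_add:
  fixes X Y :: ennreal
  shows "4 * (X * Y) \<le> (X + Y)\<^sup>2"
proof (cases "X = top \<or> Y = top")
  case True
  then have "(X + Y)\<^sup>2 = top" by (auto simp: power2_eq_square ennreal_top_mult)
  then show ?thesis by simp
next
  case False
  then obtain x y where xy: "X = ennreal x" "0 \<le> x" "Y = ennreal y" "0 \<le> y"
    by (cases X; cases Y) auto
  have "4 * (x * y) \<le> (x + y)\<^sup>2"
    using zero_le_power2[of "x - y"] by (simp add: power2_eq_square algebra_simps)
  moreover have "4 * (X * Y) = ennreal (4 * (x * y))"
    using xy by (simp add: ennreal_mult)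
  moreover have "(X + Y)\<^sup>2 = ennreal ((x + y)\<^sup>2)"
    using xy by (simp add: ennreal_power[symmetric])
  ultimately show ?thesis by (simp only: ennreal_leI)
qed

text \<open>Divide \<open>f\<close> and \<open>g\<close> by their suprema and \<open>h\<close> by
  the geometric mean of these; the additive inequality then becomes multiplicative by the inequality
  of arithmetic and geometric means.\<close>

lemma Prekopa_Leindler_bounded:
  fixes f g h :: "real \<Rightarrow> ennreal"
  assumes [measurable]: "f \<in> borel_measurable borel" "g \<in> borel_measurable borel" "h \<in> borel_measurable borel"
    and bdd: "(SUP x. f x) \<noteq> top" "(SUP x. g x) \<noteq> top"
    and mid: "\<And>x y. f x * g y \<le> (h ((x + y) / 2))\<^sup>2"
  shows "(\<integral>\<^sup>+x. f x \<partial>lborel) * (\<integral>\<^sup>+x. g x \<partial>lborel) \<le> (\<integral>\<^sup>+x. h x \<partial>lborel)\<^sup>2"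
proof (cases "(SUP x. f x) = 0 \<or> (SUP x. g x) = 0")
  case True
  then have "(\<forall>x. f x = 0) \<or> (\<forall>x. g x = 0)" by (metis SUP_upper UNIV_I le_zero_eq)
  then show ?thesis by auto
next
  case False
  obtain a where a: "(SUP x. f x) = ennreal a" "0 < a"
    using bdd False by (cases "SUP x. f x") (auto simp: less_le)
  obtain b where b: "(SUP x. g x) = ennreal b" "0 < b"
    using bdd False by (cases "SUP x. g x") (auto simp: less_le)
  define c where "c = 1 / sqrt (a * b)"
  have c: "0 < c" "c * c = (1 / a) * (1 / b)"
    using a b by (auto simp: c_def)
  have cc: "ennreal (c * c) = ennreal c * ennreal c"
    using c(1) by (intro ennreal_mult) auto
  let ?f = "\<lambda>x. ennreal (1 / a) * f x" and ?g = "\<lambda>x. ennreal (1 / b) * g x" and ?h = "\<lambda>x. ennreal c * h x"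
  have "(\<integral>\<^sup>+x. ?f x \<partial>lborel) + (\<integral>\<^sup>+x. ?g x \<partial>lborel) \<le> 2 * (\<integral>\<^sup>+x. ?h x \<partial>lborel)"
  proof (rule Prekopa_Leindler_normalized)
    show "(SUP x. ?f x) = 1" "(SUP x. ?g x) = 1"
      unfolding SUP_mult_left_ennreal[symmetric] a b
      using a(2) b(2) by (subst ennreal_mult[symmetric]; simp)+
    fix x y
    have "?f x * ?g y = ennreal ((1 / a) * (1 / b)) * (f x * g y)"
      using a(2) b(2) by (subst ennreal_mult) (auto simp only: ac_simps less_imp_le divide_nonneg_nonneg zero_le_one)
    also have "\<dots> \<le> ennreal (c * c) * (h ((x + y) / 2))\<^sup>2"
      using mid c by (intro mult_mono) auto
    also have "\<dots> = (?h ((x + y) / 2))\<^sup>2"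
      using cc by (simp only: power2_eq_square) (simp only: ac_simps)
    finally show "?f x * ?g y \<le> (?h ((x + y) / 2))\<^sup>2" .
  qed measurable
  then have le: "ennreal (1 / a) * (\<integral>\<^sup>+x. f x \<partial>lborel) + ennreal (1 / b) * (\<integral>\<^sup>+x. g x \<partial>lborel)
      \<le> 2 * (ennreal c * (\<integral>\<^sup>+x. h x \<partial>lborel))"
    by (simp add: nn_integral_cmult)
  let ?F = "\<integral>\<^sup>+x. f x \<partial>lborel" and ?G = "\<integral>\<^sup>+x. g x \<partial>lborel" and ?H = "\<integral>\<^sup>+x. h x \<partial>lborel"
  have "4 * (ennreal (c * c) * (?F * ?G)) = 4 * ((ennreal (1 / a) * ?F) * (ennreal (1 / b) * ?G))"
    using a(2) b(2) unfolding c(2) by (subst ennreal_mult) (auto simp only: ac_simps less_imp_le divide_nonneg_nonneg zero_le_one)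
  also have "\<dots> \<le> (ennreal (1 / a) * ?F + ennreal (1 / b) * ?G)\<^sup>2"
    by (rule ennreal_four_mult_le_square_add)
  also have "\<dots> \<le> (2 * (ennreal c * ?H))\<^sup>2"
    using le by (intro power_mono) auto
  also have "\<dots> = 4 * (ennreal (c * c) * ?H\<^sup>2)"
  proof -
    have "(2 * (ennreal c * ?H))\<^sup>2 = (2 * 2) * ((ennreal c * ennreal c) * (?H * ?H))"
      by (simp only: power2_eq_square ac_simps)
    then show ?thesis by (simp only: cc power2_eq_square) simp
  qed
  finally have le4: "4 * (ennreal (c * c) * (?F * ?G)) \<le> 4 * (ennreal (c * c) * ?H\<^sup>2)" .
  have inv: "ennreal (1 / (4 * (c * c))) * (4 * (ennreal (c * c) * X)) = X" for X
  proof -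
    have "ennreal (1 / (4 * (c * c))) * (4 * (ennreal (c * c) * X))
       = (ennreal (1 / (4 * (c * c))) * ennreal 4 * ennreal (c * c)) * X"
      by (simp only: ac_simps) simp
    also have "ennreal (1 / (4 * (c * c))) * ennreal 4 * ennreal (c * c) = ennreal (1 / (4 * (c * c)) * 4 * (c * c))"
      using c(1) ennreal_mult[of "1 / (4 * (c * c)) * 4" "c * c"] ennreal_mult[of "1 / (4 * (c * c))" 4]
      by (simp only:) simp
    also have "1 / (4 * (c * c)) * 4 * (c * c) = 1" using c(1) by simp
    finally show ?thesis by simp
  qed
  show ?thesis
    using mult_left_mono[OF le4, of "ennreal (1 / (4 * (c * c)))"] by (simp only: inv) simp
qed

text \<open>Truncating \<open>f\<close> and \<open>g\<close> at integer heights preserves the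
  hypothesis with the same \<open>h\<close>, so the bounded case passes to the limit by monotone
  convergence.\<close>

lemma Prekopa_Leindler_real:
  fixes f g h :: "real \<Rightarrow> ennreal"
  assumes [measurable]: "f \<in> borel_measurable borel" "g \<in> borel_measurable borel" "h \<in> borel_measurable borel"
    and mid: "\<And>x y. f x * g y \<le> (h ((x + y) / 2))\<^sup>2"
  shows "(\<integral>\<^sup>+x. f x \<partial>lborel) * (\<integral>\<^sup>+x. g x \<partial>lborel) \<le> (\<integral>\<^sup>+x. h x \<partial>lborel)\<^sup>2"
proof -
  have trunc: "(\<integral>\<^sup>+x. F x \<partial>lborel) = (SUP k. \<integral>\<^sup>+x. min (F x) (of_nat k) \<partial>lborel)"
    if [measurable]: "F \<in> borel_measurable borel" for F :: "real \<Rightarrow> ennreal"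
  proof -
    have "(SUP k. min (F x) (of_nat k)) = F x" for x
    proof (rule antisym)
      have "F x = min (F x) (SUP k. of_nat k)" by (simp add: ennreal_SUP_of_nat_eq_top)
      also have "\<dots> = (SUP k. min (F x) (of_nat k))"
        by (metis inf_SUP inf_ennreal.rep_eq inf_min)
      finally show "F x \<le> (SUP k. min (F x) (of_nat k))" by simp
    qed (auto intro: SUP_least)
    then have "(\<integral>\<^sup>+x. F x \<partial>lborel) = (\<integral>\<^sup>+x. (SUP k. min (F x) (of_nat k)) \<partial>lborel)" by simp
    also have "\<dots> = (SUP k. \<integral>\<^sup>+x. min (F x) (of_nat k) \<partial>lborel)"
      by (intro nn_integral_monotone_convergence_SUP)
        (auto simp: incseq_def le_fun_def min_def intro: order_trans)
    finally show ?thesis .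
  qed
  have *: "(\<integral>\<^sup>+x. min (f x) (of_nat k) \<partial>lborel) * (\<integral>\<^sup>+x. min (g x) (of_nat l) \<partial>lborel)
     \<le> (\<integral>\<^sup>+x. h x \<partial>lborel)\<^sup>2" for k l
  proof (rule Prekopa_Leindler_bounded)
    have "(SUP x. min (F x) (of_nat k)) \<le> of_nat k" for F :: "real \<Rightarrow> ennreal" and k
      by (auto intro: SUP_least)
    then show "(SUP x. min (f x) (of_nat k)) \<noteq> top" "(SUP x. min (g x) (of_nat l)) \<noteq> top"
      by (metis ennreal_of_nat_neq_top top.extremum_uniqueI)+
    show "min (f x) (of_nat k) * min (g y) (of_nat l) \<le> (h ((x + y) / 2))\<^sup>2" for x y
      using mid[of x y] by (rule order_trans[rotated]) (intro mult_mono, auto)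
  qed measurable
  show ?thesis
    unfolding trunc[of f, simplified] trunc[of g, simplified]
    by (simp only: SUP_mult_left_ennreal SUP_mult_right_ennreal) (intro SUP_least *)
qed

text \<open>Tensorisation: for fixed values s and t of one coordinate the induction hypothesis says
  exactly that the integrals over the other coordinates satisfy the hypothesis of the
  one-dimensional case.\<close>

theorem Prekopa_Leindler:
  fixes f g h :: "('i \<Rightarrow> real) \<Rightarrow> ennreal"
  assumes "finite I"
    and "f \<in> borel_measurable (Leb I)" "g \<in> borel_measurable (Leb I)" "h \<in> borel_measurable (Leb I)"
    and "\<And>x y. x \<in> space (Leb I) \<Longrightarrow> y \<in> space (Leb I) \<Longrightarrow> f x * g y \<le> (h (\<lambda>i\<in>I. (x i + y i) / 2))\<^sup>2"
  shows "(\<integral>\<^sup>+x. f x \<partial>Leb I) * (\<integral>\<^sup>+x. g x \<partial>Leb I) \<le> (\<integral>\<^sup>+x. h x \<partial>Leb I)\<^sup>2"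
  using assms
proof (induction I arbitrary: f g h rule: finite_induct)
  case empty
  then show ?case
    by (simp add: Leb.nn_integral_empty space_PiM restrict_def)
next
  case (insert i I)
  note [measurable] = insert.prems(1,2,3)
  have upd: "x(i := s) \<in> space (Leb (insert i I))" if "x \<in> space (Leb I)" for x s
    using that insert.hyps by (auto simp: space_PiM PiE_iff extensional_def)
  have eq: "(\<integral>\<^sup>+x. F x \<partial>Leb (insert i I)) = (\<integral>\<^sup>+s. \<integral>\<^sup>+x. F (x(i := s)) \<partial>Leb I \<partial>lborel)"
    if "F \<in> borel_measurable (Leb (insert i I))" for F :: "('i \<Rightarrow> real) \<Rightarrow> ennreal"
    using insert.hyps that by (rule Leb.product_nn_integral_insert_rev)
  have sf: "sigma_finite_measure (Leb I)" using insert.hyps by (intro Leb.sigma_finite)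
  have M: "(\<lambda>s. \<integral>\<^sup>+x. F (x(i := s)) \<partial>Leb I) \<in> borel_measurable borel"
    if [measurable]: "F \<in> borel_measurable (Leb (insert i I))" for F :: "('i \<Rightarrow> real) \<Rightarrow> ennreal"
  proof -
    interpret sigma_finite_measure "Leb I" by (rule sf)
    show ?thesis by measurable
  qed
  show ?case
    unfolding eq[OF insert.prems(1)] eq[OF insert.prems(2)] eq[OF insert.prems(3)]
  proof (rule Prekopa_Leindler_real)
    fix s t :: real
    show "(\<integral>\<^sup>+x. f (x(i := s)) \<partial>Leb I) * (\<integral>\<^sup>+x. g (x(i := t)) \<partial>Leb I)
       \<le> (\<integral>\<^sup>+x. h (x(i := (s + t) / 2)) \<partial>Leb I)\<^sup>2"
    proof (rule insert.IH)
      fix x y assume xy: "x \<in> space (Leb I)" "y \<in> space (Leb I)"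
      have "(\<lambda>j\<in>insert i I. ((x(i := s)) j + (y(i := t)) j) / 2) = (\<lambda>j\<in>I. (x j + y j) / 2)(i := (s + t) / 2)"
        using insert.hyps by (auto simp: fun_eq_iff)
      then show "f (x(i := s)) * g (y(i := t)) \<le> (h ((\<lambda>j\<in>I. (x j + y j) / 2)(i := (s + t) / 2)))\<^sup>2"
        using insert.prems(4)[OF upd[OF xy(1), of s] upd[OF xy(2), of t]] by (simp del: fun_upd_apply)
    qed measurable
  qed (use M insert.prems in auto)
qed

section \<open>Hausdorff measure of a norm\<close>

text \<open>The premeasure at mesh \<epsilon>, named because covers are compared at a fixed mesh
  before the supremum over \<epsilon> is taken.\<close>

definition hausdorff_content :: "('a \<Rightarrow> 'a \<Rightarrow> real) \<Rightarrow> 'a set \<Rightarrow> nat \<Rightarrow> real \<Rightarrow> 'a set \<Rightarrow> ennreal" where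
  "hausdorff_content d X n \<epsilon> A = (INF U\<in>hausdorff_cover d X \<epsilon> A. \<Sum>k. hausdorff_weight d n (U k))"

lemma hausdorff_outer_eq_SUP_content:
  "hausdorff_outer d X n A = (SUP \<epsilon>\<in>{0<..}. hausdorff_content d X n \<epsilon> A)"
  by (simp add: hausdorff_outer_def hausdorff_content_def)

lemma hausdorff_content_le_outer: "0 < \<epsilon> \<Longrightarrow> hausdorff_content d X n \<epsilon> A \<le> hausdorff_outer d X n A"
  unfolding hausdorff_outer_eq_SUP_content by (rule SUP_upper) simp

lemma hausdorff_content_antimono:
  "\<epsilon> \<le> \<epsilon>' \<Longrightarrow> hausdorff_content d X n \<epsilon>' A \<le> hausdorff_content d X n \<epsilon> A"
  unfolding hausdorff_content_def hausdorff_cover_def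
  by (intro INF_superset_mono) (auto intro: order_trans ennreal_leI)

lemma hausdorff_weight_empty [simp]: "hausdorff_weight d n {} = 0"
  by (simp add: hausdorff_weight_def)

lemma hausdorff_outer_mono:
  "A \<subseteq> B \<Longrightarrow> B \<subseteq> X \<Longrightarrow> hausdorff_outer d X n A \<le> hausdorff_outer d X n B"
  using outer_measure_space_hausdorff_outer[of X d n]
  by (auto simp: outer_measure_space_def increasing_def)

lemma hausdorff_outer_empty: "hausdorff_outer d X n {} = 0"
  using outer_measure_space_hausdorff_outer[of X d n]
  by (auto simp: outer_measure_space_def positive_def)

text \<open>The predicate \<open>countably_subadditive\<close> speaks of disjoint families only;
  passing to \<open>disjointed\<close> and using monotonicity extends it to arbitrary ones.\<close>

lemma hausdorff_outer_UN_le: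
  assumes A: "\<And>i. A i \<subseteq> X"
  shows "hausdorff_outer d X n (\<Union>i::nat. A i) \<le> (\<Sum>i. hausdorff_outer d X n (A i))"
proof -
  have "countably_subadditive (Pow X) (hausdorff_outer d X n)"
    using outer_measure_space_hausdorff_outer[of X d n] by (simp add: outer_measure_space_def)
  moreover have "disjointed A i \<subseteq> X" for i
    using A disjointed_subset[of A i] by blast
  ultimately have "hausdorff_outer d X n (\<Union>i. disjointed A i) \<le> (\<Sum>i. hausdorff_outer d X n (disjointed A i))"
    using disjoint_family_disjointed[of A] unfolding countably_subadditive_def
    by blast
  also have "\<dots> \<le> (\<Sum>i. hausdorff_outer d X n (A i))"
    using A by (intro suminf_le hausdorff_outer_mono disjointed_subset) auto
  finally show ?thesis by (simp add: UN_disjointed_eq)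
qed

lemma hausdorff_outer_Un_le:
  assumes "A \<subseteq> X" "B \<subseteq> X"
  shows "hausdorff_outer d X n (A \<union> B) \<le> hausdorff_outer d X n A + hausdorff_outer d X n B"
proof -
  let ?C = "\<lambda>i::nat. if i = 0 then A else if i = 1 then B else {}"
  have "A \<union> B = (\<Union>i. ?C i)"
    by (auto split: if_splits)
  then have "hausdorff_outer d X n (A \<union> B) \<le> (\<Sum>i. hausdorff_outer d X n (?C i))"
    using hausdorff_outer_UN_le[of ?C X d n] assms by simp
  also have "\<dots> = (\<Sum>i\<in>{0,1}. hausdorff_outer d X n (?C i))"
    by (intro suminf_finite) (auto simp: hausdorff_outer_empty)
  finally show ?thesis by simp
qed

section \<open>Invariance of Hausdorff measure under isometries\<close>

lemma set_diam_isometry: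
  assumes "\<And>x y. x \<in> U \<Longrightarrow> y \<in> U \<Longrightarrow> d' (T x) (T y) = d x y"
  shows "set_diam d' (T ` U) = set_diam d U"
  unfolding set_diam_def using assms by (auto simp: image_image intro!: SUP_cong)

text \<open>Covering sets are subsets of the carrier, where distances are preserved, so the image of
  a cover is a cover with the same weights. For a bijection the inverse gives the reverse
  inequality.\<close>

lemma hausdorff_outer_isometry_le:
  assumes T: "T ` X \<subseteq> Y" "\<And>x y. x \<in> X \<Longrightarrow> y \<in> X \<Longrightarrow> d' (T x) (T y) = d x y"
  shows "hausdorff_outer d' Y n (T ` A) \<le> hausdorff_outer d X n A"
  unfolding hausdorff_outer_def
proof (intro SUP_mono bexI)
  fix \<epsilon> :: real assume "\<epsilon> \<in> {0<..}"
  show "(INF U\<in>hausdorff_cover d' Y \<epsilon> (T ` A). \<Sum>k. hausdorff_weight d' n (U k))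
     \<le> (INF U\<in>hausdorff_cover d X \<epsilon> A. \<Sum>k. hausdorff_weight d n (U k))"
  proof (rule INF_greatest)
    fix U assume U: "U \<in> hausdorff_cover d X \<epsilon> A"
    have diam: "set_diam d' (T ` U k) = set_diam d (U k)" for k
    proof (rule set_diam_isometry)
      fix x y assume "x \<in> U k" "y \<in> U k"
      then have "x \<in> X" "y \<in> X" using U by (auto simp: hausdorff_cover_def)
      then show "d' (T x) (T y) = d x y" by (rule T(2))
    qed
    have "(\<lambda>k. T ` U k) \<in> hausdorff_cover d' Y \<epsilon> (T ` A)"
      using U T(1) by (fastforce simp: hausdorff_cover_def diam)
    then have "(INF U\<in>hausdorff_cover d' Y \<epsilon> (T ` A). \<Sum>k. hausdorff_weight d' n (U k))
       \<le> (\<Sum>k. hausdorff_weight d' n (T ` U k))" by (rule INF_lower)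
    also have "\<dots> = (\<Sum>k. hausdorff_weight d n (U k))"
      by (simp add: hausdorff_weight_def diam cong: if_cong)
    finally show "(INF U\<in>hausdorff_cover d' Y \<epsilon> (T ` A). \<Sum>k. hausdorff_weight d' n (U k))
       \<le> (\<Sum>k. hausdorff_weight d n (U k))" .
  qed
qed auto

lemma hausdorff_outer_bij_isometry:
  assumes T: "bij_betw T X Y" "\<And>x y. x \<in> X \<Longrightarrow> y \<in> X \<Longrightarrow> d' (T x) (T y) = d x y" and "A \<subseteq> X"
  shows "hausdorff_outer d' Y n (T ` A) = hausdorff_outer d X n A"
proof (rule antisym)
  show "hausdorff_outer d' Y n (T ` A) \<le> hausdorff_outer d X n A"
    using T by (intro hausdorff_outer_isometry_le) (auto simp: bij_betw_def)
  let ?S = "the_inv_into X T"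
  have inj: "inj_on T X" and im: "T ` X = Y" using T(1) by (auto simp: bij_betw_def)
  have "hausdorff_outer d X n (?S ` (T ` A)) \<le> hausdorff_outer d' Y n (T ` A)"
  proof (rule hausdorff_outer_isometry_le)
    show "?S ` Y \<subseteq> X" using the_inv_into_into[OF inj] im by auto
    show "d (?S x) (?S y) = d' x y" if "x \<in> Y" "y \<in> Y" for x y
      using that T(2) inj im by (auto simp: the_inv_into_f_f)
  qed
  also have "?S ` (T ` A) = A"
    using \<open>A \<subseteq> X\<close> inj by (force simp: image_image the_inv_into_f_f subset_eq)
  finally show "hausdorff_outer d X n A \<le> hausdorff_outer d' Y n (T ` A)" .
qed

section \<open>Measurability by Caratheodory's criterion for metric outer measures\<close>

lemma set_diam_ge: "x \<in> U \<Longrightarrow> y \<in> U \<Longrightarrow> ennreal (d x y) \<le> set_diam d U"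
  unfolding set_diam_def by (intro SUP_upper2[of x] SUP_upper2[of y]) auto

lemma set_diam_le: "(\<And>x y. x \<in> U \<Longrightarrow> y \<in> U \<Longrightarrow> d x y \<le> D) \<Longrightarrow> set_diam d U \<le> ennreal D"
  unfolding set_diam_def by (intro SUP_least ennreal_leI)

text \<open>A set of diameter below the gap \<open>r\<close> cannot meet both \<open>A\<close> and
  \<open>B\<close>, so a fine cover of the union splits into covers of the two parts. The meshes for
  the two sides are independent so that both suprema can be taken.\<close>

lemma hausdorff_outer_separated:
  assumes AB: "A \<subseteq> X" "B \<subseteq> X" and r: "0 < r" "\<And>a b. a \<in> A \<Longrightarrow> b \<in> B \<Longrightarrow> r \<le> d a b"
  shows "hausdorff_outer d X n A + hausdorff_outer d X n B \<le> hausdorff_outer d X n (A \<union> B)"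
proof -
  have *: "hausdorff_content d X n \<epsilon>1 A + hausdorff_content d X n \<epsilon>2 B \<le> hausdorff_outer d X n (A \<union> B)"
    if "0 < \<epsilon>1" "0 < \<epsilon>2" for \<epsilon>1 \<epsilon>2
  proof -
    define \<epsilon> where "\<epsilon> = min (min \<epsilon>1 \<epsilon>2) (r / 2)"
    have \<epsilon>: "0 < \<epsilon>" "\<epsilon> \<le> \<epsilon>1" "\<epsilon> \<le> \<epsilon>2" "\<epsilon> < r" using that r(1) by (auto simp: \<epsilon>_def)
    have "hausdorff_content d X n \<epsilon> A + hausdorff_content d X n \<epsilon> B \<le> hausdorff_content d X n \<epsilon> (A \<union> B)"
      unfolding hausdorff_content_def[of _ _ _ _ "A \<union> B"]
    proof (rule INF_greatest)
      fix U assume U: "U \<in> hausdorff_cover d X \<epsilon> (A \<union> B)"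
      define V where "V C k = (if U k \<inter> C = {} then {} else U k)" for C k
      have V: "V C \<in> hausdorff_cover d X \<epsilon> C" if "C = A \<or> C = B" for C
        using U that by (fastforce simp: hausdorff_cover_def V_def)
      have disj: "U k \<inter> A = {} \<or> U k \<inter> B = {}" for k
      proof (rule ccontr)
        assume "\<not> ?thesis"
        then obtain a b where "a \<in> U k" "a \<in> A" "b \<in> U k" "b \<in> B" by auto
        then have "ennreal r \<le> set_diam d (U k)"
          using r(2) set_diam_ge[of a "U k" b d] by (meson ennreal_leI order_trans)
        also have "\<dots> \<le> ennreal \<epsilon>" using U by (auto simp: hausdorff_cover_def)
        finally show False using \<epsilon> by (simp add: ennreal_le_iff)
      qed
      have "hausdorff_content d X n \<epsilon> A + hausdorff_content d X n \<epsilon> B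
         \<le> (\<Sum>k. hausdorff_weight d n (V A k)) + (\<Sum>k. hausdorff_weight d n (V B k))"
        unfolding hausdorff_content_def using V by (intro add_mono INF_lower) auto
      also have "\<dots> = (\<Sum>k. hausdorff_weight d n (V A k) + hausdorff_weight d n (V B k))"
        by (rule suminf_add) auto
      also have "\<dots> \<le> (\<Sum>k. hausdorff_weight d n (U k))"
        using disj by (intro suminf_le) (auto simp: V_def)
      finally show "hausdorff_content d X n \<epsilon> A + hausdorff_content d X n \<epsilon> B
        \<le> (\<Sum>k. hausdorff_weight d n (U k))" .
    qed
    moreover have "hausdorff_content d X n \<epsilon> (A \<union> B) \<le> hausdorff_outer d X n (A \<union> B)"
      using \<epsilon> by (intro hausdorff_content_le_outer)
    moreover have "hausdorff_content d X n \<epsilon>1 A + hausdorff_content d X n \<epsilon>2 B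
       \<le> hausdorff_content d X n \<epsilon> A + hausdorff_content d X n \<epsilon> B"
      using \<epsilon> by (intro add_mono hausdorff_content_antimono)
    ultimately show ?thesis by (meson order_trans)
  qed
  have "hausdorff_outer d X n A + hausdorff_outer d X n B
    = (SUP \<epsilon>1\<in>{0<..}. SUP \<epsilon>2\<in>{0<..}. hausdorff_content d X n \<epsilon>1 A + hausdorff_content d X n \<epsilon>2 B)"
    unfolding hausdorff_outer_eq_SUP_content
    by (simp add: ennreal_SUP_add_left[symmetric] ennreal_SUP_add_right[symmetric])
  also have "\<dots> \<le> hausdorff_outer d X n (A \<union> B)"
    using * by (intro SUP_least) auto
  finally show ?thesis .
qed

text \<open>Only finite stages are compared, so the gap \<open>r\<close> may shrink as
  \<open>m\<close> grows; this is the situation of shells accumulating at a level set.\<close>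

lemma hausdorff_outer_separated_suminf:
  fixes B :: "nat \<Rightarrow> 'a set"
  assumes B: "\<And>j. B j \<subseteq> X"
    and r: "\<And>m. \<exists>r>0. \<forall>j<m. \<forall>a\<in>B j. \<forall>b\<in>B m. r \<le> d a b"
  shows "(\<Sum>j. hausdorff_outer d X n (B j)) \<le> hausdorff_outer d X n (\<Union>j. B j)"
proof -
  have *: "(\<Sum>j<m. hausdorff_outer d X n (B j)) \<le> hausdorff_outer d X n (\<Union>j<m. B j)" for m
  proof (induction m)
    case (Suc m)
    obtain r where "r > 0" "\<forall>j<m. \<forall>a\<in>B j. \<forall>b\<in>B m. r \<le> d a b" using r[of m] by auto
    then have "hausdorff_outer d X n (\<Union>j<m. B j) + hausdorff_outer d X n (B m)
       \<le> hausdorff_outer d X n ((\<Union>j<m. B j) \<union> B m)"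
      using B by (intro hausdorff_outer_separated[of _ _ _ r]) (auto simp: UN_least)
    then have "(\<Sum>j<m. hausdorff_outer d X n (B j)) + hausdorff_outer d X n (B m)
       \<le> hausdorff_outer d X n ((\<Union>j<m. B j) \<union> B m)"
      using Suc.IH by (meson add_right_mono order_trans)
    then show ?case by (simp add: lessThan_Suc Un_commute add.commute)
  qed simp
  show ?thesis
    unfolding suminf_eq_SUP
    using B by (intro SUP_least order_trans[OF *] hausdorff_outer_mono) auto
qed

text \<open>The classical argument: outside the sublevel set, \<open>T\<close> is cut into shells
  \<open>S k\<close> accumulating at the level \<open>a\<close>. Shells of equal parity are
  separated, so their outer measures form convergent series; the tails vanish, and the part
  \<open>R k\<close> that remains is separated from the sublevel set.\<close>

lemma sublevel_in_sets_hausdorff_measure: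
  assumes lip: "\<And>x y. x \<in> X \<Longrightarrow> y \<in> X \<Longrightarrow> \<bar>p x - p y\<bar> \<le> d x y"
  shows "{x \<in> X. p x \<le> a} \<in> sets (hausdorff_measure d X n)"
proof -
  let ?\<phi> = "hausdorff_outer d X n" and ?E = "{x \<in> X. p x \<le> a}"
  have main: "?\<phi> (T \<inter> ?E) + ?\<phi> (T - ?E) \<le> ?\<phi> T" if T: "T \<subseteq> X" for T
  proof (cases "?\<phi> T = top")
    case False
    define R where "R k = {x \<in> T. a + 1 / (real k + 1) < p x}" for k :: nat
    define S where "S k = {x \<in> T. a + 1 / (real k + 2) < p x \<and> p x \<le> a + 1 / (real k + 1)}" for k :: nat
    have SX: "S k \<subseteq> X" for k using T by (auto simp: S_def)
    have half: "(\<Sum>j. ?\<phi> (S (2 * j + c))) \<le> ?\<phi> T" for c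
    proof -
      have "(\<Sum>j. ?\<phi> (S (2 * j + c))) \<le> ?\<phi> (\<Union>j. S (2 * j + c))"
      proof (rule hausdorff_outer_separated_suminf[of "\<lambda>j. S (2 * j + c)"])
        fix m
        \<comment> \<open>For j < m the earlier shell lies above a + 1 / (2j + c + 2), hence above a
          + 1 / (2m + c), while the shell with index 2m + c ends at a + 1 / (2m + c + 1).\<close>
        define r where "r = 1 / real (2 * m + c) - 1 / real (2 * m + c + 1)"
        show "\<exists>r>0. \<forall>j<m. \<forall>u\<in>S (2 * j + c). \<forall>v\<in>S (2 * m + c). r \<le> d u v"
        proof (cases "m = 0")
          case False
          have "r > 0" using False by (auto simp: r_def intro!: divide_strict_left_mono mult_pos_pos)
          moreover have "r \<le> d u v" if "j < m" "u \<in> S (2 * j + c)" "v \<in> S (2 * m + c)" for j u v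
          proof -
            have "1 / real (2 * m + c) \<le> 1 / (real (2 * j + c) + 2)"
              using that(1) by (intro divide_left_mono) auto
            then have "r \<le> p u - p v" using that by (auto simp: S_def r_def add_ac)
            also have "\<dots> \<le> d u v" using lip[of u v] that SX by fastforce
            finally show ?thesis .
          qed
          ultimately show ?thesis by blast
        qed (auto intro: exI[of _ 1])
      qed (rule SX)
      also have "\<dots> \<le> ?\<phi> T" using T by (intro hausdorff_outer_mono) (auto simp: S_def)
      finally show ?thesis .
    qed
    define f where "f = (\<lambda>j. enn2real (?\<phi> (S j)))"
    have fin: "?\<phi> (S j) = ennreal (f j)" for j
    proof -
      have "?\<phi> (S j) \<le> ?\<phi> T" using T by (intro hausdorff_outer_mono) (auto simp: S_def)
      then have "?\<phi> (S j) < top" using False by (meson le_less_trans less_top)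
      then show ?thesis by (simp add: f_def)
    qed
    have f0: "0 \<le> f j" for j by (simp add: f_def)
    have "summable (\<lambda>j. f (2 * j + c))" for c
      using half[of c] False f0 unfolding fin by (intro summable_suminf_not_top) (auto simp: top_unique) note sm = this
    have R: "?\<phi> (T \<inter> ?E) + ?\<phi> (R k) \<le> ?\<phi> T" for k
    proof -
      have "?\<phi> (T \<inter> ?E) + ?\<phi> (R k) \<le> ?\<phi> (T \<inter> ?E \<union> R k)"
      proof (rule hausdorff_outer_separated)
        show "0 < 1 / (real k + 1)" by simp
        show "1 / (real k + 1) \<le> d u v" if "u \<in> T \<inter> ?E" "v \<in> R k" for u v
          using lip[of u v] that T by (auto simp: R_def subset_eq)
      qed (use T in \<open>auto simp: R_def\<close>)
      also have "\<dots> \<le> ?\<phi> T" using T by (intro hausdorff_outer_mono) (auto simp: R_def)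
      finally show ?thesis .
    qed
    have cover: "T - ?E \<subseteq> R (2 * k) \<union> ((\<Union>j. S (2 * (j + k) + 0)) \<union> (\<Union>j. S (2 * (j + k) + 1)))" for k
    proof
      fix x assume x: "x \<in> T - ?E"
      then have pos: "0 < p x - a" using T by auto
      show "x \<in> R (2 * k) \<union> ((\<Union>j. S (2 * (j + k) + 0)) \<union> (\<Union>j. S (2 * (j + k) + 1)))"
      proof (cases "x \<in> R (2 * k)")
        case False
        define t where "t = 1 / (p x - a)"
        have px: "p x = a + 1 / t" "0 < t" using pos by (auto simp: t_def)
        have "p x \<le> a + 1 / (real (2 * k) + 1)" using False x by (auto simp: R_def)
        then have tk: "real (2 * k) + 1 \<le> t" using px by (simp add: field_simps)
        \<comment> \<open>The index of the shell containing \<open>x\<close>, determined by l + 1 <=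
          t < l + 2.\<close>
        define l where "l = nat \<lfloor>t\<rfloor> - 1"
        have fl: "real (2 * k + 1) \<le> t" using tk by simp
        then have "int (2 * k + 1) \<le> \<lfloor>t\<rfloor>" by (simp add: le_floor_iff)
        then have l: "2 * k \<le> l" "int l + 1 = \<lfloor>t\<rfloor>" unfolding l_def by linarith+
        have l2: "real l + 1 \<le> t" "t < real l + 2"
          using floor_correct[of t] l(2) by linarith+
        have "x \<in> S l"
        proof -
          have "1 / (real l + 2) < 1 / t" "1 / t \<le> 1 / (real l + 1)"
            using l2 px(2) by (auto intro!: divide_strict_left_mono divide_left_mono mult_pos_pos)
          then show ?thesis using x px(1) by (auto simp: S_def)
        qed
        moreover have "l = 2 * ((l div 2 - k) + k) + l mod 2" using l(1) by presburger
        moreover have "l mod 2 = 0 \<or> l mod 2 = 1" by presburger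
        ultimately have "x \<in> S (2 * ((l div 2 - k) + k) + 0) \<or> x \<in> S (2 * ((l div 2 - k) + k) + 1)" by metis
        then show ?thesis by blast
      qed simp
    qed
    show ?thesis
    proof (rule ennreal_le_epsilon)
      fix e :: real assume "0 < e"
      have "\<exists>N. \<forall>k\<ge>N. norm (\<Sum>j. f (2 * (j + k) + c)) < e / 2" for c
        using suminf_exist_split[of "e / 2" "\<lambda>j. f (2 * j + c)"] sm[of c] \<open>0 < e\<close> by auto
      then obtain N where N: "\<And>c k. k \<ge> N c \<Longrightarrow> norm (\<Sum>j. f (2 * (j + k) + c)) < e / 2" by metis
      define k where "k = max (N 0) (N 1)"
      have tail: "(\<Sum>j. ?\<phi> (S (2 * (j + k) + c))) \<le> ennreal (e / 2)" if "c = 0 \<or> c = 1" for c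
      proof -
        have "summable (\<lambda>j. f (2 * (j + k) + c))" using sm[of c] summable_ignore_initial_segment[of "\<lambda>j. f (2 * j + c)" k] by simp
        then have "(\<Sum>j. ?\<phi> (S (2 * (j + k) + c))) = ennreal (\<Sum>j. f (2 * (j + k) + c))"
          unfolding fin using f0 by (intro suminf_ennreal2) auto
        also have "\<dots> \<le> ennreal (e / 2)" using N[of c k] that by (intro ennreal_leI) (auto simp: k_def)
        finally show ?thesis .
      qed
      have UX: "(\<Union>j. S (2 * (j + k) + c)) \<subseteq> X" for c using SX by auto
      have "?\<phi> (T - ?E) \<le> ?\<phi> (R (2 * k) \<union> ((\<Union>j. S (2 * (j + k) + 0)) \<union> (\<Union>j. S (2 * (j + k) + 1))))"
        using UX T by (intro hausdorff_outer_mono cover) (auto simp: R_def S_def)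
      also have "\<dots> \<le> ?\<phi> (R (2 * k)) + ?\<phi> ((\<Union>j. S (2 * (j + k) + 0)) \<union> (\<Union>j. S (2 * (j + k) + 1)))"
        using UX T by (intro hausdorff_outer_Un_le) (auto simp: R_def S_def)
      also have "\<dots> \<le> ?\<phi> (R (2 * k)) + (?\<phi> (\<Union>j. S (2 * (j + k) + 0)) + ?\<phi> (\<Union>j. S (2 * (j + k) + 1)))"
        using UX by (intro add_left_mono hausdorff_outer_Un_le)
      also have "\<dots> \<le> ?\<phi> (R (2 * k)) + (ennreal (e / 2) + ennreal (e / 2))"
        by (intro add_left_mono add_mono order_trans[OF hausdorff_outer_UN_le tail] SX) auto
      also have "ennreal (e / 2) + ennreal (e / 2) = ennreal e"
        using \<open>0 < e\<close> by (subst ennreal_plus[symmetric]) auto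
      finally have "?\<phi> (T - ?E) \<le> ?\<phi> (R (2 * k)) + ennreal e" .
      then have "?\<phi> (T \<inter> ?E) + ?\<phi> (T - ?E) \<le> ?\<phi> (T \<inter> ?E) + (?\<phi> (R (2 * k)) + ennreal e)"
        by (intro add_left_mono)
      also have "\<dots> \<le> ?\<phi> T + ennreal e"
        using R[of "2 * k"] by (simp add: add.assoc[symmetric] add_right_mono)
      finally show "?\<phi> (T \<inter> ?E) + ?\<phi> (T - ?E) \<le> ?\<phi> T + ennreal e" .
    qed
  qed simp
  show ?thesis
    unfolding sets_hausdorff_measure lambda_system_def
  proof (intro CollectI conjI ballI)
    fix T assume "T \<in> Pow X"
    then have T: "T \<subseteq> X" by simp
    have "?\<phi> T = ?\<phi> ((T \<inter> ?E) \<union> (T - ?E))" by (rule arg_cong[of _ _ ?\<phi>]) auto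
    also have "\<dots> \<le> ?\<phi> (T \<inter> ?E) + ?\<phi> (T - ?E)" using T by (intro hausdorff_outer_Un_le) auto
    finally have "?\<phi> (T \<inter> ?E) + ?\<phi> (T - ?E) = ?\<phi> T" using main[OF T] by simp
    moreover have "?E \<inter> T = T \<inter> ?E" "(X - ?E) \<inter> T = T - ?E" using T by auto
    ultimately show "?\<phi> (?E \<inter> T) + ?\<phi> ((X - ?E) \<inter> T) = ?\<phi> T" by simp
  qed auto
qed

text \<open>An explicit finite family is put in front of an arbitrary cover of the rest
  \<open>B\<close>. With \<open>B\<close> empty this bounds the content by a grid; with
  \<open>B\<close> the uncovered remainder it gives the packing argument.\<close>

lemma hausdorff_content_le_finite:
  assumes F: "finite F" and E: "\<And>v. v \<in> F \<Longrightarrow> E v \<subseteq> X" "\<And>v. v \<in> F \<Longrightarrow> set_diam d (E v) \<le> ennreal \<epsilon>"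
    and cov: "A \<subseteq> (\<Union>v\<in>F. E v) \<union> B"
  shows "hausdorff_content d X n \<epsilon> A \<le> (\<Sum>v\<in>F. hausdorff_weight d n (E v)) + hausdorff_content d X n \<epsilon> B"
proof -
  obtain m and e :: "nat \<Rightarrow> _" where e: "bij_betw e {..<m} F"
    using ex_bij_betw_nat_finite[OF F] by (auto simp: atLeast0LessThan)
  have "hausdorff_content d X n \<epsilon> A
      \<le> (\<Sum>v\<in>F. hausdorff_weight d n (E v)) + (\<Sum>k. hausdorff_weight d n (U k))"
    if U: "U \<in> hausdorff_cover d X \<epsilon> B" for U
  proof -
    define W where "W k = (if k < m then E (e k) else U (k - m))" for k
    have eF: "e k \<in> F" if "k < m" for k using e that by (auto simp: bij_betw_def)
    have "A \<subseteq> (\<Union>k. W k)"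
    proof
      fix x assume "x \<in> A"
      then consider v where "v \<in> F" "x \<in> E v" | "x \<in> B" using cov by auto
      then show "x \<in> (\<Union>k. W k)"
      proof cases
        case 1
        then obtain k where "k < m" "e k = v" using e by (auto simp: bij_betw_def)
        then show ?thesis using 1 by (auto simp: W_def intro!: exI[of _ k])
      next
        case 2
        then obtain j where "x \<in> U j" using U by (auto simp: hausdorff_cover_def)
        then show ?thesis by (auto simp: W_def intro!: exI[of _ "j + m"])
      qed
    qed
    then have "W \<in> hausdorff_cover d X \<epsilon> A"
      using U E eF by (auto simp: hausdorff_cover_def W_def subset_eq)
    then have "hausdorff_content d X n \<epsilon> A \<le> (\<Sum>k. hausdorff_weight d n (W k))"
      unfolding hausdorff_content_def by (rule INF_lower)
    also have "\<dots> = (\<Sum>k. hausdorff_weight d n (W (k + m))) + (\<Sum>k<m. hausdorff_weight d n (W k))"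
      by (rule suminf_offset) simp
    also have "(\<Sum>k<m. hausdorff_weight d n (W k)) = (\<Sum>v\<in>F. hausdorff_weight d n (E v))"
      using e by (intro sum.reindex_bij_betw[of e, THEN trans[rotated]] sum.cong) (auto simp: W_def)
    finally show ?thesis by (simp add: W_def add.commute)
  qed
  note le = this
  show ?thesis
  proof (rule ennreal_le_epsilon)
    fix e :: real
    assume e: "0 < e" and lt: "(\<Sum>v\<in>F. hausdorff_weight d n (E v)) + hausdorff_content d X n \<epsilon> B < top"
    then have "hausdorff_content d X n \<epsilon> B < hausdorff_content d X n \<epsilon> B + ennreal e"
      by (auto simp: ennreal_add_left_cancel_less[of _ 0, simplified])
    then obtain U where U: "U \<in> hausdorff_cover d X \<epsilon> B"
      "(\<Sum>k. hausdorff_weight d n (U k)) < hausdorff_content d X n \<epsilon> B + ennreal e"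
      unfolding hausdorff_content_def by (subst (asm) (1) INF_less_iff) blast
    have "hausdorff_content d X n \<epsilon> A
        \<le> (\<Sum>v\<in>F. hausdorff_weight d n (E v)) + (\<Sum>k. hausdorff_weight d n (U k))"
      by (rule le[OF U(1)])
    also have "\<dots> \<le> (\<Sum>v\<in>F. hausdorff_weight d n (E v)) + (hausdorff_content d X n \<epsilon> B + ennreal e)"
      using U(2) by (intro add_left_mono less_imp_le)
    finally show "hausdorff_content d X n \<epsilon> A
        \<le> (\<Sum>v\<in>F. hausdorff_weight d n (E v)) + hausdorff_content d X n \<epsilon> B + ennreal e"
      by (simp add: add.assoc)
  qed
qed

text \<open>Integrate the indicator of x + y in \<open>A\<close> and y in \<open>B\<close> in both
  orders: translating in x gives the left-hand side; translating in y first and then in x gives the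
  right-hand side, where \<open>B\<close> appears reflected. With \<open>B\<close> of Lebesgue
  measure 1 the factor of proportionality does not depend on \<open>A\<close>.\<close>

lemma translation_invariant_measure_unique:
  fixes \<mu> :: "('i \<Rightarrow> real) measure"
  assumes I: "finite I" and "sigma_finite_measure \<mu>" and sets_\<mu>: "sets \<mu> = sets (Leb I)"
    and inv: "\<And>v A. A \<in> sets (Leb I) \<Longrightarrow>
      emeasure \<mu> {x \<in> space (Leb I). (\<lambda>i\<in>I. v i + x i) \<in> A} = emeasure \<mu> A"
    and A: "A \<in> sets (Leb I)" and B: "B \<in> sets (Leb I)"
  shows "emeasure \<mu> A * emeasure (Leb I) B
    = emeasure (Leb I) A * emeasure \<mu> {x \<in> space (Leb I). (\<lambda>i\<in>I. - x i) \<in> B}"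
proof -
  interpret \<mu>: sigma_finite_measure \<mu> by fact
  interpret L: sigma_finite_measure "Leb I" using I by (rule Leb.sigma_finite)
  interpret P: pair_sigma_finite "Leb I" \<mu> ..
  note [measurable_cong] = sets_\<mu>
  note [measurable] = A B
  have space_\<mu>: "space \<mu> = space (Leb I)" using sets_\<mu> by (rule sets_eq_imp_space_eq)
  let ?plus = "\<lambda>x y. \<lambda>i\<in>I. x i + y i :: real" and ?minus = "\<lambda>x y. \<lambda>i\<in>I. x i - y i :: real"
  have "(\<integral>\<^sup>+x. \<integral>\<^sup>+y. indicator A (?plus x y) * indicator B y \<partial>Leb I \<partial>\<mu>)
      = (\<integral>\<^sup>+y. \<integral>\<^sup>+x. indicator A (?plus x y) * indicator B y \<partial>\<mu> \<partial>Leb I)"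
    by (rule P.Fubini') measurable
  also have "\<dots> = (\<integral>\<^sup>+y. emeasure \<mu> A * indicator B y \<partial>Leb I)"
  proof (rule nn_integral_cong)
    fix y assume y: "y \<in> space (Leb I)"
    have "(\<integral>\<^sup>+x. indicator A (?plus x y) * indicator B y \<partial>\<mu>)
       = (\<integral>\<^sup>+x. indicator {x \<in> space (Leb I). (\<lambda>i\<in>I. y i + x i) \<in> A} x * indicator B y \<partial>\<mu>)"
      by (intro nn_integral_cong) (auto simp: indicator_def space_\<mu> add.commute)
    also have "\<dots> = emeasure \<mu> A * indicator B y"
      using inv[OF A, of y] y by (subst nn_integral_multc) (auto simp: sets_\<mu>)
    finally show "(\<integral>\<^sup>+x. indicator A (?plus x y) * indicator B y \<partial>\<mu>) = emeasure \<mu> A * indicator B y" .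
  qed
  also have "\<dots> = emeasure \<mu> A * emeasure (Leb I) B"
    by (simp add: nn_integral_cmult)
  finally have 1: "(\<integral>\<^sup>+x. \<integral>\<^sup>+y. indicator A (?plus x y) * indicator B y \<partial>Leb I \<partial>\<mu>)
      = emeasure \<mu> A * emeasure (Leb I) B" .
  have "(\<integral>\<^sup>+x. \<integral>\<^sup>+y. indicator A (?plus x y) * indicator B y \<partial>Leb I \<partial>\<mu>)
     = (\<integral>\<^sup>+x. \<integral>\<^sup>+y. indicator A y * indicator B (?minus y x) \<partial>Leb I \<partial>\<mu>)"
  proof (rule nn_integral_cong)
    fix x assume x: "x \<in> space \<mu>"
    have "(\<integral>\<^sup>+y. indicator A (?plus x y) * indicator B y \<partial>Leb I)
      = (\<integral>\<^sup>+y. indicator A (?plus x (\<lambda>i\<in>I. - x i + 1 * y i)) * indicator B (\<lambda>i\<in>I. - x i + 1 * y i) \<partial>Leb I)"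
      using nn_integral_Leb_affine[OF I, of 1 "\<lambda>y. indicator A (?plus x y) * indicator B y" "\<lambda>i. - x i"] x
      by (simp add: space_\<mu>)
    also have "\<dots> = (\<integral>\<^sup>+y. indicator A y * indicator B (?minus y x) \<partial>Leb I)"
    proof (rule nn_integral_cong)
      fix y assume y: "y \<in> space (Leb I)"
      have "?plus x (\<lambda>i\<in>I. - x i + 1 * y i) = y"
        using y by (auto simp: space_PiM PiE_iff extensional_def fun_eq_iff)
      moreover have "(\<lambda>i\<in>I. - x i + 1 * y i) = ?minus y x" by (auto simp: fun_eq_iff)
      ultimately show "indicator A (?plus x (\<lambda>i\<in>I. - x i + 1 * y i)) * indicator B (\<lambda>i\<in>I. - x i + 1 * y i)
         = indicator A y * (indicator B (?minus y x) :: ennreal)" by simp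
    qed
    finally show "(\<integral>\<^sup>+y. indicator A (?plus x y) * indicator B y \<partial>Leb I)
      = (\<integral>\<^sup>+y. indicator A y * indicator B (?minus y x) \<partial>Leb I)" .
  qed
  also have "\<dots> = (\<integral>\<^sup>+y. \<integral>\<^sup>+x. indicator A y * indicator B (?minus y x) \<partial>\<mu> \<partial>Leb I)"
    by (rule P.Fubini') measurable
  also have "\<dots> = (\<integral>\<^sup>+y. indicator A y * emeasure \<mu> {x \<in> space (Leb I). (\<lambda>i\<in>I. - x i) \<in> B} \<partial>Leb I)"
  proof (rule nn_integral_cong)
    fix y assume y: "y \<in> space (Leb I)"
    define C where "C = {x \<in> space (Leb I). (\<lambda>i\<in>I. y i - x i) \<in> B}"
    have C [measurable]: "C \<in> sets (Leb I)" unfolding C_def using y by measurable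
    have "(\<integral>\<^sup>+x. indicator A y * indicator B (?minus y x) \<partial>\<mu>) = (\<integral>\<^sup>+x. indicator A y * indicator C x \<partial>\<mu>)"
      by (intro nn_integral_cong) (auto simp: indicator_def C_def space_\<mu>)
    also have "\<dots> = indicator A y * emeasure \<mu> C"
      by (subst nn_integral_cmult) (auto simp: sets_\<mu>)
    also have "emeasure \<mu> C = emeasure \<mu> {x \<in> space (Leb I). (\<lambda>i\<in>I. y i + x i) \<in> C}"
      using inv[OF C, of y] by simp
    also have "{x \<in> space (Leb I). (\<lambda>i\<in>I. y i + x i) \<in> C} = {x \<in> space (Leb I). (\<lambda>i\<in>I. - x i) \<in> B}"
    proof -
      have "(\<lambda>i\<in>I. y i - (\<lambda>i\<in>I. y i + x i) i) = (\<lambda>i\<in>I. - x i)" for x :: "'i \<Rightarrow> real"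
        by (auto simp: fun_eq_iff)
      then show ?thesis by (auto simp: C_def space_PiM PiE_iff)
    qed
    finally show "(\<integral>\<^sup>+x. indicator A y * indicator B (?minus y x) \<partial>\<mu>)
       = indicator A y * emeasure \<mu> {x \<in> space (Leb I). (\<lambda>i\<in>I. - x i) \<in> B}" .
  qed
  also have "\<dots> = emeasure (Leb I) A * emeasure \<mu> {x \<in> space (Leb I). (\<lambda>i\<in>I. - x i) \<in> B}"
    by (simp add: nn_integral_multc)
  finally show ?thesis using 1 by simp
qed

text \<open>A norm on coordinates in \<open>I\<close>, represented on all functions, with
  \<open>q_cong\<close> saying that only these coordinates count. \<open>q_ge\<close> and
  \<open>q_le\<close> compare it with the maximum norm. The instance of interest is the Euclidean
  metric of the hyperplane read in N - 1 coordinates.\<close>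

locale coord_norm =
  fixes I :: "'i set" and q :: "('i \<Rightarrow> real) \<Rightarrow> real" and K :: real
  assumes fin: "finite I"
    and q_meas [measurable]: "q \<in> borel_measurable (Leb I)"
    and q_cong: "\<And>x y. (\<And>i. i \<in> I \<Longrightarrow> x i = y i) \<Longrightarrow> q x = q y"
    and q_scale: "\<And>c x. q (\<lambda>i. c * x i) = \<bar>c\<bar> * q x"
    and q_add: "\<And>x y. q (\<lambda>i. x i + y i) \<le> q x + q y"
    and q_ge: "\<And>i x. i \<in> I \<Longrightarrow> \<bar>x i\<bar> \<le> q x"
    and q_le: "\<And>r x. 0 \<le> r \<Longrightarrow> (\<And>i. i \<in> I \<Longrightarrow> \<bar>x i\<bar> \<le> r) \<Longrightarrow> q x \<le> K * r"
    and K_pos: "0 < K"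
begin

abbreviation "Y \<equiv> space (Leb I)"
definition "qdist x y = q (\<lambda>i. x i - y i)"
definition "qball r = {x \<in> Y. q x \<le> r}"
definition "V = measure (Leb I) (qball 1)"

section \<open>Volumes of balls and the isodiametric inequality\<close>

lemma qball_sets [measurable]: "qball r \<in> sets (Leb I)"
  unfolding qball_def by measurable

lemma emeasure_box:
  fixes a b :: real
  assumes "a \<le> b"
  shows "emeasure (Leb I) (PiE I (\<lambda>_. {a..b})) = ennreal ((b - a) ^ card I)"
proof -
  have "emeasure (Leb I) (PiE I (\<lambda>_. {a..b})) = (\<Prod>i\<in>I. emeasure lborel {a..b})"
    using fin by (intro Leb.emeasure_PiM) auto
  then show ?thesis using assms by (simp add: ennreal_power)
qed

lemma emeasure_qball1: "emeasure (Leb I) (qball 1) = ennreal V"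
proof -
  have "emeasure (Leb I) (qball 1) \<le> emeasure (Leb I) (PiE I (\<lambda>_. {-1..1}))"
  proof (rule emeasure_mono)
    show "qball 1 \<subseteq> PiE I (\<lambda>_. {-1..1})"
    proof
      fix x assume x: "x \<in> qball 1"
      then have "\<bar>x i\<bar> \<le> 1" if "i \<in> I" for i using q_ge[OF that, of x] by (auto simp: qball_def)
      then show "x \<in> PiE I (\<lambda>_. {-1..1})"
        using x by (auto simp: qball_def space_PiM PiE_iff abs_le_iff)
    qed
  qed (use fin in \<open>auto intro!: sets_PiM_I_finite\<close>)
  also have "\<dots> < top" by (subst emeasure_box) auto
  finally show ?thesis unfolding V_def by (simp add: emeasure_eq_ennreal_measure)
qed

lemma V_pos: "0 < V"
proof -
  define r where "r = 1 / K"
  have "emeasure (Leb I) (PiE I (\<lambda>_. {-r..r})) \<le> emeasure (Leb I) (qball 1)"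
  proof (intro emeasure_mono subsetI)
    fix x assume x: "x \<in> PiE I (\<lambda>_. {-r..r})"
    have "q x \<le> K * r" using x K_pos by (intro q_le) (auto simp: r_def PiE_iff abs_le_iff)
    then show "x \<in> qball 1" using x K_pos by (auto simp: qball_def r_def space_PiM PiE_iff)
  qed simp
  then have "ennreal ((2 * r) ^ card I) \<le> ennreal V"
    using K_pos emeasure_box[of "-r" r] unfolding emeasure_qball1 by (simp add: r_def)
  moreover have "0 < (2 * r) ^ card I" using K_pos by (simp add: r_def)
  ultimately show ?thesis by (meson ennreal_le_iff2 le_less_trans linorder_not_less order_less_le_trans)
qed

lemma q_minus: "q (\<lambda>i. - x i) = q x"
  using q_scale[of "-1" x] by simp

lemma emeasure_qball:
  assumes "0 < r"
  shows "emeasure (Leb I) (qball r) = ennreal (V * r ^ card I)"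
proof -
  have "{x \<in> Y. (\<lambda>i\<in>I. 0 + r * x i) \<in> qball r} = qball 1"
  proof -
    have "q (\<lambda>i\<in>I. r * x i) = r * q x" for x
      using q_scale[of r x] q_cong[of "\<lambda>i\<in>I. r * x i" "\<lambda>i. r * x i"] assms by simp
    then show ?thesis using assms by (auto simp: qball_def space_PiM PiE_iff)
  qed
  then show ?thesis
    using emeasure_Leb_affine[OF fin, of r "qball r" "\<lambda>_. 0"] assms V_pos
    by (simp add: emeasure_qball1 ennreal_mult[symmetric] mult.commute)
qed

text \<open>Apply Prekopa-Leindler to the indicators of \<open>A\<close> and of its reflection:
  midpoints are half differences of points of \<open>A\<close>, hence lie in the ball of radius D /
  2. The reflection has the same volume, so the product on the left is a square. No symmetrisation
  is involved, and any norm is allowed.\<close>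

lemma isodiametric:
  assumes A [measurable]: "A \<in> sets (Leb I)" and D: "\<And>x y. x \<in> A \<Longrightarrow> y \<in> A \<Longrightarrow> qdist x y \<le> D" "0 < D"
  shows "emeasure (Leb I) A \<le> ennreal (V * (D / 2) ^ card I)"
proof -
  define B where "B = {x \<in> Y. (\<lambda>i\<in>I. 0 + -1 * x i) \<in> A}"
  have [measurable]: "B \<in> sets (Leb I)" unfolding B_def by measurable
  have "emeasure (Leb I) A = emeasure (Leb I) B"
    using emeasure_Leb_affine[OF fin, of "-1" A "\<lambda>_. 0"] A by (simp add: B_def)
  moreover have "(\<integral>\<^sup>+x. indicator A x \<partial>Leb I) * (\<integral>\<^sup>+x. indicator B x \<partial>Leb I)
     \<le> (\<integral>\<^sup>+x. indicator (qball (D / 2)) x \<partial>Leb I)\<^sup>2"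
  proof (rule Prekopa_Leindler[OF fin])
    fix x y assume "x \<in> Y" "y \<in> Y"
    show "indicator A x * indicator B y \<le> ((indicator (qball (D / 2)) (\<lambda>i\<in>I. (x i + y i) / 2))\<^sup>2 :: ennreal)"
    proof (cases "x \<in> A \<and> y \<in> B")
      case True
      then have "qdist x (\<lambda>i\<in>I. 0 + -1 * y i) \<le> D" by (intro D) (auto simp: B_def)
      also have "qdist x (\<lambda>i\<in>I. 0 + -1 * y i) = q (\<lambda>i. x i + y i)"
        unfolding qdist_def by (rule q_cong) simp
      finally have "q (\<lambda>i\<in>I. (x i + y i) / 2) \<le> D / 2"
        using q_scale[of "1/2" "\<lambda>i. x i + y i"] q_cong[of "\<lambda>i\<in>I. (x i + y i) / 2" "\<lambda>i. 1/2 * (x i + y i)"] by simp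
      then show ?thesis by (auto simp: qball_def space_PiM indicator_def)
    qed (auto simp: indicator_def)
  qed measurable
  ultimately have "(emeasure (Leb I) A)\<^sup>2 \<le> (ennreal (V * (D / 2) ^ card I))\<^sup>2"
    using D(2) by (simp add: power2_eq_square emeasure_qball)
  note sq = this
  have le: "c \<le> ennreal b" if "c\<^sup>2 \<le> (ennreal b)\<^sup>2" "0 \<le> b" for c :: ennreal and b
  proof (cases c)
    case (real a)
    then have "a\<^sup>2 \<le> b\<^sup>2" using that by (simp add: ennreal_power ennreal_le_iff)
    then show ?thesis using real that(2) by (auto simp: power2_le_iff_abs_le intro!: ennreal_leI)
  qed (use that in \<open>simp add: ennreal_power power2_eq_square ennreal_mult[symmetric] top_unique\<close>)
  show ?thesis using V_pos D(2) by (intro le[OF sq]) simp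
qed

text \<open>\<open>U\<close> is arbitrary, but there are only countably many cells, so the union of
  those that meet \<open>U\<close> is measurable.\<close>

lemma grid_sets:
  fixes k :: real
  shows "{x \<in> Y. \<exists>u\<in>U. \<forall>i\<in>I. \<lfloor>k * x i\<rfloor> = \<lfloor>k * u i\<rfloor>} \<in> sets (Leb I)"
proof -
  define F where "F = (\<lambda>u. \<lambda>i\<in>I. \<lfloor>k * u i\<rfloor>) ` U"
  have "countable (PiE I (\<lambda>_. UNIV :: int set))" using fin by (intro countable_PiE) auto
  moreover have "F \<subseteq> PiE I (\<lambda>_. UNIV)" by (auto simp: F_def)
  ultimately have F: "countable F" by (rule countable_subset[rotated])
  have "{x \<in> Y. \<exists>u\<in>U. \<forall>i\<in>I. \<lfloor>k * x i\<rfloor> = \<lfloor>k * u i\<rfloor>} = (\<Union>v\<in>F. {x \<in> Y. \<forall>i\<in>I. \<lfloor>k * x i\<rfloor> = v i})"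
    by (auto simp: F_def)
  also have "\<dots> \<in> sets (Leb I)"
  proof (rule sets.countable_UN''[OF F])
    fix v assume "v \<in> F"
    show "{x \<in> Y. \<forall>i\<in>I. \<lfloor>k * x i\<rfloor> = v i} \<in> sets (Leb I)"
      using fin by measurable
  qed
  finally show ?thesis .
qed

lemma qdist_triangle: "qdist x z \<le> qdist x y + qdist y z"
  using q_add[of "\<lambda>i. x i - y i" "\<lambda>i. y i - z i"] by (simp add: qdist_def)

lemma qdist_commute: "qdist x y = qdist y x"
  using q_minus[of "\<lambda>i. x i - y i"] by (simp add: qdist_def)

lemma qdist_le_grid:
  assumes "0 < k" "\<And>i. i \<in> I \<Longrightarrow> \<lfloor>k * x i\<rfloor> = \<lfloor>k * u i\<rfloor>"
  shows "qdist x u \<le> K / k"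
proof -
  have "\<bar>x i - u i\<bar> \<le> 1 / k" if "i \<in> I" for i
  proof -
    have "\<bar>k * x i - k * u i\<bar> \<le> 1" using assms(2)[OF that] by linarith
    then have "k * \<bar>x i - u i\<bar> \<le> 1" using \<open>0 < k\<close> by (simp add: right_diff_distrib[symmetric] abs_mult)
    then show ?thesis using \<open>0 < k\<close> by (simp add: field_simps)
  qed
  then show ?thesis unfolding qdist_def using q_le[of "1 / k" "\<lambda>i. x i - u i"] \<open>0 < k\<close> by simp
qed

text \<open>The members of a Hausdorff cover need not be measurable, so the isodiametric inequality
  is applied to the union of the grid cells that meet \<open>U\<close>. The intersection over finer
  and finer grids loses nothing in the limit.\<close>

lemma measurable_hull:
  assumes U: "U \<subseteq> Y" "set_diam qdist U \<noteq> top"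
  obtains U' where "U' \<in> sets (Leb I)" "U \<subseteq> U'"
    "ennreal (unit_ball_vol (card I) / V) * emeasure (Leb I) U' \<le> hausdorff_weight qdist (card I) U"
proof (cases "U = {}")
  case True
  then show ?thesis by (intro that[of "{}"]) auto
next
  case False
  obtain D where D: "set_diam qdist U = ennreal D" "0 \<le> D" using U(2) by (cases "set_diam qdist U") auto
  have dist: "qdist x y \<le> D" if "x \<in> U" "y \<in> U" for x y
    using set_diam_ge[OF that, of qdist] D by (simp add: ennreal_le_iff)
  define G where "G j = {x \<in> Y. \<exists>u\<in>U. \<forall>i\<in>I. \<lfloor>real (Suc j) * x i\<rfloor> = \<lfloor>real (Suc j) * u i\<rfloor>}" for j
  have [measurable]: "G j \<in> sets (Leb I)" for j unfolding G_def by (rule grid_sets)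
  \<comment> \<open>Each of two points of the hull is moved to a point of \<open>U\<close> in its
    own cell, at a cost of at most K / (j + 1). The excess also keeps the diameter bound positive
    when D = 0.\<close>
  define b where "b j = V * ((D + 2 * (K / real (Suc j))) / 2) ^ card I" for j
  have G: "emeasure (Leb I) (G j) \<le> ennreal (b j)" for j
    unfolding b_def
  proof (rule isodiametric)
    fix x y assume "x \<in> G j" "y \<in> G j"
    then obtain u v where uv: "u \<in> U" "v \<in> U" "qdist x u \<le> K / real (Suc j)" "qdist y v \<le> K / real (Suc j)"
      unfolding G_def by (auto intro!: qdist_le_grid simp del: of_nat_Suc) (metis of_nat_0_less_iff qdist_le_grid zero_less_Suc)
    have "qdist x y \<le> qdist x u + (qdist u v + qdist v y)"
      using qdist_triangle[of x y u] qdist_triangle[of u y v] by linarith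
    then show "qdist x y \<le> D + 2 * (K / real (Suc j))"
      using uv dist[of u v] qdist_commute[of v y] by linarith
  next
    show "0 < D + 2 * (K / real (Suc j))" using D K_pos by (simp add: add_nonneg_pos)
  qed simp
  let ?U = "\<Inter>j. G j"
  have U': "?U \<in> sets (Leb I)" by (intro sets.countable_INT) auto
  have "U \<subseteq> ?U" using U(1) by (auto simp: G_def)
  have "emeasure (Leb I) ?U \<le> ennreal (V * (D / 2) ^ card I)"
  proof (rule LIMSEQ_le_const)
    have "(\<lambda>j. K / real (Suc j)) \<longlonglongrightarrow> 0"
      by (rule LIMSEQ_Suc[OF lim_const_over_n])
    then have "b \<longlonglongrightarrow> V * ((D + 2 * 0) / 2) ^ card I"
      unfolding b_def by (intro tendsto_intros) auto
    then show "(\<lambda>j. ennreal (b j)) \<longlonglongrightarrow> ennreal (V * (D / 2) ^ card I)"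
      by (intro tendsto_ennrealI) simp
    show "\<exists>N. \<forall>j\<ge>N. emeasure (Leb I) ?U \<le> ennreal (b j)"
      by (intro exI allI impI order_trans[OF _ G] emeasure_mono) auto
  qed
  then have "ennreal (unit_ball_vol (card I) / V) * emeasure (Leb I) ?U
     \<le> ennreal (unit_ball_vol (card I) / V) * ennreal (V * (D / 2) ^ card I)"
    by (intro mult_left_mono) auto
  also have "\<dots> = ennreal (unit_ball_vol (card I) / V * (V * (D / 2) ^ card I))"
    using V_pos D(2) by (intro ennreal_mult[symmetric]) auto
  also have "unit_ball_vol (card I) / V * (V * (D / 2) ^ card I) = unit_ball_vol (card I) / 2 ^ card I * D ^ card I"
    using V_pos by (simp add: power_divide)
  also have "ennreal \<dots> = hausdorff_weight qdist (card I) U"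
    using False D(2) by (simp add: hausdorff_weight_def D(1) ennreal_power ennreal_mult[symmetric])
  finally show ?thesis using that[OF U' \<open>U \<subseteq> ?U\<close>] by simp
qed

text \<open>The isodiametric inequality bounds each covering set separately, so it bounds the
  content at every mesh; mesh 1 is used because it makes all diameters finite.\<close>

lemma Leb_le_hausdorff_outer:
  assumes A: "A \<in> sets (Leb I)"
  shows "ennreal (unit_ball_vol (card I) / V) * emeasure (Leb I) A \<le> hausdorff_outer qdist Y (card I) A"
proof -
  have "ennreal (unit_ball_vol (card I) / V) * emeasure (Leb I) A \<le> hausdorff_content qdist Y (card I) 1 A"
    unfolding hausdorff_content_def
  proof (rule INF_greatest)
    fix U assume U: "U \<in> hausdorff_cover qdist Y 1 A"
    have "\<exists>U'. U' \<in> sets (Leb I) \<and> U k \<subseteq> U' \<and>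
      ennreal (unit_ball_vol (card I) / V) * emeasure (Leb I) U' \<le> hausdorff_weight qdist (card I) (U k)" for k
    proof (rule measurable_hull[of "U k"])
      show "U k \<subseteq> Y" using U by (auto simp: hausdorff_cover_def)
      have "set_diam qdist (U k) \<le> ennreal 1" using U unfolding hausdorff_cover_def by blast
      then show "set_diam qdist (U k) \<noteq> top" by (metis ennreal_neq_top top.extremum_uniqueI)
    qed blast
    then obtain U' where U': "\<And>k. U' k \<in> sets (Leb I)" "\<And>k. U k \<subseteq> U' k"
      "\<And>k. ennreal (unit_ball_vol (card I) / V) * emeasure (Leb I) (U' k) \<le> hausdorff_weight qdist (card I) (U k)"
      by metis
    have "emeasure (Leb I) A \<le> emeasure (Leb I) (\<Union>k. U' k)"
      using U U'(1,2) by (intro emeasure_mono) (fastforce simp: hausdorff_cover_def)+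
    also have "\<dots> \<le> (\<Sum>k. emeasure (Leb I) (U' k))"
      using U'(1) by (intro emeasure_subadditive_countably) auto
    finally have "ennreal (unit_ball_vol (card I) / V) * emeasure (Leb I) A
      \<le> (\<Sum>k. ennreal (unit_ball_vol (card I) / V) * emeasure (Leb I) (U' k))"
      by (simp add: mult_left_mono)
    also have "\<dots> \<le> (\<Sum>k. hausdorff_weight qdist (card I) (U k))"
      using U'(3) by (intro suminf_le) auto
    finally show "ennreal (unit_ball_vol (card I) / V) * emeasure (Leb I) A
      \<le> (\<Sum>k. hausdorff_weight qdist (card I) (U k))" .
  qed
  also have "\<dots> \<le> hausdorff_outer qdist Y (card I) A" by (rule hausdorff_content_le_outer) simp
  finally show ?thesis .
qed


section \<open>Hausdorff measure of the norm as a multiple of Lebesgue measure\<close>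

abbreviation "HM \<equiv> hausdorff_measure qdist Y (card I)"

text \<open>By \<open>q_ge\<close> every coordinate is 1-Lipschitz for \<open>qdist\<close>, so its
  sublevel sets satisfy the Caratheodory criterion.\<close>

lemma identity_measurable_HM: "(\<lambda>x. x) \<in> measurable HM (Leb I)"
proof (rule measurable_PiM_single')
  fix i assume i: "i \<in> I"
  have "{x \<in> Y. x i \<le> a} \<in> sets HM" for a
    by (rule sublevel_in_sets_hausdorff_measure) (use q_ge[OF i] in \<open>auto simp: qdist_def\<close>)
  then have "(\<lambda>x. x i) \<in> borel_measurable HM"
    by (subst borel_measurable_iff_le) simp
  then show "(\<lambda>x. x i) \<in> measurable HM lborel" by simp
qed (simp add: space_PiM)

text \<open>The restriction to the product \<sigma>-algebra, on which Hausdorff and Lebesgue measure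
  can be compared; the Caratheodory \<sigma>-algebra of \<open>HM\<close> may be larger.\<close>

definition "\<mu> = distr HM (Leb I) (\<lambda>x. x)"

lemma sets_\<mu> [measurable_cong]: "sets \<mu> = sets (Leb I)" by (simp add: \<mu>_def)

lemma sets_HM: "A \<in> sets (Leb I) \<Longrightarrow> A \<in> sets HM"
  using measurable_sets[OF identity_measurable_HM, of A] sets.sets_into_space[of A "Leb I"]
  by (simp add: Int_absorb2)

lemma emeasure_\<mu>: "A \<in> sets (Leb I) \<Longrightarrow> emeasure \<mu> A = hausdorff_outer qdist Y (card I) A"
  using sets.sets_into_space[of A "Leb I"] sets_HM[of A]
  by (simp add: \<mu>_def emeasure_distr[OF identity_measurable_HM] emeasure_hausdorff_measure Int_absorb2)

lemma \<mu>_translate: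
  assumes A: "A \<in> sets (Leb I)"
  shows "emeasure \<mu> {x \<in> Y. (\<lambda>i\<in>I. v i + x i) \<in> A} = emeasure \<mu> A"
proof -
  let ?T = "\<lambda>x. \<lambda>i\<in>I. v i + x i" and ?P = "{x \<in> Y. (\<lambda>i\<in>I. v i + x i) \<in> A}"
  have P: "?P \<in> sets (Leb I)" using A by measurable
  have bij: "bij_betw ?T Y Y"
    by (rule bij_betw_byWitness[where f' = "\<lambda>x. \<lambda>i\<in>I. x i - v i"])
      (auto simp: space_PiM PiE_iff extensional_def fun_eq_iff)
  have "hausdorff_outer qdist Y (card I) (?T ` ?P) = hausdorff_outer qdist Y (card I) ?P"
  proof (rule hausdorff_outer_bij_isometry[OF bij])
    show "qdist (?T x) (?T y) = qdist x y" for x y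
      unfolding qdist_def by (rule q_cong) simp
  qed auto
  moreover have "?T ` ?P = A"
  proof
    show "A \<subseteq> ?T ` ?P"
    proof
      fix a assume a: "a \<in> A"
      then have "a \<in> ?T ` Y" using sets.sets_into_space[OF A] bij by (auto simp: bij_betw_def)
      then obtain x where "a = ?T x" "x \<in> Y" by (rule imageE)
      then show "a \<in> ?T ` ?P" using a by (intro image_eqI[of _ _ x]) auto
    qed
  qed auto
  ultimately show ?thesis using A P by (simp add: emeasure_\<mu>)
qed

text \<open>Half-open cells written with floors, so that the cells of one grid are disjoint and
  cover everything.\<close>

definition "cube k v = {x \<in> Y. \<forall>i\<in>I. \<lfloor>k * x i\<rfloor> = v i}" for k :: real and v :: "'i \<Rightarrow> int"

lemma cube_sets [measurable]: "cube k v \<in> sets (Leb I)"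
  unfolding cube_def using fin by measurable

lemma cube_diam: "0 < k \<Longrightarrow> set_diam qdist (cube k v) \<le> ennreal (K / k)"
  by (intro set_diam_le qdist_le_grid) (auto simp: cube_def)

abbreviation "grid k \<equiv> PiE I (\<lambda>_. {0..<int k})"

lemma card_grid: "card (grid k) = k ^ card I"
  using fin by (simp add: card_PiE)

lemma unit_cube_eq:
  assumes "0 < k"
  shows "cube 1 (\<lambda>_. 0) = (\<Union>v\<in>grid k. cube (real k) v)"
proof -
  have *: "\<lfloor>t\<rfloor> = 0 \<longleftrightarrow> \<lfloor>real k * t\<rfloor> \<in> {0..<int k}" for t
  proof -
    have "\<lfloor>t\<rfloor> = 0 \<longleftrightarrow> 0 \<le> t \<and> t < 1" by (simp add: floor_eq_iff)
    also have "\<dots> \<longleftrightarrow> 0 \<le> real k * t \<and> real k * t < real k" using assms by (simp add: zero_le_mult_iff)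
    also have "\<dots> \<longleftrightarrow> \<lfloor>real k * t\<rfloor> \<in> {0..<int k}" by (simp add: floor_less_iff)
    finally show ?thesis .
  qed
  show ?thesis
  proof (intro set_eqI iffI)
    fix x assume "x \<in> cube 1 (\<lambda>_. 0)"
    then have "(\<lambda>i\<in>I. \<lfloor>real k * x i\<rfloor>) \<in> grid k" "x \<in> cube (real k) (\<lambda>i\<in>I. \<lfloor>real k * x i\<rfloor>)"
      using * by (auto simp: cube_def PiE_iff simp del: atLeastLessThan_iff)
    then show "x \<in> (\<Union>v\<in>grid k. cube (real k) v)" by blast
  next
    fix x assume "x \<in> (\<Union>v\<in>grid k. cube (real k) v)"
    then obtain v where "v \<in> grid k" "x \<in> cube (real k) v" by blast
    then have "x \<in> Y" "\<forall>i\<in>I. \<lfloor>real k * x i\<rfloor> \<in> {0..<int k}" by (auto simp: cube_def PiE_iff)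
    then show "x \<in> cube 1 (\<lambda>_. 0)" using * by (simp add: cube_def del: atLeastLessThan_iff)
  qed
qed

lemma cube_emeasure: "emeasure (Leb I) (cube 1 v) = 1"
proof -
  have "cube 1 v = PiE I (\<lambda>i. {of_int (v i)..<of_int (v i) + 1})"
    by (auto simp: cube_def space_PiM PiE_iff floor_eq_iff extensional_def)
  then show ?thesis using fin by (simp add: Leb.emeasure_PiM)
qed

lemma \<mu>_cube: "emeasure \<mu> (cube 1 v) = emeasure \<mu> (cube 1 (\<lambda>_. 0))"
proof -
  have "{x \<in> Y. (\<lambda>i\<in>I. of_int (v i) + x i) \<in> cube 1 v} = cube 1 (\<lambda>_. 0)"
    by (auto simp: cube_def space_PiM int_add_floor[symmetric])
  then show ?thesis using \<mu>_translate[OF cube_sets[of 1 v], of "\<lambda>i. of_int (v i)"] by simp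
qed

lemma weight_le:
  assumes "set_diam qdist E \<le> ennreal r" "0 \<le> r"
  shows "hausdorff_weight qdist (card I) E \<le> ennreal (unit_ball_vol (card I) / 2 ^ card I * r ^ card I)"
proof -
  have "hausdorff_weight qdist (card I) E
    \<le> ennreal (unit_ball_vol (card I) / 2 ^ card I) * ennreal r ^ card I"
    unfolding hausdorff_weight_def using assms by (auto intro!: mult_left_mono power_mono)
  also have "\<dots> = ennreal (unit_ball_vol (card I) / 2 ^ card I * r ^ card I)"
    using assms(2) by (subst ennreal_mult) (auto simp: ennreal_power)
  finally show ?thesis .
qed

lemma content_empty: "hausdorff_content qdist Y n \<epsilon> {} = 0"
proof -
  have "hausdorff_content qdist Y n \<epsilon> {} \<le> (\<Sum>k. hausdorff_weight qdist n {})"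
    unfolding hausdorff_content_def by (rule INF_lower) (auto simp: hausdorff_cover_def)
  then show ?thesis by simp
qed

lemma sum_grid_weight_le:
  assumes "\<And>v. v \<in> grid k \<Longrightarrow> set_diam qdist (E v) \<le> ennreal (a / real k)" "0 < k" "0 \<le> a"
  shows "(\<Sum>v\<in>grid k. hausdorff_weight qdist (card I) (E v)) \<le> ennreal (unit_ball_vol (card I) / 2 ^ card I * a ^ card I)"
proof -
  have "(\<Sum>v\<in>grid k. hausdorff_weight qdist (card I) (E v))
     \<le> (\<Sum>v\<in>grid k. ennreal (unit_ball_vol (card I) / 2 ^ card I * (a / real k) ^ card I))"
    using assms by (intro sum_mono weight_le) auto
  also have "\<dots> = ennreal (real (k ^ card I)) * ennreal (unit_ball_vol (card I) / 2 ^ card I * (a / real k) ^ card I)"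
    using card_grid[of k] by (simp add: ennreal_of_nat_eq_real_of_nat)
  also have "\<dots> = ennreal (real (k ^ card I) * (unit_ball_vol (card I) / 2 ^ card I * (a / real k) ^ card I))"
    using assms(3) by (intro ennreal_mult[symmetric]) auto
  also have "real (k ^ card I) * (unit_ball_vol (card I) / 2 ^ card I * (a / real k) ^ card I)
     = unit_ball_vol (card I) / 2 ^ card I * a ^ card I"
    using assms(2) by (simp add: power_divide)
  finally show ?thesis .
qed

lemma finite_grid: "finite (grid k)" using fin by (intro finite_PiE) auto

text \<open>The unit cube consists of k^n cells of diameter at most K / k, whose total weight does
  not depend on k. The bound is far from sharp; it only provides the \<sigma>-finiteness required
  for uniqueness.\<close>

lemma \<mu>_unit_cube_finite: "emeasure \<mu> (cube 1 (\<lambda>_. 0)) \<noteq> top"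
proof -
  let ?b = "ennreal (unit_ball_vol (card I) / 2 ^ card I * K ^ card I)"
  have "hausdorff_outer qdist Y (card I) (cube 1 (\<lambda>_. 0)) \<le> ?b"
    unfolding hausdorff_outer_eq_SUP_content
  proof (rule SUP_least)
    fix \<epsilon> :: real assume "\<epsilon> \<in> {0<..}"
    then have "0 < \<epsilon>" by simp
    obtain k :: nat where k: "K / \<epsilon> < real k" using reals_Archimedean2 by blast
    moreover have "0 < K / \<epsilon>" using K_pos \<open>0 < \<epsilon>\<close> by simp
    ultimately have "0 < k" by linarith
    have Kk: "K / real k \<le> \<epsilon>" using k \<open>0 < k\<close> \<open>0 < \<epsilon>\<close> by (simp add: field_simps)
    have "hausdorff_content qdist Y (card I) \<epsilon> (cube 1 (\<lambda>_. 0))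
      \<le> (\<Sum>v\<in>grid k. hausdorff_weight qdist (card I) (cube (real k) v)) + hausdorff_content qdist Y (card I) \<epsilon> {}"
    proof (rule hausdorff_content_le_finite[OF finite_grid])
      show "set_diam qdist (cube (real k) v) \<le> ennreal \<epsilon>" for v
        using cube_diam[of "real k" v] \<open>0 < k\<close> Kk by (meson ennreal_leI of_nat_0_less_iff order_trans)
      show "cube (real k) v \<subseteq> Y" for v by (auto simp: cube_def)
    qed (use unit_cube_eq[OF \<open>0 < k\<close>] in auto)
    also have "\<dots> \<le> ?b + 0"
      using K_pos \<open>0 < k\<close> by (intro add_mono sum_grid_weight_le) (auto simp: content_empty intro: cube_diam)
    finally show "hausdorff_content qdist Y (card I) \<epsilon> (cube 1 (\<lambda>_. 0)) \<le> ?b" by simp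
  qed
  then show ?thesis by (subst emeasure_\<mu>) (auto simp: top_unique)
qed

lemma sigma_finite_\<mu>: "sigma_finite_measure \<mu>"
proof
  let ?A = "cube 1 ` (PiE I (\<lambda>_. UNIV))"
  have sp: "space \<mu> = Y" using sets_\<mu> by (rule sets_eq_imp_space_eq)
  have "countable ?A" using fin by (intro countable_image countable_PiE) auto
  moreover have "?A \<subseteq> sets \<mu>" by (auto simp: sets_\<mu>)
  moreover have "\<Union>?A = space \<mu>"
  proof -
    have "x \<in> cube 1 (\<lambda>i\<in>I. \<lfloor>x i\<rfloor>)" if "x \<in> Y" for x using that by (auto simp: cube_def)
    moreover have "(\<lambda>i\<in>I. \<lfloor>x i\<rfloor>) \<in> PiE I (\<lambda>_. UNIV)" for x :: "'i \<Rightarrow> real" by auto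
    ultimately show ?thesis unfolding sp by (intro set_eqI iffI) (force simp: cube_def, blast)
  qed
  moreover have "\<forall>a\<in>?A. emeasure \<mu> a \<noteq> \<infinity>"
  proof
    fix a assume "a \<in> ?A"
    then obtain v where "a = cube 1 v" by blast
    then show "emeasure \<mu> a \<noteq> \<infinity>" using \<mu>_cube[of v] \<mu>_unit_cube_finite by (metis infinity_ennreal_def)
  qed
  ultimately show "\<exists>A. countable A \<and> A \<subseteq> sets \<mu> \<and> \<Union>A = space \<mu> \<and> (\<forall>a\<in>A. emeasure \<mu> a \<noteq> \<infinity>)" by blast
qed

lemma \<mu>_eq_cube_mult:
  assumes A: "A \<in> sets (Leb I)"
  shows "emeasure \<mu> A = emeasure \<mu> (cube 1 (\<lambda>_. 0)) * emeasure (Leb I) A"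
proof -
  let ?Q = "cube 1 (\<lambda>_. 0)" and ?c = "emeasure \<mu> {x \<in> Y. (\<lambda>i\<in>I. - x i) \<in> cube 1 (\<lambda>_. 0)}"
  have *: "emeasure \<mu> A = emeasure (Leb I) A * ?c" if "A \<in> sets (Leb I)" for A
    using translation_invariant_measure_unique[OF fin sigma_finite_\<mu> sets_\<mu> \<mu>_translate that cube_sets[of 1 "\<lambda>_. 0"]]
    by (simp add: cube_emeasure)
  show ?thesis using *[OF A] *[OF cube_sets[of 1 "\<lambda>_. 0"]] by (simp add: cube_emeasure mult.commute)
qed

lemma emeasure_small_ball:
  assumes "0 < r"
  shows "emeasure (Leb I) {x \<in> Y. q (\<lambda>i. x i - v i) \<le> r} = ennreal (V * r ^ card I)"
proof -
  let ?E = "{x \<in> Y. q (\<lambda>i. x i - v i) \<le> r}"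
  have qr: "q (\<lambda>i\<in>I. x i - v i) = q (\<lambda>i. x i - v i)" for x by (rule q_cong) simp
  have "(\<lambda>x. q (\<lambda>i\<in>I. x i - v i)) \<in> borel_measurable (Leb I)" by measurable
  then have E: "?E \<in> sets (Leb I)" unfolding qr by measurable
  have "q (\<lambda>i. (\<lambda>i\<in>I. v i + 1 * x i) i - v i) = q x" for x by (rule q_cong) simp
  then have "{x \<in> Y. (\<lambda>i\<in>I. v i + 1 * x i) \<in> ?E} = qball r"
    by (auto simp: qball_def space_PiM)
  then show ?thesis using emeasure_Leb_affine[OF fin _ E, of 1 v] emeasure_qball[OF assms] by simp
qed

lemma sets_small_ball: "{x \<in> Y. q (\<lambda>i. x i - v i) \<le> r} \<in> sets (Leb I)"
proof -
  have qr: "q (\<lambda>i\<in>I. x i - v i) = q (\<lambda>i. x i - v i)" for x by (rule q_cong) simp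
  have "(\<lambda>x. q (\<lambda>i\<in>I. x i - v i)) \<in> borel_measurable (Leb I)" by measurable
  then show ?thesis unfolding qr by measurable
qed

text \<open>
  Packing: each cell of the grid of mesh \<open>1/k\<close> contains a ball of radius \<open>1/(4k)\<close>, whose weight is
  exactly \<open>unit_ball_vol n / V\<close> times its volume; the rest of the cube keeps the fraction
  \<open>1 - V/4^n\<close> of the unknown constant, independently of \<open>k\<close>.
\<close>

lemma \<mu>_unit_cube: "emeasure \<mu> (cube 1 (\<lambda>_. 0)) = ennreal (unit_ball_vol (card I) / V)"
proof -
  let ?Q = "cube 1 (\<lambda>_. 0)" and ?\<omega> = "unit_ball_vol (card I)"
  obtain c where c: "emeasure \<mu> ?Q = ennreal c" "0 \<le> c"
    using \<mu>_unit_cube_finite by (cases "emeasure \<mu> ?Q") auto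
  \<comment> \<open>The volume fraction of the cube filled by the balls: k^n V (1 / (4
    k))^n.\<close>
  define \<theta> where "\<theta> = V / 4 ^ card I"
  have \<theta>0: "0 < \<theta>" using V_pos by (simp add: \<theta>_def)
  have "ennreal (?\<omega> / V) \<le> ennreal c"
    using Leb_le_hausdorff_outer[OF cube_sets[of 1 "\<lambda>_. 0"]] c by (simp add: cube_emeasure emeasure_\<mu>)
  moreover have "ennreal c \<le> ennreal (?\<omega> / 4 ^ card I + c * (1 - \<theta>)) \<and> \<theta> \<le> 1"
  proof -
    have step: "hausdorff_content qdist Y (card I) \<epsilon> ?Q \<le> ennreal (?\<omega> / 4 ^ card I + c * (1 - \<theta>)) \<and> \<theta> \<le> 1"
      if "0 < \<epsilon>" for \<epsilon> :: real
    proof -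
      obtain k :: nat where k: "1 / \<epsilon> < real k" using reals_Archimedean2 by blast
      moreover have "0 < 1 / \<epsilon>" using \<open>0 < \<epsilon>\<close> by simp
      ultimately have k0: "0 < k" by linarith
      have k\<epsilon>: "(1/2) / real k \<le> \<epsilon>" using k k0 \<open>0 < \<epsilon>\<close> by (simp add: field_simps)
      \<comment> \<open>Half of the inradius 1 / (2 k) of a cell in the maximum norm, which keeps
        the balls away from the faces, where the floor function jumps.\<close>
      define r where "r = 1 / (4 * real k)"
      have r0: "0 < r" using k0 by (simp add: r_def)
      define m where "m v i = (of_int (v i) + 1/2) / real k" for v :: "'i \<Rightarrow> int" and i
      define E where "E v = {x \<in> Y. q (\<lambda>i. x i - m v i) \<le> r}" for v
      have E [measurable]: "E v \<in> sets (Leb I)" for v unfolding E_def by (rule sets_small_ball)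
      have E_cube: "E v \<subseteq> cube (real k) v" for v
      proof
        fix x assume x: "x \<in> E v"
        have "\<lfloor>real k * x i\<rfloor> = v i" if "i \<in> I" for i
        proof -
          have "\<bar>x i - m v i\<bar> \<le> r" using q_ge[OF that, of "\<lambda>i. x i - m v i"] x by (auto simp: E_def)
          then have "real k * \<bar>x i - m v i\<bar> \<le> real k * r" by (intro mult_left_mono) auto
          also have "real k * r = 1/4" using k0 by (simp add: r_def)
          also have "real k * \<bar>x i - m v i\<bar> = \<bar>real k * x i - (of_int (v i) + 1/2)\<bar>"
          proof -
            have "real k * x i - (of_int (v i) + 1/2) = real k * (x i - m v i)"
              using k0 by (simp add: m_def right_diff_distrib)
            then show ?thesis by (simp add: abs_mult)
          qed
          finally show ?thesis by (intro floor_unique) linarith+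
        qed
        then show "x \<in> cube (real k) v" using x by (auto simp: cube_def E_def)
      qed
      have disj: "disjoint_family_on E (grid k)"
      unfolding disjoint_family_on_def
      proof (intro ballI impI)
        fix v w assume vw: "v \<in> grid k" "w \<in> grid k" "v \<noteq> w"
        show "E v \<inter> E w = {}"
        proof (rule ccontr)
          assume "E v \<inter> E w \<noteq> {}"
          then obtain x where "x \<in> cube (real k) v" "x \<in> cube (real k) w" using E_cube by blast
          then have "\<forall>i\<in>I. v i = w i" by (auto simp: cube_def)
          then have "v = w" using vw by (metis PiE_ext)
          then show False using vw by simp
        qed
      qed
      let ?E = "\<Union>v\<in>grid k. E v"
      have E_Q: "?E \<subseteq> ?Q" using E_cube unfolding unit_cube_eq[OF k0] by blast
      have E_sets: "?E \<in> sets (Leb I)" using finite_grid by (intro sets.finite_UN) auto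
      have "emeasure (Leb I) ?E = (\<Sum>v\<in>grid k. emeasure (Leb I) (E v))"
        using disj finite_grid by (intro sum_emeasure[symmetric]) auto
      also have "\<dots> = (\<Sum>v\<in>grid k. ennreal (V * r ^ card I))"
        unfolding E_def by (intro sum.cong refl emeasure_small_ball r0)
      also have "\<dots> = ennreal (real (k ^ card I)) * ennreal (V * r ^ card I)"
        using card_grid[of k] by (simp add: ennreal_of_nat_eq_real_of_nat)
      also have "\<dots> = ennreal (real (k ^ card I) * (V * r ^ card I))"
        using V_pos r0 by (intro ennreal_mult[symmetric]) auto
      also have "real (k ^ card I) * (V * r ^ card I) = \<theta>"
        using k0 by (simp add: r_def \<theta>_def power_divide power_mult_distrib)
      finally have L_E: "emeasure (Leb I) ?E = ennreal \<theta>" .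
      have "ennreal \<theta> \<le> emeasure (Leb I) ?Q" unfolding L_E[symmetric] using E_Q by (intro emeasure_mono) auto
      then have \<theta>1: "\<theta> \<le> 1" by (simp add: cube_emeasure)
      have "emeasure (Leb I) (?Q - ?E) = emeasure (Leb I) ?Q - emeasure (Leb I) ?E"
        using E_Q E_sets L_E by (intro emeasure_Diff) auto
      also have "\<dots> = ennreal (1 - \<theta>)"
        using \<theta>0 by (simp add: cube_emeasure L_E ennreal_minus flip: ennreal_1)
      finally have L_R: "emeasure (Leb I) (?Q - ?E) = ennreal (1 - \<theta>)" .
      have R: "hausdorff_content qdist Y (card I) \<epsilon> (?Q - ?E) \<le> ennreal (c * (1 - \<theta>))"
      proof -
        have "hausdorff_content qdist Y (card I) \<epsilon> (?Q - ?E) \<le> hausdorff_outer qdist Y (card I) (?Q - ?E)"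
          using \<open>0 < \<epsilon>\<close> by (rule hausdorff_content_le_outer)
        also have "\<dots> = emeasure \<mu> (?Q - ?E)" using E_sets by (intro emeasure_\<mu>[symmetric]) auto
        also have "\<dots> = emeasure \<mu> ?Q * emeasure (Leb I) (?Q - ?E)"
          using E_sets by (intro \<mu>_eq_cube_mult) auto
        also have "\<dots> = ennreal (c * (1 - \<theta>))" unfolding c(1) L_R using c(2) \<theta>1 by (intro ennreal_mult[symmetric]) auto
        finally show ?thesis .
      qed
      have diam: "set_diam qdist (E v) \<le> ennreal ((1/2) / real k)" for v
      proof (rule set_diam_le)
        fix x y assume xy: "x \<in> E v" "y \<in> E v"
        have "qdist x y \<le> qdist x (m v) + qdist (m v) y" by (rule qdist_triangle)
        also have "\<dots> \<le> r + r" using xy qdist_commute[of "m v" y] by (intro add_mono) (auto simp: E_def qdist_def)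
        finally show "qdist x y \<le> (1/2) / real k" by (simp add: r_def)
      qed
      have "hausdorff_content qdist Y (card I) \<epsilon> ?Q
        \<le> (\<Sum>v\<in>grid k. hausdorff_weight qdist (card I) (E v)) + hausdorff_content qdist Y (card I) \<epsilon> (?Q - ?E)"
      proof (rule hausdorff_content_le_finite[OF finite_grid])
        show "set_diam qdist (E v) \<le> ennreal \<epsilon>" for v
          using diam[of v] k\<epsilon> by (meson ennreal_leI order_trans)
      qed (auto simp: E_def)
      also have "\<dots> \<le> ennreal (?\<omega> / 2 ^ card I * (1/2) ^ card I) + ennreal (c * (1 - \<theta>))"
        using diam k0 R by (intro add_mono sum_grid_weight_le) auto
      also have "\<dots> = ennreal (?\<omega> / 2 ^ card I * (1/2) ^ card I + c * (1 - \<theta>))"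
        using c(2) \<theta>1 by (intro ennreal_plus[symmetric]) auto
      also have "?\<omega> / 2 ^ card I * (1/2) ^ card I = ?\<omega> / 4 ^ card I"
        by (simp add: power_divide power_mult_distrib[symmetric])
      finally show ?thesis using \<theta>1 by simp
    qed
    have "emeasure \<mu> ?Q \<le> ennreal (?\<omega> / 4 ^ card I + c * (1 - \<theta>))"
      unfolding emeasure_\<mu>[OF cube_sets] hausdorff_outer_eq_SUP_content using step by (intro SUP_least) auto
    then show ?thesis using c step[of 1] by simp
  qed
  ultimately have "?\<omega> / V \<le> c" "c \<le> ?\<omega> / 4 ^ card I + c * (1 - \<theta>)"
  proof -
    assume le: "ennreal (?\<omega> / V) \<le> ennreal c" "ennreal c \<le> ennreal (?\<omega> / 4 ^ card I + c * (1 - \<theta>)) \<and> \<theta> \<le> 1"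
    show "?\<omega> / V \<le> c" using le(1) c(2) by (simp add: ennreal_le_iff)
    have "0 \<le> ?\<omega> / 4 ^ card I + c * (1 - \<theta>)" using le(2) c(2) by simp
    then show "c \<le> ?\<omega> / 4 ^ card I + c * (1 - \<theta>)" using le(2) ennreal_le_iff by blast
  qed
  \<comment> \<open>The unknown c occurs on both sides of the packing bound. Since \<theta> is
    positive, a single packing at each mesh already forces the upper bound, without iterating to
    fill the whole cube.\<close>
  then have "c * \<theta> \<le> ?\<omega> / 4 ^ card I" by (simp add: algebra_simps)
  then have "c * V \<le> ?\<omega>" by (simp add: \<theta>_def field_simps)
  then have "c = ?\<omega> / V" using \<open>?\<omega> / V \<le> c\<close> V_pos by (simp add: field_simps)
  then show ?thesis using c by simp
qed

theorem distr_hausdorff_measure: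
  "distr HM (Leb I) (\<lambda>x. x) = density (Leb I) (\<lambda>_. ennreal (unit_ball_vol (card I) / V))"
proof (rule measure_eqI)
  fix A assume "A \<in> sets (distr HM (Leb I) (\<lambda>x. x))"
  then have A: "A \<in> sets (Leb I)" by simp
  show "emeasure (distr HM (Leb I) (\<lambda>x. x)) A
     = emeasure (density (Leb I) (\<lambda>_. ennreal (unit_ball_vol (card I) / V))) A"
    using \<mu>_eq_cube_mult[OF A] A
    by (simp add: \<mu>_def[symmetric] \<mu>_unit_cube emeasure_density nn_integral_cmult)
qed simp

lemma integral_hausdorff_measure:
  fixes f :: "('i \<Rightarrow> real) \<Rightarrow> real"
  assumes [measurable]: "f \<in> borel_measurable (Leb I)"
  shows "(\<integral>x. f x \<partial>HM) = unit_ball_vol (card I) / V * (\<integral>x. f x \<partial>Leb I)"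
proof -
  have "(\<integral>x. f x \<partial>HM) = (\<integral>x. f x \<partial>distr HM (Leb I) (\<lambda>x. x))"
    by (subst integral_distr[OF identity_measurable_HM]) auto
  also have "\<dots> = (\<integral>x. unit_ball_vol (card I) / V * f x \<partial>Leb I)"
    unfolding distr_hausdorff_measure using V_pos by (subst integral_density) auto
  finally show ?thesis by simp
qed

end

section \<open>Integration over the hyperplane\<close>

text \<open>Write exp (- g^2) as the integral of exp (- t) over t >= g^2 and exchange the integrals.
  This links the volume of a ball to a Gaussian integral, which is how the volume of the unit ball
  of the hyperplane norm is found below.\<close>

lemma nn_integral_exp_minus_square_layer:
  fixes g :: "'a \<Rightarrow> real"
  assumes "sigma_finite_measure M" and [measurable]: "g \<in> borel_measurable M" and "0 \<le> v" "-1 < a"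
    and vol: "\<And>t. 0 < t \<Longrightarrow> emeasure M {x \<in> space M. (g x)\<^sup>2 \<le> t} = ennreal (v * t powr a)"
  shows "(\<integral>\<^sup>+x. ennreal (exp (- (g x)\<^sup>2)) \<partial>M) = ennreal (v * Gamma (a + 1))"
proof -
  interpret M: sigma_finite_measure M by fact
  interpret P: pair_sigma_finite lborel M ..
  have tail: "(\<integral>\<^sup>+t. ennreal (exp (-t)) * indicator {b..} t \<partial>lborel) = ennreal (exp (- b))" for b :: real
  proof -
    have "(\<integral>\<^sup>+t. ennreal (exp (-t)) * indicator {b..} t \<partial>lborel) = ennreal (0 - (- exp (- b)))"
    proof (rule nn_integral_FTC_atLeast)
      show "((\<lambda>t::real. - exp (- t)) \<longlongrightarrow> 0) at_top"
        using filterlim_compose[OF exp_at_bot filterlim_uminus_at_bot_at_top] tendsto_minus by fastforce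
    qed (auto intro!: derivative_eq_intros)
    then show ?thesis by simp
  qed
  have "(\<integral>\<^sup>+x. ennreal (exp (- (g x)\<^sup>2)) \<partial>M)
      = (\<integral>\<^sup>+x. \<integral>\<^sup>+t. ennreal (exp (-t)) * indicator {(g x)\<^sup>2..} t \<partial>lborel \<partial>M)"
    by (simp add: tail)
  also have "\<dots> = (\<integral>\<^sup>+x. \<integral>\<^sup>+t. ennreal (exp (-t)) * (if (g x)\<^sup>2 \<le> t then 1 else 0) \<partial>lborel \<partial>M)"
    by (intro nn_integral_cong) (auto simp: indicator_def)
  also have "\<dots> = (\<integral>\<^sup>+t. \<integral>\<^sup>+x. ennreal (exp (-t)) * (if (g x)\<^sup>2 \<le> t then 1 else 0) \<partial>M \<partial>lborel)"
    by (rule P.Fubini') measurable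
  also have "\<dots> = (\<integral>\<^sup>+t. ennreal (v * (indicator {0..} t * t powr (a + 1 - 1) / exp t)) \<partial>lborel)"
  proof (rule nn_integral_cong_AE)
    have "AE t in lborel. t \<noteq> (0::real)" by (rule AE_lborel_singleton)
    then show "AE t in lborel. (\<integral>\<^sup>+x. ennreal (exp (-t)) * (if (g x)\<^sup>2 \<le> t then 1 else 0) \<partial>M)
      = ennreal (v * (indicator {0..} t * t powr (a + 1 - 1) / exp t))"
    proof eventually_elim
      fix t :: real assume "t \<noteq> 0"
      have "(\<integral>\<^sup>+x. ennreal (exp (-t)) * (if (g x)\<^sup>2 \<le> t then 1 else 0) \<partial>M)
         = (\<integral>\<^sup>+x. ennreal (exp (-t)) * indicator {x \<in> space M. (g x)\<^sup>2 \<le> t} x \<partial>M)"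
        by (intro nn_integral_cong) (auto simp: indicator_def)
      also have "\<dots> = ennreal (exp (-t)) * emeasure M {x \<in> space M. (g x)\<^sup>2 \<le> t}"
        by (subst nn_integral_cmult) auto
      also have "\<dots> = ennreal (v * (indicator {0..} t * t powr (a + 1 - 1) / exp t))"
      proof (cases "0 < t")
        case True
        then show ?thesis using \<open>0 \<le> v\<close>
          by (subst vol[OF True]) (auto simp: ennreal_mult[symmetric] exp_minus field_simps)
      next
        case False
        then have "\<not> (g x)\<^sup>2 \<le> t" for x using \<open>t \<noteq> 0\<close> zero_le_power2[of "g x"] by linarith
        then have emp: "{x \<in> space M. (g x)\<^sup>2 \<le> t} = {}" by blast
        show ?thesis unfolding emp using False \<open>t \<noteq> 0\<close> by simp
      qed
      finally show "(\<integral>\<^sup>+x. ennreal (exp (-t)) * (if (g x)\<^sup>2 \<le> t then 1 else 0) \<partial>M)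
        = ennreal (v * (indicator {0..} t * t powr (a + 1 - 1) / exp t))" .
    qed
  qed
  also have "\<dots> = ennreal v * (\<integral>\<^sup>+t. ennreal (indicator {0..} t * t powr (a + 1 - 1) / exp t) \<partial>lborel)"
  proof -
    have "ennreal (v * u) = ennreal v * ennreal u" for u using \<open>0 \<le> v\<close> by (rule ennreal_mult')
    then show ?thesis by (simp only:) (rule nn_integral_cmult, measurable)
  qed
  also have "\<dots> = ennreal v * ennreal (Gamma (a + 1))"
    using \<open>-1 < a\<close> by (subst Gamma_conv_nn_integral_real) auto
  also have "\<dots> = ennreal (v * Gamma (a + 1))"
    using \<open>0 \<le> v\<close> \<open>-1 < a\<close> by (intro ennreal_mult[symmetric]) (auto intro: Gamma_real_nonneg)
  finally show ?thesis .
qed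

lemma nn_integral_gaussian_std: "(\<integral>\<^sup>+t. ennreal (exp (- t\<^sup>2)) \<partial>lborel) = ennreal (sqrt pi)"
proof -
  have "(\<integral>\<^sup>+t. ennreal (exp (- t\<^sup>2)) \<partial>lborel) = ennreal (2 * Gamma (1/2 + 1))"
  proof (rule nn_integral_exp_minus_square_layer)
    fix t :: real assume "0 < t"
    have "x\<^sup>2 \<le> t \<longleftrightarrow> \<bar>x\<bar> \<le> sqrt t" for x :: real by (metis real_sqrt_abs real_sqrt_le_iff)
    moreover have "\<bar>x\<bar> \<le> r \<longleftrightarrow> x \<in> {- r..r}" for x r :: real by auto
    ultimately have "{x. x\<^sup>2 \<le> t} = {- sqrt t..sqrt t}" by blast
    then show "emeasure lborel {x \<in> space lborel. x\<^sup>2 \<le> t} = ennreal (2 * t powr (1/2))"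
      using \<open>0 < t\<close> by (simp add: powr_half_sqrt)
  qed (auto intro: sigma_finite_lborel)
  also have "2 * Gamma (1/2 + 1 :: real) = sqrt pi"
  proof -
    have "(1/2 :: real) \<notin> \<int>\<^sub>\<le>\<^sub>0" by (auto elim!: nonpos_Ints_cases)
    then show ?thesis using Gamma_plus1[of "1/2 :: real"] by (simp add: Gamma_one_half_real)
  qed
  finally show ?thesis .
qed

lemma nn_integral_gaussian:
  assumes "0 < a"
  shows "(\<integral>\<^sup>+t. ennreal (exp (- (a * (t - b)\<^sup>2))) \<partial>lborel) = ennreal (sqrt (pi / a))"
proof -
  have "(\<integral>\<^sup>+t. ennreal (exp (- (a * (t - b)\<^sup>2))) \<partial>lborel)
     = \<bar>1 / sqrt a\<bar> * (\<integral>\<^sup>+t. ennreal (exp (- (a * ((b + 1 / sqrt a * t) - b)\<^sup>2))) \<partial>lborel)"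
    using assms by (intro nn_integral_real_affine) auto
  also have "(\<lambda>t. a * ((b + 1 / sqrt a * t) - b)\<^sup>2) = (\<lambda>t. t\<^sup>2)"
    using assms by (auto simp: power_divide)
  also have "ennreal \<bar>1 / sqrt a\<bar> * (\<integral>\<^sup>+t. ennreal (exp (- t\<^sup>2)) \<partial>lborel) = ennreal (sqrt (pi / a))"
    using assms by (simp add: nn_integral_gaussian_std ennreal_mult[symmetric] real_sqrt_divide)
  finally show ?thesis .
qed

text \<open>The convolution of card I + 1 Gaussians at s. Only s = 0 is used later, but integrating
  out one coordinate t moves s to s - t, so the induction needs general s.\<close>

lemma nn_integral_gaussian_convolution:
  assumes "finite I"
  shows "(\<integral>\<^sup>+x. ennreal (exp (- ((\<Sum>i\<in>I. (x i)\<^sup>2) + (s - (\<Sum>i\<in>I. x i))\<^sup>2))) \<partial>Leb I)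
    = ennreal (sqrt pi ^ card I / sqrt (real (card I) + 1) * exp (- (s\<^sup>2 / (real (card I) + 1))))"
  using assms
proof (induction I arbitrary: s rule: finite_induct)
  case empty
  then show ?case by (simp add: Leb.nn_integral_empty space_PiM)
next
  case (insert i I)
  let ?n = "real (card I)"
  let ?c = "sqrt pi ^ card I / sqrt (?n + 1)"
  have c0: "0 \<le> ?c" by simp
  have "(\<integral>\<^sup>+x. ennreal (exp (- ((\<Sum>i\<in>insert i I. (x i)\<^sup>2) + (s - (\<Sum>i\<in>insert i I. x i))\<^sup>2))) \<partial>Leb (insert i I))
    = (\<integral>\<^sup>+t. \<integral>\<^sup>+x. ennreal (exp (- ((\<Sum>j\<in>insert i I. ((x(i := t)) j)\<^sup>2) + (s - (\<Sum>j\<in>insert i I. (x(i := t)) j))\<^sup>2))) \<partial>Leb I \<partial>lborel)"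
    using insert.hyps by (intro Leb.product_nn_integral_insert_rev) auto
  also have "\<dots> = (\<integral>\<^sup>+t. \<integral>\<^sup>+x. ennreal (exp (- t\<^sup>2)) * ennreal (exp (- ((\<Sum>j\<in>I. (x j)\<^sup>2) + ((s - t) - (\<Sum>j\<in>I. x j))\<^sup>2))) \<partial>Leb I \<partial>lborel)"
  proof (intro nn_integral_cong)
    fix t :: real and x :: "'a \<Rightarrow> real"
    have "(\<Sum>j\<in>insert i I. ((x(i := t)) j)\<^sup>2) = t\<^sup>2 + (\<Sum>j\<in>I. (x j)\<^sup>2)"
      "(\<Sum>j\<in>insert i I. (x(i := t)) j) = t + (\<Sum>j\<in>I. x j)"
      using insert.hyps by (auto intro!: sum.cong)
    then show "ennreal (exp (- ((\<Sum>j\<in>insert i I. ((x(i := t)) j)\<^sup>2) + (s - (\<Sum>j\<in>insert i I. (x(i := t)) j))\<^sup>2)))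
       = ennreal (exp (- t\<^sup>2)) * ennreal (exp (- ((\<Sum>j\<in>I. (x j)\<^sup>2) + ((s - t) - (\<Sum>j\<in>I. x j))\<^sup>2)))"
      by (simp add: ennreal_mult[symmetric] exp_add[symmetric] algebra_simps)
  qed
  also have "\<dots> = (\<integral>\<^sup>+t. ennreal (exp (- t\<^sup>2)) * ennreal (?c * exp (- ((s - t)\<^sup>2 / (?n + 1)))) \<partial>lborel)"
  proof (rule nn_integral_cong)
    fix t :: real
    have "(\<integral>\<^sup>+x. ennreal (exp (- t\<^sup>2)) * ennreal (exp (- ((\<Sum>j\<in>I. (x j)\<^sup>2) + ((s - t) - (\<Sum>j\<in>I. x j))\<^sup>2))) \<partial>Leb I)
      = ennreal (exp (- t\<^sup>2)) * (\<integral>\<^sup>+x. ennreal (exp (- ((\<Sum>j\<in>I. (x j)\<^sup>2) + ((s - t) - (\<Sum>j\<in>I. x j))\<^sup>2))) \<partial>Leb I)"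
      by (rule nn_integral_cmult) measurable
    then show "(\<integral>\<^sup>+x. ennreal (exp (- t\<^sup>2)) * ennreal (exp (- ((\<Sum>j\<in>I. (x j)\<^sup>2) + ((s - t) - (\<Sum>j\<in>I. x j))\<^sup>2))) \<partial>Leb I)
      = ennreal (exp (- t\<^sup>2)) * ennreal (?c * exp (- ((s - t)\<^sup>2 / (?n + 1))))"
      by (simp only: insert.IH)
  qed
  also have "\<dots> = (\<integral>\<^sup>+t. ennreal (?c * exp (- (s\<^sup>2 / (?n + 2)))) *
      ennreal (exp (- ((?n + 2) / (?n + 1) * (t - s / (?n + 2))\<^sup>2))) \<partial>lborel)"
  proof (rule nn_integral_cong)
    fix t :: real
    \<comment> \<open>Completing the square in t, with k the number of coordinates already
      integrated.\<close>
    have "t\<^sup>2 + (s - t)\<^sup>2 / (k + 1) = s\<^sup>2 / (k + 2) + (k + 2) / (k + 1) * (t - s / (k + 2))\<^sup>2" if "k \<ge> 0" for k :: real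
    proof -
      have "(k + 1) * (k + 2) * (t\<^sup>2 + (s - t)\<^sup>2 / (k + 1)) = (k + 1) * (k + 2) * t\<^sup>2 + (k + 2) * (s - t)\<^sup>2"
        using that by (simp add: field_simps)
      also have "\<dots> = (k + 1) * s\<^sup>2 + ((k + 2) * t - s)\<^sup>2"
        by (simp add: power2_eq_square algebra_simps)
      also have "(k + 2) * t - s = (k + 2) * (t - s / (k + 2))"
        using that by (simp add: field_simps)
      also have "(k + 1) * s\<^sup>2 + ((k + 2) * (t - s / (k + 2)))\<^sup>2
        = (k + 1) * (k + 2) * (s\<^sup>2 / (k + 2) + (k + 2) / (k + 1) * (t - s / (k + 2))\<^sup>2)"
      proof -
        have "(k + 1) * (k + 2) * (s\<^sup>2 / (k + 2)) = (k + 1) * s\<^sup>2" using that by simp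
        moreover have "(k + 1) * (k + 2) * ((k + 2) / (k + 1) * (t - s / (k + 2))\<^sup>2) = ((k + 2) * (t - s / (k + 2)))\<^sup>2"
          using that by (simp add: power_mult_distrib power2_eq_square)
        ultimately show ?thesis by (simp only: distrib_left)
      qed
      finally show ?thesis using that by (simp only: mult_cancel_left) auto
    qed
    from this[of ?n] show "ennreal (exp (- t\<^sup>2)) * ennreal (?c * exp (- ((s - t)\<^sup>2 / (?n + 1))))
       = ennreal (?c * exp (- (s\<^sup>2 / (?n + 2)))) * ennreal (exp (- ((?n + 2) / (?n + 1) * (t - s / (?n + 2))\<^sup>2)))"
      by (simp add: ennreal_mult[symmetric] exp_add[symmetric] mult.assoc mult.left_commute)
  qed
  also have "\<dots> = ennreal (?c * exp (- (s\<^sup>2 / (?n + 2)))) * ennreal (sqrt (pi / ((?n + 2) / (?n + 1))))"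
  proof -
    have "(\<integral>\<^sup>+t. ennreal (exp (- ((?n + 2) / (?n + 1) * (t - s / (?n + 2))\<^sup>2))) \<partial>lborel)
      = ennreal (sqrt (pi / ((?n + 2) / (?n + 1))))"
      by (rule nn_integral_gaussian) (simp add: add_pos_pos)
    then show ?thesis by (subst nn_integral_cmult) simp_all
  qed
  also have "\<dots> = ennreal (?c * exp (- (s\<^sup>2 / (?n + 2))) * sqrt (pi / ((?n + 2) / (?n + 1))))"
    by (intro ennreal_mult[symmetric]) auto
  also have "?c * exp (- (s\<^sup>2 / (?n + 2))) * sqrt (pi / ((?n + 2) / (?n + 1)))
     = sqrt pi ^ Suc (card I) / sqrt (?n + 2) * exp (- (s\<^sup>2 / (?n + 2)))"
  proof -
    have "sqrt (pi / ((?n + 2) / (?n + 1))) = sqrt pi * sqrt (?n + 1) / sqrt (?n + 2)"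
      by (simp add: real_sqrt_divide real_sqrt_mult)
    moreover have "sqrt (?n + 1) \<noteq> 0" by simp
    ultimately show ?thesis by simp
  qed
  finally show ?case using insert.hyps by (simp add: add_ac)
qed

text \<open>The Euclidean length of a vector tangent to the hyperplane in terms of all coordinates
  but the last, which is minus the sum of the others.\<close>

definition sum_norm :: "'i set \<Rightarrow> ('i \<Rightarrow> real) \<Rightarrow> real" where
  "sum_norm I x = sqrt ((\<Sum>i\<in>I. (x i)\<^sup>2) + (\<Sum>i\<in>I. x i)\<^sup>2)"

lemma coord_norm_sum_norm:
  assumes "finite I"
  shows "coord_norm I (sum_norm I) (real (card I) + 1)"
proof
  have eq: "sum_norm I x = norm (L2_set x I, \<Sum>i\<in>I. x i)" for x
    by (simp add: sum_norm_def norm_Pair L2_set_def sum_nonneg)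
  show "finite I" by fact
  show "sum_norm I \<in> borel_measurable (Leb I)" unfolding sum_norm_def by measurable
  show "sum_norm I x = sum_norm I y" if "\<And>i. i \<in> I \<Longrightarrow> x i = y i" for x y
    using that by (simp add: sum_norm_def cong: sum.cong)
  show "sum_norm I (\<lambda>i. c * x i) = \<bar>c\<bar> * sum_norm I x" for c x
  proof -
    have "(\<Sum>i\<in>I. (c * x i)\<^sup>2) + (\<Sum>i\<in>I. c * x i)\<^sup>2 = c\<^sup>2 * ((\<Sum>i\<in>I. (x i)\<^sup>2) + (\<Sum>i\<in>I. x i)\<^sup>2)"
      by (simp add: power_mult_distrib sum_distrib_left[symmetric] distrib_left)
    then show ?thesis by (simp add: sum_norm_def real_sqrt_mult)
  qed
  show "sum_norm I (\<lambda>i. x i + y i) \<le> sum_norm I x + sum_norm I y" for x y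
  proof -
    have "sum_norm I (\<lambda>i. x i + y i) \<le> norm (L2_set x I + L2_set y I, (\<Sum>i\<in>I. x i) + (\<Sum>i\<in>I. y i))"
      unfolding eq norm_Pair using L2_set_triangle_ineq[of x y I]
      by (auto simp: sum.distrib abs_of_nonneg intro!: real_sqrt_le_mono power_mono add_mono)
    also have "\<dots> \<le> sum_norm I x + sum_norm I y"
      unfolding eq using norm_triangle_ineq[of "(L2_set x I, \<Sum>i\<in>I. x i)" "(L2_set y I, \<Sum>i\<in>I. y i)"] by simp
    finally show ?thesis .
  qed
  show "\<bar>x i\<bar> \<le> sum_norm I x" if "i \<in> I" for i x
  proof -
    have "(x i)\<^sup>2 \<le> (\<Sum>i\<in>I. (x i)\<^sup>2)" using that \<open>finite I\<close> by (intro member_le_sum) auto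
    then have "(x i)\<^sup>2 \<le> (\<Sum>i\<in>I. (x i)\<^sup>2) + (\<Sum>i\<in>I. x i)\<^sup>2" by (simp add: add_increasing2)
    then show ?thesis unfolding sum_norm_def by (metis real_sqrt_abs real_sqrt_le_iff)
  qed
  show "sum_norm I x \<le> (real (card I) + 1) * r" if r: "0 \<le> r" "\<And>i. i \<in> I \<Longrightarrow> \<bar>x i\<bar> \<le> r" for r x
  proof -
    have "(\<Sum>i\<in>I. (x i)\<^sup>2) \<le> (\<Sum>i\<in>I. r\<^sup>2)"
      using r by (intro sum_mono) (metis abs_le_square_iff abs_of_nonneg)
    moreover have "(\<Sum>i\<in>I. x i)\<^sup>2 \<le> (real (card I) * r)\<^sup>2"
    proof -
      have "\<bar>\<Sum>i\<in>I. x i\<bar> \<le> (\<Sum>i\<in>I. r)" using r by (intro order_trans[OF sum_abs] sum_mono)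
      then show ?thesis using r(1) by (simp add: abs_le_square_iff[symmetric])
    qed
    ultimately have "(\<Sum>i\<in>I. (x i)\<^sup>2) + (\<Sum>i\<in>I. x i)\<^sup>2 \<le> real (card I) * r\<^sup>2 + (real (card I) * r)\<^sup>2" by simp
    also have "\<dots> \<le> ((real (card I) + 1) * r)\<^sup>2"
      using r(1) by (simp add: power2_eq_square algebra_simps)
    finally show ?thesis unfolding sum_norm_def using r(1) by (intro real_le_lsqrt) auto
  qed
  show "0 < real (card I) + 1" by simp
qed

text \<open>The Gaussian integral of the norm is computed twice, by layers in terms of
  \<open>V\<close> and by convolution. Comparison yields the square root of the Gram determinant
  card I + 1 without any matrix calculation.\<close>

lemma unit_ball_vol_div_sum_norm:
  assumes "finite I"
  shows "unit_ball_vol (card I) / coord_norm.V I (sum_norm I) = sqrt (real (card I) + 1)"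
proof -
  interpret coord_norm I "sum_norm I" "real (card I) + 1" by (rule coord_norm_sum_norm[OF assms])
  have nn: "0 \<le> sum_norm I x" for x by (simp add: sum_norm_def sum_nonneg)
  have "(\<integral>\<^sup>+x. ennreal (exp (- (sum_norm I x)\<^sup>2)) \<partial>Leb I) = ennreal (V * Gamma (real (card I) / 2 + 1))"
  proof (rule nn_integral_exp_minus_square_layer)
    fix t :: real assume t: "0 < t"
    have "{x \<in> Y. (sum_norm I x)\<^sup>2 \<le> t} = qball (sqrt t)"
    proof -
      have "(sum_norm I x)\<^sup>2 \<le> t \<longleftrightarrow> sum_norm I x \<le> sqrt t" for x
        by (metis nn real_sqrt_abs real_sqrt_le_iff abs_of_nonneg)
      then show ?thesis by (simp add: qball_def)
    qed
    moreover have "sqrt t ^ card I = t powr (real (card I) / 2)"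
      using t by (simp add: powr_half_sqrt[symmetric] powr_realpow[symmetric] powr_powr)
    ultimately show "emeasure (Leb I) {x \<in> Y. (sum_norm I x)\<^sup>2 \<le> t} = ennreal (V * t powr (real (card I) / 2))"
      using t by (simp add: emeasure_qball)
  qed (use V_pos assms in \<open>auto intro: Leb.sigma_finite less_imp_le\<close>)
  moreover have "(\<integral>\<^sup>+x. ennreal (exp (- (sum_norm I x)\<^sup>2)) \<partial>Leb I)
     = ennreal (sqrt pi ^ card I / sqrt (real (card I) + 1))"
    using nn_integral_gaussian_convolution[OF assms, of 0] by (simp add: sum_norm_def sum_nonneg)
  ultimately have "V * Gamma (real (card I) / 2 + 1) = sqrt pi ^ card I / sqrt (real (card I) + 1)"
    using V_pos by (intro ennreal_inj[THEN iffD1]) (auto intro!: mult_nonneg_nonneg Gamma_real_nonneg)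
  moreover have "sqrt pi ^ card I = pi powr (real (card I) / 2)"
    by (simp add: powr_half_sqrt[symmetric] powr_realpow[symmetric] powr_powr)
  moreover have "0 < Gamma (real (card I) / 2 + 1)" by (intro Gamma_real_pos) simp
  moreover have "P / G / v = s" if "v * G = P / s" "0 < G" "0 < v" "0 < s" for P G v s :: real
    using that by (simp add: field_simps)
  ultimately show ?thesis unfolding unit_ball_vol_def using V_pos by simp
qed

section \<open>Transport of the integral to the hyperplane\<close>

lemma image_sets_hausdorff_measure:
  assumes T: "bij_betw T X Y" "\<And>x y. x \<in> X \<Longrightarrow> y \<in> X \<Longrightarrow> d' (T x) (T y) = d x y"
    and B: "B \<in> sets (hausdorff_measure d X n)"
  shows "T ` B \<in> sets (hausdorff_measure d' Y n)"
proof -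
  have inj: "inj_on T X" and im: "T ` X = Y" using T(1) by (auto simp: bij_betw_def)
  have BX: "B \<subseteq> X" and B': "\<And>Z. Z \<subseteq> X \<Longrightarrow>
     hausdorff_outer d X n (B \<inter> Z) + hausdorff_outer d X n ((X - B) \<inter> Z) = hausdorff_outer d X n Z"
    using B by (auto simp: sets_hausdorff_measure lambda_system_def)
  have tr: "hausdorff_outer d' Y n (T ` A) = hausdorff_outer d X n A" if "A \<subseteq> X" for A
    using T(2) that by (intro hausdorff_outer_bij_isometry[OF T(1)])
  show ?thesis
    unfolding sets_hausdorff_measure lambda_system_def
  proof (intro CollectI conjI ballI)
    show "T ` B \<in> Pow Y" using BX im by auto
    fix W assume "W \<in> Pow Y"
    then obtain Z where Z: "Z \<subseteq> X" "W = T ` Z" using im by (metis PowD subset_imageE)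
    have "T ` B \<inter> W = T ` (B \<inter> Z)" "(Y - T ` B) \<inter> W = T ` ((X - B) \<inter> Z)"
      using BX Z inj im by (auto simp: inj_on_image_Int[OF inj] inj_on_image_set_diff[OF inj] simp del: image_Int)
    then show "hausdorff_outer d' Y n (T ` B \<inter> W) + hausdorff_outer d' Y n ((Y - T ` B) \<inter> W) = hausdorff_outer d' Y n W"
      using B'[OF Z(1)] BX Z by (simp add: tr le_infI1 le_infI2 Diff_subset)
  qed
qed

lemma integral_hausdorff_measure_bij:
  fixes f :: "'b \<Rightarrow> real"
  assumes T: "bij_betw T X Y" "\<And>x y. x \<in> X \<Longrightarrow> y \<in> X \<Longrightarrow> d' (T x) (T y) = d x y"
    and f: "(\<lambda>x. f (T x)) \<in> borel_measurable (hausdorff_measure d X n)"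
  shows "(\<integral>y. f y \<partial>hausdorff_measure d' Y n) = (\<integral>x. f (T x) \<partial>hausdorff_measure d X n)"
proof -
  let ?S = "the_inv_into X T" and ?MX = "hausdorff_measure d X n" and ?MY = "hausdorff_measure d' Y n"
  have inj: "inj_on T X" and im: "T ` X = Y" using T(1) by (auto simp: bij_betw_def)
  have vim: "?S -` A \<inter> Y = T ` A" if "A \<subseteq> X" for A
    using that im inj by (auto simp: the_inv_into_f_f[OF inj] subset_eq)
  have im_sets: "T ` A \<in> sets ?MY" if "A \<in> sets ?MX" for A
    using T(2) that by (intro image_sets_hausdorff_measure[OF T(1)])
  have S: "?S \<in> measurable ?MY ?MX"
  proof (rule measurableI)
    show "?S y \<in> space ?MX" if "y \<in> space ?MY" for y
      using the_inv_into_into[OF inj, of y X] that im by simp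
    show "?S -` A \<inter> space ?MY \<in> sets ?MY" if A: "A \<in> sets ?MX" for A
      using im_sets[OF A] vim[of A] sets.sets_into_space[OF A] by simp
  qed
  have distr: "distr ?MY ?MX ?S = ?MX"
  proof (rule measure_eqI)
    fix A assume "A \<in> sets (distr ?MY ?MX ?S)"
    then have A: "A \<in> sets ?MX" by simp
    then have AX: "A \<subseteq> X" using sets.sets_into_space[OF A] by simp
    have "emeasure (distr ?MY ?MX ?S) A = emeasure ?MY (T ` A)"
      using A S vim[OF AX] by (simp add: emeasure_distr)
    also have "\<dots> = hausdorff_outer d' Y n (T ` A)"
      by (intro emeasure_hausdorff_measure im_sets[OF A])
    also have "\<dots> = hausdorff_outer d X n A" using T(2) AX by (intro hausdorff_outer_bij_isometry[OF T(1)])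
    also have "\<dots> = emeasure ?MX A" using A by (intro emeasure_hausdorff_measure[symmetric])
    finally show "emeasure (distr ?MY ?MX ?S) A = emeasure ?MX A" .
  qed simp
  have "(\<integral>y. f y \<partial>?MY) = (\<integral>y. f (T (?S y)) \<partial>?MY)"
    using inj im by (intro Bochner_Integration.integral_cong refl) (simp add: f_the_inv_into_f)
  also have "\<dots> = (\<integral>x. f (T x) \<partial>distr ?MY ?MX ?S)"
    using S f by (subst integral_distr) auto
  finally show ?thesis by (simp add: distr)
qed

definition plane_point :: "nat \<Rightarrow> real \<Rightarrow> (int \<Rightarrow> real) \<Rightarrow> int \<Rightarrow> real" where
  "plane_point N s y = (\<lambda>j. if j \<in> {1..int N - 1} then y j
     else if j = int N then s - (\<Sum>i\<in>{1..int N - 1}. y i) else 0)"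

lemma atLeastAtMost_int_Suc: "1 \<le> N \<Longrightarrow> {1..int N} = insert (int N) {1..int N - 1}"
  by auto

text \<open>The chart forgetting the last coordinate is an isometry between \<open>sum_norm\<close>
  and Euclidean distance, so the density found above applies with card I + 1 = N. For N = 1 the
  index set is empty and both sides evaluate at a single point.\<close>

lemma integral_hyperplane:
  fixes f :: "(int \<Rightarrow> real) \<Rightarrow> real"
  assumes N: "1 \<le> N"
    and f: "(\<lambda>y. f (plane_point N (real N * m) y)) \<in> borel_measurable (Leb {1..int N - 1})"
  shows "(\<integral>x. f x \<partial>hausdorff_measure (eucl_dist N) (hyperplane N m) (N - 1))
    = sqrt (real N) * (\<integral>y. f (plane_point N (real N * m) y) \<partial>Leb {1..int N - 1})"
proof -
  let ?I = "{1..int N - 1}" and ?T = "plane_point N (real N * m)"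
  have card: "card ?I = N - 1" "real (card ?I) + 1 = real N" using N by auto
  interpret coord_norm ?I "sum_norm ?I" "real (card ?I) + 1" by (rule coord_norm_sum_norm) simp
  have sumT: "(\<Sum>i\<in>{1..int N}. g (?T y i) i) = g (real N * m - (\<Sum>i\<in>?I. y i)) (int N) + (\<Sum>i\<in>?I. g (y i) i)"
    for y and g :: "real \<Rightarrow> int \<Rightarrow> real"
    unfolding atLeastAtMost_int_Suc[OF N] by (subst sum.insert) (auto simp: plane_point_def)
  have bij: "bij_betw ?T Y (hyperplane N m)"
  proof (rule bij_betw_byWitness[where f' = "\<lambda>x. restrict x ?I"])
    show "\<forall>y\<in>Y. restrict (?T y) ?I = y"
      by (auto simp: space_PiM PiE_iff extensional_def plane_point_def fun_eq_iff)
    show "\<forall>x\<in>hyperplane N m. ?T (restrict x ?I) = x"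
    proof
      fix x assume x: "x \<in> hyperplane N m"
      then have "(\<Sum>i\<in>{1..int N}. x i) = real N * m"
        using N by (simp add: hyperplane_def field_simps)
      then have "x (int N) = real N * m - (\<Sum>i\<in>?I. x i)"
        unfolding atLeastAtMost_int_Suc[OF N] by (subst (asm) sum.insert) auto
      then show "?T (restrict x ?I) = x"
        using x by (auto simp: plane_point_def fun_eq_iff hyperplane_def configs_def)
    qed
    show "?T ` Y \<subseteq> hyperplane N m"
      using N sumT[of "\<lambda>a i. a"] by (auto simp: hyperplane_def configs_def) (auto simp: plane_point_def)
    show "(\<lambda>x. restrict x ?I) ` hyperplane N m \<subseteq> Y" by (auto simp: space_PiM)
  qed
  have iso: "eucl_dist N (?T y) (?T z) = qdist y z" for y z
  proof -
    have "(\<Sum>i\<in>{1..int N}. (?T y i - ?T z i)\<^sup>2)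
      = ((real N * m - (\<Sum>i\<in>?I. y i)) - (real N * m - (\<Sum>i\<in>?I. z i)))\<^sup>2 + (\<Sum>i\<in>?I. (y i - z i)\<^sup>2)"
      unfolding atLeastAtMost_int_Suc[OF N] by (subst sum.insert) (auto simp: plane_point_def)
    also have "((real N * m - (\<Sum>i\<in>?I. y i)) - (real N * m - (\<Sum>i\<in>?I. z i)))\<^sup>2 = (\<Sum>i\<in>?I. y i - z i)\<^sup>2"
      by (simp add: sum_subtractf power2_commute)
    finally show ?thesis by (simp add: eucl_dist_def qdist_def sum_norm_def add.commute)
  qed
  have "(\<integral>x. f x \<partial>hausdorff_measure (eucl_dist N) (hyperplane N m) (card ?I)) = (\<integral>y. f (?T y) \<partial>HM)"
    using bij iso measurable_compose[OF identity_measurable_HM f]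
    by (intro integral_hausdorff_measure_bij) auto
  also have "\<dots> = unit_ball_vol (card ?I) / V * (\<integral>y. f (?T y) \<partial>Leb ?I)"
    by (rule integral_hausdorff_measure[OF f])
  also have "unit_ball_vol (card ?I) / V = sqrt (real N)"
    using unit_ball_vol_div_sum_norm[of ?I] card(2) by simp
  finally show ?thesis unfolding card(1) .
qed

section \<open>Gibbs measures\<close>

text \<open>Relabelling of coordinates. It serves for translating a chain, for identifying each
  replica with a single chain and for exchanging replicas.\<close>

lemma distr_Leb_reindex:
  fixes \<pi> :: "'j \<Rightarrow> 'i"
  assumes I: "finite I" and \<pi>: "bij_betw \<pi> J I"
  shows "distr (Leb I) (Leb J) (\<lambda>x. \<lambda>j\<in>J. x (\<pi> j)) = Leb J"
proof (rule Leb.PiM_eqI)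
  have J: "finite J" using I \<pi> by (simp add: bij_betw_finite)
  then show "finite J" .
  have \<pi>I: "j \<in> J \<Longrightarrow> \<pi> j \<in> I" for j using \<pi> by (auto simp: bij_betw_def)
  have T: "(\<lambda>x. \<lambda>j\<in>J. x (\<pi> j)) \<in> measurable (Leb I) (Leb J)"
    using \<pi>I by (intro measurable_restrict measurable_component_singleton) auto
  fix A :: "'j \<Rightarrow> real set" assume A: "\<And>j. j \<in> J \<Longrightarrow> A j \<in> sets lborel"
  let ?\<rho> = "the_inv_into J \<pi>"
  have \<rho>: "?\<rho> i \<in> J" "\<pi> (?\<rho> i) = i" if "i \<in> I" for i
    using that \<pi> by (auto simp: bij_betw_def f_the_inv_into_f intro!: the_inv_into_into)
  have \<rho>': "?\<rho> (\<pi> j) = j" if "j \<in> J" for j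
    using that \<pi> by (auto simp: bij_betw_def the_inv_into_f_f)
  have "(\<lambda>x. \<lambda>j\<in>J. x (\<pi> j)) -` PiE J A \<inter> space (Leb I) = PiE I (\<lambda>i. A (?\<rho> i))"
    using \<rho> \<rho>' \<pi>I by (auto simp: space_PiM PiE_iff) (metis)+
  moreover have "PiE J A \<in> sets (Leb J)" using A J by (intro sets_PiM_I_finite) auto
  ultimately have "emeasure (distr (Leb I) (Leb J) (\<lambda>x. \<lambda>j\<in>J. x (\<pi> j))) (PiE J A)
     = emeasure (Leb I) (PiE I (\<lambda>i. A (?\<rho> i)))"
    using T by (simp add: emeasure_distr)
  also have "\<dots> = (\<Prod>i\<in>I. emeasure lborel (A (?\<rho> i)))"
    using I A \<rho> by (intro Leb.emeasure_PiM) auto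
  also have "\<dots> = (\<Prod>j\<in>J. emeasure lborel (A j))"
    using \<rho>' by (subst prod.reindex_bij_betw[OF \<pi>, symmetric]) (auto intro!: prod.cong)
  finally show "emeasure (distr (Leb I) (Leb J) (\<lambda>x. \<lambda>j\<in>J. x (\<pi> j))) (PiE J A)
    = (\<Prod>j\<in>J. emeasure lborel (A j))" .
qed simp

lemma measurable_Leb_reindex:
  "(\<And>j. j \<in> J \<Longrightarrow> \<pi> j \<in> I) \<Longrightarrow> (\<lambda>x. \<lambda>j\<in>J. x (\<pi> j)) \<in> measurable (Leb I) (Leb J)"
  by (intro measurable_restrict measurable_component_singleton) auto

lemma integral_Leb_reindex:
  fixes f :: "('j \<Rightarrow> real) \<Rightarrow> real"
  assumes I: "finite I" and \<pi>: "bij_betw \<pi> J I" and f: "f \<in> borel_measurable (Leb J)"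
  shows "(\<integral>x. f (\<lambda>j\<in>J. x (\<pi> j)) \<partial>Leb I) = (\<integral>x. f x \<partial>Leb J)"
proof -
  have "(\<integral>x. f x \<partial>distr (Leb I) (Leb J) (\<lambda>x. \<lambda>j\<in>J. x (\<pi> j))) = (\<integral>x. f (\<lambda>j\<in>J. x (\<pi> j)) \<partial>Leb I)"
    using \<pi> f by (intro integral_distr measurable_Leb_reindex) (auto simp: bij_betw_def)
  then show ?thesis by (simp add: distr_Leb_reindex[OF I \<pi>])
qed

lemma integrable_Leb_reindex:
  fixes f :: "('j \<Rightarrow> real) \<Rightarrow> real"
  assumes I: "finite I" and \<pi>: "bij_betw \<pi> J I" and f: "integrable (Leb J) f"
  shows "integrable (Leb I) (\<lambda>x. f (\<lambda>j\<in>J. x (\<pi> j)))"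
proof (rule integrable_distr[where T = "\<lambda>x. \<lambda>j\<in>J. x (\<pi> j)"])
  show "(\<lambda>x. \<lambda>j\<in>J. x (\<pi> j)) \<in> measurable (Leb I) (Leb J)"
    using \<pi> by (intro measurable_Leb_reindex) (auto simp: bij_betw_def)
  show "integrable (distr (Leb I) (Leb J) (\<lambda>x. \<lambda>j\<in>J. x (\<pi> j))) f"
    using f by (simp add: distr_Leb_reindex[OF I \<pi>])
qed

lemma integral_Leb_Un_product:
  fixes f g :: "('i \<Rightarrow> real) \<Rightarrow> real"
  assumes IJ: "finite I" "finite J" "I \<inter> J = {}"
    and f: "integrable (Leb I) f" and g: "integrable (Leb J) g"
  shows "integrable (Leb (I \<union> J)) (\<lambda>x. f (restrict x I) * g (restrict x J))"
    and "(\<integral>x. f (restrict x I) * g (restrict x J) \<partial>Leb (I \<union> J)) = (\<integral>x. f x \<partial>Leb I) * (\<integral>x. g x \<partial>Leb J)"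
proof -
  interpret I: sigma_finite_measure "Leb I" using IJ(1) by (rule Leb.sigma_finite)
  interpret J: sigma_finite_measure "Leb J" using IJ(2) by (rule Leb.sigma_finite)
  interpret P: pair_sigma_finite "Leb I" "Leb J" ..
  note [measurable] = borel_measurable_integrable[OF f] borel_measurable_integrable[OF g]
  let ?F = "\<lambda>x. f (restrict x I) * g (restrict x J)"
  have F [measurable]: "?F \<in> borel_measurable (Leb (I \<union> J))"
    by (intro borel_measurable_times measurable_compose[OF measurable_restrict_subset]) auto
  have m: "(\<lambda>p. merge I J p) \<in> measurable (Leb I \<Otimes>\<^sub>M Leb J) (Leb (I \<union> J))" by (rule measurable_merge)
  have eq: "?F (merge I J (x, y)) = f x * g y" if "x \<in> space (Leb I)" "y \<in> space (Leb J)" for x y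
  proof -
    have "restrict (merge I J (x, y)) I = x" "restrict (merge I J (x, y)) J = y"
      using that IJ by (auto simp: space_PiM)
    then show ?thesis by simp
  qed
  have int: "integrable (Leb I \<Otimes>\<^sub>M Leb J) (\<lambda>p. f (fst p) * g (snd p))"
  proof (rule P.Fubini_integrable)
    show "(\<lambda>p. f (fst p) * g (snd p)) \<in> borel_measurable (Leb I \<Otimes>\<^sub>M Leb J)" by measurable
    show "integrable (Leb I) (\<lambda>x. \<integral>y. norm (f (fst (x, y)) * g (snd (x, y))) \<partial>Leb J)"
      using f by (simp add: abs_mult)
    show "AE x in Leb I. integrable (Leb J) (\<lambda>y. f (fst (x, y)) * g (snd (x, y)))"
      using g by simp
  qed
  have int2: "integrable (Leb I \<Otimes>\<^sub>M Leb J) (\<lambda>p. ?F (merge I J p))"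
    using int by (rule Bochner_Integration.integrable_cong[THEN iffD1, rotated 2])
      (auto simp: space_pair_measure eq)
  have d: "distr (Leb I \<Otimes>\<^sub>M Leb J) (Leb (I \<union> J)) (merge I J) = Leb (I \<union> J)"
    using IJ by (intro Leb.distr_merge) auto
  show "integrable (Leb (I \<union> J)) ?F"
    using int2 m F by (subst d[symmetric]) (simp add: integrable_distr_eq)
  have "(\<integral>x. ?F x \<partial>Leb (I \<union> J)) = (\<integral>p. ?F (merge I J p) \<partial>(Leb I \<Otimes>\<^sub>M Leb J))"
    using m F by (subst d[symmetric]) (simp add: integral_distr)
  also have "\<dots> = (\<integral>p. f (fst p) * g (snd p) \<partial>(Leb I \<Otimes>\<^sub>M Leb J))"
    by (intro Bochner_Integration.integral_cong) (auto simp: space_pair_measure eq)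
  also have "\<dots> = (\<integral>x. f x \<partial>Leb I) * (\<integral>x. g x \<partial>Leb J)"
    using P.integral_fst'[of "\<lambda>p. f (fst p) * g (snd p)"] int by simp
  finally show "(\<integral>x. ?F x \<partial>Leb (I \<union> J)) = (\<integral>x. f x \<partial>Leb I) * (\<integral>x. g x \<partial>Leb J)" .
qed

section \<open>Gaussian integrability, positivity, Jensen and vanishing of integrated
  derivatives\<close>

lemma integrable_gaussian:
  assumes "0 < a"
  shows "integrable lborel (\<lambda>t. exp (- (a * (t :: real)\<^sup>2)))"
proof (rule integrableI_bounded)
  show "(\<integral>\<^sup>+t. ennreal (norm (exp (- (a * t\<^sup>2)))) \<partial>lborel) < \<infinity>"
    using nn_integral_gaussian[OF assms, of 0] by simp
qed simp

lemma integrable_Leb_gaussian: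
  assumes "finite I" "0 < a"
  shows "integrable (Leb I) (\<lambda>x. exp (- (a * (\<Sum>i\<in>I. (x i)\<^sup>2))))"
proof -
  have "integrable (Leb I) (\<lambda>x. \<Prod>i\<in>I. exp (- (a * (x i)\<^sup>2)))"
    using assms by (intro Leb.product_integrable_prod integrable_gaussian)
  then show ?thesis using assms by (simp add: exp_sum[symmetric] sum_negf sum_distrib_left)
qed

lemma integral_Leb_pos:
  fixes f :: "('i \<Rightarrow> real) \<Rightarrow> real"
  assumes I: "finite I" and f: "integrable (Leb I) f" "\<And>x. 0 < f x"
  shows "0 < (\<integral>x. f x \<partial>Leb I)"
proof -
  have "(\<integral>x. f x \<partial>Leb I) \<noteq> 0"
  proof
    assume "(\<integral>x. f x \<partial>Leb I) = 0"
    then have "AE x in Leb I. f x = 0"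
      using f(1) less_imp_le[OF f(2)] by (subst (asm) integral_nonneg_eq_0_iff_AE) auto
    then have "AE x in Leb I. False" using f(2) by (auto elim!: eventually_mono simp: less_le)
    then have "emeasure (Leb I) (space (Leb I)) = 0" by (subst (asm) AE_iff_measurable[OF _ refl]) auto
    moreover have "emeasure (Leb I) (PiE I (\<lambda>_. {0..1})) = 1"
      using I by (subst Leb.emeasure_PiM) auto
    moreover have "emeasure (Leb I) (PiE I (\<lambda>_. {0..1})) \<le> emeasure (Leb I) (space (Leb I))"
      by (intro emeasure_space)
    ultimately show False by simp
  qed
  moreover have "0 \<le> (\<integral>x. f x \<partial>Leb I)"
    using f(2) by (intro Bochner_Integration.integral_nonneg less_imp_le)
  ultimately show ?thesis by simp
qed

text \<open>The tangent of exp at the weighted mean lies below exp. The weight is left unnormalised,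
  so the result compares two partition functions directly.\<close>

lemma Jensen_exp_weight:
  fixes W g :: "'a \<Rightarrow> real"
  assumes W: "integrable M W" "\<And>x. 0 \<le> W x" and Z: "0 < (\<integral>x. W x \<partial>M)"
    and g: "integrable M (\<lambda>x. g x * W x)" and e: "integrable M (\<lambda>x. exp (g x) * W x)"
  shows "(\<integral>x. W x \<partial>M) * exp ((\<integral>x. g x * W x \<partial>M) / (\<integral>x. W x \<partial>M)) \<le> (\<integral>x. exp (g x) * W x \<partial>M)"
proof -
  let ?Z = "\<integral>x. W x \<partial>M"
  let ?E = "(\<integral>x. g x * W x \<partial>M) / ?Z"
  have eq: "(\<lambda>x. exp ?E * (1 + (g x - ?E)) * W x) = (\<lambda>x. exp ?E * ((1 - ?E) * W x + g x * W x))"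
    by (auto simp: algebra_simps)
  have "(\<integral>x. exp ?E * (1 + (g x - ?E)) * W x \<partial>M) \<le> (\<integral>x. exp (g x) * W x \<partial>M)"
  proof (rule integral_mono[OF _ e])
    show "integrable M (\<lambda>x. exp ?E * (1 + (g x - ?E)) * W x)"
      unfolding eq using g W(1) by (intro integrable_mult_right Bochner_Integration.integrable_add) auto
    fix x
    have "exp ?E * (1 + (g x - ?E)) \<le> exp ?E * exp (g x - ?E)" by (intro mult_left_mono) auto
    also have "\<dots> = exp (g x)" by (simp add: exp_add[symmetric])
    finally show "exp ?E * (1 + (g x - ?E)) * W x \<le> exp (g x) * W x"
      using W(2)[of x] by (intro mult_right_mono) auto
  qed
  moreover have "(\<integral>x. exp ?E * (1 + (g x - ?E)) * W x \<partial>M) = exp ?E * ((1 - ?E) * ?Z + ?E * ?Z)"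
    unfolding eq using g W(1) Z by simp
  ultimately show ?thesis by (simp add: algebra_simps)
qed

text \<open>A slice of an integrable function may fail to be integrable for a null set of the other
  coordinates. There the Bochner integral is 0 by convention, in agreement with the claim, so the
  statement can be used on every slice.\<close>

lemma integral_derivative_eq_0:
  fixes F f :: "real \<Rightarrow> real"
  assumes "\<And>t. (F has_real_derivative f t) (at t)" "\<And>t. isCont f t"
    and "(F \<longlongrightarrow> 0) at_top" "(F \<longlongrightarrow> 0) at_bot"
  shows "(\<integral>t. f t \<partial>lborel) = 0"
proof (cases "integrable lborel f")
  case True
  have "(LBINT t=-\<infinity>..\<infinity>. f t) = 0 - 0"
  proof (rule interval_integral_FTC_integrable)
    show "set_integrable lborel (einterval (-\<infinity>) \<infinity>) f"
      using True by (simp add: set_integrable_def)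
    show "((F \<circ> real_of_ereal) \<longlongrightarrow> 0) (at_right (-\<infinity>))" "((F \<circ> real_of_ereal) \<longlongrightarrow> 0) (at_left \<infinity>)"
      using assms(3,4) by (simp_all add: ereal_tendsto_simps)
  qed (use assms(1,2) in \<open>auto simp: has_real_derivative_iff_has_vector_derivative\<close>)
  then show ?thesis by (simp add: interval_lebesgue_integral_def set_lebesgue_integral_def)
qed (simp add: not_integrable_integral_eq)

lemma integral_partial_derivative_eq_0:
  fixes F f :: "('i \<Rightarrow> real) \<Rightarrow> real"
  assumes I: "finite I" "b \<in> I" and f: "integrable (Leb I) f"
    and "\<And>x t. ((\<lambda>t. F (x(b := t))) has_real_derivative f (x(b := t))) (at t)"
    and "\<And>x t. isCont (\<lambda>t. f (x(b := t))) t"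
    and "\<And>x. ((\<lambda>t. F (x(b := t))) \<longlongrightarrow> 0) at_top" "\<And>x. ((\<lambda>t. F (x(b := t))) \<longlongrightarrow> 0) at_bot"
  shows "(\<integral>x. f x \<partial>Leb I) = 0"
proof -
  have ins: "insert b (I - {b}) = I" using I by auto
  have "(\<integral>x. f x \<partial>Leb (insert b (I - {b}))) = (\<integral>x. \<integral>t. f (x(b := t)) \<partial>lborel \<partial>Leb (I - {b}))"
    using I f by (intro Leb.product_integral_insert) (auto simp: insert_absorb)
  also have "\<dots> = (\<integral>x. 0 \<partial>Leb (I - {b}))"
    using assms by (intro Bochner_Integration.integral_cong refl integral_derivative_eq_0)
  finally show ?thesis by (simp only: ins) simp
qed

text \<open>
  \<open>Q\<close> is the quadratic part, \<open>s\<close> the external field and \<open>V\<close> the bounded perturbation of the single-site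
  potential. The two-replica system used for the decay of correlations is an instance with sites in
  \<open>int \<times> bool\<close>.
\<close>

locale gibbs =
  fixes I :: "'i set" and Q :: "'i \<Rightarrow> 'i \<Rightarrow> real" and s :: "'i \<Rightarrow> real" and V V' :: "real \<Rightarrow> real"
    and a B B1 :: real
  assumes fin: "finite I"
    and sym: "\<And>i j. Q i j = Q j i"
    and a_pos: "0 < a"
    and coercive: "\<And>x. 2 * a * (\<Sum>i\<in>I. (x i)\<^sup>2) \<le> (\<Sum>i\<in>I. \<Sum>j\<in>I. Q i j * x i * x j)"
    and V_bound: "\<And>t. \<bar>V t\<bar> \<le> B"
    and V_deriv: "\<And>t. (V has_real_derivative V' t) (at t)"
    and V'_bound: "\<And>t. \<bar>V' t\<bar> \<le> B1"
    and V'_cont: "\<And>t. isCont V' t"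
begin

definition H :: "('i \<Rightarrow> real) \<Rightarrow> real" where
  "H x = 1/2 * (\<Sum>i\<in>I. \<Sum>j\<in>I. Q i j * x i * x j) + (\<Sum>i\<in>I. V (x i)) - (\<Sum>i\<in>I. s i * x i)"

definition dH :: "'i \<Rightarrow> ('i \<Rightarrow> real) \<Rightarrow> real" where
  "dH b x = (\<Sum>j\<in>I. Q b j * x j) + V' (x b) - s b"

definition W :: "('i \<Rightarrow> real) \<Rightarrow> real" where "W x = exp (- H x)"

definition Z :: real where "Z = (\<integral>x. W x \<partial>Leb I)"

definition E :: "(('i \<Rightarrow> real) \<Rightarrow> real) \<Rightarrow> real" where
  "E f = (\<integral>x. f x * W x \<partial>Leb I) / Z"

abbreviation sq :: "('i \<Rightarrow> real) \<Rightarrow> real" where "sq x \<equiv> (\<Sum>i\<in>I. (x i)\<^sup>2)"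

section \<open>Gaussian domination of the Gibbs weight\<close>

lemma V_measurable [measurable]: "V \<in> borel_measurable borel"
  using V_deriv by (intro borel_measurable_continuous_onI continuous_at_imp_continuous_on ballI DERIV_isCont)

lemma V'_measurable [measurable]: "V' \<in> borel_measurable borel"
  using V'_cont by (intro borel_measurable_continuous_onI continuous_at_imp_continuous_on ballI)

lemma H_measurable [measurable]: "H \<in> borel_measurable (Leb I)"
  unfolding H_def by measurable

lemma W_measurable [measurable]: "W \<in> borel_measurable (Leb I)"
  unfolding W_def by measurable

lemma W_pos: "0 < W x" by (simp add: W_def)

lemma sq_nonneg: "0 \<le> sq x" by (intro sum_nonneg) auto

definition C0 :: real where "C0 = exp (B * card I + (\<Sum>i\<in>I. (s i)\<^sup>2) / (2 * a))"

text \<open>Coercivity provides \<open>a\<close> times the sum of squares; half of it absorbs the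
  linear field term by Young's inequality, and the bounded potential costs a constant per
  site.\<close>

lemma W_le: "W x \<le> C0 * exp (- (a / 2 * sq x))"
proof -
  have "(\<Sum>i\<in>I. s i * x i) \<le> (\<Sum>i\<in>I. (s i)\<^sup>2 / (2 * a) + a / 2 * (x i)\<^sup>2)"
  proof (rule sum_mono)
    fix i
    have "0 \<le> (s i - a * x i)\<^sup>2 / (2 * a)" using a_pos by simp
    also have "\<dots> = (s i)\<^sup>2 / (2 * a) + a / 2 * (x i)\<^sup>2 - s i * x i"
      using a_pos by (simp add: power2_diff power_mult_distrib field_simps power2_eq_square)
    finally show "s i * x i \<le> (s i)\<^sup>2 / (2 * a) + a / 2 * (x i)\<^sup>2" by simp
  qed
  also have "\<dots> = (\<Sum>i\<in>I. (s i)\<^sup>2) / (2 * a) + a / 2 * sq x"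
    by (simp add: sum.distrib sum_distrib_left sum_divide_distrib)
  finally have 1: "(\<Sum>i\<in>I. s i * x i) \<le> (\<Sum>i\<in>I. (s i)\<^sup>2) / (2 * a) + a / 2 * sq x" .
  have "(\<Sum>i\<in>I. - V (x i)) \<le> (\<Sum>i\<in>I. B)"
    using V_bound by (intro sum_mono) (metis abs_le_D2)
  then have 2: "- (\<Sum>i\<in>I. V (x i)) \<le> B * card I" by (simp add: sum_negf mult.commute)
  have "- H x \<le> B * card I + (\<Sum>i\<in>I. (s i)\<^sup>2) / (2 * a) + (- (a / 2 * sq x))"
    using 1 2 coercive[of x] unfolding H_def by linarith
  then show ?thesis by (simp add: W_def C0_def exp_add[symmetric])
qed

text \<open>Half of the remaining Gaussian decay is spent on the quadratic prefactor.\<close>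

lemma quadratic_W_le:
  assumes "\<bar>r\<bar> \<le> c * (1 + sq x)" "0 \<le> c"
  shows "\<bar>r * W x\<bar> \<le> c * (1 + 4 / a) * C0 * exp (- (a / 4 * sq x))"
proof -
  have "a / 4 * sq x \<le> exp (a / 4 * sq x)" using exp_ge_add_one_self[of "a / 4 * sq x"] by linarith
  then have "sq x \<le> 4 / a * exp (a / 4 * sq x)" using a_pos by (simp add: field_simps)
  moreover have "1 \<le> exp (a / 4 * sq x)" using a_pos sq_nonneg[of x] by simp
  ultimately have "1 + sq x \<le> exp (a / 4 * sq x) + 4 / a * exp (a / 4 * sq x)" by linarith
  then have "1 + sq x \<le> (1 + 4 / a) * exp (a / 4 * sq x)" by (simp only: distrib_right mult_1)
  then have "\<bar>r\<bar> \<le> c * ((1 + 4 / a) * exp (a / 4 * sq x))"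
    using assms by (meson mult_left_mono order_trans)
  then have "\<bar>r * W x\<bar> \<le> c * ((1 + 4 / a) * exp (a / 4 * sq x)) * (C0 * exp (- (a / 2 * sq x)))"
    unfolding abs_mult using W_le[of x] W_pos[of x] assms(2) a_pos
    by (intro mult_mono) auto
  also have "\<dots> = c * (1 + 4 / a) * C0 * (exp (a / 4 * sq x) * exp (- (a / 2 * sq x)))" by (simp add: mult_ac)
  also have "exp (a / 4 * sq x) * exp (- (a / 2 * sq x)) = exp (- (a / 4 * sq x))"
    by (simp add: exp_add[symmetric] algebra_simps)
  finally show ?thesis .
qed

lemma integrable_W_quadratic:
  assumes [measurable]: "f \<in> borel_measurable (Leb I)"
    and "\<And>x. x \<in> space (Leb I) \<Longrightarrow> \<bar>f x\<bar> \<le> c * (1 + sq x)"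
  shows "integrable (Leb I) (\<lambda>x. f x * W x)"
proof (rule Bochner_Integration.integrable_bound)
  let ?c = "max c 0"
  show "integrable (Leb I) (\<lambda>x. ?c * (1 + 4 / a) * C0 * exp (- (a / 4 * sq x)))"
    using fin a_pos by (intro integrable_mult_right integrable_Leb_gaussian) auto
  show "AE x in Leb I. norm (f x * W x) \<le> norm (?c * (1 + 4 / a) * C0 * exp (- (a / 4 * sq x)))"
  proof (rule AE_I2)
    fix x assume x: "x \<in> space (Leb I)"
    have "c * (1 + sq x) \<le> ?c * (1 + sq x)" using sq_nonneg[of x] by (intro mult_right_mono) auto
    then have "\<bar>f x * W x\<bar> \<le> ?c * (1 + 4 / a) * C0 * exp (- (a / 4 * sq x))"
      using assms(2)[OF x] by (intro quadratic_W_le) auto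
    then show "norm (f x * W x) \<le> norm (?c * (1 + 4 / a) * C0 * exp (- (a / 4 * sq x)))"
      by (metis abs_ge_self norm_conv_dist order_trans real_norm_def)
  qed
qed measurable

lemma integrable_W: "integrable (Leb I) W"
  using integrable_W_quadratic[of "\<lambda>_. 1" 1] by (simp add: sq_nonneg)

lemma Z_pos: "0 < Z"
  unfolding Z_def by (rule integral_Leb_pos[OF fin integrable_W W_pos])

lemma abs_mult_le_sq: "i \<in> I \<Longrightarrow> j \<in> I \<Longrightarrow> \<bar>x i * x j\<bar> \<le> sq x"
proof -
  assume ij: "i \<in> I" "j \<in> I"
  have "(x k)\<^sup>2 \<le> sq x" if "k \<in> I" for k using that fin by (intro member_le_sum) auto
  note this[OF ij(1)] this[OF ij(2)]
  moreover have "2 * \<bar>x i * x j\<bar> \<le> (x i)\<^sup>2 + (x j)\<^sup>2"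
    using sum_squares_bound[of "\<bar>x i\<bar>" "\<bar>x j\<bar>"] by (simp add: abs_mult)
  ultimately show ?thesis by linarith
qed

lemma abs_le_sq: "i \<in> I \<Longrightarrow> \<bar>x i\<bar> \<le> 1 + sq x"
proof -
  assume "i \<in> I"
  then have "\<bar>x i * x i\<bar> \<le> sq x" by (intro abs_mult_le_sq)
  moreover have "2 * \<bar>x i\<bar> \<le> 1 + \<bar>x i * x i\<bar>"
    using sum_squares_bound[of 1 "\<bar>x i\<bar>"] by (simp add: power2_eq_square abs_mult)
  moreover have "0 \<le> \<bar>x i * x i\<bar>" by simp
  ultimately show ?thesis by linarith
qed

lemma H_deriv:
  assumes b: "b \<in> I"
  shows "((\<lambda>t. H (x(b := t))) has_real_derivative dH b (x(b := t))) (at t)"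
proof -
  let ?y = "x(b := t)"
  have c: "((\<lambda>t. (x(b := t)) i) has_real_derivative (if i = b then 1 else 0)) (at t)" for i
    by (cases "i = b") auto
  have v: "((\<lambda>t. V ((x(b := t)) i)) has_real_derivative V' (?y i) * (if i = b then 1 else 0)) (at t)" for i
    using DERIV_chain2[OF V_deriv c] .
  have q: "((\<lambda>t. Q i j * (x(b := t)) i * (x(b := t)) j) has_real_derivative
       (if i = b then Q i j * ?y j else 0) + (if j = b then Q i j * ?y i else 0)) (at t)" for i j
    by (rule derivative_eq_intros c refl)+ auto
  have "((\<lambda>t. H (x(b := t))) has_real_derivative
      1/2 * (\<Sum>i\<in>I. \<Sum>j\<in>I. (if i = b then Q i j * ?y j else 0) + (if j = b then Q i j * ?y i else 0))
      + (\<Sum>i\<in>I. V' (?y i) * (if i = b then 1 else 0)) - (\<Sum>i\<in>I. s i * (if i = b then 1 else 0))) (at t)"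
    unfolding H_def by (intro DERIV_add DERIV_diff DERIV_cmult DERIV_sum q v c)
  moreover have "(\<Sum>i\<in>I. \<Sum>j\<in>I. (if i = b then Q i j * ?y j else 0) + (if j = b then Q i j * ?y i else 0))
     = 2 * (\<Sum>j\<in>I. Q b j * ?y j)"
  proof -
    have "(\<Sum>i\<in>I. \<Sum>j\<in>I. (if i = b then Q i j * ?y j else 0)) = (\<Sum>j\<in>I. \<Sum>i\<in>I. (if i = b then Q i j * ?y j else 0))"
      by (rule sum.swap)
    then have "(\<Sum>i\<in>I. \<Sum>j\<in>I. (if i = b then Q i j * ?y j else 0)) = (\<Sum>j\<in>I. Q b j * ?y j)"
      using b fin by (simp add: sum.delta)
    moreover have "(\<Sum>i\<in>I. \<Sum>j\<in>I. (if j = b then Q i j * ?y i else 0)) = (\<Sum>i\<in>I. Q b i * ?y i)"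
      using b fin by (simp add: sum.delta sym[of _ b])
    ultimately show ?thesis by (simp add: sum.distrib)
  qed
  moreover have "(\<Sum>i\<in>I. V' (?y i) * (if i = b then 1 else 0)) = V' (?y b)"
    "(\<Sum>i\<in>I. s i * (if i = b then 1 else 0)) = s b"
    using b fin by (simp_all add: if_distrib[of "\<lambda>u. _ * u"] sum.delta cong: if_cong)
  ultimately show ?thesis unfolding dH_def by simp
qed

lemma dH_measurable [measurable]: "b \<in> I \<Longrightarrow> dH b \<in> borel_measurable (Leb I)"
  unfolding dH_def by measurable

lemma coord_dH_le:
  assumes "b \<in> I" "c \<in> I"
  shows "\<bar>x c * dH b x\<bar> \<le> ((\<Sum>j\<in>I. \<bar>Q b j\<bar>) + B1 + \<bar>s b\<bar>) * (1 + sq x)"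
proof -
  have "\<bar>x c * dH b x\<bar> = \<bar>(\<Sum>j\<in>I. Q b j * (x c * x j)) + V' (x b) * x c - s b * x c\<bar>"
    unfolding dH_def by (simp add: distrib_left right_diff_distrib sum_distrib_left mult_ac)
  also have "\<dots> \<le> (\<Sum>j\<in>I. \<bar>Q b j * (x c * x j)\<bar>) + \<bar>V' (x b) * x c\<bar> + \<bar>s b * x c\<bar>"
    using sum_abs[of "\<lambda>j. Q b j * (x c * x j)" I] by linarith
  also have "\<dots> \<le> (\<Sum>j\<in>I. \<bar>Q b j\<bar> * (1 + sq x)) + B1 * (1 + sq x) + \<bar>s b\<bar> * (1 + sq x)"
  proof (intro add_mono sum_mono)
    show "\<bar>Q b j * (x c * x j)\<bar> \<le> \<bar>Q b j\<bar> * (1 + sq x)" if "j \<in> I" for j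
      unfolding abs_mult[of "Q b j"] using abs_mult_le_sq[OF assms(2) that, of x] by (intro mult_left_mono) auto
    show "\<bar>V' (x b) * x c\<bar> \<le> B1 * (1 + sq x)"
      unfolding abs_mult using V'_bound abs_le_sq[OF assms(2), of x] by (intro mult_mono) (auto intro: order_trans[OF abs_ge_zero V'_bound])
    show "\<bar>s b * x c\<bar> \<le> \<bar>s b\<bar> * (1 + sq x)"
      unfolding abs_mult using abs_le_sq[OF assms(2), of x] by (intro mult_left_mono) auto
  qed
  finally show ?thesis by (simp add: sum_distrib_right[symmetric] distrib_right)
qed

lemma integrable_coord_dH:
  assumes "b \<in> I" "c \<in> I"
  shows "integrable (Leb I) (\<lambda>x. x c * dH b x * W x)"
  using assms coord_dH_le[OF assms] by (intro integrable_W_quadratic) auto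

text \<open>The derivative of x_c W in direction b is (\<delta>_bc - x_c dH_b) W, which integrates
  to 0. This identity is the only source of moment bounds, both for one chain and for two
  replicas.\<close>

lemma integration_by_parts:
  assumes b: "b \<in> I" and c: "c \<in> I"
  shows "E (\<lambda>x. x c * dH b x) = (if b = c then 1 else 0)"
proof -
  let ?k = "if b = c then 1 else 0 :: real"
  have int: "integrable (Leb I) (\<lambda>x. ?k * W x - x c * dH b x * W x)"
    using integrable_W integrable_coord_dH[OF b c] by (intro Bochner_Integration.integrable_diff integrable_mult_right)
  have co: "isCont (\<lambda>t. (x(b := t)) i) t" for x :: "'i \<Rightarrow> real" and i t by (cases "i = b") auto
  have Hc: "isCont (\<lambda>t. H (x(b := t))) t" for x t using H_deriv[OF b] by (rule DERIV_isCont)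
  \<comment> \<open>Boundary terms vanish: along the line in direction b the weight times a
    coordinate is dominated by a Gaussian in t. The hypothesis on t^2 treats both ends at
    once.\<close>
  have lim: "((\<lambda>t. (x(b := t)) c * W (x(b := t))) \<longlongrightarrow> 0) F" if F: "LIM t F. t\<^sup>2 :> at_top" for x and F :: "real filter"
  proof (rule Lim_null_comparison)
    let ?C = "1 * (1 + 4 / a) * C0"
    show "\<forall>\<^sub>F t in F. norm ((x(b := t)) c * W (x(b := t))) \<le> ?C * exp (- (a / 4 * t\<^sup>2))"
    proof (rule always_eventually, rule allI)
      fix t
      let ?y = "x(b := t)"
      have "\<bar>?y c * W ?y\<bar> \<le> ?C * exp (- (a / 4 * sq ?y))"
        using abs_le_sq[OF c, of ?y] by (intro quadratic_W_le) auto
      also have "\<dots> \<le> ?C * exp (- (a / 4 * t\<^sup>2))"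
      proof -
        have "(?y b)\<^sup>2 \<le> sq ?y" using b fin by (intro member_le_sum) auto
        then show ?thesis using a_pos by (intro mult_left_mono) (auto simp: C0_def)
      qed
      finally show "norm (?y c * W ?y) \<le> ?C * exp (- (a / 4 * t\<^sup>2))" by simp
    qed
    have "LIM t F. a / 4 * t\<^sup>2 :> at_top"
      using F a_pos by (intro filterlim_tendsto_pos_mult_at_top[OF tendsto_const]) auto
    then have "((\<lambda>t. exp (- (a / 4 * t\<^sup>2))) \<longlongrightarrow> 0) F"
      by (intro filterlim_compose[OF exp_at_bot] filterlim_compose[OF filterlim_uminus_at_bot_at_top])
    then show "((\<lambda>t. ?C * exp (- (a / 4 * t\<^sup>2))) \<longlongrightarrow> 0) F" by (rule tendsto_mult_right_zero)
  qed
  have "(\<integral>x. ?k * W x - x c * dH b x * W x \<partial>Leb I) = 0"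
  proof (rule integral_partial_derivative_eq_0[OF fin b int, where F = "\<lambda>x. x c * W x"])
    fix x :: "'i \<Rightarrow> real" and t
    have "((\<lambda>t. (x(b := t)) c) has_real_derivative ?k) (at t)" by (cases "b = c") auto
    from DERIV_mult[OF this DERIV_chain2[OF DERIV_exp DERIV_minus[OF H_deriv[OF b]]]]
    show "((\<lambda>t. (x(b := t)) c * W (x(b := t))) has_real_derivative
       ?k * W (x(b := t)) - (x(b := t)) c * dH b (x(b := t)) * W (x(b := t))) (at t)"
      unfolding W_def by (rule DERIV_cong) (simp add: algebra_simps)
    show "isCont (\<lambda>t. ?k * W (x(b := t)) - (x(b := t)) c * dH b (x(b := t)) * W (x(b := t))) t"
      unfolding W_def dH_def
      by (intro continuous_intros co Hc isCont_o2[OF co V'_cont] isCont_o2[OF _ isCont_exp] continuous_sum)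
    show "((\<lambda>t. (x(b := t)) c * W (x(b := t))) \<longlongrightarrow> 0) at_top"
      by (rule lim) (intro filterlim_pow_at_top filterlim_ident, simp)
    show "((\<lambda>t. (x(b := t)) c * W (x(b := t))) \<longlongrightarrow> 0) at_bot"
    proof (rule lim)
      have "LIM t at_bot. (- t :: real)\<^sup>2 :> at_top"
        by (intro filterlim_pow_at_top filterlim_uminus_at_top_at_bot) simp
      then show "LIM t at_bot. (t :: real)\<^sup>2 :> at_top" by simp
    qed
  qed
  then have "?k * Z = (\<integral>x. x c * dH b x * W x \<partial>Leb I)"
    using integrable_W integrable_coord_dH[OF b c] by (simp add: Z_def)
  then show ?thesis using Z_pos by (simp add: E_def field_simps)
qed

lemma E_cmult: "E (\<lambda>x. c * f x) = c * E f"
  by (simp add: E_def mult.assoc)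

lemma E_const: "E (\<lambda>x. c) = c"
  using Z_pos by (simp add: E_def Z_def)

lemma E_mono:
  assumes "integrable (Leb I) (\<lambda>x. f x * W x)" "integrable (Leb I) (\<lambda>x. g x * W x)"
    and "\<And>x. x \<in> space (Leb I) \<Longrightarrow> f x \<le> g x"
  shows "E f \<le> E g"
  unfolding E_def using assms Z_pos W_pos
  by (intro divide_right_mono integral_mono mult_right_mono) (auto intro: less_imp_le)

lemma E_add:
  assumes "integrable (Leb I) (\<lambda>x. f x * W x)" "integrable (Leb I) (\<lambda>x. g x * W x)"
  shows "E (\<lambda>x. f x + g x) = E f + E g"
  using assms by (simp add: E_def distrib_right add_divide_distrib)

lemma E_diff:
  assumes "integrable (Leb I) (\<lambda>x. f x * W x)" "integrable (Leb I) (\<lambda>x. g x * W x)"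
  shows "E (\<lambda>x. f x - g x) = E f - E g"
  using assms by (simp add: E_def left_diff_distrib diff_divide_distrib)

lemma E_sum:
  assumes "\<And>k. k \<in> K \<Longrightarrow> integrable (Leb I) (\<lambda>x. f k x * W x)"
  shows "E (\<lambda>x. \<Sum>k\<in>K. f k x) = (\<Sum>k\<in>K. E (f k))"
  using assms by (simp add: E_def sum_distrib_right sum_divide_distrib)

lemma Jensen_exp:
  assumes g: "integrable (Leb I) (\<lambda>x. g x * W x)" and e: "integrable (Leb I) (\<lambda>x. exp (g x) * W x)"
  shows "Z * exp (E g) \<le> (\<integral>x. exp (g x) * W x \<partial>Leb I)"
  using Jensen_exp_weight[OF integrable_W less_imp_le[OF W_pos] _ g e] Z_pos by (simp add: Z_def E_def)

end

section \<open>Decay of correlations\<close>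

lemma sinh_real_abs_eq_tanh: "\<bar>sinh (x :: real)\<bar> = tanh \<bar>x\<bar> * cosh x"
proof -
  have "\<bar>sinh x\<bar> = sinh \<bar>x\<bar>" "cosh x = cosh \<bar>x\<bar>" by (auto simp: abs_if sinh_minus)
  then show ?thesis by (simp add: tanh_def)
qed

text \<open>tanh x <= 1 - exp (- 2 x) <= exp (- exp (- 2 x)), and the convex function exp (- 2 x)
  lies above its tangent of slope - \<kappa>. A factor close to 1 for large x is thereby bounded by
  a constant gain times a cost that is exponential with small rate \<kappa>.\<close>

lemma tanh_real_le_exp:
  fixes x \<kappa> :: real
  assumes "0 \<le> x" "0 < \<kappa>"
  shows "tanh x \<le> exp (- (\<kappa> / 2 * (1 - ln (\<kappa> / 2))) + \<kappa> * x)"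
proof -
  define \<theta> where "\<theta> = \<kappa> / 2"
  have \<theta>: "0 < \<theta>" "\<kappa> = 2 * \<theta>" using assms(2) by (auto simp: \<theta>_def)
  \<comment> \<open>The point of tangency is where exp (- 2 x) equals \<theta> = \<kappa> /
    2.\<close>
  have "1 + (- 2 * x - ln \<theta>) \<le> exp (- 2 * x - ln \<theta>)" by (rule exp_ge_add_one_self)
  also have "\<dots> = exp (- 2 * x) / \<theta>" using \<theta> by (simp add: exp_diff)
  finally have tangent: "\<theta> * (1 - ln \<theta>) - \<kappa> * x \<le> exp (- 2 * x)"
    using \<theta> by (simp add: field_simps)
  have "tanh x = 1 - 2 * exp (- 2 * x) / (1 + exp (- 2 * x))"
  proof -
    have "(1 - e) / (1 + e) = 1 - 2 * e / (1 + e)" if "0 < e" for e :: real using that by (simp add: field_simps)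
    then show ?thesis unfolding tanh_real_altdef by simp
  qed
  also have "\<dots> \<le> 1 - exp (- 2 * x)"
  proof -
    have "exp (- 2 * x) \<le> 1" using assms(1) by simp
    then have "exp (- 2 * x) * (1 + exp (- 2 * x)) \<le> 2 * exp (- 2 * x)"
      using mult_left_mono[of "1 + exp (- 2 * x)" 2 "exp (- 2 * x)"] by (simp add: mult.commute)
    then have "exp (- 2 * x) \<le> 2 * exp (- 2 * x) / (1 + exp (- 2 * x))"
      by (simp add: pos_le_divide_eq add_pos_pos)
    then show ?thesis by simp
  qed
  also have "\<dots> \<le> exp (- exp (- 2 * x))" using exp_ge_add_one_self[of "- exp (- 2 * x)"] by simp
  also have "\<dots> \<le> exp (- (\<theta> * (1 - ln \<theta>)) + \<kappa> * x)" using tangent by simp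
  finally show ?thesis by (simp add: \<theta>_def)
qed

text \<open>
  Averaging over the sign flips \<open>\<Theta> m\<close> is the transfer-matrix computation for a one-dimensional
  Ising chain with couplings \<open>K m\<close>, whose two-point function is a product of hyperbolic tangents.
\<close>

lemma sign_flip_correlation_bound:
  fixes M :: "'a measure" and \<Theta> :: "nat \<Rightarrow> 'a \<Rightarrow> 'a" and K :: "nat \<Rightarrow> 'a \<Rightarrow> real" and f w :: "'a \<Rightarrow> real"
  assumes \<Theta>: "\<And>m. m < n \<Longrightarrow> \<Theta> m \<in> measurable M M" "\<And>m. m < n \<Longrightarrow> distr M M (\<Theta> m) = M"
    and K: "\<And>m. m < n \<Longrightarrow> K m \<in> borel_measurable M"
    and w: "w \<in> borel_measurable M" "\<And>x. 0 \<le> w x" "\<And>m x. m < n \<Longrightarrow> x \<in> space M \<Longrightarrow> w (\<Theta> m x) = w x"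
    and K\<Theta>: "\<And>l m x. l < n \<Longrightarrow> m < n \<Longrightarrow> x \<in> space M \<Longrightarrow> K l (\<Theta> m x) = (if l = m then - K l x else K l x)"
    and f: "f \<in> borel_measurable M" "\<And>m x. m < n \<Longrightarrow> x \<in> space M \<Longrightarrow> f (\<Theta> m x) = - f x"
    and int: "integrable M (\<lambda>x. f x * w x * exp (- (\<Sum>m<n. K m x)))"
  shows "\<bar>\<integral>x. f x * w x * exp (- (\<Sum>m<n. K m x)) \<partial>M\<bar>
    \<le> (\<integral>x. \<bar>f x\<bar> * w x * (\<Prod>m<n. tanh \<bar>K m x\<bar>) * exp (- (\<Sum>m<n. K m x)) \<partial>M)"
  using assms
proof (induction n arbitrary: f)
  case 0
  then show ?case
    using integral_abs_bound[of M "\<lambda>x. f x * w x"] by (simp add: abs_mult)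
next
  case (Suc n)
  note [measurable] = Suc.prems(8) Suc.prems(4)
  have [measurable]: "K n \<in> borel_measurable M" "\<And>m. m \<in> {..<n} \<Longrightarrow> K m \<in> borel_measurable M"
    using Suc.prems(3) by auto
  have [measurable]: "(tanh :: real \<Rightarrow> real) \<in> borel_measurable borel" "(sinh :: real \<Rightarrow> real) \<in> borel_measurable borel"
    by (auto intro!: borel_measurable_continuous_onI continuous_intros)
  have \<Theta>n: "\<Theta> n \<in> measurable M M" "distr M M (\<Theta> n) = M" using Suc.prems(1,2)[of n] by auto
  have inv: "(\<integral>x. F x \<partial>M) = (\<integral>x. F (\<Theta> n x) \<partial>M)" if "F \<in> borel_measurable M" for F :: "'a \<Rightarrow> real"
    using integral_distr[OF \<Theta>n(1) that] \<Theta>n(2) by simp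
  have inv': "(\<integral>x. F x \<partial>M) = (\<integral>x. F' x \<partial>M)"
    if "F \<in> borel_measurable M" "\<And>x. x \<in> space M \<Longrightarrow> F (\<Theta> n x) = F' x" for F F' :: "'a \<Rightarrow> real"
    unfolding inv[OF that(1)] using that(2) by (intro Bochner_Integration.integral_cong refl)
  have inv_int: "integrable M (\<lambda>x. F (\<Theta> n x))" if "integrable M F" for F :: "'a \<Rightarrow> real"
    using integrable_distr[OF \<Theta>n(1), of F] \<Theta>n(2) that by simp
  let ?e = "\<lambda>x. exp (- (\<Sum>m<n. K m x))" and ?K = "K n"
  have e: "exp (- (\<Sum>m<Suc n. K m x)) = ?e x * exp (- ?K x)" for x by (simp add: exp_add[symmetric])
  have e\<Theta>: "?e (\<Theta> n x) = ?e x" if "x \<in> space M" for x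
    using Suc.prems(7)[of _ n x] that by (auto intro!: sum.cong)
  have K\<Theta>n: "?K (\<Theta> n x) = - ?K x" if "x \<in> space M" for x using Suc.prems(7)[of n n x] that by simp
  have I1: "integrable M (\<lambda>x. f x * w x * ?e x * exp (- ?K x))"
    using Suc.prems(10) by (simp only: e mult.assoc)
  have eq2: "f (\<Theta> n x) * w (\<Theta> n x) * ?e (\<Theta> n x) * exp (- ?K (\<Theta> n x)) = - (f x * w x * ?e x * exp (?K x))"
    if "x \<in> space M" for x
    using that Suc.prems(6)[of n x] Suc.prems(9)[of n x] by (simp add: e\<Theta> K\<Theta>n)
  have I2: "integrable M (\<lambda>x. f x * w x * ?e x * exp (?K x))"
  proof -
    have "integrable M (\<lambda>x. - (f x * w x * ?e x * exp (?K x)))"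
      using inv_int[OF I1] by (rule Bochner_Integration.integrable_cong[THEN iffD1, rotated 2]) (auto simp: eq2)
    then show ?thesis by simp
  qed
  have "(\<integral>x. f x * w x * ?e x * exp (- ?K x) \<partial>M) = (\<integral>x. - (f x * w x * ?e x * exp (?K x)) \<partial>M)"
    by (rule inv', measurable) (rule eq2)
  \<comment> \<open>\<open>f\<close> is odd under the last flip, so averaging over it leaves only
    the odd part of exp (- K), which is - sinh K.\<close>
  then have sinh: "(\<integral>x. f x * w x * ?e x * exp (- ?K x) \<partial>M) = - (\<integral>x. (f x * sinh (?K x)) * w x * ?e x \<partial>M)"
  proof -
    assume *: "(\<integral>x. f x * w x * ?e x * exp (- ?K x) \<partial>M) = (\<integral>x. - (f x * w x * ?e x * exp (?K x)) \<partial>M)"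
    have "(\<lambda>x. (f x * sinh (?K x)) * w x * ?e x)
       = (\<lambda>x. 1/2 * (f x * w x * ?e x * exp (?K x)) - 1/2 * (f x * w x * ?e x * exp (- ?K x)))"
      by (auto simp: sinh_field_def algebra_simps diff_divide_distrib)
    then have "(\<integral>x. (f x * sinh (?K x)) * w x * ?e x \<partial>M)
      = 1/2 * (\<integral>x. f x * w x * ?e x * exp (?K x) \<partial>M) - 1/2 * (\<integral>x. f x * w x * ?e x * exp (- ?K x) \<partial>M)"
      using I1 I2 by simp
    then show ?thesis using * by simp
  qed
  have I3: "integrable M (\<lambda>x. (f x * sinh (?K x)) * w x * ?e x)"
  proof -
    have "(\<lambda>x. (f x * sinh (?K x)) * w x * ?e x)
       = (\<lambda>x. 1/2 * (f x * w x * ?e x * exp (?K x)) - 1/2 * (f x * w x * ?e x * exp (- ?K x)))"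
      by (auto simp: sinh_field_def algebra_simps diff_divide_distrib)
    then show ?thesis using I1 I2 by simp
  qed
  let ?G = "\<lambda>x. \<bar>f x\<bar> * w x * (\<Prod>m<n. tanh \<bar>K m x\<bar>) * ?e x"
  have G\<Theta>: "?G (\<Theta> n x) = ?G x" if "x \<in> space M" for x
  proof -
    have "(\<Prod>m<n. tanh \<bar>K m (\<Theta> n x)\<bar>) = (\<Prod>m<n. tanh \<bar>K m x\<bar>)"
      using Suc.prems(7)[of _ n x] that by (auto intro!: prod.cong)
    then show ?thesis using that Suc.prems(6)[of n x] Suc.prems(9)[of n x] by (simp add: e\<Theta>)
  qed
  have th: "0 \<le> tanh \<bar>u\<bar>" "tanh \<bar>u\<bar> \<le> 1" for u :: real
    using tanh_real_lt_1[of "\<bar>u\<bar>"] by auto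
  have prod1: "0 \<le> (\<Prod>m<n. tanh \<bar>K m x\<bar>)" "(\<Prod>m<n. tanh \<bar>K m x\<bar>) \<le> 1" for x
    using th by (auto intro!: prod_nonneg prod_le_1)
  have IG: "integrable M (\<lambda>x. ?G x * tanh \<bar>?K x\<bar> * exp (u * ?K x))" if "u = 1 \<or> u = -1" for u
  proof (rule Bochner_Integration.integrable_bound)
    show "integrable M (\<lambda>x. f x * w x * ?e x * exp (u * ?K x))" using that I1 I2 by auto
    show "AE x in M. norm (?G x * tanh \<bar>?K x\<bar> * exp (u * ?K x)) \<le> norm (f x * w x * ?e x * exp (u * ?K x))"
    proof (rule AE_I2)
      fix x
      have "(\<Prod>m<n. tanh \<bar>K m x\<bar>) * tanh \<bar>?K x\<bar> \<le> 1 * 1" using prod1[of x] th by (intro mult_mono) auto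
      then have "(\<bar>f x\<bar> * w x * ?e x * exp (u * ?K x)) * ((\<Prod>m<n. tanh \<bar>K m x\<bar>) * tanh \<bar>?K x\<bar>) \<le> (\<bar>f x\<bar> * w x * ?e x * exp (u * ?K x)) * 1"
        using Suc.prems(5) by (intro mult_left_mono) auto
      then show "norm (?G x * tanh \<bar>?K x\<bar> * exp (u * ?K x)) \<le> norm (f x * w x * ?e x * exp (u * ?K x))"
        using Suc.prems(5)[of x] prod1(1)[of x] th(1)[of "?K x"] by (simp add: abs_mult mult_ac)
    qed
  qed measurable
  have "(\<integral>x. ?G x * tanh \<bar>?K x\<bar> * exp (- 1 * ?K x) \<partial>M) = (\<integral>x. ?G x * tanh \<bar>?K x\<bar> * exp (1 * ?K x) \<partial>M)"
    by (rule inv', measurable) (simp only: G\<Theta> K\<Theta>n, simp)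
  moreover have "(\<integral>x. ?G x * \<bar>sinh (?K x)\<bar> \<partial>M) = 1/2 * (\<integral>x. ?G x * tanh \<bar>?K x\<bar> * exp (1 * ?K x) \<partial>M)
     + 1/2 * (\<integral>x. ?G x * tanh \<bar>?K x\<bar> * exp (- 1 * ?K x) \<partial>M)"
  proof -
    have "(\<lambda>x. ?G x * \<bar>sinh (?K x)\<bar>) = (\<lambda>x. 1/2 * (?G x * tanh \<bar>?K x\<bar> * exp (1 * ?K x)) + 1/2 * (?G x * tanh \<bar>?K x\<bar> * exp (- 1 * ?K x)))"
      by (auto simp: sinh_real_abs_eq_tanh cosh_field_def algebra_simps add_divide_distrib)
    then show ?thesis using IG[of 1] IG[of "-1"] by simp
  qed
  \<comment> \<open>The absolute value of sinh K is tanh |K| cosh K. All other factors are even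
    under the flip, so cosh K may be turned back into exp (- K): the net effect of one flip is the
    factor tanh |K|.\<close>
  ultimately have G: "(\<integral>x. ?G x * \<bar>sinh (?K x)\<bar> \<partial>M) = (\<integral>x. ?G x * tanh \<bar>?K x\<bar> * exp (- ?K x) \<partial>M)" by simp
  have "\<bar>\<integral>x. f x * w x * exp (- (\<Sum>m<Suc n. K m x)) \<partial>M\<bar> = \<bar>\<integral>x. (f x * sinh (?K x)) * w x * ?e x \<partial>M\<bar>"
    using sinh by (simp only: e mult.assoc abs_minus_cancel)
  \<comment> \<open>The product of \<open>f\<close> with sinh of the last coupling is still odd
    under each remaining flip, since these leave that coupling alone.\<close>
  also have "\<dots> \<le> (\<integral>x. \<bar>f x * sinh (?K x)\<bar> * w x * (\<Prod>m<n. tanh \<bar>K m x\<bar>) * ?e x \<partial>M)"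
  proof (rule Suc.IH)
    show "f (\<Theta> m x) * sinh (?K (\<Theta> m x)) = - (f x * sinh (?K x))" if "m < n" "x \<in> space M" for m x
      using that Suc.prems(9)[of m x] Suc.prems(7)[of n m x] by simp
  qed (use Suc.prems I3 in auto)
  also have "\<dots> = (\<integral>x. ?G x * \<bar>sinh (?K x)\<bar> \<partial>M)"
    by (intro Bochner_Integration.integral_cong) (auto simp: abs_mult)
  also have "\<dots> = (\<integral>x. ?G x * tanh \<bar>?K x\<bar> * exp (- ?K x) \<partial>M)" by (rule G)
  also have "\<dots> = (\<integral>x. \<bar>f x\<bar> * w x * (\<Prod>m<Suc n. tanh \<bar>K m x\<bar>) * exp (- (\<Sum>m<Suc n. K m x)) \<partial>M)"
    by (intro Bochner_Integration.integral_cong refl) (simp only: e prod.lessThan_Suc mult_ac)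
  finally show ?case .
qed

text \<open>\<open>V\<close> stands for the bounded part of the potential. Dominance is stated at
  site 1: couplings depend on the distance only and \<open>neighbours\<close> is not cut off at the
  ends of a chain, so translation gives every row. \<open>B2\<close> enters as a Lipschitz constant
  of \<open>V'\<close>, the form in which second differences use it.\<close>

locale chain =
  fixes R :: nat and \<delta> :: real and h :: "int \<Rightarrow> real" and V V' :: "real \<Rightarrow> real" and B B1 B2 :: real
  assumes \<delta>_pos: "0 < \<delta>"
    and dominance: "(\<Sum>j\<in>neighbours R 1. \<bar>coupling R h 1 j\<bar>) + \<delta> \<le> 1"
    and V_bound: "\<And>t. \<bar>V t\<bar> \<le> B"
    and V_deriv: "\<And>t. (V has_real_derivative V' t) (at t)"
    and V'_bound: "\<And>t. \<bar>V' t\<bar> \<le> B1"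
    and V'_lipschitz: "\<And>t u. \<bar>V' t - V' u\<bar> \<le> B2 * \<bar>t - u\<bar>"
    and V'_cont: "\<And>t. isCont V' t"
begin

section \<open>Bounds for the off-diagonal couplings\<close>

definition J :: "int \<Rightarrow> int \<Rightarrow> real" where "J i j = (if i = j then 0 else coupling R h i j)"

lemma J_sym: "J i j = J j i"
  by (auto simp: J_def coupling_def abs_minus_commute)

lemma coupling_sym: "coupling R h i j = coupling R h j i"
  by (auto simp: coupling_def abs_minus_commute)

lemma coupling_eq: "coupling R h i j = (if i = j then 1 else 0) + J i j"
  by (simp add: J_def coupling_def)

lemma J_far: "int R < \<bar>i - j\<bar> \<Longrightarrow> J i j = 0"
  by (simp add: J_def coupling_def)

lemma J_row:
  assumes "finite I"
  shows "(\<Sum>j\<in>I. \<bar>J i j\<bar>) \<le> 1 - \<delta>"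
proof -
  have fin: "finite (neighbours R i)" for i
    by (rule finite_subset[of _ "{i - int R..i + int R}"]) (auto simp: neighbours_def)
  have "(\<Sum>j\<in>I. \<bar>J i j\<bar>) = (\<Sum>j\<in>I \<inter> neighbours R i. \<bar>J i j\<bar>)"
    using assms J_far by (intro sum.mono_neutral_right) (auto simp: neighbours_def J_def coupling_def abs_minus_commute)
  also have "\<dots> \<le> (\<Sum>j\<in>neighbours R i. \<bar>J i j\<bar>)"
    using fin by (intro sum_mono2) auto
  also have "\<dots> = (\<Sum>j\<in>neighbours R 1. \<bar>coupling R h 1 j\<bar>)"
    by (rule sum.reindex_bij_witness[where i = "\<lambda>j. j + i - 1" and j = "\<lambda>j. j - i + 1"])
      (auto simp: neighbours_def J_def coupling_def)
  finally show ?thesis using dominance by simp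
qed

text \<open>Schur's test for the symmetric matrix \<open>J\<close>, whose row sums are at most 1 -
  \<delta>.\<close>

lemma J_quadratic_le:
  assumes "finite I"
  shows "\<bar>\<Sum>i\<in>I. \<Sum>j\<in>I. J i j * x i * x j\<bar> \<le> (1 - \<delta>) * (\<Sum>i\<in>I. (x i)\<^sup>2)"
proof -
  have "\<bar>\<Sum>i\<in>I. \<Sum>j\<in>I. J i j * x i * x j\<bar> \<le> (\<Sum>i\<in>I. \<Sum>j\<in>I. \<bar>J i j * x i * x j\<bar>)"
    by (intro order_trans[OF sum_abs] sum_mono) auto
  also have "\<dots> \<le> (\<Sum>i\<in>I. \<Sum>j\<in>I. 1/2 * (\<bar>J i j\<bar> * (x i)\<^sup>2) + 1/2 * (\<bar>J i j\<bar> * (x j)\<^sup>2))"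
  proof (intro sum_mono)
    fix i j
    have "\<bar>x i * x j\<bar> \<le> 1/2 * (x i)\<^sup>2 + 1/2 * (x j)\<^sup>2"
      using sum_squares_bound[of "\<bar>x i\<bar>" "\<bar>x j\<bar>"] by (simp add: abs_mult)
    then have "\<bar>J i j\<bar> * \<bar>x i * x j\<bar> \<le> \<bar>J i j\<bar> * (1/2 * (x i)\<^sup>2 + 1/2 * (x j)\<^sup>2)" by (intro mult_left_mono) auto
    then show "\<bar>J i j * x i * x j\<bar> \<le> 1/2 * (\<bar>J i j\<bar> * (x i)\<^sup>2) + 1/2 * (\<bar>J i j\<bar> * (x j)\<^sup>2)"
      by (simp add: abs_mult algebra_simps)
  qed
  also have "\<dots> = 1/2 * (\<Sum>i\<in>I. \<Sum>j\<in>I. \<bar>J i j\<bar> * (x i)\<^sup>2) + 1/2 * (\<Sum>i\<in>I. \<Sum>j\<in>I. \<bar>J i j\<bar> * (x j)\<^sup>2)"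
    by (simp add: sum.distrib sum_distrib_left)
  also have "(\<Sum>i\<in>I. \<Sum>j\<in>I. \<bar>J i j\<bar> * (x j)\<^sup>2) = (\<Sum>i\<in>I. \<Sum>j\<in>I. \<bar>J i j\<bar> * (x i)\<^sup>2)"
    by (subst sum.swap) (simp add: J_sym)
  also have "1/2 * (\<Sum>i\<in>I. \<Sum>j\<in>I. \<bar>J i j\<bar> * (x i)\<^sup>2) + 1/2 * (\<Sum>i\<in>I. \<Sum>j\<in>I. \<bar>J i j\<bar> * (x i)\<^sup>2)
     = (\<Sum>i\<in>I. (\<Sum>j\<in>I. \<bar>J i j\<bar>) * (x i)\<^sup>2)" by (simp add: sum_distrib_right)
  also have "\<dots> \<le> (\<Sum>i\<in>I. (1 - \<delta>) * (x i)\<^sup>2)"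
    using J_row[OF assms] by (intro sum_mono mult_right_mono) auto
  finally show ?thesis by (simp add: sum_distrib_left)
qed

lemma coupling_quadratic:
  assumes "finite I"
  shows "(\<Sum>i\<in>I. \<Sum>j\<in>I. coupling R h i j * x i * x j) = (\<Sum>i\<in>I. (x i)\<^sup>2) + (\<Sum>i\<in>I. \<Sum>j\<in>I. J i j * x i * x j)"
  using assms by (simp add: coupling_eq distrib_right sum.distrib if_distrib[of "\<lambda>u. u * _"] sum.delta power2_eq_square cong: if_cong)

lemma coupling_row:
  assumes "finite I" "j \<in> I"
  shows "(\<Sum>k\<in>I. coupling R h j k * x k) = x j + (\<Sum>k\<in>I. J j k * x k)"
proof -
  have "(\<Sum>k\<in>I. (if j = k then 1 else 0) * x k) = x j"
    using assms sum.delta'[of I j x] by (simp add: if_distrib[of "\<lambda>u. u * _"] cong: if_cong)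
  then show ?thesis by (simp add: coupling_eq distrib_right sum.distrib)
qed

lemma gibbs_single:
  assumes "finite I"
  shows "gibbs I (coupling R h) V V' (\<delta> / 2) B B1"
proof
  show "2 * (\<delta> / 2) * (\<Sum>i\<in>I. (x i)\<^sup>2) \<le> (\<Sum>i\<in>I. \<Sum>j\<in>I. coupling R h i j * x i * x j)" for x
    unfolding coupling_quadratic[OF assms] using J_quadratic_le[OF assms, of x] by (simp add: algebra_simps abs_le_iff)
qed (use assms \<delta>_pos coupling_sym V_bound V_deriv V'_bound V'_cont in auto)

text \<open>A maximum principle: at the site with the largest moment the neighbours contribute at
  most 1 - \<delta> times that moment. This is why the bounds do not depend on the size of the
  chain.\<close>

lemma max_moment_bound:
  assumes "finite I" and u: "\<And>i. i \<in> I \<Longrightarrow> 0 \<le> u i"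
    and le: "\<And>i. i \<in> I \<Longrightarrow> \<alpha> * u i \<le> \<beta> + (\<Sum>j\<in>I. \<bar>J i j\<bar> * ((u i + u j) / 2))"
    and \<alpha>: "1 - \<delta> < \<alpha>" and i: "i \<in> I"
  shows "u i \<le> \<beta> / (\<alpha> - (1 - \<delta>))"
proof -
  obtain k where k: "k \<in> I" "\<And>j. j \<in> I \<Longrightarrow> u j \<le> u k"
    using Max_in[of "u ` I"] Max_ge[of "u ` I"] assms(1) i by (metis (no_types, lifting) empty_iff finite_imageI image_iff)
  have "\<alpha> * u k \<le> \<beta> + (\<Sum>j\<in>I. \<bar>J k j\<bar> * u k)"
    using le[OF k(1)] k by (intro order_trans[OF le[OF k(1)]] add_left_mono sum_mono mult_left_mono) auto
  also have "(\<Sum>j\<in>I. \<bar>J k j\<bar> * u k) \<le> (1 - \<delta>) * u k"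
    unfolding sum_distrib_right[symmetric] using J_row[OF assms(1)] u k by (intro mult_right_mono) auto
  finally have "(\<alpha> - (1 - \<delta>)) * u k \<le> \<beta>" by (simp add: algebra_simps)
  then have "u k \<le> \<beta> / (\<alpha> - (1 - \<delta>))" using \<alpha> by (simp add: field_simps)
  then show ?thesis using k(2)[OF i] by linarith
qed

section \<open>Second moments of one chain\<close>

abbreviation "W1 \<sigma> I \<equiv> gibbs.W I (coupling R h) (\<lambda>_. \<sigma>) V"
abbreviation "Z1 \<sigma> I \<equiv> gibbs.Z I (coupling R h) (\<lambda>_. \<sigma>) V"
abbreviation "E1 \<sigma> I \<equiv> gibbs.E I (coupling R h) (\<lambda>_. \<sigma>) V"

definition "c1 = 2 / \<delta> + 4 * B1\<^sup>2 / \<delta>\<^sup>2"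

text \<open>The common scheme for \<open>x i\<close> in one chain and for the difference of two
  replicas. \<open>f i\<close> is the variable times the matching derivative of the energy; its
  expectation is known by integration by parts, and it dominates the square of the variable up to
  nearest interactions and a constant.\<close>

lemma gibbs_moment_bound:
  fixes y f :: "int \<Rightarrow> ('k \<Rightarrow> real) \<Rightarrow> real"
  assumes "gibbs K Q V V' a B B1" and I: "finite I"
    and sqi: "\<And>i. i \<in> I \<Longrightarrow> integrable (Leb K) (\<lambda>x. (y i x)\<^sup>2 * gibbs.W K Q s V x)"
    and fi: "\<And>i. i \<in> I \<Longrightarrow> integrable (Leb K) (\<lambda>x. f i x * gibbs.W K Q s V x)"
    and le: "\<And>i x. i \<in> I \<Longrightarrow>
      \<alpha> * (y i x)\<^sup>2 - (\<Sum>j\<in>I. \<bar>J i j\<bar> / 2 * ((y i x)\<^sup>2 + (y j x)\<^sup>2)) - \<beta> \<le> f i x"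
    and Ef: "\<And>i. i \<in> I \<Longrightarrow> gibbs.E K Q s V (f i) \<le> \<gamma>"
    and \<alpha>: "1 - \<delta> < \<alpha>" and i: "i \<in> I"
  shows "gibbs.E K Q s V (\<lambda>x. (y i x)\<^sup>2) \<le> (\<gamma> + \<beta>) / (\<alpha> - (1 - \<delta>))"
proof -
  interpret G: gibbs K Q s V V' a B B1 by fact
  let ?E = G.E
  show ?thesis
  proof (rule max_moment_bound[OF I, where u = "\<lambda>i. ?E (\<lambda>x. (y i x)\<^sup>2)"])
    show "0 \<le> ?E (\<lambda>x. (y j x)\<^sup>2)" for j
      unfolding G.E_def using G.Z_pos G.W_pos
      by (intro divide_nonneg_pos Bochner_Integration.integral_nonneg mult_nonneg_nonneg) (auto intro: less_imp_le)
    fix j assume j: "j \<in> I"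
    let ?S = "\<lambda>x. \<Sum>k\<in>I. \<bar>J j k\<bar> / 2 * ((y j x)\<^sup>2 + (y k x)\<^sup>2)"
    have intS: "integrable (Leb K) (\<lambda>x. \<bar>J j k\<bar> / 2 * ((y j x)\<^sup>2 + (y k x)\<^sup>2) * G.W x)" if "k \<in> I" for k
      using integrable_mult_right[OF Bochner_Integration.integrable_add[OF sqi[OF j] sqi[OF that]], of "\<bar>J j k\<bar> / 2"]
      by (simp add: algebra_simps)
    have intS': "integrable (Leb K) (\<lambda>x. ?S x * G.W x)"
      unfolding sum_distrib_right using intS by (intro Bochner_Integration.integrable_sum)
    have int1: "integrable (Leb K) (\<lambda>x. \<alpha> * (y j x)\<^sup>2 * G.W x)"
      using sqi[OF j] by (simp add: mult.assoc)
    have int2: "integrable (Leb K) (\<lambda>x. (\<alpha> * (y j x)\<^sup>2 - ?S x) * G.W x)"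
      using Bochner_Integration.integrable_diff[OF int1 intS'] by (simp only: left_diff_distrib)
    have int0: "integrable (Leb K) (\<lambda>x. c * G.W x)" for c using G.integrable_W by simp
    have "?E (\<lambda>x. \<alpha> * (y j x)\<^sup>2 - ?S x - \<beta>) \<le> ?E (f j)"
    proof (rule G.E_mono[OF _ fi[OF j] le[OF j]])
      show "integrable (Leb K) (\<lambda>x. (\<alpha> * (y j x)\<^sup>2 - ?S x - \<beta>) * G.W x)"
        using Bochner_Integration.integrable_diff[OF int2 int0[of \<beta>]] by (simp add: left_diff_distrib)
    qed
    also have "\<dots> \<le> \<gamma>" by (rule Ef[OF j])
    also have "?E (\<lambda>x. \<alpha> * (y j x)\<^sup>2 - ?S x - \<beta>)
      = \<alpha> * ?E (\<lambda>x. (y j x)\<^sup>2) - (\<Sum>k\<in>I. \<bar>J j k\<bar> / 2 * (?E (\<lambda>x. (y j x)\<^sup>2) + ?E (\<lambda>x. (y k x)\<^sup>2))) - \<beta>"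
    proof -
      have "?E ?S = (\<Sum>k\<in>I. ?E (\<lambda>x. \<bar>J j k\<bar> / 2 * ((y j x)\<^sup>2 + (y k x)\<^sup>2)))"
        by (rule G.E_sum[OF intS])
      also have "\<dots> = (\<Sum>k\<in>I. \<bar>J j k\<bar> / 2 * (?E (\<lambda>x. (y j x)\<^sup>2) + ?E (\<lambda>x. (y k x)\<^sup>2)))"
        by (intro sum.cong refl) (simp only: G.E_cmult G.E_add[OF sqi[OF j] sqi])
      finally show ?thesis
        by (simp only: G.E_diff[OF int2 int0] G.E_diff[OF int1 intS'] G.E_cmult G.E_const)
    qed
    finally show "\<alpha> * ?E (\<lambda>x. (y j x)\<^sup>2)
       \<le> (\<gamma> + \<beta>) + (\<Sum>k\<in>I. \<bar>J j k\<bar> * ((?E (\<lambda>x. (y j x)\<^sup>2) + ?E (\<lambda>x. (y k x)\<^sup>2)) / 2))"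
      by (simp add: mult_ac)
  qed (use \<alpha> i in auto)
qed

lemma J_cross_ge: "- (\<Sum>j\<in>I. \<bar>J i j\<bar> / 2 * ((u i)\<^sup>2 + (u j)\<^sup>2)) \<le> (\<Sum>j\<in>I. J i j * (u i * u j))"
  unfolding sum_negf[symmetric]
proof (rule sum_mono)
  fix j
  have "\<bar>J i j * (u i * u j)\<bar> \<le> \<bar>J i j\<bar> * (((u i)\<^sup>2 + (u j)\<^sup>2) / 2)"
    unfolding abs_mult[of "J i j"] using sum_squares_bound[of "\<bar>u i\<bar>" "\<bar>u j\<bar>"] by (intro mult_left_mono) (auto simp: abs_mult)
  then show "- (\<bar>J i j\<bar> / 2 * ((u i)\<^sup>2 + (u j)\<^sup>2)) \<le> J i j * (u i * u j)" by (simp add: abs_le_iff)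
qed

lemma linear_term_ge:
  assumes "\<bar>v\<bar> \<le> b"
  shows "- (\<delta> / 4 * u\<^sup>2 + b\<^sup>2 / \<delta>) \<le> u * v"
proof -
  have "\<bar>u * v\<bar> \<le> \<bar>u\<bar> * b" unfolding abs_mult using assms by (intro mult_left_mono) auto
  also have "\<dots> \<le> \<delta> / 4 * u\<^sup>2 + b\<^sup>2 / \<delta>"
  proof -
    have "0 \<le> (\<delta> / 2 * \<bar>u\<bar> - b)\<^sup>2 / \<delta>" using \<delta>_pos by simp
    also have "\<dots> = \<delta> / 4 * u\<^sup>2 + b\<^sup>2 / \<delta> - \<bar>u\<bar> * b"
      using \<delta>_pos by (simp add: power2_diff power_mult_distrib field_simps power2_eq_square)
    finally show ?thesis by simp
  qed
  finally show ?thesis by (simp add: abs_le_iff)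
qed

text \<open>Here x_i dH_i has mean 1. The field is treated as part of a bounded force of size at
  most B1 + |\<sigma>|, which produces the growth in \<sigma>^2.\<close>

lemma single_second_moment:
  assumes I: "finite I" and i: "i \<in> I"
  shows "E1 \<sigma> I (\<lambda>x. (x i)\<^sup>2) \<le> c1 + 4 / \<delta>\<^sup>2 * \<sigma>\<^sup>2"
proof -
  interpret G: gibbs I "coupling R h" "\<lambda>_. \<sigma>" V V' "\<delta> / 2" B B1 by (rule gibbs_single[OF I])
  let ?b = "B1 + \<bar>\<sigma>\<bar>"
  have "G.E (\<lambda>x. (x i)\<^sup>2) \<le> (1 + ?b\<^sup>2 / \<delta>) / ((1 - \<delta> / 4) - (1 - \<delta>))"
  proof (rule gibbs_moment_bound[OF gibbs_single[OF I] I, where y = "\<lambda>i x. x i" and f = "\<lambda>i x. x i * G.dH i x"])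
    fix j assume j: "j \<in> I"
    show "integrable (Leb I) (\<lambda>x. (x j)\<^sup>2 * G.W x)"
      using j I by (intro G.integrable_W_quadratic[of _ 1])
        (auto intro!: order_trans[OF member_le_sum[of j I "\<lambda>i. (_ i)\<^sup>2"]])
    show "integrable (Leb I) (\<lambda>x. x j * G.dH j x * G.W x)" by (rule G.integrable_coord_dH[OF j j])
    show "G.E (\<lambda>x. x j * G.dH j x) \<le> 1" using G.integration_by_parts[OF j j] by simp
    fix x :: "int \<Rightarrow> real"
    have "x j * G.dH j x = (x j)\<^sup>2 + (\<Sum>k\<in>I. J j k * (x j * x k)) + x j * (V' (x j) - \<sigma>)"
      unfolding G.dH_def coupling_row[OF I j]
      by (simp add: distrib_left sum_distrib_left right_diff_distrib power2_eq_square mult_ac)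
    moreover have "\<bar>V' (x j) - \<sigma>\<bar> \<le> ?b" using V'_bound[of "x j"] by linarith
    ultimately show "(1 - \<delta> / 4) * (x j)\<^sup>2 - (\<Sum>k\<in>I. \<bar>J j k\<bar> / 2 * ((x j)\<^sup>2 + (x k)\<^sup>2)) - ?b\<^sup>2 / \<delta> \<le> x j * G.dH j x"
      using J_cross_ge[of j x I] linear_term_ge[of "V' (x j) - \<sigma>" ?b "x j"] by (simp add: left_diff_distrib)
  qed (use \<delta>_pos i in auto)
  \<comment> \<open>The denominator is 3 \<delta> / 4, since Young's inequality spends \<delta> / 4;
    it is rounded down to \<delta> / 2.\<close>
  also have "\<dots> \<le> (1 + ?b\<^sup>2 / \<delta>) / (\<delta> / 2)"
    using \<delta>_pos by (intro divide_left_mono) (auto intro!: add_nonneg_nonneg)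
  also have "\<dots> = 2 / \<delta> + 2 * ?b\<^sup>2 / \<delta>\<^sup>2" using \<delta>_pos by (simp add: field_simps power2_eq_square)
  also have "\<dots> \<le> 2 / \<delta> + (4 * B1\<^sup>2 + 4 * \<sigma>\<^sup>2) / \<delta>\<^sup>2"
  proof -
    have "2 * ?b\<^sup>2 \<le> 4 * B1\<^sup>2 + 4 * \<sigma>\<^sup>2"
      using zero_le_power2[of "B1 - \<bar>\<sigma>\<bar>"] by (simp add: power2_sum power2_diff)
    then show ?thesis by (intro add_left_mono divide_right_mono) auto
  qed
  finally show ?thesis by (simp add: c1_def add_divide_distrib)
qed

text \<open>The second summand contributes \<open>- \<tau> (dd x i)\<^sup>2\<close> to the energy for each \<open>i \<in> A\<close>.\<close>

definition Q2 :: "real \<Rightarrow> int set \<Rightarrow> int \<times> bool \<Rightarrow> int \<times> bool \<Rightarrow> real" where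
  "Q2 \<tau> A p q = (if snd p = snd q then coupling R h (fst p) (fst q) else 0)
    + (if fst p = fst q \<and> fst p \<in> A then (if snd p = snd q then - 2 * \<tau> else 2 * \<tau>) else 0)"

abbreviation "dd x i \<equiv> x (i, False) - x (i, True) :: real"
abbreviation "W2 \<sigma> \<tau> A I \<equiv> gibbs.W (I \<times> UNIV) (Q2 \<tau> A) (\<lambda>_. \<sigma>) V"
abbreviation "Z2 \<sigma> \<tau> A I \<equiv> gibbs.Z (I \<times> UNIV) (Q2 \<tau> A) (\<lambda>_. \<sigma>) V"
abbreviation "E2 \<sigma> \<tau> A I \<equiv> gibbs.E (I \<times> UNIV) (Q2 \<tau> A) (\<lambda>_. \<sigma>) V"

section \<open>The tilted two-replica system\<close>

lemma sum_bool: "(\<Sum>p\<in>I \<times> (UNIV :: bool set). f p) = (\<Sum>i\<in>I. f (i, False) + f (i, True))"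
  by (simp add: sum.cartesian_product' UNIV_bool add.commute)

lemma Q2_row:
  assumes "finite I" "i \<in> I"
  shows "(\<Sum>q\<in>I \<times> UNIV. Q2 \<tau> A (i, b) q * x q)
    = (\<Sum>j\<in>I. coupling R h i j * x (j, b)) - (if i \<in> A then 2 * \<tau> * (x (i, b) - x (i, \<not> b)) else 0)"
proof -
  have "Q2 \<tau> A (i, b) (j, False) * x (j, False) + Q2 \<tau> A (i, b) (j, True) * x (j, True)
     = coupling R h i j * x (j, b) + (if i = j then (if i \<in> A then - 2 * \<tau> * (x (i, b) - x (i, \<not> b)) else 0) else 0)" for j
    by (cases b) (auto simp: Q2_def algebra_simps)
  then show ?thesis using assms by (simp add: sum_bool sum.distrib sum.delta')
qed

lemma Q2_quadratic:
  assumes "finite I"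
  shows "(\<Sum>p\<in>I \<times> UNIV. \<Sum>q\<in>I \<times> UNIV. Q2 \<tau> A p q * x p * x q)
    = (\<Sum>i\<in>I. \<Sum>j\<in>I. coupling R h i j * x (i, False) * x (j, False))
    + (\<Sum>i\<in>I. \<Sum>j\<in>I. coupling R h i j * x (i, True) * x (j, True)) - 2 * \<tau> * (\<Sum>i\<in>I \<inter> A. (dd x i)\<^sup>2)"
proof -
  have row: "(\<Sum>q\<in>I \<times> UNIV. Q2 \<tau> A p q * x p * x q) = x p * (\<Sum>q\<in>I \<times> UNIV. Q2 \<tau> A p q * x q)" for p
    by (simp add: sum_distrib_left mult_ac)
  have tilt: "(\<Sum>i\<in>I. if i \<in> A then 2 * \<tau> * (dd x i)\<^sup>2 else 0) = 2 * \<tau> * (\<Sum>i\<in>I \<inter> A. (dd x i)\<^sup>2)"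
    using assms by (simp add: sum.inter_restrict sum_distrib_left if_distrib[of "\<lambda>u. 2 * \<tau> * u"] cong: if_cong)
  have "(\<Sum>p\<in>I \<times> UNIV. \<Sum>q\<in>I \<times> UNIV. Q2 \<tau> A p q * x p * x q)
    = (\<Sum>i\<in>I. x (i, False) * (\<Sum>j\<in>I. coupling R h i j * x (j, False)) + x (i, True) * (\<Sum>j\<in>I. coupling R h i j * x (j, True))
        - (if i \<in> A then 2 * \<tau> * (dd x i)\<^sup>2 else 0))"
  proof -
    have "(\<Sum>p\<in>I \<times> UNIV. \<Sum>q\<in>I \<times> UNIV. Q2 \<tau> A p q * x p * x q)
      = (\<Sum>i\<in>I. x (i, False) * (\<Sum>q\<in>I \<times> UNIV. Q2 \<tau> A (i, False) q * x q) + x (i, True) * (\<Sum>q\<in>I \<times> UNIV. Q2 \<tau> A (i, True) q * x q))"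
      unfolding row by (rule sum_bool)
    also have "\<dots> = (\<Sum>i\<in>I. x (i, False) * (\<Sum>j\<in>I. coupling R h i j * x (j, False)) + x (i, True) * (\<Sum>j\<in>I. coupling R h i j * x (j, True))
        - (if i \<in> A then 2 * \<tau> * (dd x i)\<^sup>2 else 0))"
    proof (rule sum.cong[OF refl])
      fix i assume i: "i \<in> I"
      show "x (i, False) * (\<Sum>q\<in>I \<times> UNIV. Q2 \<tau> A (i, False) q * x q) + x (i, True) * (\<Sum>q\<in>I \<times> UNIV. Q2 \<tau> A (i, True) q * x q)
        = x (i, False) * (\<Sum>j\<in>I. coupling R h i j * x (j, False)) + x (i, True) * (\<Sum>j\<in>I. coupling R h i j * x (j, True))
        - (if i \<in> A then 2 * \<tau> * (dd x i)\<^sup>2 else 0)"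
        unfolding Q2_row[OF assms i] by (simp add: power2_eq_square algebra_simps)
    qed
    finally show ?thesis .
  qed
  also have "\<dots> = (\<Sum>i\<in>I. x (i, False) * (\<Sum>j\<in>I. coupling R h i j * x (j, False)))
      + (\<Sum>i\<in>I. x (i, True) * (\<Sum>j\<in>I. coupling R h i j * x (j, True))) - 2 * \<tau> * (\<Sum>i\<in>I \<inter> A. (dd x i)\<^sup>2)"
    unfolding tilt[symmetric] by (simp add: sum.distrib sum_subtractf)
  finally show ?thesis by (simp add: sum_distrib_left mult_ac)
qed

text \<open>The untilted form is at least \<delta> times the sum of squares. As (x - y)^2 <= 2 x^2 +
  2 y^2, a tilt with 16 \<tau> <= \<delta> takes at most a quarter of it; what is left exceeds the
  \<delta> / 2 asked for.\<close>

lemma gibbs_double: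
  assumes I: "finite I" and \<tau>: "0 \<le> \<tau>" "16 * \<tau> \<le> \<delta>"
  shows "gibbs (I \<times> UNIV) (Q2 \<tau> A) V V' (\<delta> / 4) B B1"
proof
  fix x :: "int \<times> bool \<Rightarrow> real"
  let ?q = "\<lambda>b. \<Sum>i\<in>I. (x (i, b))\<^sup>2"
  have co: "\<delta> * ?q b \<le> (\<Sum>i\<in>I. \<Sum>j\<in>I. coupling R h i j * x (i, b) * x (j, b))" for b
    using J_quadratic_le[OF I, of "\<lambda>i. x (i, b)"] coupling_quadratic[OF I, of "\<lambda>i. x (i, b)"]
    by (simp add: algebra_simps abs_le_iff)
  have "(\<Sum>i\<in>I \<inter> A. (dd x i)\<^sup>2) \<le> (\<Sum>i\<in>I. (dd x i)\<^sup>2)" using I by (intro sum_mono2) auto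
  also have "\<dots> \<le> (\<Sum>i\<in>I. 2 * (x (i, False))\<^sup>2 + 2 * (x (i, True))\<^sup>2)"
  proof (rule sum_mono)
    fix i show "(dd x i)\<^sup>2 \<le> 2 * (x (i, False))\<^sup>2 + 2 * (x (i, True))\<^sup>2"
      using zero_le_power2[of "x (i, False) + x (i, True)"] by (simp add: power2_eq_square algebra_simps)
  qed
  also have "\<dots> = 2 * ?q False + 2 * ?q True" by (simp add: sum.distrib sum_distrib_left)
  finally have "2 * \<tau> * (\<Sum>i\<in>I \<inter> A. (dd x i)\<^sup>2) \<le> 2 * \<tau> * (2 * ?q False + 2 * ?q True)"
    using \<tau> by (intro mult_left_mono) auto
  also have "\<dots> = 4 * \<tau> * (?q False + ?q True)" by simp
  also have "\<dots> \<le> \<delta> / 4 * (?q False + ?q True)"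
    using \<tau> by (intro mult_right_mono) (auto intro!: add_nonneg_nonneg sum_nonneg)
  finally have tilt: "2 * \<tau> * (\<Sum>i\<in>I \<inter> A. (dd x i)\<^sup>2) \<le> \<delta> / 4 * (?q False + ?q True)" .
  have nn: "0 \<le> \<delta> * ?q b" for b using \<delta>_pos by (intro mult_nonneg_nonneg sum_nonneg) auto
  have sq: "(\<Sum>p\<in>I \<times> UNIV. (x p)\<^sup>2) = ?q False + ?q True" by (simp add: sum_bool sum.distrib)
  show "2 * (\<delta> / 4) * (\<Sum>p\<in>I \<times> UNIV. (x p)\<^sup>2) \<le> (\<Sum>p\<in>I \<times> UNIV. \<Sum>q\<in>I \<times> UNIV. Q2 \<tau> A p q * x p * x q)"
    unfolding Q2_quadratic[OF I] sq using tilt co[of False] co[of True] nn[of False] nn[of True]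
    by (simp add: algebra_simps)
qed (use I \<delta>_pos coupling_sym V_bound V_deriv V'_bound V'_cont in \<open>auto simp: Q2_def\<close>)

definition "c2 = 4 / \<delta> + 8 * B1\<^sup>2 / \<delta>\<^sup>2"

text \<open>The field drops out of the difference of the two derivatives of the energy, so the bound
  is uniform in \<sigma>. This uniformity passes to the decay of correlations and to the
  variance.\<close>

lemma double_second_moment:
  assumes I: "finite I" and i: "i \<in> I" and \<tau>: "0 \<le> \<tau>" "16 * \<tau> \<le> \<delta>"
  shows "E2 \<sigma> \<tau> A I (\<lambda>x. (dd x i)\<^sup>2) \<le> c2"
proof -
  interpret G: gibbs "I \<times> UNIV" "Q2 \<tau> A" "\<lambda>_. \<sigma>" V V' "\<delta> / 4" B B1 by (rule gibbs_double[OF I \<tau>])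
  let ?\<alpha> = "1 - 4 * \<tau> - \<delta> / 4"
  have "G.E (\<lambda>x. (dd x i)\<^sup>2) \<le> (2 + (2 * B1)\<^sup>2 / \<delta>) / (?\<alpha> - (1 - \<delta>))"
  proof (rule gibbs_moment_bound[OF gibbs_double[OF I \<tau>] I, where y = "\<lambda>i x. dd x i"
        and f = "\<lambda>i x. dd x i * (G.dH (i, False) x - G.dH (i, True) x)"])
    fix j assume j: "j \<in> I"
    have jb: "(j, b) \<in> I \<times> UNIV" for b using j by simp
    show "integrable (Leb (I \<times> UNIV)) (\<lambda>x. (dd x j)\<^sup>2 * G.W x)"
    proof (rule G.integrable_W_quadratic[of _ 4])
      show "(\<lambda>x. (dd x j)\<^sup>2) \<in> borel_measurable (Leb (I \<times> UNIV))" using jb by measurable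
      fix x :: "int \<times> bool \<Rightarrow> real"
      have "(x (j, b))\<^sup>2 \<le> G.sq x" for b
        using G.abs_mult_le_sq[OF jb[of b] jb[of b], of x] by (simp add: power2_eq_square)
      moreover have "(dd x j)\<^sup>2 \<le> 2 * (x (j, False))\<^sup>2 + 2 * (x (j, True))\<^sup>2"
        using zero_le_power2[of "x (j, False) + x (j, True)"] by (simp add: power2_eq_square algebra_simps)
      ultimately have "(dd x j)\<^sup>2 \<le> 4 * G.sq x"
        by (smt (verit))
      then show "\<bar>(dd x j)\<^sup>2\<bar> \<le> 4 * (1 + G.sq x)" by simp
    qed
    note ip = G.integration_by_parts[OF jb jb] and ii = G.integrable_coord_dH[OF jb jb]
    have exp: "(\<lambda>x. dd x j * (G.dH (j, False) x - G.dH (j, True) x))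
      = (\<lambda>x. x (j, False) * G.dH (j, False) x - x (j, True) * G.dH (j, False) x
          - (x (j, False) * G.dH (j, True) x - x (j, True) * G.dH (j, True) x))"
      by (auto simp: algebra_simps)
    have ii1: "integrable (Leb (I \<times> UNIV)) (\<lambda>x. (x (j, False) * G.dH (j, b) x - x (j, True) * G.dH (j, b) x) * G.W x)" for b
      using Bochner_Integration.integrable_diff[OF ii[of False b] ii[of True b]] by (simp add: left_diff_distrib)
    show "integrable (Leb (I \<times> UNIV)) (\<lambda>x. dd x j * (G.dH (j, False) x - G.dH (j, True) x) * G.W x)"
      using Bochner_Integration.integrable_diff[OF ii1[of False] ii1[of True]] by (simp add: algebra_simps)
    \<comment> \<open>Of the four terms the two diagonal ones have mean 1 each and the mixed ones
      have mean 0.\<close>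
    show "G.E (\<lambda>x. dd x j * (G.dH (j, False) x - G.dH (j, True) x)) \<le> 2"
      unfolding exp using ii ii1 ip by (simp add: G.E_diff)
    fix x :: "int \<times> bool \<Rightarrow> real"
    let ?v = "V' (x (j, False)) - V' (x (j, True))"
    let ?S = "\<Sum>k\<in>I. J j k * (dd x j * dd x k)" and ?A = "\<Sum>k\<in>I. \<bar>J j k\<bar> / 2 * ((dd x j)\<^sup>2 + (dd x k)\<^sup>2)"
    have diff: "G.dH (j, False) x - G.dH (j, True) x
       = dd x j + (\<Sum>k\<in>I. J j k * dd x k) - (if j \<in> A then 4 * \<tau> * dd x j else 0) + ?v"
      unfolding G.dH_def Q2_row[OF I j] using coupling_row[OF I j, of "\<lambda>k. x (k, False)"] coupling_row[OF I j, of "\<lambda>k. x (k, True)"]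
      by (simp add: right_diff_distrib sum_subtractf)
    have "dd x j * (G.dH (j, False) x - G.dH (j, True) x)
       = (dd x j)\<^sup>2 + ?S - (if j \<in> A then 4 * \<tau> * (dd x j)\<^sup>2 else 0) + dd x j * ?v"
      unfolding diff by (simp add: distrib_left right_diff_distrib[of "dd x j" "dd x j + _"] sum_distrib_left power2_eq_square mult_ac)
    moreover have "(if j \<in> A then 4 * \<tau> * (dd x j)\<^sup>2 else 0) \<le> 4 * \<tau> * (dd x j)\<^sup>2" using \<tau> by simp
    moreover have "\<bar>?v\<bar> \<le> 2 * B1" using V'_bound[of "x (j, False)"] V'_bound[of "x (j, True)"] by linarith
    then have "- (\<delta> / 4 * (dd x j)\<^sup>2 + (2 * B1)\<^sup>2 / \<delta>) \<le> dd x j * ?v" by (rule linear_term_ge)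
    moreover have "- ?A \<le> ?S" by (rule J_cross_ge)
    moreover have "?\<alpha> * (dd x j)\<^sup>2 = (dd x j)\<^sup>2 - 4 * \<tau> * (dd x j)\<^sup>2 - \<delta> / 4 * (dd x j)\<^sup>2" by (simp add: left_diff_distrib)
    ultimately show "?\<alpha> * (dd x j)\<^sup>2 - ?A - (2 * B1)\<^sup>2 / \<delta> \<le> dd x j * (G.dH (j, False) x - G.dH (j, True) x)"
      by linarith
  qed (use \<tau> \<delta>_pos i in auto)
  \<comment> \<open>The denominator is 3 \<delta> / 4 - 4 \<tau>, and 4 \<tau> is at most \<delta> /
    4.\<close>
  also have "\<dots> \<le> (2 + (2 * B1)\<^sup>2 / \<delta>) / (\<delta> / 2)"
    using \<delta>_pos \<tau> by (intro divide_left_mono) (auto intro!: add_nonneg_nonneg mult_pos_pos)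
  also have "\<dots> = c2" using \<delta>_pos by (simp add: c2_def field_simps power2_eq_square)
  finally show ?thesis .
qed

lemma H2_eq:
  assumes I: "finite I" and \<tau>: "0 \<le> \<tau>" "16 * \<tau> \<le> \<delta>"
  shows "gibbs.H (I \<times> UNIV) (Q2 \<tau> A) (\<lambda>_. \<sigma>) V x
    = 1/2 * (\<Sum>i\<in>I. \<Sum>j\<in>I. coupling R h i j * (x (i, False) * x (j, False) + x (i, True) * x (j, True)))
      - \<tau> * (\<Sum>i\<in>I \<inter> A. (dd x i)\<^sup>2)
      + (\<Sum>i\<in>I. V (x (i, False)) + V (x (i, True))) - (\<Sum>i\<in>I. \<sigma> * (x (i, False) + x (i, True)))"
proof -
  interpret G: gibbs "I \<times> UNIV" "Q2 \<tau> A" "\<lambda>_. \<sigma>" V V' "\<delta> / 4" B B1 by (rule gibbs_double[OF I \<tau>])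
  have "(\<Sum>i\<in>I. \<Sum>j\<in>I. coupling R h i j * (x (i, False) * x (j, False) + x (i, True) * x (j, True)))
    = (\<Sum>i\<in>I. \<Sum>j\<in>I. coupling R h i j * x (i, False) * x (j, False)) + (\<Sum>i\<in>I. \<Sum>j\<in>I. coupling R h i j * x (i, True) * x (j, True))"
    by (simp add: distrib_left sum.distrib mult.assoc)
  then show ?thesis unfolding G.H_def Q2_quadratic[OF I] by (simp add: sum_bool distrib_left)
qed

lemma W2_tilt:
  assumes I: "finite I" and \<tau>: "0 \<le> \<tau>" "16 * \<tau> \<le> \<delta>"
  shows "W2 \<sigma> \<tau> A I x = W2 \<sigma> 0 {} I x * exp (\<tau> * (\<Sum>i\<in>I \<inter> A. (dd x i)\<^sup>2))"
proof -
  interpret G: gibbs "I \<times> UNIV" "Q2 \<tau> A" "\<lambda>_. \<sigma>" V V' "\<delta> / 4" B B1 by (rule gibbs_double[OF I \<tau>])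
  interpret G0: gibbs "I \<times> UNIV" "Q2 0 {}" "\<lambda>_. \<sigma>" V V' "\<delta> / 4" B B1
    using \<delta>_pos by (intro gibbs_double[OF I]) auto
  have "G.H x = G0.H x - \<tau> * (\<Sum>i\<in>I \<inter> A. (dd x i)\<^sup>2)"
    using H2_eq[OF I \<tau>] H2_eq[OF I, of 0 "{}"] \<delta>_pos by simp
  then show ?thesis
    unfolding G.W_def G0.W_def by (simp add: exp_add[symmetric])
qed

text \<open>
  Exchanging the replicas to the right of \<open>c\<close> reverses the energy of the bonds across \<open>c\<close> and no other,
  so cuts without common bonds give independent sign flips.
\<close>

definition swap :: "int set \<Rightarrow> int \<Rightarrow> (int \<times> bool \<Rightarrow> real) \<Rightarrow> int \<times> bool \<Rightarrow> real" where
  "swap I c x = (\<lambda>p\<in>I \<times> UNIV. x (fst p, (c < fst p) \<noteq> snd p))"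

lemma swap_bij: "bij_betw (\<lambda>p. (fst p, (c < fst p) \<noteq> snd p)) (I \<times> (UNIV :: bool set)) (I \<times> UNIV)"
  by (rule bij_betw_byWitness[where f' = "\<lambda>p. (fst p, (c < fst p) \<noteq> snd p)"]) auto

lemma swap_measurable: "swap I c \<in> measurable (Leb (I \<times> UNIV)) (Leb (I \<times> UNIV))"
  unfolding swap_def by (intro measurable_Leb_reindex) auto

lemma swap_distr: "finite I \<Longrightarrow> distr (Leb (I \<times> UNIV)) (Leb (I \<times> UNIV)) (swap I c) = Leb (I \<times> UNIV)"
  using distr_Leb_reindex[OF _ swap_bij, of I] unfolding swap_def by simp

lemma dd_swap: "i \<in> I \<Longrightarrow> dd (swap I c x) i = (if c < i then - dd x i else dd x i)"
  by (auto simp: swap_def)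

text \<open>The part of the energy that is odd under the exchange at \<open>c\<close>. With replicas
  x and y, the odd part of x_i x_j + y_i y_j is half the product of the differences, and the sum
  over ordered pairs counts each bond twice; together these give 1/4.\<close>

definition cut :: "int set \<Rightarrow> int \<Rightarrow> (int \<times> bool \<Rightarrow> real) \<Rightarrow> real" where
  "cut I c x = 1/4 * (\<Sum>i\<in>I. \<Sum>j\<in>I. if (c < i) \<noteq> (c < j) then coupling R h i j * (dd x i * dd x j) else 0)"

lemma W2_swap:
  assumes I: "finite I"
  shows "W2 \<sigma> 0 {} I (swap I c x) = W2 \<sigma> 0 {} I x * exp (2 * cut I c x)"
proof -
  interpret G: gibbs "I \<times> UNIV" "Q2 0 {}" "\<lambda>_. \<sigma>" V V' "\<delta> / 4" B B1
    using \<delta>_pos by (intro gibbs_double[OF I]) auto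
  let ?y = "swap I c x"
  have "(\<Sum>i\<in>I. \<Sum>j\<in>I. coupling R h i j * (?y (i, False) * ?y (j, False) + ?y (i, True) * ?y (j, True)))
    = (\<Sum>i\<in>I. \<Sum>j\<in>I. coupling R h i j * (x (i, False) * x (j, False) + x (i, True) * x (j, True))
        - (if (c < i) \<noteq> (c < j) then coupling R h i j * (dd x i * dd x j) else 0))"
    by (intro sum.cong refl) (auto simp: swap_def algebra_simps)
  also have "\<dots> = (\<Sum>i\<in>I. \<Sum>j\<in>I. coupling R h i j * (x (i, False) * x (j, False) + x (i, True) * x (j, True))) - 4 * cut I c x"
    by (simp add: sum_subtractf cut_def)
  finally have q: "(\<Sum>i\<in>I. \<Sum>j\<in>I. coupling R h i j * (?y (i, False) * ?y (j, False) + ?y (i, True) * ?y (j, True)))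
    = (\<Sum>i\<in>I. \<Sum>j\<in>I. coupling R h i j * (x (i, False) * x (j, False) + x (i, True) * x (j, True))) - 4 * cut I c x" .
  have v: "(\<Sum>i\<in>I. V (?y (i, False)) + V (?y (i, True))) = (\<Sum>i\<in>I. V (x (i, False)) + V (x (i, True)))"
    "(\<Sum>i\<in>I. \<sigma> * (?y (i, False) + ?y (i, True))) = (\<Sum>i\<in>I. \<sigma> * (x (i, False) + x (i, True)))"
  proof -
    have "V (?y (i, False)) + V (?y (i, True)) = V (x (i, False)) + V (x (i, True))"
      "?y (i, False) + ?y (i, True) = x (i, False) + x (i, True)" if "i \<in> I" for i
      using that by (cases "c < i"; simp add: swap_def)+
    then show "(\<Sum>i\<in>I. V (?y (i, False)) + V (?y (i, True))) = (\<Sum>i\<in>I. V (x (i, False)) + V (x (i, True)))"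
      "(\<Sum>i\<in>I. \<sigma> * (?y (i, False) + ?y (i, True))) = (\<Sum>i\<in>I. \<sigma> * (x (i, False) + x (i, True)))"
      by (auto intro!: sum.cong)
  qed
  have H0: "G.H z = 1/2 * (\<Sum>i\<in>I. \<Sum>j\<in>I. coupling R h i j * (z (i, False) * z (j, False) + z (i, True) * z (j, True)))
      + (\<Sum>i\<in>I. V (z (i, False)) + V (z (i, True))) - (\<Sum>i\<in>I. \<sigma> * (z (i, False) + z (i, True)))" for z
    using H2_eq[OF I, of 0 "{}"] \<delta>_pos by simp
  have "G.H ?y = G.H x - 2 * cut I c x"
    unfolding H0 q v by (simp add: right_diff_distrib)
  then show ?thesis unfolding G.W_def by (simp add: exp_add[symmetric])
qed

lemma cut_swap:
  assumes "c = c' \<or> int R \<le> \<bar>c - c'\<bar>"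
  shows "cut I c (swap I c' x) = (if c = c' then - cut I c x else cut I c x)"
proof -
  have "(if (c < i) \<noteq> (c < j) then coupling R h i j * (dd (swap I c' x) i * dd (swap I c' x) j) else 0)
    = (if c = c' then -1 else 1) * (if (c < i) \<noteq> (c < j) then coupling R h i j * (dd x i * dd x j) else 0)"
    if "i \<in> I" "j \<in> I" for i j
  proof (cases "c = c'")
    case True
    then show ?thesis using that by (auto simp: dd_swap algebra_simps)
  next
    case False
    show ?thesis
    proof (cases "((c < i) \<noteq> (c < j)) \<and> ((c' < i) \<noteq> (c' < j))")
      case True
      then have "int R < \<bar>i - j\<bar>" using assms False by auto
      then have "coupling R h i j = 0" by (simp add: coupling_def)
      then show ?thesis by simp
    next
      case nsplit: False
      then show ?thesis using that False by (auto simp: dd_swap algebra_simps)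
    qed
  qed
  then have "(\<Sum>i\<in>I. \<Sum>j\<in>I. if (c < i) \<noteq> (c < j) then coupling R h i j * (dd (swap I c' x) i * dd (swap I c' x) j) else 0)
    = (if c = c' then -1 else 1) * (\<Sum>i\<in>I. \<Sum>j\<in>I. if (c < i) \<noteq> (c < j) then coupling R h i j * (dd x i * dd x j) else 0)"
    unfolding sum_distrib_left by (intro sum.cong refl) 
  then show ?thesis unfolding cut_def by simp
qed

text \<open>Schur's test again, restricted to bonds across \<open>c\<close>. Only the 2 R sites of
  the window can have such a bond, so a tilt supported on this window pays for the cut
  energy.\<close>

lemma cut_le:
  assumes I: "finite I"
  shows "\<bar>cut I c x\<bar> \<le> 1/4 * (\<Sum>k\<in>I \<inter> {c - int R + 1..c + int R}. (dd x k)\<^sup>2)"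
proof -
  define j where "j i k = (if (c < i) \<noteq> (c < k) then \<bar>J i k\<bar> else 0)" for i k
  let ?w = "{c - int R + 1..c + int R}"
  have jsym: "j i k = j k i" for i k by (auto simp: j_def J_sym)
  have jrow: "(\<Sum>k\<in>I. j i k) \<le> (if i \<in> ?w then 1 else 0)" for i
  proof (cases "i \<in> ?w")
    case True
    have "(\<Sum>k\<in>I. j i k) \<le> (\<Sum>k\<in>I. \<bar>J i k\<bar>)" by (intro sum_mono) (auto simp: j_def)
    also have "\<dots> \<le> 1" using J_row[OF I, of i] \<delta>_pos by simp
    finally show ?thesis using True by simp
  next
    case False
    have "j i k = 0" for k
      using False J_far[of i k] by (auto simp: j_def)
    then show ?thesis using False by simp
  qed
  have "\<bar>cut I c x\<bar> \<le> 1/4 * (\<Sum>i\<in>I. \<Sum>k\<in>I. j i k * \<bar>dd x i * dd x k\<bar>)"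
    unfolding cut_def abs_mult[of "1/4"]
    by (auto intro!: mult_left_mono order_trans[OF sum_abs] sum_mono simp: j_def J_def abs_mult)
  also have "\<dots> \<le> 1/4 * (\<Sum>i\<in>I. \<Sum>k\<in>I. 1/2 * (j i k * (dd x i)\<^sup>2) + 1/2 * (j i k * (dd x k)\<^sup>2))"
  proof (intro mult_left_mono sum_mono)
    fix i k
    have "\<bar>dd x i * dd x k\<bar> \<le> 1/2 * (dd x i)\<^sup>2 + 1/2 * (dd x k)\<^sup>2"
      using sum_squares_bound[of "\<bar>dd x i\<bar>" "\<bar>dd x k\<bar>"] by (simp add: abs_mult)
    then have "j i k * \<bar>dd x i * dd x k\<bar> \<le> j i k * (1/2 * (dd x i)\<^sup>2 + 1/2 * (dd x k)\<^sup>2)"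
      by (intro mult_left_mono) (auto simp: j_def)
    then show "j i k * \<bar>dd x i * dd x k\<bar> \<le> 1/2 * (j i k * (dd x i)\<^sup>2) + 1/2 * (j i k * (dd x k)\<^sup>2)"
      by (simp add: distrib_left)
  qed simp
  also have "(\<Sum>i\<in>I. \<Sum>k\<in>I. 1/2 * (j i k * (dd x i)\<^sup>2) + 1/2 * (j i k * (dd x k)\<^sup>2))
     = 1/2 * (\<Sum>i\<in>I. \<Sum>k\<in>I. j i k * (dd x i)\<^sup>2) + 1/2 * (\<Sum>i\<in>I. \<Sum>k\<in>I. j i k * (dd x k)\<^sup>2)"
    by (simp add: sum.distrib sum_distrib_left)
  also have "(\<Sum>i\<in>I. \<Sum>k\<in>I. j i k * (dd x k)\<^sup>2) = (\<Sum>i\<in>I. \<Sum>k\<in>I. j i k * (dd x i)\<^sup>2)"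
    by (subst sum.swap) (simp add: jsym)
  also have "1/2 * (\<Sum>i\<in>I. \<Sum>k\<in>I. j i k * (dd x i)\<^sup>2) + 1/2 * (\<Sum>i\<in>I. \<Sum>k\<in>I. j i k * (dd x i)\<^sup>2)
     = (\<Sum>i\<in>I. (\<Sum>k\<in>I. j i k) * (dd x i)\<^sup>2)" by (simp add: sum_distrib_right)
  also have "\<dots> \<le> (\<Sum>i\<in>I. (if i \<in> ?w then 1 else 0) * (dd x i)\<^sup>2)"
    using jrow by (intro sum_mono mult_right_mono) auto
  also have "\<dots> = (\<Sum>k\<in>I \<inter> ?w. (dd x k)\<^sup>2)"
    using I by (simp add: sum.inter_restrict if_distrib[of "\<lambda>u. u * _"] cong: if_cong)
  finally show ?thesis by simp
qed

text \<open>
  The first bound on \<open>\<kappa>\<close> keeps the two-replica energy coercive after the tilt by \<open>\<kappa> / 4\<close>; the second makes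
  the gain per cut exceed the cost of the tilt. Cuts at distance \<open>spacing\<close> have no common bond.
\<close>

definition "\<kappa> = min (\<delta> / 4) (2 * exp (- (1 + c2 * real R)))"
definition "spacing = 2 * int R + 1"

lemma \<kappa>_pos: "0 < \<kappa>" using \<delta>_pos by (simp add: \<kappa>_def)

lemma \<kappa>_le: "16 * (\<kappa> / 4) \<le> \<delta>" by (simp add: \<kappa>_def)

lemma c2_pos: "0 < c2" using \<delta>_pos by (simp add: c2_def add_pos_nonneg)

text \<open>The right-hand side is the gain per cut in \<open>tanh_real_le_exp\<close>. The term
  with \<open>c2\<close> is the cost of tilting the 2 R sites of a window by \<kappa> / 4, and the
  leading \<kappa> is the net rate of decay.\<close>

lemma \<kappa>_gain: "\<kappa> + \<kappa> * c2 * real R / 2 \<le> \<kappa> / 2 * (1 - ln (\<kappa> / 2))"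
proof -
  have "\<kappa> / 2 \<le> exp (- (1 + c2 * real R))" by (simp add: \<kappa>_def)
  then have "ln (\<kappa> / 2) \<le> ln (exp (- (1 + c2 * real R)))" using \<kappa>_pos by (subst ln_le_cancel_iff) auto
  then have "2 + c2 * real R \<le> 1 - ln (\<kappa> / 2)" by simp
  then have "\<kappa> / 2 * (2 + c2 * real R) \<le> \<kappa> / 2 * (1 - ln (\<kappa> / 2))" using \<kappa>_pos by (intro mult_left_mono) auto
  then show ?thesis by (simp add: algebra_simps)
qed

section \<open>Exponential decay through separated cuts\<close>

lemma integrable_dd:
  assumes I: "finite I" and i: "i \<in> I" "j \<in> I" and \<tau>: "0 \<le> \<tau>" "16 * \<tau> \<le> \<delta>"
  shows "integrable (Leb (I \<times> UNIV)) (\<lambda>x. dd x i * dd x j * W2 \<sigma> \<tau> A I x)"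
proof -
  interpret G: gibbs "I \<times> UNIV" "Q2 \<tau> A" "\<lambda>_. \<sigma>" V V' "\<delta> / 4" B B1 by (rule gibbs_double[OF I \<tau>])
  have ib: "(i, b) \<in> I \<times> UNIV" "(j, b) \<in> I \<times> UNIV" for b using i by auto
  show ?thesis
  proof (rule G.integrable_W_quadratic[of _ 4])
    show "(\<lambda>x. dd x i * dd x j) \<in> borel_measurable (Leb (I \<times> UNIV))" using ib by measurable
    fix x :: "int \<times> bool \<Rightarrow> real"
    have "\<bar>x (i, b) * x (j, b')\<bar> \<le> G.sq x" for b b' by (intro G.abs_mult_le_sq ib)
    from this[of False False] this[of False True] this[of True False] this[of True True]
    have "\<bar>dd x i * dd x j\<bar> \<le> 4 * G.sq x"
      unfolding left_diff_distrib right_diff_distrib by linarith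
    then show "\<bar>dd x i * dd x j\<bar> \<le> 4 * (1 + G.sq x)" by simp
  qed
qed

text \<open>Jensen is applied under the tilted measure to the factor that removes the tilt; under
  the untilted measure it would bound the ratio from the wrong side. Hence second moments are needed
  for the tilted system too.\<close>

lemma Z2_tilt_le:
  assumes I: "finite I" and \<tau>: "0 \<le> \<tau>" "16 * \<tau> \<le> \<delta>"
  shows "Z2 \<sigma> \<tau> A I \<le> Z2 \<sigma> 0 {} I * exp (\<tau> * c2 * card (I \<inter> A))"
proof -
  interpret G: gibbs "I \<times> UNIV" "Q2 \<tau> A" "\<lambda>_. \<sigma>" V V' "\<delta> / 4" B B1 by (rule gibbs_double[OF I \<tau>])
  interpret G0: gibbs "I \<times> UNIV" "Q2 0 {}" "\<lambda>_. \<sigma>" V V' "\<delta> / 4" B B1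
    using \<delta>_pos by (intro gibbs_double[OF I]) auto
  let ?g = "\<lambda>x. \<Sum>i\<in>I \<inter> A. - \<tau> * (dd x i)\<^sup>2"
  have gi: "integrable (Leb (I \<times> UNIV)) (\<lambda>x. - \<tau> * (dd x i)\<^sup>2 * G.W x)" if "i \<in> I \<inter> A" for i
    using integrable_mult_right[OF integrable_dd[OF I _ _ \<tau>, where \<sigma> = \<sigma> and A = A and i = i and j = i], of "- \<tau>"] that
    by (simp add: power2_eq_square mult.assoc)
  have gint: "integrable (Leb (I \<times> UNIV)) (\<lambda>x. ?g x * G.W x)"
    unfolding sum_distrib_right using gi by (intro Bochner_Integration.integrable_sum)
  have eg: "exp (?g x) * G.W x = G0.W x" for x
    unfolding W2_tilt[OF I \<tau>, where \<sigma> = \<sigma> and A = A] by (simp add: sum_negf sum_distrib_left exp_minus)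
  have "G.Z * exp (G.E ?g) \<le> (\<integral>x. exp (?g x) * G.W x \<partial>Leb (I \<times> UNIV))"
    using G0.integrable_W gint by (intro G.Jensen_exp) (simp_all only: eg)
  then have le: "G.Z * exp (G.E ?g) \<le> G0.Z" by (simp only: eg G0.Z_def)
  have "G.E ?g = (\<Sum>i\<in>I \<inter> A. - \<tau> * G.E (\<lambda>x. (dd x i)\<^sup>2))"
    using gi by (subst G.E_sum) (simp_all only: G.E_cmult)
  also have "\<dots> \<ge> (\<Sum>i\<in>I \<inter> A. - \<tau> * c2)"
    using double_second_moment[OF I _ \<tau>] \<tau> by (intro sum_mono) (auto intro: mult_left_mono)
  finally have "- (\<tau> * c2 * card (I \<inter> A)) \<le> G.E ?g" by (simp add: mult_ac)
  then have "G.Z * exp (- (\<tau> * c2 * card (I \<inter> A))) \<le> G.Z * exp (G.E ?g)"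
    using G.Z_pos by (intro mult_left_mono) auto
  then have "G.Z * exp (- (\<tau> * c2 * card (I \<inter> A))) \<le> G0.Z" using le by linarith
  then show ?thesis by (simp add: exp_minus field_simps)
qed

text \<open>Untilted replicas are independent copies, so the expectation is twice the covariance of
  the spins at i and j. The cuts between i and j turn it into a product of tanh factors of unbounded
  energies, and the tilt converts this product into a deterministic exponential.\<close>

theorem covariance_decay:
  assumes I: "finite I" and ij: "i \<in> I" "j \<in> I" "i \<le> j"
  shows "\<bar>E2 \<sigma> 0 {} I (\<lambda>x. dd x i * dd x j)\<bar> \<le> c2 * exp (- (\<kappa> * nat ((j - i) div spacing)))"
proof -
  interpret G: gibbs "I \<times> UNIV" "Q2 0 {}" "\<lambda>_. \<sigma>" V V' "\<delta> / 4" B B1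
    using \<delta>_pos by (intro gibbs_double[OF I]) auto
  define n where "n = nat ((j - i) div spacing)"
  \<comment> \<open>The first cut is at i itself: an exchange acts on the sites strictly to its
    right, so it keeps i and moves j, which makes the observable odd under every flip.\<close>
  define c where "c m = i + int m * spacing" for m
  define A where "A = (\<Union>m<n. {c m - int R + 1..c m + int R})"
  define \<tau> where "\<tau> = \<kappa> / 4"
  have \<tau>: "0 \<le> \<tau>" "16 * \<tau> \<le> \<delta>" using \<kappa>_pos \<kappa>_le by (auto simp: \<tau>_def)
  interpret T: gibbs "I \<times> UNIV" "Q2 \<tau> A" "\<lambda>_. \<sigma>" V V' "\<delta> / 4" B B1 by (rule gibbs_double[OF I \<tau>])
  let ?L = "Leb (I \<times> (UNIV :: bool set))"
  have c_less: "c m < j" if "m < n" for m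
  proof -
    have "int m < (j - i) div spacing" using that by (simp add: n_def)
    then have "int m + 1 \<le> (j - i) div spacing" by simp
    then have "(int m + 1) * spacing \<le> (j - i) div spacing * spacing"
      by (intro mult_right_mono) (auto simp: spacing_def)
    also have "\<dots> \<le> j - i" using pos_mod_sign[of spacing "j - i"] by (simp add: spacing_def minus_mod_eq_div_mult[symmetric])
    finally show ?thesis by (simp add: c_def distrib_right spacing_def)
  qed
  have c_ge: "i \<le> c m" for m by (simp add: c_def spacing_def)
  have c_sep: "2 * int R + 1 \<le> \<bar>c m - c l\<bar>" if "m \<noteq> l" for m l
  proof -
    have "\<bar>c m - c l\<bar> = \<bar>int m - int l\<bar> * spacing"
      by (simp add: c_def spacing_def left_diff_distrib[symmetric] abs_mult)
    moreover have "1 \<le> \<bar>int m - int l\<bar>" using that by auto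
    moreover have "0 \<le> spacing" by (simp add: spacing_def)
    ultimately have "1 * spacing \<le> \<bar>c m - c l\<bar>" by (simp only: mult_right_mono)
    then show ?thesis by (simp add: spacing_def)
  qed
  have mcut: "cut I c' \<in> borel_measurable ?L" for c'
    unfolding cut_def by measurable
  \<comment> \<open>The Gibbs weight without the energies of the chosen cuts. It is invariant under
    all the exchanges, because each of them reverses exactly one of these energies.\<close>
  define w where "w x = G.W x * exp (\<Sum>m<n. cut I (c m) x)" for x
  have wW: "w x * exp (- (\<Sum>m<n. cut I (c m) x)) = G.W x" for x
    by (simp add: w_def exp_minus)
  let ?f = "\<lambda>x. dd x i * dd x j"
  have ib: "(i, b) \<in> I \<times> UNIV" "(j, b) \<in> I \<times> UNIV" for b using ij by auto
  have fm: "?f \<in> borel_measurable ?L" using ib by measurable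
  have main: "\<bar>\<integral>x. ?f x * w x * exp (- (\<Sum>m<n. cut I (c m) x)) \<partial>?L\<bar>
    \<le> (\<integral>x. \<bar>?f x\<bar> * w x * (\<Prod>m<n. tanh \<bar>cut I (c m) x\<bar>) * exp (- (\<Sum>m<n. cut I (c m) x)) \<partial>?L)"
  proof (rule sign_flip_correlation_bound[where \<Theta> = "\<lambda>m. swap I (c m)"])
    show "cut I (c l) (swap I (c m) x) = (if l = m then - cut I (c l) x else cut I (c l) x)" for l m x
      using c_sep[of l m] cut_swap[of "c l" "c m" I x] by (cases "l = m") auto
    then have "(\<Sum>l<n. cut I (c l) (swap I (c m) x)) = (\<Sum>l<n. cut I (c l) x) - 2 * cut I (c m) x" if "m < n" for m x
    proof -
      have "(\<Sum>l<n. cut I (c l) (swap I (c m) x)) = (\<Sum>l<n. cut I (c l) x - (if l = m then 2 * cut I (c l) x else 0))"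
        using \<open>\<And>x m l. cut I (c l) (swap I (c m) x) = (if l = m then - cut I (c l) x else cut I (c l) x)\<close>
        by (intro sum.cong refl) auto
      then show ?thesis using that by (simp add: sum_subtractf)
    qed
    then show "w (swap I (c m) x) = w x" if "m < n" for m x
      using that unfolding w_def W2_swap[OF I] by (simp add: exp_diff)
    show "?f (swap I (c m) x) = - ?f x" if "m < n" for m x
      using c_ge[of m] c_less[OF that] ij by (simp add: dd_swap algebra_simps)
    show "integrable ?L (\<lambda>x. ?f x * w x * exp (- (\<Sum>m<n. cut I (c m) x)))"
      using integrable_dd[OF I ij(1,2), where \<tau> = 0 and \<sigma> = \<sigma> and A = "{}"] \<delta>_pos by (simp add: mult.assoc wW)
    show "w \<in> borel_measurable ?L" unfolding w_def using mcut by measurable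
    show "0 \<le> w x" for x using G.W_pos[of x] by (simp add: w_def)
  qed (use mcut fm swap_measurable swap_distr[OF I] in auto)
  define \<kappa>' where "\<kappa>' = \<kappa> / 2 * (1 - ln (\<kappa> / 2))"
  \<comment> \<open>The windows have length 2 R and their centres are at least 2 R + 1 apart, so
    they are disjoint and one tilt on their union controls all cut energies at once.\<close>
  have windows: "(\<Sum>m<n. \<bar>cut I (c m) x\<bar>) \<le> 1/4 * (\<Sum>k\<in>I \<inter> A. (dd x k)\<^sup>2)" for x
  proof -
    have "(\<Sum>m<n. \<bar>cut I (c m) x\<bar>) \<le> (\<Sum>m<n. 1/4 * (\<Sum>k\<in>I \<inter> {c m - int R + 1..c m + int R}. (dd x k)\<^sup>2))"
      using cut_le[OF I] by (intro sum_mono)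
    also have "\<dots> = 1/4 * (\<Sum>k\<in>(\<Union>m<n. I \<inter> {c m - int R + 1..c m + int R}). (dd x k)\<^sup>2)"
    proof -
      have "I \<inter> {c m - int R + 1..c m + int R} \<inter> (I \<inter> {c l - int R + 1..c l + int R}) = {}" if "m \<noteq> l" for m l
        using c_sep[OF that] by auto
      then show ?thesis using I by (subst sum.UNION_disjoint) (auto simp: sum_distrib_left)
    qed
    also have "(\<Union>m<n. I \<inter> {c m - int R + 1..c m + int R}) = I \<inter> A" by (auto simp: A_def)
    finally show ?thesis .
  qed
  have card_A: "card (I \<inter> A) \<le> 2 * R * n"
  proof -
    have "card (I \<inter> A) \<le> card A" by (intro card_mono) (auto simp: A_def)
    also have "\<dots> \<le> (\<Sum>m<n. card {c m - int R + 1..c m + int R})" unfolding A_def by (rule card_UN_le) simp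
    also have "\<dots> = 2 * R * n" by (simp add: nat_mult_distrib)
    finally show ?thesis .
  qed
  have "(\<integral>x. \<bar>?f x\<bar> * w x * (\<Prod>m<n. tanh \<bar>cut I (c m) x\<bar>) * exp (- (\<Sum>m<n. cut I (c m) x)) \<partial>?L)
    \<le> (\<integral>x. exp (- (\<kappa>' * n)) * ((1/2 * (dd x i * dd x i) + 1/2 * (dd x j * dd x j)) * T.W x) \<partial>?L)"
  proof (rule integral_mono')
    show "integrable ?L (\<lambda>x. exp (- (\<kappa>' * n)) * ((1/2 * (dd x i * dd x i) + 1/2 * (dd x j * dd x j)) * T.W x))"
    proof -
      have "integrable ?L (\<lambda>x. exp (- (\<kappa>' * n)) * (1/2 * (dd x i * dd x i * T.W x) + 1/2 * (dd x j * dd x j * T.W x)))"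
        using integrable_dd[OF I ij(1,1) \<tau>, where \<sigma> = \<sigma> and A = A] integrable_dd[OF I ij(2,2) \<tau>, where \<sigma> = \<sigma> and A = A]
        by (intro integrable_mult_right Bochner_Integration.integrable_add)
      then show ?thesis by (simp add: algebra_simps)
    qed
    fix x
    \<comment> \<open>The cut energies, multiplied by \<kappa>, are at most \<kappa> / 4 times the
      squared differences over the windows, which is exactly the exponent of the tilted
      weight.\<close>
    have "(\<Prod>m<n. tanh \<bar>cut I (c m) x\<bar>) \<le> (\<Prod>m<n. exp (- \<kappa>' + \<kappa> * \<bar>cut I (c m) x\<bar>))"
      unfolding \<kappa>'_def using \<kappa>_pos by (intro prod_mono conjI tanh_real_le_exp) auto
    also have "\<dots> = exp (- (\<kappa>' * n) + \<kappa> * (\<Sum>m<n. \<bar>cut I (c m) x\<bar>))"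
      by (simp add: exp_sum[symmetric] sum.distrib sum_subtractf sum_distrib_left mult_ac)
    also have "\<dots> \<le> exp (- (\<kappa>' * n) + \<tau> * (\<Sum>k\<in>I \<inter> A. (dd x k)\<^sup>2))"
      using mult_left_mono[OF windows[of x], of \<kappa>] \<kappa>_pos by (simp add: \<tau>_def)
    finally have P: "(\<Prod>m<n. tanh \<bar>cut I (c m) x\<bar>) \<le> exp (- (\<kappa>' * n)) * exp (\<tau> * (\<Sum>k\<in>I \<inter> A. (dd x k)\<^sup>2))"
      by (simp only: exp_add)
    have "\<bar>?f x\<bar> * w x * (\<Prod>m<n. tanh \<bar>cut I (c m) x\<bar>) * exp (- (\<Sum>m<n. cut I (c m) x))
      = \<bar>?f x\<bar> * G.W x * (\<Prod>m<n. tanh \<bar>cut I (c m) x\<bar>)"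
      unfolding wW[symmetric] by (simp add: mult_ac)
    also have "\<dots> \<le> \<bar>?f x\<bar> * G.W x * (exp (- (\<kappa>' * n)) * exp (\<tau> * (\<Sum>k\<in>I \<inter> A. (dd x k)\<^sup>2)))"
      using P G.W_pos[of x] by (intro mult_left_mono) auto
    also have "\<dots> = exp (- (\<kappa>' * n)) * (\<bar>?f x\<bar> * T.W x)"
      unfolding W2_tilt[OF I \<tau>, where \<sigma> = \<sigma> and A = A] by (simp add: mult_ac)
    also have "\<dots> \<le> exp (- (\<kappa>' * n)) * ((1/2 * (dd x i * dd x i) + 1/2 * (dd x j * dd x j)) * T.W x)"
      using T.W_pos[of x] sum_squares_bound[of "\<bar>dd x i\<bar>" "\<bar>dd x j\<bar>"]
      by (intro mult_left_mono mult_right_mono) (auto simp: abs_mult power2_eq_square)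
    finally show "\<bar>?f x\<bar> * w x * (\<Prod>m<n. tanh \<bar>cut I (c m) x\<bar>) * exp (- (\<Sum>m<n. cut I (c m) x))
      \<le> exp (- (\<kappa>' * n)) * ((1/2 * (dd x i * dd x i) + 1/2 * (dd x j * dd x j)) * T.W x)" .
    show "0 \<le> exp (- (\<kappa>' * n)) * ((1/2 * (dd x i * dd x i) + 1/2 * (dd x j * dd x j)) * T.W x)"
      using T.W_pos[of x] by (auto intro!: mult_nonneg_nonneg add_nonneg_nonneg less_imp_le)
  qed
  also have "\<dots> = exp (- (\<kappa>' * n)) * ((1/2 * T.E (\<lambda>x. (dd x i)\<^sup>2) + 1/2 * T.E (\<lambda>x. (dd x j)\<^sup>2)) * T.Z)"
  proof -
    have "(\<integral>x. (1/2 * (dd x i * dd x i) + 1/2 * (dd x j * dd x j)) * T.W x \<partial>?L)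
      = (\<integral>x. 1/2 * (dd x i * dd x i * T.W x) + 1/2 * (dd x j * dd x j * T.W x) \<partial>?L)"
      by (simp add: algebra_simps)
    also have "\<dots> = 1/2 * (\<integral>x. dd x i * dd x i * T.W x \<partial>?L) + 1/2 * (\<integral>x. dd x j * dd x j * T.W x \<partial>?L)"
      using integrable_dd[OF I ij(1,1) \<tau>, where \<sigma> = \<sigma> and A = A] integrable_dd[OF I ij(2,2) \<tau>, where \<sigma> = \<sigma> and A = A]
      by (subst Bochner_Integration.integral_add) auto
    finally have "(\<integral>x. (1/2 * (dd x i * dd x i) + 1/2 * (dd x j * dd x j)) * T.W x \<partial>?L)
      = (1/2 * T.E (\<lambda>x. (dd x i)\<^sup>2) + 1/2 * T.E (\<lambda>x. (dd x j)\<^sup>2)) * T.Z"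
      using T.Z_pos by (simp add: T.E_def power2_eq_square distrib_right)
    then show ?thesis by (simp only: integral_mult_right_zero)
  qed
  also have "\<dots> \<le> exp (- (\<kappa>' * n)) * ((1/2 * c2 + 1/2 * c2) * (G.Z * exp (\<tau> * c2 * card (I \<inter> A))))"
  proof (intro mult_left_mono mult_mono add_mono)
    show "T.E (\<lambda>x. (dd x i)\<^sup>2) \<le> c2" "T.E (\<lambda>x. (dd x j)\<^sup>2) \<le> c2"
      using double_second_moment[OF I _ \<tau>] ij by auto
    show "T.Z \<le> G.Z * exp (\<tau> * c2 * card (I \<inter> A))" by (rule Z2_tilt_le[OF I \<tau>])
  qed (use c2_pos T.Z_pos in auto)
  also have "\<dots> \<le> G.Z * (c2 * exp (- (\<kappa> * n)))"
  proof -
    have "\<tau> * c2 * card (I \<inter> A) \<le> \<tau> * c2 * (2 * R * n)"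
      using card_A \<tau>(1) c2_pos by (intro mult_left_mono) (auto simp flip: of_nat_mult)
    also have "\<dots> = \<kappa> * c2 * real R / 2 * n" by (simp add: \<tau>_def)
    also have "\<dots> \<le> (\<kappa>' - \<kappa>) * n" using \<kappa>_gain by (intro mult_right_mono) (auto simp: \<kappa>'_def)
    finally have "exp (- (\<kappa>' * n)) * exp (\<tau> * c2 * card (I \<inter> A)) \<le> exp (- (\<kappa> * n))"
      by (simp add: exp_add[symmetric] algebra_simps)
    then have "(c2 * G.Z) * (exp (- (\<kappa>' * n)) * exp (\<tau> * c2 * card (I \<inter> A))) \<le> (c2 * G.Z) * exp (- (\<kappa> * n))"
      using c2_pos G.Z_pos by (intro mult_left_mono) auto
    then show ?thesis by (simp add: mult_ac)
  qed
  finally have "(\<integral>x. \<bar>?f x\<bar> * w x * (\<Prod>m<n. tanh \<bar>cut I (c m) x\<bar>) * exp (- (\<Sum>m<n. cut I (c m) x)) \<partial>?L)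
    \<le> G.Z * (c2 * exp (- (\<kappa> * n)))" .
  with main have "\<bar>\<integral>x. ?f x * G.W x \<partial>?L\<bar> \<le> G.Z * (c2 * exp (- (\<kappa> * n)))" by (simp add: mult.assoc wW)
  then show ?thesis
    using G.Z_pos unfolding G.E_def n_def by (simp add: abs_div divide_le_eq mult.commute)
qed

end

text \<open>Each value of the quotient of the distance by q is taken by at most 2 q sites, q on
  either side.\<close>

lemma sum_geometric_distance_le:
  fixes \<rho> :: real and q i :: int
  assumes "finite I" "0 \<le> \<rho>" "\<rho> < 1" "0 < q"
  shows "(\<Sum>j\<in>I. \<rho> ^ nat (\<bar>j - i\<bar> div q)) \<le> 2 * real_of_int q / (1 - \<rho>)"
proof -
  let ?g = "\<lambda>j. nat (\<bar>j - i\<bar> div q)"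
  have card: "card {j \<in> I. ?g j = k} \<le> 2 * nat q" for k
  proof -
    have "{j \<in> I. ?g j = k} \<subseteq> {i + int k * q..<i + int k * q + q} \<union> {i - int k * q - q<..i - int k * q}"
    proof
      fix j assume "j \<in> {j \<in> I. ?g j = k}"
      then have "\<bar>j - i\<bar> div q = int k" using assms(4) by (auto simp: pos_imp_zdiv_nonneg_iff)
      then have "\<bar>j - i\<bar> = int k * q + \<bar>j - i\<bar> mod q" using div_mult_mod_eq[of "\<bar>j - i\<bar>" q] by simp
      moreover have "0 \<le> \<bar>j - i\<bar> mod q" "\<bar>j - i\<bar> mod q < q" using assms(4) by auto
      ultimately have "int k * q \<le> \<bar>j - i\<bar>" "\<bar>j - i\<bar> < int k * q + q" by linarith+
      then show "j \<in> {i + int k * q..<i + int k * q + q} \<union> {i - int k * q - q<..i - int k * q}"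
        by (cases "i \<le> j") auto
    qed
    then have "card {j \<in> I. ?g j = k} \<le> card ({i + int k * q..<i + int k * q + q} \<union> {i - int k * q - q<..i - int k * q})"
      by (intro card_mono) auto
    also have "\<dots> \<le> card {i + int k * q..<i + int k * q + q} + card {i - int k * q - q<..i - int k * q}"
      by (rule card_Un_le)
    finally show ?thesis by simp
  qed
  have "(\<Sum>j\<in>I. \<rho> ^ ?g j) = (\<Sum>k\<in>?g ` I. \<Sum>j\<in>{j \<in> I. ?g j = k}. \<rho> ^ ?g j)"
    using assms(1) by (rule sum.image_gen)
  also have "\<dots> = (\<Sum>k\<in>?g ` I. real (card {j \<in> I. ?g j = k}) * \<rho> ^ k)"
    by (intro sum.cong refl) simp
  also have "\<dots> \<le> (\<Sum>k\<in>?g ` I. 2 * real_of_int q * \<rho> ^ k)"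
  proof (intro sum_mono mult_right_mono)
    fix k
    have "real (card {j \<in> I. ?g j = k}) \<le> real (2 * nat q)" using card by (simp only: of_nat_le_iff)
    also have "\<dots> = 2 * real_of_int q" using assms(4) by simp
    finally show "real (card {j \<in> I. ?g j = k}) \<le> 2 * real_of_int q" .
  qed (use assms in auto)
  also have "\<dots> \<le> (\<Sum>k. 2 * real_of_int q * \<rho> ^ k)"
    using assms by (intro sum_le_suminf summable_mult summable_geometric) auto
  also have "\<dots> = 2 * real_of_int q / (1 - \<rho>)"
    using assms by (subst suminf_mult) (auto simp: suminf_geometric summable_geometric)
  finally show ?thesis .
qed

context chain
begin

section \<open>Variance of the total spin\<close>

abbreviation replica :: "int set \<Rightarrow> bool \<Rightarrow> (int \<times> bool \<Rightarrow> real) \<Rightarrow> int \<Rightarrow> real" where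
  "replica I b x \<equiv> (\<lambda>i\<in>I. x (i, b))"

lemma W2_replica:
  assumes I: "finite I"
  shows "W2 \<sigma> 0 {} I x = W1 \<sigma> I (replica I False x) * W1 \<sigma> I (replica I True x)"
proof -
  interpret G: gibbs I "coupling R h" "\<lambda>_. \<sigma>" V V' "\<delta> / 2" B B1 by (rule gibbs_single[OF I])
  interpret G2: gibbs "I \<times> UNIV" "Q2 0 {}" "\<lambda>_. \<sigma>" V V' "\<delta> / 4" B B1
    using \<delta>_pos by (intro gibbs_double[OF I]) auto
  have r: "G.H (replica I b x) = 1/2 * (\<Sum>i\<in>I. \<Sum>j\<in>I. coupling R h i j * x (i, b) * x (j, b))
      + (\<Sum>i\<in>I. V (x (i, b))) - (\<Sum>i\<in>I. \<sigma> * x (i, b))" for b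
    unfolding G.H_def by (simp cong: sum.cong)
  have "G2.H x = G.H (replica I False x) + G.H (replica I True x)"
    unfolding r using H2_eq[OF I, of 0 "{}" \<sigma> x] \<delta>_pos
    by (simp add: distrib_left sum.distrib mult.assoc)
  then show ?thesis by (simp add: G.W_def G2.W_def exp_add[symmetric])
qed

lemma replica_product:
  fixes f g :: "(int \<Rightarrow> real) \<Rightarrow> real"
  assumes I: "finite I"
    and f: "integrable (Leb I) (\<lambda>x. f x * W1 \<sigma> I x)" and g: "integrable (Leb I) (\<lambda>x. g x * W1 \<sigma> I x)"
  shows "integrable (Leb (I \<times> UNIV)) (\<lambda>x. f (replica I False x) * g (replica I True x) * W2 \<sigma> 0 {} I x)"
    and "(\<integral>x. f (replica I False x) * g (replica I True x) * W2 \<sigma> 0 {} I x \<partial>Leb (I \<times> UNIV))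
      = (\<integral>x. f x * W1 \<sigma> I x \<partial>Leb I) * (\<integral>x. g x * W1 \<sigma> I x \<partial>Leb I)"
proof -
  have bij: "bij_betw (\<lambda>i. (i, b)) I (I \<times> {b})" for b :: bool
    by (auto simp: bij_betw_def inj_on_def)
  have un: "I \<times> UNIV = (I \<times> {False}) \<union> (I \<times> {True})" by (auto simp: UNIV_bool)
  let ?f = "\<lambda>x. f x * W1 \<sigma> I x" and ?g = "\<lambda>x. g x * W1 \<sigma> I x"
  have fin: "finite (I \<times> {b})" for b :: bool using I by simp
  note F = integrable_Leb_reindex[OF fin bij f, of False] integral_Leb_reindex[OF fin bij borel_measurable_integrable[OF f], of False]
  note G = integrable_Leb_reindex[OF fin bij g, of True] integral_Leb_reindex[OF fin bij borel_measurable_integrable[OF g], of True]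
  have eq: "(\<lambda>x. ?f (replica I False (restrict x (I \<times> {False}))) * ?g (replica I True (restrict x (I \<times> {True}))))
    = (\<lambda>x. f (replica I False x) * g (replica I True x) * W2 \<sigma> 0 {} I x)"
  proof
    fix x :: "int \<times> bool \<Rightarrow> real"
    have "replica I b (restrict x (I \<times> {b})) = replica I b x" for b by (auto simp: fun_eq_iff)
    then show "?f (replica I False (restrict x (I \<times> {False}))) * ?g (replica I True (restrict x (I \<times> {True})))
      = f (replica I False x) * g (replica I True x) * W2 \<sigma> 0 {} I x"
      by (simp add: W2_replica[OF I] mult_ac)
  qed
  have dis: "(I \<times> {False}) \<inter> (I \<times> {True}) = {}" by auto
  show "integrable (Leb (I \<times> UNIV)) (\<lambda>x. f (replica I False x) * g (replica I True x) * W2 \<sigma> 0 {} I x)"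
    using integral_Leb_Un_product(1)[OF fin fin dis F(1) G(1)] unfolding eq un[symmetric] .
  show "(\<integral>x. f (replica I False x) * g (replica I True x) * W2 \<sigma> 0 {} I x \<partial>Leb (I \<times> UNIV))
      = (\<integral>x. f x * W1 \<sigma> I x \<partial>Leb I) * (\<integral>x. g x * W1 \<sigma> I x \<partial>Leb I)"
    using integral_Leb_Un_product(2)[OF fin fin dis F(1) G(1)] unfolding eq un[symmetric] F(2) G(2) .
qed

lemma integrable_S_sq:
  assumes I: "finite I"
  shows "integrable (Leb I) (\<lambda>x. (\<Sum>i\<in>I. x i)\<^sup>2 * W1 \<sigma> I x)" "integrable (Leb I) (\<lambda>x. (\<Sum>i\<in>I. x i) * W1 \<sigma> I x)"
proof -
  interpret G: gibbs I "coupling R h" "\<lambda>_. \<sigma>" V V' "\<delta> / 2" B B1 by (rule gibbs_single[OF I])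
  have sq: "(\<Sum>i\<in>I. x i)\<^sup>2 \<le> real (card I) * G.sq x" for x
    using sum_squared_le_sum_of_squares[of x I] I by (simp add: mult.commute)
  show "integrable (Leb I) (\<lambda>x. (\<Sum>i\<in>I. x i)\<^sup>2 * G.W x)"
  proof (rule G.integrable_W_quadratic[of _ "real (card I)"])
    show "\<bar>(\<Sum>i\<in>I. x i)\<^sup>2\<bar> \<le> real (card I) * (1 + G.sq x)" for x
      using sq[of x] by (simp add: distrib_left)
  qed measurable
  show "integrable (Leb I) (\<lambda>x. (\<Sum>i\<in>I. x i) * G.W x)"
  proof (rule G.integrable_W_quadratic[of _ "1 + real (card I)"])
    show "\<bar>\<Sum>i\<in>I. x i\<bar> \<le> (1 + real (card I)) * (1 + G.sq x)" for x
    proof -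
      have "\<bar>\<Sum>i\<in>I. x i\<bar> \<le> 1 + (\<Sum>i\<in>I. x i)\<^sup>2"
        using sum_squares_bound[of 1 "\<bar>\<Sum>i\<in>I. x i\<bar>"] zero_le_power2[of "\<Sum>i\<in>I. x i"] by simp
      also have "\<dots> \<le> 1 + real (card I) * G.sq x" using sq[of x] by simp
      also have "\<dots> \<le> (1 + real (card I)) * (1 + G.sq x)"
        using G.sq_nonneg[of x] by (simp add: algebra_simps)
      finally show ?thesis .
    qed
  qed measurable
qed

definition "cv = c2 * real_of_int spacing / (1 - exp (- \<kappa>))"

text \<open>The variance is half the second moment of the difference of two independent copies, so
  it is half the sum of the replica correlations; their decay makes each row summable with a bound
  uniform in the field and the size.\<close>

theorem variance_sum_le:
  assumes I: "finite I"
  shows "E1 \<sigma> I (\<lambda>x. ((\<Sum>i\<in>I. x i) - E1 \<sigma> I (\<lambda>x. \<Sum>i\<in>I. x i))\<^sup>2) \<le> cv * card I"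
proof -
  interpret G: gibbs I "coupling R h" "\<lambda>_. \<sigma>" V V' "\<delta> / 2" B B1 by (rule gibbs_single[OF I])
  interpret G2: gibbs "I \<times> UNIV" "Q2 0 {}" "\<lambda>_. \<sigma>" V V' "\<delta> / 4" B B1
    using \<delta>_pos by (intro gibbs_double[OF I]) auto
  let ?S = "\<lambda>x. \<Sum>i\<in>I. x i :: real" and ?L = "Leb (I \<times> (UNIV :: bool set))"
  note S2 = integrable_S_sq(1)[OF I, of \<sigma>] and S1 = integrable_S_sq(2)[OF I, of \<sigma>]
  have one: "integrable (Leb I) (\<lambda>x. 1 * G.W x)" using G.integrable_W by simp
  have Z: "G2.Z = G.Z * G.Z"
    using replica_product(2)[OF I one one] by (simp add: G.Z_def G2.Z_def)
  have dd: "(\<Sum>i\<in>I. dd x i) = ?S (replica I False x) - ?S (replica I True x)" for x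
    by (simp add: sum_subtractf)
  note P1 = replica_product[OF I S2 one] and P2 = replica_product[OF I S1 S1] and P3 = replica_product[OF I one S2]
  have "(\<lambda>x. (\<Sum>i\<in>I. dd x i)\<^sup>2 * G2.W x)
    = (\<lambda>x. (?S (replica I False x))\<^sup>2 * 1 * G2.W x - 2 * (?S (replica I False x) * ?S (replica I True x) * G2.W x)
        + 1 * (?S (replica I True x))\<^sup>2 * G2.W x)"
    unfolding dd by (auto simp: power2_eq_square algebra_simps)
  then have "(\<integral>x. (\<Sum>i\<in>I. dd x i)\<^sup>2 * G2.W x \<partial>?L)
    = (\<integral>x. (?S x)\<^sup>2 * G.W x \<partial>Leb I) * G.Z - 2 * (\<integral>x. ?S x * G.W x \<partial>Leb I)\<^sup>2 + G.Z * (\<integral>x. (?S x)\<^sup>2 * G.W x \<partial>Leb I)"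
    using P1 P2 P3 by (simp add: G.Z_def power2_eq_square)
  then have "G2.E (\<lambda>x. (\<Sum>i\<in>I. dd x i)\<^sup>2) = 2 * (G.E (\<lambda>x. (?S x)\<^sup>2) - (G.E ?S)\<^sup>2)"
    using G.Z_pos unfolding G2.E_def G.E_def Z by (simp add: field_simps power2_eq_square)
  moreover have "G.E (\<lambda>x. (?S x - G.E ?S)\<^sup>2) = G.E (\<lambda>x. (?S x)\<^sup>2) - (G.E ?S)\<^sup>2"
  proof -
    have "(\<lambda>x. (?S x - G.E ?S)\<^sup>2) = (\<lambda>x. ((?S x)\<^sup>2 - 2 * G.E ?S * ?S x) + (G.E ?S)\<^sup>2)"
      by (auto simp: power2_diff)
    moreover have i1: "integrable (Leb I) (\<lambda>x. (2 * G.E ?S * ?S x) * G.W x)"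
      using S1 by (simp add: mult.assoc)
    moreover have "integrable (Leb I) (\<lambda>x. ((?S x)\<^sup>2 - 2 * G.E ?S * ?S x) * G.W x)"
      using Bochner_Integration.integrable_diff[OF S2 i1] by (simp add: left_diff_distrib)
    moreover have "integrable (Leb I) (\<lambda>x. (G.E ?S)\<^sup>2 * G.W x)" using G.integrable_W by simp
    ultimately have "G.E (\<lambda>x. (?S x - G.E ?S)\<^sup>2) = G.E (\<lambda>x. (?S x)\<^sup>2) - 2 * G.E ?S * G.E ?S + (G.E ?S)\<^sup>2"
      using S2 by (simp only: G.E_add G.E_diff G.E_cmult G.E_const)
    then show ?thesis by (simp add: power2_eq_square)
  qed
  moreover have "G2.E (\<lambda>x. (\<Sum>i\<in>I. dd x i)\<^sup>2) \<le> 2 * (cv * card I)"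
  proof -
    let ?\<rho> = "exp (- \<kappa>)"
    have int: "integrable ?L (\<lambda>x. dd x i * dd x j * G2.W x)" if "i \<in> I" "j \<in> I" for i j
      using integrable_dd[OF I that, of 0] \<delta>_pos by simp
    have int': "integrable ?L (\<lambda>x. (\<Sum>j\<in>I. dd x i * dd x j) * G2.W x)" if "i \<in> I" for i
      unfolding sum_distrib_right using int that by (intro Bochner_Integration.integrable_sum)
    have "G2.E (\<lambda>x. (\<Sum>i\<in>I. dd x i)\<^sup>2) = G2.E (\<lambda>x. \<Sum>i\<in>I. \<Sum>j\<in>I. dd x i * dd x j)"
      by (simp add: power2_eq_square sum_product)
    also have "\<dots> = (\<Sum>i\<in>I. G2.E (\<lambda>x. \<Sum>j\<in>I. dd x i * dd x j))"
      using int' by (intro G2.E_sum)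
    also have "\<dots> = (\<Sum>i\<in>I. \<Sum>j\<in>I. G2.E (\<lambda>x. dd x i * dd x j))"
      using int by (intro sum.cong refl G2.E_sum)
    also have "\<dots> \<le> (\<Sum>i\<in>I. \<Sum>j\<in>I. c2 * ?\<rho> ^ nat (\<bar>j - i\<bar> div spacing))"
    proof (intro sum_mono)
      fix i j assume ij: "i \<in> I" "j \<in> I"
      have e: "exp (- (\<kappa> * real n)) = ?\<rho> ^ n" for n by (simp add: exp_of_nat_mult[symmetric] mult.commute)
      show "G2.E (\<lambda>x. dd x i * dd x j) \<le> c2 * ?\<rho> ^ nat (\<bar>j - i\<bar> div spacing)"
      proof (cases "i \<le> j")
        case True
        then show ?thesis using covariance_decay[OF I ij, of \<sigma>] by (simp only: e) simp
      next
        case False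
        then show ?thesis using covariance_decay[OF I ij(2,1), of \<sigma>] by (simp only: e mult.commute[of "dd _ i"]) simp
      qed
    qed
    also have "\<dots> \<le> (\<Sum>i\<in>I. c2 * (2 * real_of_int spacing / (1 - ?\<rho>)))"
      unfolding sum_distrib_left[symmetric] using c2_pos \<kappa>_pos
      by (intro mult_left_mono sum_mono sum_geometric_distance_le I) (auto simp: spacing_def)
    also have "\<dots> = 2 * (cv * card I)" by (simp add: cv_def)
    finally show ?thesis .
  qed
  ultimately show ?thesis by simp
qed

end

section \<open>Free energy\<close>

text \<open>Comparing a (m n) with m a(n) and with n a(m) shows that a(n) / n is Cauchy with error K
  / n + K / m. Letting m tend to infinity leaves the error K, without growth in n.\<close>

lemma almost_additive_limit:
  fixes a :: "nat \<Rightarrow> real"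
  assumes add: "\<And>m n. \<bar>a (m + n) - a m - a n\<bar> \<le> K"
  shows "\<exists>L. \<forall>n. \<bar>a n - real n * L\<bar> \<le> K"
proof -
  have K0: "0 \<le> K" using add[of 0 0] by linarith
  have mult: "\<bar>a (Suc k * n) - real (Suc k) * a n\<bar> \<le> real k * K" for k n
  proof (induction k)
    case (Suc k)
    have nat: "Suc (Suc k) * n = n + Suc k * n" by simp
    have real: "real (Suc (Suc k)) * a n = a n + real (Suc k) * a n" by (simp add: distrib_right)
    have eq: "a (Suc (Suc k) * n) - real (Suc (Suc k)) * a n
       = (a (n + Suc k * n) - a n - a (Suc k * n)) + (a (Suc k * n) - real (Suc k) * a n)"
      unfolding nat real by simp
    have "real (Suc k) * K = K + real k * K" by (simp add: distrib_right)
    then show ?case unfolding eq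
      by (simp only:) (intro order_trans[OF abs_triangle_ineq] add_mono add Suc.IH)
  qed simp
  have mult': "\<bar>a (m * n) - real m * a n\<bar> \<le> real m * K" if m: "0 < m" for m n
  proof -
    obtain k where mk: "m = Suc k" using gr0_implies_Suc[OF m] by blast
    have "real k * K \<le> real (Suc k) * K" using K0 by (intro mult_right_mono) auto
    then show ?thesis unfolding mk by (rule order_trans[OF mult])
  qed
  have diff: "\<bar>a n / real n - a m / real m\<bar> \<le> K / real n + K / real m" if "0 < m" "0 < n" for m n
  proof -
    have "\<bar>real m * a n - real n * a m\<bar> \<le> real m * K + real n * K"
      using mult'[OF that(1), of n] mult'[OF that(2), of m] by (simp add: mult.commute[of n m])
    moreover have "a n / real n - a m / real m = (real m * a n - real n * a m) / (real m * real n)"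
      using that by (simp add: field_simps)
    moreover have "K / real n + K / real m = (real m * K + real n * K) / (real m * real n)"
      using that by (simp add: field_simps)
    ultimately show ?thesis using that by (simp add: abs_divide divide_right_mono)
  qed
  have "Cauchy (\<lambda>n. a n / real n)"
  proof (rule metric_CauchyI)
    fix e :: real assume "0 < e"
    obtain N :: nat where N: "2 * K / e < real N" using reals_Archimedean2 by blast
    have "0 \<le> 2 * K / e" using K0 \<open>0 < e\<close> by simp
    then have N0: "0 < real N" using N by linarith
    have small: "K / real n < e / 2" if "N \<le> n" for n
    proof -
      have "2 * K / e < real n" using N that by linarith
      then show ?thesis using \<open>0 < e\<close> N0 that by (simp add: field_simps)
    qed
    show "\<exists>N. \<forall>m\<ge>N. \<forall>n\<ge>N. dist (a m / real m) (a n / real n) < e"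
    proof (intro exI allI impI)
      fix m n assume mn: "N \<le> m" "N \<le> n"
      then have "0 < m" "0 < n" using N0 by auto
      from diff[OF this(2,1)] small[OF mn(1)] small[OF mn(2)]
      show "dist (a m / real m) (a n / real n) < e" unfolding dist_real_def by linarith
    qed
  qed
  then obtain L where L: "(\<lambda>n. a n / real n) \<longlonglongrightarrow> L" using Cauchy_convergent convergent_def by blast
  have "\<bar>a n - real n * L\<bar> \<le> K" for n
  proof (cases "n = 0")
    case True
    then show ?thesis using add[of 0 0] by simp
  next
    case False
    have "\<bar>a n / real n - L\<bar> \<le> K / real n + 0"
    proof (rule LIMSEQ_le)
      show "(\<lambda>m. \<bar>a n / real n - a m / real m\<bar>) \<longlonglongrightarrow> \<bar>a n / real n - L\<bar>" by (intro tendsto_intros L)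
      show "(\<lambda>m. K / real n + K / real m) \<longlonglongrightarrow> K / real n + 0" by (intro tendsto_intros lim_const_over_n)
      show "\<exists>N. \<forall>m\<ge>N. \<bar>a n / real n - a m / real m\<bar> \<le> K / real n + K / real m"
        using diff False by (intro exI[of _ 1]) auto
    qed
    then have "real n * \<bar>a n / real n - L\<bar> \<le> real n * (K / real n)" by (intro mult_left_mono) auto
    moreover have "real n * \<bar>a n / real n - L\<bar> = \<bar>real n * (a n / real n - L)\<bar>" by (simp add: abs_mult)
    ultimately show ?thesis using False by (simp add: right_diff_distrib)
  qed
  then show ?thesis by blast
qed

context chain
begin

definition "m2 \<sigma> = c1 + 4 / \<delta>\<^sup>2 * \<sigma>\<^sup>2"

section \<open>Splitting a chain into two blocks\<close>

lemma H1_eq: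
  assumes "finite I"
  shows "gibbs.H I (coupling R h) (\<lambda>_. \<sigma>) V x
    = 1/2 * (\<Sum>i\<in>I. (x i)\<^sup>2) + 1/2 * (\<Sum>i\<in>I. \<Sum>j\<in>I. J i j * x i * x j) + (\<Sum>i\<in>I. V (x i)) - \<sigma> * (\<Sum>i\<in>I. x i)"
proof -
  interpret G: gibbs I "coupling R h" "\<lambda>_. \<sigma>" V V' "\<delta> / 2" B B1 by (rule gibbs_single[OF assms])
  show ?thesis unfolding G.H_def coupling_quadratic[OF assms] by (simp add: sum_distrib_left distrib_left)
qed

lemma W1_cong:
  assumes "finite I" "\<And>i. i \<in> I \<Longrightarrow> x i = y i"
  shows "W1 \<sigma> I x = W1 \<sigma> I y"
proof -
  interpret G: gibbs I "coupling R h" "\<lambda>_. \<sigma>" V V' "\<delta> / 2" B B1 by (rule gibbs_single[OF assms(1)])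
  show ?thesis unfolding G.W_def H1_eq[OF assms(1)] using assms(2) by (simp cong: sum.cong)
qed

lemma W1_tilt:
  assumes "finite I"
  shows "W1 \<sigma>' I x = exp ((\<sigma>' - \<sigma>) * (\<Sum>i\<in>I. x i)) * W1 \<sigma> I x"
proof -
  interpret G: gibbs I "coupling R h" "\<lambda>_. \<sigma>" V V' "\<delta> / 2" B B1 by (rule gibbs_single[OF assms])
  interpret G': gibbs I "coupling R h" "\<lambda>_. \<sigma>'" V V' "\<delta> / 2" B B1 by (rule gibbs_single[OF assms])
  show ?thesis unfolding G.W_def G'.W_def H1_eq[OF assms] by (simp add: exp_add[symmetric] algebra_simps)
qed

lemma Z1_pos: "finite I \<Longrightarrow> 0 < Z1 \<sigma> I"
  by (rule gibbs.Z_pos[OF gibbs_single])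

lemma Z1_reindex:
  assumes I: "finite I" and bij: "bij_betw \<pi> K I"
    and eq: "\<And>i j. coupling R h (\<pi> i) (\<pi> j) = coupling R h i j"
  shows "Z1 \<sigma> I = Z1 \<sigma> K"
proof -
  have K: "finite K" using I bij by (simp add: bij_betw_finite)
  interpret GI: gibbs I "coupling R h" "\<lambda>_. \<sigma>" V V' "\<delta> / 2" B B1 by (rule gibbs_single[OF I])
  interpret GK: gibbs K "coupling R h" "\<lambda>_. \<sigma>" V V' "\<delta> / 2" B B1 by (rule gibbs_single[OF K])
  have re: "(\<Sum>i\<in>I. f i) = (\<Sum>j\<in>K. f (\<pi> j))" for f :: "int \<Rightarrow> real"
    using sum.reindex_bij_betw[OF bij, of f] by simp
  have "GI.H x = GK.H (\<lambda>j\<in>K. x (\<pi> j))" for x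
    unfolding GI.H_def GK.H_def re by (simp add: eq cong: sum.cong)
  then have "GI.W = (\<lambda>x. GK.W (\<lambda>j\<in>K. x (\<pi> j)))" by (simp add: GI.W_def GK.W_def fun_eq_iff)
  then show ?thesis
    unfolding GI.Z_def GK.Z_def using integral_Leb_reindex[OF I bij GK.W_measurable] by (simp only:)
qed

lemma Z1_shift: "Z1 \<sigma> {k + 1..k + int M} = Z1 \<sigma> {1..int M}"
proof (rule Z1_reindex)
  show "bij_betw (\<lambda>j. j + k) {1..int M} {k + 1..k + int M}"
    by (rule bij_betw_byWitness[where f' = "\<lambda>j. j - k"]) auto
qed (auto simp: coupling_def)

lemma single_cross_moment:
  assumes I: "finite I" and ij: "i \<in> I" "j \<in> I"
  shows "integrable (Leb I) (\<lambda>x. x i * x j * W1 \<sigma> I x)" "\<bar>E1 \<sigma> I (\<lambda>x. x i * x j)\<bar> \<le> m2 \<sigma>"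
proof -
  interpret G: gibbs I "coupling R h" "\<lambda>_. \<sigma>" V V' "\<delta> / 2" B B1 by (rule gibbs_single[OF I])
  have int: "integrable (Leb I) (\<lambda>x. x i * x j * G.W x)" if "i \<in> I" "j \<in> I" for i j
  proof (rule G.integrable_W_quadratic[of _ 1])
    show "(\<lambda>x. x i * x j) \<in> borel_measurable (Leb I)" using that by measurable
    show "\<bar>x i * x j\<bar> \<le> 1 * (1 + G.sq x)" for x using G.abs_mult_le_sq[OF that, of x] by simp
  qed
  show "integrable (Leb I) (\<lambda>x. x i * x j * G.W x)" using int ij by blast
  have sq: "integrable (Leb I) (\<lambda>x. c / 2 * (x i)\<^sup>2 * G.W x)" if "i \<in> I" for i c
    using integrable_mult_right[OF int[OF that that], of "c / 2"] by (simp add: power2_eq_square mult_ac)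
  have sq2: "integrable (Leb I) (\<lambda>x. (c / 2 * (x i)\<^sup>2 + c / 2 * (x j)\<^sup>2) * G.W x)" for c
    unfolding distrib_right using sq ij by (intro Bochner_Integration.integrable_add)
  have E: "G.E (\<lambda>x. c / 2 * (x i)\<^sup>2 + c / 2 * (x j)\<^sup>2) = c / 2 * G.E (\<lambda>x. (x i)\<^sup>2) + c / 2 * G.E (\<lambda>x. (x j)\<^sup>2)" for c
    using G.E_add[OF sq[OF ij(1)] sq[OF ij(2)], of c c] by (simp only: G.E_cmult)
  have b: "\<bar>u * v\<bar> \<le> u\<^sup>2 / 2 + v\<^sup>2 / 2" for u v :: real
    using sum_squares_bound[of "\<bar>u\<bar>" "\<bar>v\<bar>"] by (simp add: abs_mult)
  have "G.E (\<lambda>x. x i * x j) \<le> G.E (\<lambda>x. 1 / 2 * (x i)\<^sup>2 + 1 / 2 * (x j)\<^sup>2)"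
    using b by (intro G.E_mono int ij sq2) (auto simp: abs_le_iff)
  moreover have "G.E (\<lambda>x. (-1) / 2 * (x i)\<^sup>2 + (-1) / 2 * (x j)\<^sup>2) \<le> G.E (\<lambda>x. x i * x j)"
  proof (intro G.E_mono int ij sq2)
    fix x :: "int \<Rightarrow> real"
    show "(-1) / 2 * (x i)\<^sup>2 + (-1) / 2 * (x j)\<^sup>2 \<le> x i * x j" using b[of "x i" "x j"] by (simp add: abs_le_iff)
  qed
  ultimately show "\<bar>G.E (\<lambda>x. x i * x j)\<bar> \<le> m2 \<sigma>"
    unfolding E using single_second_moment[OF I ij(1), of \<sigma>] single_second_moment[OF I ij(2), of \<sigma>] by (simp add: m2_def)
qed

lemma single_mean:
  assumes I: "finite I" and i: "i \<in> I"
  shows "integrable (Leb I) (\<lambda>x. x i * W1 \<sigma> I x)" "(E1 \<sigma> I (\<lambda>x. x i))\<^sup>2 \<le> m2 \<sigma>"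
proof -
  interpret G: gibbs I "coupling R h" "\<lambda>_. \<sigma>" V V' "\<delta> / 2" B B1 by (rule gibbs_single[OF I])
  show int: "integrable (Leb I) (\<lambda>x. x i * G.W x)"
  proof (rule G.integrable_W_quadratic[of _ 1])
    show "(\<lambda>x. x i) \<in> borel_measurable (Leb I)" using i by measurable
    show "\<bar>x i\<bar> \<le> 1 * (1 + G.sq x)" for x using G.abs_le_sq[OF i, of x] by simp
  qed
  let ?e = "G.E (\<lambda>x. x i)"
  have int2: "integrable (Leb I) (\<lambda>x. (x i)\<^sup>2 * G.W x)"
    using single_cross_moment(1)[OF I i i, of \<sigma>] by (simp add: power2_eq_square)
  have i1: "integrable (Leb I) (\<lambda>x. 2 * ?e * x i * G.W x)" using int by (simp add: mult.assoc)
  have i0: "integrable (Leb I) (\<lambda>x. - (?e\<^sup>2) * G.W x)" using G.integrable_W by simp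
  have i01: "integrable (Leb I) (\<lambda>x. (2 * ?e * x i + - (?e\<^sup>2)) * G.W x)"
    unfolding distrib_right using i1 i0 by (intro Bochner_Integration.integrable_add)
  have "G.E (\<lambda>x. 2 * ?e * x i + - (?e\<^sup>2)) \<le> G.E (\<lambda>x. (x i)\<^sup>2)"
  proof (rule G.E_mono[OF i01 int2])
    show "2 * ?e * x i + - (?e\<^sup>2) \<le> (x i)\<^sup>2" for x
      using zero_le_power2[of "x i - ?e"] by (simp add: power2_diff mult_ac)
  qed
  also have "G.E (\<lambda>x. 2 * ?e * x i + - (?e\<^sup>2)) = 2 * ?e * ?e + - (?e\<^sup>2)"
    using G.E_add[OF i1 i0] by (simp only: G.E_cmult G.E_const)
  finally show "?e\<^sup>2 \<le> m2 \<sigma>"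
    using single_second_moment[OF I i, of \<sigma>] by (simp add: m2_def power2_eq_square)
qed

definition cross :: "int set \<Rightarrow> int set \<Rightarrow> (int \<Rightarrow> real) \<Rightarrow> real" where
  "cross I K x = (\<Sum>i\<in>I. \<Sum>j\<in>K. J i j * (x i * x j))"

lemma W1_Un:
  assumes I: "finite I" "finite K" "I \<inter> K = {}"
  shows "W1 \<sigma> (I \<union> K) x = exp (- cross I K x) * (W1 \<sigma> I (restrict x I) * W1 \<sigma> K (restrict x K))"
proof -
  interpret GI: gibbs I "coupling R h" "\<lambda>_. \<sigma>" V V' "\<delta> / 2" B B1 by (rule gibbs_single[OF I(1)])
  interpret GK: gibbs K "coupling R h" "\<lambda>_. \<sigma>" V V' "\<delta> / 2" B B1 by (rule gibbs_single[OF I(2)])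
  interpret GU: gibbs "I \<union> K" "coupling R h" "\<lambda>_. \<sigma>" V V' "\<delta> / 2" B B1 by (rule gibbs_single) (use I in auto)
  have fin: "finite (I \<union> K)" using I by simp
  have sw: "(\<Sum>i\<in>K. \<Sum>j\<in>I. J i j * x i * x j) = (\<Sum>i\<in>I. \<Sum>j\<in>K. J i j * x i * x j)"
    by (subst sum.swap) (simp add: J_sym mult_ac)
  have "(\<Sum>i\<in>I \<union> K. \<Sum>j\<in>I \<union> K. J i j * x i * x j)
    = (\<Sum>i\<in>I. \<Sum>j\<in>I. J i j * x i * x j) + (\<Sum>i\<in>K. \<Sum>j\<in>K. J i j * x i * x j) + 2 * cross I K x"
    using I sw by (simp add: sum.union_disjoint sum.distrib cross_def mult.assoc)
  then have "GU.H x = GI.H x + GK.H x + cross I K x"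
    unfolding H1_eq[OF I(1)] H1_eq[OF I(2)] H1_eq[OF fin] using I
    by (simp add: sum.union_disjoint distrib_left)
  then have "GU.W x = exp (- cross I K x) * (GI.W x * GK.W x)"
    by (simp add: GU.W_def GI.W_def GK.W_def exp_add[symmetric])
  also have "GI.W x = GI.W (restrict x I)" by (rule W1_cong[OF I(1)]) simp
  also have "GK.W x = GK.W (restrict x K)" by (rule W1_cong[OF I(2)]) simp
  finally show ?thesis .
qed

text \<open>Only the last R sites of the left block reach the right block, and each row sum is at
  most 1.\<close>

lemma cross_coeff_le:
  "(\<Sum>i\<in>{1..int N}. \<Sum>j\<in>{int N + 1..int N + int M}. \<bar>J i j\<bar>) \<le> real R"
proof -
  have "(\<Sum>i\<in>{1..int N}. \<Sum>j\<in>{int N + 1..int N + int M}. \<bar>J i j\<bar>)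
    \<le> (\<Sum>i\<in>{1..int N}. if i \<in> {int N - int R + 1..int N} then 1 else 0)"
  proof (rule sum_mono)
    fix i assume i: "i \<in> {1..int N}"
    show "(\<Sum>j\<in>{int N + 1..int N + int M}. \<bar>J i j\<bar>) \<le> (if i \<in> {int N - int R + 1..int N} then 1 else 0)"
    proof (cases "i \<in> {int N - int R + 1..int N}")
      case True
      then show ?thesis using J_row[of "{int N + 1..int N + int M}" i] \<delta>_pos by simp
    next
      case False
      then have "(\<Sum>j\<in>{int N + 1..int N + int M}. \<bar>J i j\<bar>) = 0"
        using i by (intro sum.neutral) (auto intro!: J_far)
      then show ?thesis using False by simp
    qed
  qed
  also have "\<dots> = real (card ({1..int N} \<inter> {int N - int R + 1..int N}))"
    unfolding real_of_card by (rule sum.inter_restrict[symmetric]) simp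
  also have "\<dots> \<le> real (card {int N - int R + 1..int N})" by (intro of_nat_mono card_mono) auto
  finally show ?thesis by simp
qed

lemma m2_nonneg: "0 \<le> m2 \<sigma>" using \<delta>_pos by (simp add: m2_def c1_def)

definition "logZ \<sigma> N = ln (Z1 \<sigma> {1..int N})"

text \<open>Jensen twice. Under the joint measure, removing the interaction bounds log Z of the
  union from above by means of cross moments; under the product measure, adding it gives the lower
  bound, where the cross moments factor into means. Both are at most \<open>m2 \<sigma>\<close>, and
  boundedly many bonds are involved.\<close>

theorem logZ_almost_additive: "\<bar>logZ \<sigma> (N + M) - logZ \<sigma> N - logZ \<sigma> M\<bar> \<le> real R * m2 \<sigma>"
proof -
  let ?I = "{1..int N}" and ?K = "{int N + 1..int N + int M}"
  have un: "{1..int (N + M)} = ?I \<union> ?K" by auto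
  have fin: "finite ?I" "finite ?K" "?I \<inter> ?K = {}" by auto
  interpret GI: gibbs ?I "coupling R h" "\<lambda>_. \<sigma>" V V' "\<delta> / 2" B B1 by (rule gibbs_single[OF fin(1)])
  interpret GK: gibbs ?K "coupling R h" "\<lambda>_. \<sigma>" V V' "\<delta> / 2" B B1 by (rule gibbs_single[OF fin(2)])
  interpret GU: gibbs "?I \<union> ?K" "coupling R h" "\<lambda>_. \<sigma>" V V' "\<delta> / 2" B B1 by (rule gibbs_single) auto
  let ?X = "cross ?I ?K" and ?L = "Leb (?I \<union> ?K)"
  let ?P = "\<lambda>x. GI.W (restrict x ?I) * GK.W (restrict x ?K)"
  note prod1 = integral_Leb_Un_product[OF fin GI.integrable_W GK.integrable_W]
  have UP: "GU.W x = exp (- ?X x) * ?P x" "?P x = exp (?X x) * GU.W x" for x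
    using W1_Un[OF fin, of \<sigma> x] by (auto simp: exp_minus)
  have coeff: "\<bar>\<Sum>i\<in>?I. \<Sum>j\<in>?K. J i j * u i j\<bar> \<le> real R * m2 \<sigma>" if "\<And>i j. i \<in> ?I \<Longrightarrow> j \<in> ?K \<Longrightarrow> \<bar>u i j\<bar> \<le> m2 \<sigma>" for u
  proof -
    have "\<bar>\<Sum>i\<in>?I. \<Sum>j\<in>?K. J i j * u i j\<bar> \<le> (\<Sum>i\<in>?I. \<Sum>j\<in>?K. \<bar>J i j * u i j\<bar>)"
      by (intro order_trans[OF sum_abs] sum_mono) auto
    also have "\<dots> \<le> (\<Sum>i\<in>?I. \<Sum>j\<in>?K. \<bar>J i j\<bar> * m2 \<sigma>)"
      unfolding abs_mult using that by (intro sum_mono mult_left_mono) auto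
    also have "\<dots> \<le> real R * m2 \<sigma>"
      unfolding sum_distrib_right[symmetric] using cross_coeff_le m2_nonneg by (intro mult_right_mono)
    finally show ?thesis .
  qed
  have intU: "integrable ?L (\<lambda>x. J i j * (x i * x j) * GU.W x)" if "i \<in> ?I" "j \<in> ?K" for i j
    using single_cross_moment(1)[of "?I \<union> ?K" i j \<sigma>] that by (simp add: mult.assoc)
  have intU': "integrable ?L (\<lambda>x. (\<Sum>j\<in>?K. J i j * (x i * x j)) * GU.W x)" if "i \<in> ?I" for i
    unfolding sum_distrib_right using intU[OF that] by (intro Bochner_Integration.integrable_sum)
  have "\<bar>GU.E ?X\<bar> \<le> real R * m2 \<sigma>"
  proof -
    have "GU.E ?X = (\<Sum>i\<in>?I. \<Sum>j\<in>?K. J i j * GU.E (\<lambda>x. x i * x j))"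
    proof -
      have "GU.E ?X = (\<Sum>i\<in>?I. GU.E (\<lambda>x. \<Sum>j\<in>?K. J i j * (x i * x j)))"
        unfolding cross_def by (rule GU.E_sum[OF intU'])
      also have "\<dots> = (\<Sum>i\<in>?I. \<Sum>j\<in>?K. GU.E (\<lambda>x. J i j * (x i * x j)))"
        by (intro sum.cong refl GU.E_sum[OF intU])
      finally show ?thesis by (simp only: GU.E_cmult)
    qed
    then show ?thesis using single_cross_moment(2)[of "?I \<union> ?K" _ _ \<sigma>] by (simp only:) (intro coeff, auto)
  qed
  moreover have "GU.Z * exp (GU.E ?X) \<le> GI.Z * GK.Z"
  proof -
    have "integrable ?L (\<lambda>x. ?X x * GU.W x)"
      unfolding cross_def sum_distrib_right[of _ ?I] using intU' by (intro Bochner_Integration.integrable_sum)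
    then have "GU.Z * exp (GU.E ?X) \<le> (\<integral>x. exp (?X x) * GU.W x \<partial>?L)"
      using prod1(1) by (intro GU.Jensen_exp) (simp_all only: UP(2))
    then show ?thesis using prod1(2) by (simp only: UP(2)[symmetric] GI.Z_def GK.Z_def)
  qed
  ultimately have upper: "ln GU.Z \<le> ln GI.Z + ln GK.Z + real R * m2 \<sigma>"
  proof -
    assume e: "\<bar>GU.E ?X\<bar> \<le> real R * m2 \<sigma>" and le: "GU.Z * exp (GU.E ?X) \<le> GI.Z * GK.Z"
    have "ln (GU.Z * exp (GU.E ?X)) \<le> ln (GI.Z * GK.Z)"
      using le GU.Z_pos GI.Z_pos GK.Z_pos by (subst ln_le_cancel_iff) auto
    then show ?thesis using e GU.Z_pos GI.Z_pos GK.Z_pos by (simp add: ln_mult)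
  qed
  have intP: "integrable ?L (\<lambda>x. - (J i j * (x i * x j)) * ?P x)"
    "(\<integral>x. - (J i j * (x i * x j)) * ?P x \<partial>?L) = - (J i j * (GI.E (\<lambda>x. x i) * GK.E (\<lambda>x. x j))) * (GI.Z * GK.Z)"
    if "i \<in> ?I" "j \<in> ?K" for i j
  proof -
    note pr = integral_Leb_Un_product[OF fin single_mean(1)[OF fin(1) that(1), of \<sigma>] single_mean(1)[OF fin(2) that(2), of \<sigma>]]
    have eq: "(\<lambda>x. - (J i j * (x i * x j)) * ?P x)
      = (\<lambda>x. - J i j * ((restrict x ?I i * GI.W (restrict x ?I)) * (restrict x ?K j * GK.W (restrict x ?K))))"
      using that by (auto simp: mult_ac)
    show "integrable ?L (\<lambda>x. - (J i j * (x i * x j)) * ?P x)"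
      unfolding eq by (intro integrable_mult_right pr(1))
    show "(\<integral>x. - (J i j * (x i * x j)) * ?P x \<partial>?L) = - (J i j * (GI.E (\<lambda>x. x i) * GK.E (\<lambda>x. x j))) * (GI.Z * GK.Z)"
      unfolding eq integral_mult_right_zero pr(2) GI.E_def GK.E_def using GI.Z_pos GK.Z_pos by simp
  qed
  let ?e = "\<Sum>i\<in>?I. \<Sum>j\<in>?K. J i j * (GI.E (\<lambda>x. x i) * GK.E (\<lambda>x. x j))"
  have Xm: "(\<lambda>x. - ?X x * ?P x) = (\<lambda>x. \<Sum>i\<in>?I. \<Sum>j\<in>?K. - (J i j * (x i * x j)) * ?P x)"
    by (auto simp: cross_def sum_distrib_right sum_negf)
  have intXP: "integrable ?L (\<lambda>x. - ?X x * ?P x)" unfolding Xm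
    using intP(1) by (intro Bochner_Integration.integrable_sum)
  have XP: "(\<integral>x. - ?X x * ?P x \<partial>?L) = - ?e * (GI.Z * GK.Z)"
  proof -
    have "(\<integral>x. - ?X x * ?P x \<partial>?L) = (\<Sum>i\<in>?I. \<integral>x. (\<Sum>j\<in>?K. - (J i j * (x i * x j)) * ?P x) \<partial>?L)"
      unfolding Xm by (intro Bochner_Integration.integral_sum Bochner_Integration.integrable_sum intP(1))
    also have "\<dots> = (\<Sum>i\<in>?I. \<Sum>j\<in>?K. \<integral>x. - (J i j * (x i * x j)) * ?P x \<partial>?L)"
      by (intro sum.cong refl Bochner_Integration.integral_sum intP(1))
    also have "\<dots> = (\<Sum>i\<in>?I. \<Sum>j\<in>?K. - (J i j * (GI.E (\<lambda>x. x i) * GK.E (\<lambda>x. x j))) * (GI.Z * GK.Z))"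
      by (intro sum.cong refl intP(2))
    also have "\<dots> = - ?e * (GI.Z * GK.Z)" by (simp add: sum_distrib_right sum_negf)
    finally show ?thesis .
  qed
  have ZP: "(\<integral>x. ?P x \<partial>?L) = GI.Z * GK.Z" using prod1(2) by (simp only: GI.Z_def GK.Z_def)
  have ZZ: "0 < GI.Z * GK.Z" using GI.Z_pos GK.Z_pos by simp
  have intE: "integrable ?L (\<lambda>x. exp (- ?X x) * ?P x)" 
  proof -
    have "GU.W = (\<lambda>x. exp (- ?X x) * ?P x)" by (rule ext) (rule UP(1))
    then show ?thesis using GU.integrable_W by (simp only:)
  qed
  have P0: "0 \<le> ?P x" for x using GI.W_pos GK.W_pos by (simp add: less_imp_le)
  have "- ?e * (GI.Z * GK.Z) / (GI.Z * GK.Z) = - ?e"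
    using ZZ by (intro nonzero_mult_div_cancel_right) linarith
  then have "(GI.Z * GK.Z) * exp (- ?e) \<le> (\<integral>x. exp (- ?X x) * ?P x \<partial>?L)"
    using Jensen_exp_weight[OF prod1(1) P0 _ intXP intE] ZZ by (simp only: ZP XP)
  then have le: "(GI.Z * GK.Z) * exp (- ?e) \<le> GU.Z" by (simp only: UP(1)[symmetric] GU.Z_def)
  have "\<bar>?e\<bar> \<le> real R * m2 \<sigma>"
  proof (rule coeff)
    fix i j assume "i \<in> ?I" "j \<in> ?K"
    then have "(GI.E (\<lambda>x. x i))\<^sup>2 \<le> m2 \<sigma>" "(GK.E (\<lambda>x. x j))\<^sup>2 \<le> m2 \<sigma>" by (intro single_mean fin; simp)+
    then show "\<bar>GI.E (\<lambda>x. x i) * GK.E (\<lambda>x. x j)\<bar> \<le> m2 \<sigma>"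
      using sum_squares_bound[of "\<bar>GI.E (\<lambda>x. x i)\<bar>" "\<bar>GK.E (\<lambda>x. x j)\<bar>"] by (simp add: abs_mult)
  qed
  moreover have "ln ((GI.Z * GK.Z) * exp (- ?e)) \<le> ln GU.Z"
    using le GU.Z_pos GI.Z_pos GK.Z_pos by (subst ln_le_cancel_iff) auto
  ultimately have "ln GI.Z + ln GK.Z - real R * m2 \<sigma> \<le> ln GU.Z"
    using GI.Z_pos GK.Z_pos by (simp add: ln_mult)
  then show ?thesis using upper unfolding logZ_def un Z1_shift[where k = "int N" and M = M and \<sigma> = \<sigma>] by linarith
qed

text \<open>Since the couplings contribute at most the diagonal again, the energy is at most the sum
  of squares plus B N minus the field term, and the comparison integral factors into Gaussians. The
  growth \<sigma>^2 / 4 is what later bounds the field in terms of |m|.\<close>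

lemma Z1_ge: "exp (real N * (\<sigma>\<^sup>2 / 4 - B)) \<le> Z1 \<sigma> {1..int N}"
proof -
  let ?I = "{1..int N}"
  interpret G: gibbs ?I "coupling R h" "\<lambda>_. \<sigma>" V V' "\<delta> / 2" B B1 by (rule gibbs_single) simp
  have i1: "integrable lborel (\<lambda>t. exp (\<sigma> * t - t\<^sup>2))" and v1: "(\<integral>t. exp (\<sigma> * t - t\<^sup>2) \<partial>lborel) = exp (\<sigma>\<^sup>2 / 4) * sqrt pi"
  proof -
    have eq: "exp (\<sigma> * t - t\<^sup>2) = exp (\<sigma>\<^sup>2 / 4) * exp (- (1 * (t - \<sigma> / 2)\<^sup>2))" for t
      by (simp add: exp_add[symmetric] power2_eq_square algebra_simps)
    have "(\<integral>\<^sup>+t. ennreal (exp (\<sigma> * t - t\<^sup>2)) \<partial>lborel) = ennreal (exp (\<sigma>\<^sup>2 / 4)) * ennreal (sqrt (pi / 1))"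
      unfolding eq using nn_integral_gaussian[of 1 "\<sigma> / 2"] by (simp add: ennreal_mult nn_integral_cmult)
    then have nn: "(\<integral>\<^sup>+t. ennreal (exp (\<sigma> * t - t\<^sup>2)) \<partial>lborel) = ennreal (exp (\<sigma>\<^sup>2 / 4) * sqrt pi)"
      by (simp add: ennreal_mult)
    then show "integrable lborel (\<lambda>t. exp (\<sigma> * t - t\<^sup>2))"
      by (intro integrableI_bounded) auto
    show "(\<integral>t. exp (\<sigma> * t - t\<^sup>2) \<partial>lborel) = exp (\<sigma>\<^sup>2 / 4) * sqrt pi"
      using nn by (intro integral_eq_nn_integral[THEN trans]) auto
  qed
  have "exp (real N * (\<sigma>\<^sup>2 / 4 - B)) \<le> exp (- B * N) * (exp (\<sigma>\<^sup>2 / 4) * sqrt pi) ^ N"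
  proof -
    have "1 \<le> sqrt pi ^ N" using pi_ge_two by (intro one_le_power) auto
    then have "exp (- B * N) * exp (\<sigma>\<^sup>2 / 4) ^ N * 1 \<le> exp (- B * N) * exp (\<sigma>\<^sup>2 / 4) ^ N * sqrt pi ^ N" by (intro mult_left_mono) auto
    then show ?thesis by (simp add: power_mult_distrib exp_of_nat_mult[symmetric] exp_add[symmetric] algebra_simps)
  qed
  also have "\<dots> = (\<integral>x. exp (- B * N) * (\<Prod>i\<in>?I. exp (\<sigma> * x i - (x i)\<^sup>2)) \<partial>Leb ?I)"
    using Leb.product_integral_prod[of ?I "\<lambda>_ t. exp (\<sigma> * t - t\<^sup>2)"] i1 v1 by simp
  also have "\<dots> \<le> G.Z"
    unfolding G.Z_def
  proof (rule integral_mono[OF _ G.integrable_W])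
    show "integrable (Leb ?I) (\<lambda>x. exp (- B * N) * (\<Prod>i\<in>?I. exp (\<sigma> * x i - (x i)\<^sup>2)))"
      using i1 by (intro integrable_mult_right Leb.product_integrable_prod) auto
    fix x
    have "\<bar>\<Sum>i\<in>?I. V (x i)\<bar> \<le> (\<Sum>i\<in>?I. B)" using V_bound by (intro order_trans[OF sum_abs] sum_mono)
    then have "(\<Sum>i\<in>?I. V (x i)) \<le> B * N" by (simp add: mult.commute abs_le_iff)
    moreover have "(\<Sum>i\<in>?I. \<Sum>j\<in>?I. J i j * x i * x j) \<le> (\<Sum>i\<in>?I. (x i)\<^sup>2)"
    proof -
      have "(1 - \<delta>) * (\<Sum>i\<in>?I. (x i)\<^sup>2) \<le> 1 * (\<Sum>i\<in>?I. (x i)\<^sup>2)"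
        using \<delta>_pos by (intro mult_right_mono sum_nonneg) auto
      then show ?thesis using J_quadratic_le[of ?I x] by (simp add: abs_le_iff)
    qed
    moreover have "(\<Sum>i\<in>?I. \<sigma> * x i - (x i)\<^sup>2) = \<sigma> * (\<Sum>i\<in>?I. x i) - (\<Sum>i\<in>?I. (x i)\<^sup>2)"
      by (simp only: sum_subtractf sum_distrib_left)
    ultimately have "- B * N + (\<Sum>i\<in>?I. \<sigma> * x i - (x i)\<^sup>2) \<le> - G.H x"
      unfolding H1_eq[OF finite_atLeastAtMost_int] by linarith
    then show "exp (- B * N) * (\<Prod>i\<in>?I. exp (\<sigma> * x i - (x i)\<^sup>2)) \<le> G.W x"
      unfolding G.W_def by (simp add: exp_sum[symmetric] exp_add[symmetric])
  qed
  finally show ?thesis .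
qed

definition "cZ = B + \<bar>ln (sqrt (2 * pi / \<delta>))\<bar>"

text \<open>Needed at field 0 only, as the reference value against which the quadratic growth in
  \<sigma> is compared.\<close>

lemma Z1_zero_le: "Z1 0 {1..int N} \<le> exp (real N * cZ)"
proof -
  let ?I = "{1..int N}"
  interpret G: gibbs ?I "coupling R h" "\<lambda>_. 0" V V' "\<delta> / 2" B B1 by (rule gibbs_single) simp
  let ?g = "sqrt (2 * pi / \<delta>)"
  have g0: "0 < ?g" using \<delta>_pos by simp
  have i1: "integrable lborel (\<lambda>t. exp (- (\<delta> / 2 * (t :: real)\<^sup>2)))" using \<delta>_pos by (intro integrable_gaussian) simp
  have v1: "(\<integral>t. exp (- (\<delta> / 2 * (t :: real)\<^sup>2)) \<partial>lborel) = ?g"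
    using nn_integral_gaussian[of "\<delta> / 2" 0] \<delta>_pos by (intro integral_eq_nn_integral[THEN trans]) (auto simp: mult.commute)
  have "G.Z \<le> (\<integral>x. exp (B * N) * (\<Prod>i\<in>?I. exp (- (\<delta> / 2 * (x i)\<^sup>2))) \<partial>Leb ?I)"
    unfolding G.Z_def
  proof (rule integral_mono[OF G.integrable_W])
    show "integrable (Leb ?I) (\<lambda>x. exp (B * N) * (\<Prod>i\<in>?I. exp (- (\<delta> / 2 * (x i)\<^sup>2))))"
      using i1 by (intro integrable_mult_right Leb.product_integrable_prod) auto
    fix x
    have "\<bar>\<Sum>i\<in>?I. V (x i)\<bar> \<le> (\<Sum>i\<in>?I. B)" using V_bound by (intro order_trans[OF sum_abs] sum_mono)
    then have "- (B * N) \<le> (\<Sum>i\<in>?I. V (x i))" by (simp add: mult.commute abs_le_iff)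
    moreover have "- ((1 - \<delta>) * (\<Sum>i\<in>?I. (x i)\<^sup>2)) \<le> (\<Sum>i\<in>?I. \<Sum>j\<in>?I. J i j * x i * x j)"
      using J_quadratic_le[of ?I x] by (simp add: abs_le_iff)
    moreover have "(1 - \<delta>) * (\<Sum>i\<in>?I. (x i)\<^sup>2) = (\<Sum>i\<in>?I. (x i)\<^sup>2) - \<delta> * (\<Sum>i\<in>?I. (x i)\<^sup>2)"
      by (simp add: left_diff_distrib)
    moreover have "(\<Sum>i\<in>?I. - (\<delta> / 2 * (x i)\<^sup>2)) = - (\<delta> * (\<Sum>i\<in>?I. (x i)\<^sup>2) / 2)"
      unfolding sum_negf sum_distrib_left[symmetric] by simp
    ultimately have "- G.H x \<le> B * N + (\<Sum>i\<in>?I. - (\<delta> / 2 * (x i)\<^sup>2))"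
      unfolding H1_eq[OF finite_atLeastAtMost_int] by linarith
    then show "G.W x \<le> exp (B * N) * (\<Prod>i\<in>?I. exp (- (\<delta> / 2 * (x i)\<^sup>2)))"
      unfolding G.W_def by (simp add: exp_sum[symmetric] exp_add[symmetric])
  qed
  also have "\<dots> = exp (B * N) * ?g ^ N"
    using Leb.product_integral_prod[of ?I "\<lambda>_ t. exp (- (\<delta> / 2 * t\<^sup>2))"] i1 v1 by simp
  also have "\<dots> = exp (N * (B + ln ?g))"
  proof -
    have "?g ^ N = exp (N * ln ?g)" using g0 by (simp add: exp_of_nat_mult)
    then show ?thesis by (simp add: exp_add[symmetric] algebra_simps)
  qed
  also have "\<dots> \<le> exp (real N * cZ)" by (auto simp: cZ_def intro!: mult_left_mono)
  finally show ?thesis .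
qed

text \<open>Jensen for the factor exp ((\<sigma>' - \<sigma>) S), with S the total spin. It gives a
  supporting line of slope E S at each \<sigma>, from which convexity follows without
  differentiating under the integral.\<close>

lemma logZ_tangent:
  "logZ \<sigma> N + (\<sigma>' - \<sigma>) * E1 \<sigma> {1..int N} (\<lambda>x. \<Sum>i\<in>{1..int N}. x i) \<le> logZ \<sigma>' N"
proof -
  let ?I = "{1..int N}"
  interpret G: gibbs ?I "coupling R h" "\<lambda>_. \<sigma>" V V' "\<delta> / 2" B B1 by (rule gibbs_single) simp
  interpret G': gibbs ?I "coupling R h" "\<lambda>_. \<sigma>'" V V' "\<delta> / 2" B B1 by (rule gibbs_single) simp
  let ?g = "\<lambda>x. (\<sigma>' - \<sigma>) * (\<Sum>i\<in>?I. x i)"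
  have t: "exp (?g x) * G.W x = G'.W x" for x using W1_tilt[of ?I \<sigma>' x \<sigma>] by simp
  have "integrable (Leb ?I) (\<lambda>x. ?g x * G.W x)"
    using integrable_S_sq(2)[of ?I \<sigma>] by (simp add: mult.assoc)
  then have "G.Z * exp (G.E ?g) \<le> (\<integral>x. exp (?g x) * G.W x \<partial>Leb ?I)"
    using G'.integrable_W by (intro G.Jensen_exp) (simp_all only: t)
  then have "G.Z * exp (G.E ?g) \<le> G'.Z" by (simp only: t G'.Z_def)
  then have "ln (G.Z * exp (G.E ?g)) \<le> ln G'.Z" using G.Z_pos G'.Z_pos by (subst ln_le_cancel_iff) auto
  then show ?thesis using G.Z_pos by (simp add: ln_mult logZ_def G.E_cmult)
qed

lemma convex_logZ: "convex_on UNIV (\<lambda>\<sigma>. logZ \<sigma> N)"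
proof (rule convex_onI)
  fix t a b :: real assume t: "0 < t" "t < 1"
  let ?c = "(1 - t) * a + t * b"
  let ?e = "E1 ?c {1..int N} (\<lambda>x. \<Sum>i\<in>{1..int N}. x i)"
  have "(1 - t) * (logZ ?c N + (a - ?c) * ?e) + t * (logZ ?c N + (b - ?c) * ?e) \<le> (1 - t) * logZ a N + t * logZ b N"
    using t logZ_tangent[of ?c N a] logZ_tangent[of ?c N b] by (intro add_mono mult_left_mono) auto
  moreover have "(1 - t) * (logZ ?c N + (a - ?c) * ?e) + t * (logZ ?c N + (b - ?c) * ?e) = logZ ?c N"
    by (simp add: algebra_simps)
  ultimately show "logZ ((1 - t) *\<^sub>R a + t *\<^sub>R b) N \<le> (1 - t) * logZ a N + t * logZ b N" by simp
qed simp

lemma free_energy_exists: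
  "\<exists>A. (\<forall>\<sigma> N. \<bar>logZ \<sigma> N - real N * A \<sigma>\<bar> \<le> real R * m2 \<sigma>) \<and> convex_on UNIV A
    \<and> (\<forall>\<sigma>. \<sigma>\<^sup>2 / 4 - B \<le> A \<sigma>) \<and> A 0 \<le> cZ"
proof -
  have "\<forall>\<sigma>. \<exists>L. \<forall>N. \<bar>logZ \<sigma> N - real N * L\<bar> \<le> real R * m2 \<sigma>"
  proof
    fix \<sigma> show "\<exists>L. \<forall>N. \<bar>logZ \<sigma> N - real N * L\<bar> \<le> real R * m2 \<sigma>"
      by (rule almost_additive_limit) (rule logZ_almost_additive)
  qed
  then obtain A where A: "\<And>\<sigma> N. \<bar>logZ \<sigma> N - real N * A \<sigma>\<bar> \<le> real R * m2 \<sigma>" by metis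
  have lim: "(\<lambda>N. logZ \<sigma> N / real N) \<longlonglongrightarrow> A \<sigma>" for \<sigma>
  proof (rule LIM_zero_cancel, rule Lim_null_comparison)
    show "\<forall>\<^sub>F N in sequentially. norm (logZ \<sigma> N / real N - A \<sigma>) \<le> real R * m2 \<sigma> / real N"
      using eventually_gt_at_top[of 0]
    proof eventually_elim
      case (elim N)
      then have "logZ \<sigma> N / real N - A \<sigma> = (logZ \<sigma> N - real N * A \<sigma>) / real N" by (simp add: field_simps)
      then show ?case using A[of \<sigma> N] by (simp add: abs_divide divide_right_mono)
    qed
    show "(\<lambda>N. real R * m2 \<sigma> / real N) \<longlonglongrightarrow> 0" by (rule lim_const_over_n)
  qed
  have "convex_on UNIV A"
  proof (rule convex_onI)
    fix t a b :: real assume t: "0 < t" "t < 1"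
    have "A ((1 - t) * a + t * b) \<le> (1 - t) * A a + t * A b"
    proof (rule LIMSEQ_le[OF lim])
      show "(\<lambda>N. (1 - t) * (logZ a N / real N) + t * (logZ b N / real N)) \<longlonglongrightarrow> (1 - t) * A a + t * A b"
        by (intro tendsto_intros lim)
      show "\<exists>K. \<forall>N\<ge>K. logZ ((1 - t) * a + t * b) N / real N \<le> (1 - t) * (logZ a N / real N) + t * (logZ b N / real N)"
      proof (intro exI allI impI)
        fix N :: nat
        have "logZ ((1 - t) * a + t * b) N \<le> (1 - t) * logZ a N + t * logZ b N"
          using convex_onD[OF convex_logZ, of t a b N] t by simp
        then show "logZ ((1 - t) * a + t * b) N / real N \<le> (1 - t) * (logZ a N / real N) + t * (logZ b N / real N)"
          by (simp add: add_divide_distrib[symmetric] divide_right_mono)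
      qed
    qed
    then show "A ((1 - t) *\<^sub>R a + t *\<^sub>R b) \<le> (1 - t) * A a + t * A b" by simp
  qed simp
  moreover have "\<sigma>\<^sup>2 / 4 - B \<le> A \<sigma>" for \<sigma>
  proof (rule LIMSEQ_le_const[OF lim], intro exI allI impI)
    fix N :: nat assume "1 \<le> N"
    have "ln (exp (real N * (\<sigma>\<^sup>2 / 4 - B))) \<le> logZ \<sigma> N"
      unfolding logZ_def using Z1_ge Z1_pos by (subst ln_le_cancel_iff) auto
    then show "\<sigma>\<^sup>2 / 4 - B \<le> logZ \<sigma> N / real N" using \<open>1 \<le> N\<close> by (simp add: field_simps)
  qed
  moreover have "A 0 \<le> cZ"
  proof (rule LIMSEQ_le_const2[OF lim], intro exI allI impI)
    fix N :: nat assume "1 \<le> N"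
    have "logZ 0 N \<le> ln (exp (real N * cZ))"
      unfolding logZ_def using Z1_zero_le Z1_pos by (subst ln_le_cancel_iff) auto
    then show "logZ 0 N / real N \<le> cZ" using \<open>1 \<le> N\<close> by (simp add: field_simps)
  qed
  ultimately show ?thesis using A by blast
qed

end

section \<open>Density of the total spin\<close>

lemma sum_plane_point:
  assumes "1 \<le> N"
  shows "(\<Sum>i\<in>{1..int N}. plane_point N s y i) = s"
  unfolding atLeastAtMost_int_Suc[OF assms] by (simp add: plane_point_def)

lemma plane_point_translate:
  assumes "1 \<le> N" "i \<in> {1..int N}"
  shows "plane_point N (s + real N * c) (\<lambda>i\<in>{1..int N - 1}. c + 1 * y i) i = plane_point N s y i + c"
proof -
  have "(\<Sum>i\<in>{1..int N - 1}. (\<lambda>i\<in>{1..int N - 1}. c + 1 * y i) i) = (real N - 1) * c + (\<Sum>i\<in>{1..int N - 1}. y i)"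
    using assms(1) by (simp add: sum.distrib of_nat_diff)
  then show ?thesis using assms by (auto simp: plane_point_def algebra_simps)
qed

context chain
begin

text \<open>The density at s, with respect to Lebesgue measure on the line, of the total spin under
  the unnormalised weight at field 0. The Hausdorff integral over the hyperplane is sqrt N times
  this.\<close>

definition "canonical N s = (\<integral>y. W1 0 {1..int N} (plane_point N s y) \<partial>Leb {1..int N - 1})"

lemma plane_weight_measurable:
  "(\<lambda>p. W1 0 {1..int N} (plane_point N (fst p) (snd p))) \<in> borel_measurable (borel \<Otimes>\<^sub>M Leb {1..int N - 1})"
proof -
  interpret G: gibbs "{1..int N}" "coupling R h" "\<lambda>_. 0" V V' "\<delta> / 2" B B1 by (rule gibbs_single) simp
  have [measurable]: "V \<in> borel_measurable borel" by (rule G.V_measurable)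
  have [measurable]: "(\<lambda>p. plane_point N (fst p) (snd p) i) \<in> borel_measurable (borel \<Otimes>\<^sub>M Leb {1..int N - 1})" for i
  proof (cases "i \<in> {1..int N - 1}")
    case True
    then have "(\<lambda>p. plane_point N (fst p) (snd p) i) = (\<lambda>p. snd p i)" by (auto simp: plane_point_def)
    then show ?thesis using True by simp
  next
    case False
    then show ?thesis unfolding plane_point_def by (simp only: if_False) measurable
  qed
  show ?thesis unfolding G.W_def H1_eq[OF finite_atLeastAtMost_int] by measurable
qed

lemma plane_weight_measurable':
  "(\<lambda>y. W1 0 {1..int N} (plane_point N s y)) \<in> borel_measurable (Leb {1..int N - 1})"
  using measurable_compose[OF measurable_Pair1' plane_weight_measurable, of s N] by simp

lemma integrable_plane_weight:
  assumes N: "1 \<le> N"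
  shows "integrable (Leb {1..int N - 1}) (\<lambda>y. W1 0 {1..int N} (plane_point N s y))"
proof -
  interpret G: gibbs "{1..int N}" "coupling R h" "\<lambda>_. 0" V V' "\<delta> / 2" B B1 by (rule gibbs_single) simp
  show ?thesis
  proof (rule Bochner_Integration.integrable_bound)
    show "integrable (Leb {1..int N - 1}) (\<lambda>y. G.C0 * exp (- (\<delta> / 4 * (\<Sum>i\<in>{1..int N - 1}. (y i)\<^sup>2))))"
      using \<delta>_pos by (intro integrable_mult_right integrable_Leb_gaussian) auto
    show "(\<lambda>y. W1 0 {1..int N} (plane_point N s y)) \<in> borel_measurable (Leb {1..int N - 1})"
      by (rule plane_weight_measurable')
    have "norm (G.W (plane_point N s y)) \<le> norm (G.C0 * exp (- (\<delta> / 4 * (\<Sum>i\<in>{1..int N - 1}. (y i)\<^sup>2))))" for y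
    proof -
      have "(\<Sum>i\<in>{1..int N - 1}. (y i)\<^sup>2) = (\<Sum>i\<in>{1..int N - 1}. (plane_point N s y i)\<^sup>2)"
        by (rule sum.cong) (auto simp: plane_point_def)
      also have "\<dots> \<le> (\<Sum>i\<in>{1..int N}. (plane_point N s y i)\<^sup>2)" by (rule sum_mono2) auto
      finally have "exp (- (\<delta> / 2 / 2 * (\<Sum>i\<in>{1..int N}. (plane_point N s y i)\<^sup>2)))
        \<le> exp (- (\<delta> / 4 * (\<Sum>i\<in>{1..int N - 1}. (y i)\<^sup>2)))" using \<delta>_pos by simp
      then have "G.W (plane_point N s y) \<le> G.C0 * exp (- (\<delta> / 4 * (\<Sum>i\<in>{1..int N - 1}. (y i)\<^sup>2)))"
        by (intro order_trans[OF G.W_le] mult_left_mono) (auto simp: G.C0_def)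
      then show ?thesis using G.W_pos[of "plane_point N s y"] by simp
    qed
    then show "AE y in Leb {1..int N - 1}. norm (G.W (plane_point N s y))
      \<le> norm (G.C0 * exp (- (\<delta> / 4 * (\<Sum>i\<in>{1..int N - 1}. (y i)\<^sup>2))))" by (intro AE_I2)
  qed
qed

lemma W1_pos: "finite I \<Longrightarrow> 0 < W1 \<sigma> I x"
  by (rule gibbs.W_pos[OF gibbs_single])

lemma canonical_pos: "1 \<le> N \<Longrightarrow> 0 < canonical N s"
  unfolding canonical_def by (intro integral_Leb_pos integrable_plane_weight W1_pos) auto

lemma nn_integral_plane_weight:
  "1 \<le> N \<Longrightarrow> (\<integral>\<^sup>+y. ennreal (W1 0 {1..int N} (plane_point N s y)) \<partial>Leb {1..int N - 1}) = ennreal (canonical N s)"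
  unfolding canonical_def
  by (rule nn_integral_eq_integral[OF integrable_plane_weight]) (use less_imp_le[OF W1_pos] in auto)

lemma canonical_measurable [measurable]: "canonical N \<in> borel_measurable borel"
proof -
  interpret sigma_finite_measure "Leb {1..int N - 1}" by (rule Leb.sigma_finite) simp
  show ?thesis unfolding canonical_def
    using plane_weight_measurable[of N] by (intro borel_measurable_lebesgue_integral) (simp add: case_prod_beta')
qed

text \<open>The last spin is replaced by the total spin through a translation, which has Jacobian
  1.\<close>

lemma disintegration:
  assumes N: "1 \<le> N" and [measurable]: "f \<in> borel_measurable borel"
  shows "(\<integral>\<^sup>+x. f (\<Sum>i\<in>{1..int N}. x i) * ennreal (W1 0 {1..int N} x) \<partial>Leb {1..int N})
    = (\<integral>\<^sup>+s. f s * ennreal (canonical N s) \<partial>lborel)"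
proof -
  let ?I = "{1..int N}" and ?I' = "{1..int N - 1}"
  interpret G: gibbs ?I "coupling R h" "\<lambda>_. 0" V V' "\<delta> / 2" B B1 by (rule gibbs_single) simp
  interpret S': sigma_finite_measure "Leb ?I'" by (rule Leb.sigma_finite) simp
  interpret PS: pair_sigma_finite lborel "Leb ?I'" by standard
  note I_eq = atLeastAtMost_int_Suc[OF N]
  have [measurable]: "G.W \<in> borel_measurable (Leb (insert (int N) ?I'))" using G.W_measurable by (simp only: I_eq)
  have "(\<integral>\<^sup>+x. f (\<Sum>i\<in>?I. x i) * ennreal (G.W x) \<partial>Leb ?I)
    = (\<integral>\<^sup>+x. f (\<Sum>i\<in>insert (int N) ?I'. x i) * ennreal (G.W x) \<partial>Leb (insert (int N) ?I'))" by (simp only: I_eq)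
  also have "\<dots> = (\<integral>\<^sup>+y. \<integral>\<^sup>+t. f (\<Sum>i\<in>insert (int N) ?I'. (y(int N := t)) i) * ennreal (G.W (y(int N := t))) \<partial>lborel \<partial>Leb ?I')"
    by (subst Leb.product_nn_integral_insert) auto
  also have "\<dots> = (\<integral>\<^sup>+y. \<integral>\<^sup>+s. f s * ennreal (G.W (plane_point N s y)) \<partial>lborel \<partial>Leb ?I')"
  proof (rule nn_integral_cong)
    fix y assume y: "y \<in> space (Leb ?I')"
    let ?F = "\<lambda>t. f (\<Sum>i\<in>insert (int N) ?I'. (y(int N := t)) i) * ennreal (G.W (y(int N := t)))"
    have upd: "(\<lambda>t. y(int N := t)) \<in> measurable borel (Leb (insert (int N) ?I'))"
      using y by (intro measurable_fun_upd[where J = ?I']) (auto simp: measurable_const)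
    have [measurable]: "?F \<in> borel_measurable borel" by (rule measurable_compose[OF upd]) measurable
    have "(\<integral>\<^sup>+t. ?F t \<partial>lborel) = ennreal \<bar>1\<bar> * (\<integral>\<^sup>+s. ?F (- (\<Sum>i\<in>?I'. y i) + 1 * s) \<partial>lborel)"
      by (rule nn_integral_real_affine) (fact, simp)
    also have "\<dots> = (\<integral>\<^sup>+s. ?F (- (\<Sum>i\<in>?I'. y i) + 1 * s) \<partial>lborel)" by simp
    also have "\<dots> = (\<integral>\<^sup>+s. f s * ennreal (G.W (plane_point N s y)) \<partial>lborel)"
    proof (rule nn_integral_cong)
      fix s :: real
      let ?x = "y(int N := - (\<Sum>i\<in>?I'. y i) + 1 * s)"
      have eq: "?x i = plane_point N s y i" if "i \<in> ?I" for i
        using that by (auto simp: plane_point_def)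
      have "(\<Sum>i\<in>insert (int N) ?I'. ?x i) = (\<Sum>i\<in>?I. plane_point N s y i)"
        unfolding I_eq[symmetric] by (intro sum.cong refl eq)
      moreover have "G.W ?x = G.W (plane_point N s y)" by (rule W1_cong[OF finite_atLeastAtMost_int eq])
      ultimately show "?F (- (\<Sum>i\<in>?I'. y i) + 1 * s) = f s * ennreal (G.W (plane_point N s y))"
        by (simp only: sum_plane_point[OF N])
    qed
    finally show "(\<integral>\<^sup>+t. ?F t \<partial>lborel) = (\<integral>\<^sup>+s. f s * ennreal (G.W (plane_point N s y)) \<partial>lborel)" .
  qed
  also have "\<dots> = (\<integral>\<^sup>+s. \<integral>\<^sup>+y. f s * ennreal (G.W (plane_point N s y)) \<partial>Leb ?I' \<partial>lborel)"
  proof (rule PS.Fubini')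
    have [measurable]: "(\<lambda>p. G.W (plane_point N (fst p) (snd p))) \<in> borel_measurable (borel \<Otimes>\<^sub>M Leb ?I')"
      by (rule plane_weight_measurable)
    have "(\<lambda>p. f (fst p) * ennreal (G.W (plane_point N (fst p) (snd p)))) \<in> borel_measurable (borel \<Otimes>\<^sub>M Leb ?I')"
      by measurable
    then show "(\<lambda>(s, y). f s * ennreal (G.W (plane_point N s y))) \<in> borel_measurable (lborel \<Otimes>\<^sub>M Leb ?I')"
      by (simp add: case_prod_beta' cong: measurable_cong_sets sets_pair_measure_cong)
  qed
  also have "\<dots> = (\<integral>\<^sup>+s. f s * ennreal (canonical N s) \<partial>lborel)"
    using plane_weight_measurable' by (simp add: nn_integral_cmult nn_integral_plane_weight[OF N])
  finally show ?thesis .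
qed

lemma nn_integral_canonical:
  assumes N: "1 \<le> N" and g: "g \<in> borel_measurable borel" "\<And>s. 0 \<le> g s"
    and int: "integrable (Leb {1..int N}) (\<lambda>x. g (\<Sum>i\<in>{1..int N}. x i) * W1 \<sigma> {1..int N} x)"
  shows "(\<integral>\<^sup>+s. ennreal (g s * (exp (\<sigma> * s) * canonical N s)) \<partial>lborel)
    = ennreal (E1 \<sigma> {1..int N} (\<lambda>x. g (\<Sum>i\<in>{1..int N}. x i)) * Z1 \<sigma> {1..int N})"
proof -
  let ?I = "{1..int N}"
  interpret G: gibbs ?I "coupling R h" "\<lambda>_. \<sigma>" V V' "\<delta> / 2" B B1 by (rule gibbs_single) simp
  note [measurable] = g(1)
  have "(\<integral>\<^sup>+s. ennreal (g s * (exp (\<sigma> * s) * canonical N s)) \<partial>lborel)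
    = (\<integral>\<^sup>+s. ennreal (g s * exp (\<sigma> * s)) * ennreal (canonical N s) \<partial>lborel)"
    using g(2) canonical_pos[OF N] by (intro nn_integral_cong) (simp add: ennreal_mult[symmetric] less_imp_le mult.assoc)
  also have "\<dots> = (\<integral>\<^sup>+x. ennreal (g (\<Sum>i\<in>?I. x i) * exp (\<sigma> * (\<Sum>i\<in>?I. x i))) * ennreal (W1 0 ?I x) \<partial>Leb ?I)"
    by (rule disintegration[OF N, symmetric]) measurable
  also have "\<dots> = (\<integral>\<^sup>+x. ennreal (g (\<Sum>i\<in>?I. x i) * G.W x) \<partial>Leb ?I)"
  proof (rule nn_integral_cong)
    fix x
    show "ennreal (g (\<Sum>i\<in>?I. x i) * exp (\<sigma> * (\<Sum>i\<in>?I. x i))) * ennreal (W1 0 ?I x) = ennreal (g (\<Sum>i\<in>?I. x i) * G.W x)"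
      using W1_tilt[of ?I \<sigma> x 0] W1_pos[of ?I 0 x] g(2) by (simp add: ennreal_mult[symmetric] less_imp_le mult.assoc)
  qed
  also have "\<dots> = ennreal (\<integral>x. g (\<Sum>i\<in>?I. x i) * G.W x \<partial>Leb ?I)"
    using g(2) G.W_pos by (intro nn_integral_eq_integral int AE_I2) (simp add: less_imp_le)
  also have "(\<integral>x. g (\<Sum>i\<in>?I. x i) * G.W x \<partial>Leb ?I) = G.E (\<lambda>x. g (\<Sum>i\<in>?I. x i)) * G.Z"
    unfolding G.E_def using G.Z_pos by simp
  finally show ?thesis .
qed

lemma nn_integral_canonical_Z:
  assumes "1 \<le> N"
  shows "(\<integral>\<^sup>+s. ennreal (exp (\<sigma> * s) * canonical N s) \<partial>lborel) = ennreal (Z1 \<sigma> {1..int N})"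
proof -
  interpret G: gibbs "{1..int N}" "coupling R h" "\<lambda>_. \<sigma>" V V' "\<delta> / 2" B B1 by (rule gibbs_single) simp
  show ?thesis using nn_integral_canonical[OF assms, of "\<lambda>_. 1" \<sigma>] G.integrable_W by (simp add: G.E_const)
qed

section \<open>The shift inequality for the density of the total spin\<close>

lemma B2_nonneg: "0 \<le> B2"
proof -
  have "0 \<le> \<bar>V' 1 - V' 0\<bar>" by simp
  also have "\<dots> \<le> B2" using V'_lipschitz[of 1 0] by simp
  finally show ?thesis .
qed

lemma V_second_difference: "V (t + c) + V (t - c) \<le> 2 * V t + 2 * B2 * c\<^sup>2"
proof -
  have pos: "V (t + c) + V (t - c) \<le> 2 * V t + 2 * B2 * c\<^sup>2" if c: "0 < c" for c
  proof -
    obtain u where u: "t < u" "u < t + c" "V (t + c) - V t = (t + c - t) * V' u"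
      using MVT2[of t "t + c" V V'] V_deriv c by auto
    obtain v where v: "t - c < v" "v < t" "V t - V (t - c) = (t - (t - c)) * V' v"
      using MVT2[of "t - c" t V V'] V_deriv c by auto
    have "V' u - V' v \<le> B2 * (2 * c)"
      using V'_lipschitz[of u v] mult_left_mono[of "\<bar>u - v\<bar>" "2 * c" B2] u v B2_nonneg by linarith
    then have "c * (V' u - V' v) \<le> c * (B2 * (2 * c))" using c by (intro mult_left_mono) auto
    then show ?thesis using u(3) v(3) by (simp add: right_diff_distrib power2_eq_square mult_ac)
  qed
  consider "0 < c" | "c = 0" | "0 < - c" by linarith
  then show ?thesis using pos[of c] pos[of "- c"] by cases (auto simp: add.commute)
qed

text \<open>Per site and c^2, the second difference of the energy receives 1 from the diagonal, at
  most 1 from the couplings and 2 B2 from the bounded potential.\<close>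

definition "K1 = 2 + 2 * B2"

lemma K1_pos: "0 < K1" using B2_nonneg by (simp add: K1_def)

lemma W1_midpoint:
  "(W1 0 {1..int N} x)\<^sup>2 \<le> W1 0 {1..int N} (\<lambda>i. x i + c) * W1 0 {1..int N} (\<lambda>i. x i - c) * exp (K1 * (real N * c\<^sup>2))"
proof -
  let ?I = "{1..int N}"
  interpret G: gibbs ?I "coupling R h" "\<lambda>_. 0" V V' "\<delta> / 2" B B1 by (rule gibbs_single) simp
  have sq: "(\<Sum>i\<in>?I. (x i + c)\<^sup>2) + (\<Sum>i\<in>?I. (x i - c)\<^sup>2) = 2 * (\<Sum>i\<in>?I. (x i)\<^sup>2) + 2 * (real N * c\<^sup>2)"
    by (simp add: power2_sum power2_diff sum.distrib sum_subtractf sum_distrib_left mult_ac)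
  have "(\<Sum>i\<in>?I. \<Sum>j\<in>?I. J i j * (x i + c) * (x j + c)) + (\<Sum>i\<in>?I. \<Sum>j\<in>?I. J i j * (x i - c) * (x j - c))
    = (\<Sum>i\<in>?I. \<Sum>j\<in>?I. 2 * (J i j * x i * x j) + 2 * (J i j * c * c))"
    unfolding sum.distrib[symmetric] by (intro sum.cong refl) (simp add: algebra_simps)
  also have "\<dots> = 2 * (\<Sum>i\<in>?I. \<Sum>j\<in>?I. J i j * x i * x j) + 2 * (\<Sum>i\<in>?I. \<Sum>j\<in>?I. J i j * c * c)"
    by (simp only: sum.distrib sum_distrib_left)
  finally have JJ: "(\<Sum>i\<in>?I. \<Sum>j\<in>?I. J i j * (x i + c) * (x j + c)) + (\<Sum>i\<in>?I. \<Sum>j\<in>?I. J i j * (x i - c) * (x j - c))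
    = 2 * (\<Sum>i\<in>?I. \<Sum>j\<in>?I. J i j * x i * x j) + 2 * (\<Sum>i\<in>?I. \<Sum>j\<in>?I. J i j * c * c)" .
  have "(1 - \<delta>) * (real N * c\<^sup>2) \<le> 1 * (real N * c\<^sup>2)" using \<delta>_pos by (intro mult_right_mono) auto
  then have Jc: "(\<Sum>i\<in>?I. \<Sum>j\<in>?I. J i j * c * c) \<le> real N * c\<^sup>2"
    using J_quadratic_le[of ?I "\<lambda>_. c"] by (simp add: abs_le_iff)
  have "(\<Sum>i\<in>?I. V (x i + c)) + (\<Sum>i\<in>?I. V (x i - c)) \<le> (\<Sum>i\<in>?I. 2 * V (x i) + 2 * B2 * c\<^sup>2)"
    unfolding sum.distrib[symmetric] by (intro sum_mono V_second_difference)
  also have "\<dots> = 2 * (\<Sum>i\<in>?I. V (x i)) + 2 * B2 * (real N * c\<^sup>2)"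
    by (simp add: sum.distrib sum_distrib_left mult_ac)
  finally have VV: "(\<Sum>i\<in>?I. V (x i + c)) + (\<Sum>i\<in>?I. V (x i - c)) \<le> 2 * (\<Sum>i\<in>?I. V (x i)) + 2 * B2 * (real N * c\<^sup>2)" .
  have arith: "1/2 * s1 + 1/2 * j1 + v1 + (1/2 * s2 + 1/2 * j2 + v2) \<le> 2 * (1/2 * s + 1/2 * j + v) + k"
    if "s1 + s2 = 2 * s + 2 * n" "j1 + j2 = 2 * j + 2 * jc" "jc \<le> n" "v1 + v2 \<le> 2 * v + b" "k = 2 * n + b"
    for s1 s2 s j1 j2 j v1 v2 v n jc b k :: real
    using that by (simp add: field_simps)
  have "K1 * (real N * c\<^sup>2) = 2 * (real N * c\<^sup>2) + 2 * B2 * (real N * c\<^sup>2)" by (simp add: K1_def distrib_right)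
  then have "G.H (\<lambda>i. x i + c) + G.H (\<lambda>i. x i - c) \<le> 2 * G.H x + K1 * (real N * c\<^sup>2)"
    unfolding H1_eq[OF finite_atLeastAtMost_int] mult_zero_left diff_zero by (rule arith[OF sq JJ Jc VV])
  moreover have "(G.W x)\<^sup>2 = exp (- 2 * G.H x)" by (simp add: G.W_def exp_double[symmetric])
  moreover have "G.W (\<lambda>i. x i + c) * G.W (\<lambda>i. x i - c) * exp (K1 * (real N * c\<^sup>2))
    = exp (- G.H (\<lambda>i. x i + c) + - G.H (\<lambda>i. x i - c) + K1 * (real N * c\<^sup>2))"
    by (simp only: G.W_def exp_add)
  ultimately show ?thesis by simp
qed

lemma nn_integral_plane_weight_translate:
  assumes N: "1 \<le> N"
  shows "(\<integral>\<^sup>+y. ennreal (W1 0 {1..int N} (\<lambda>i. plane_point N s y i + c)) \<partial>Leb {1..int N - 1})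
    = ennreal (canonical N (s + real N * c))"
proof -
  let ?I = "{1..int N}" and ?I' = "{1..int N - 1}"
  have "ennreal (canonical N (s + real N * c)) = (\<integral>\<^sup>+y. ennreal (W1 0 ?I (plane_point N (s + real N * c) y)) \<partial>Leb ?I')"
    by (rule nn_integral_plane_weight[OF N, symmetric])
  also have "\<dots> = ennreal (\<bar>1\<bar> ^ card ?I') * (\<integral>\<^sup>+y. ennreal (W1 0 ?I (plane_point N (s + real N * c) (\<lambda>i\<in>?I'. c + 1 * y i))) \<partial>Leb ?I')"
    using plane_weight_measurable' by (intro nn_integral_Leb_affine measurable_compose[OF _ measurable_ennreal]) auto
  also have "\<dots> = (\<integral>\<^sup>+y. ennreal (W1 0 ?I (\<lambda>i. plane_point N s y i + c)) \<partial>Leb ?I')"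
  proof -
    have "W1 0 ?I (plane_point N (s + real N * c) (\<lambda>i\<in>?I'. c + 1 * y i)) = W1 0 ?I (\<lambda>i. plane_point N s y i + c)" for y
      by (intro W1_cong plane_point_translate N) auto
    then show ?thesis by simp
  qed
  finally show ?thesis by simp
qed

text \<open>Moving the total spin by u shifts each of the N spins by u / N and costs an energy of
  order N (u / N)^2. The pointwise bound is integrated over the hyperplane with Cauchy-Schwarz, and
  translating the coordinates identifies the two factors.\<close>

theorem canonical_midpoint:
  assumes N: "1 \<le> N"
  shows "(canonical N s)\<^sup>2 \<le> canonical N (s + u) * canonical N (s - u) * exp (K1 * u\<^sup>2 / real N)"
proof -
  let ?I = "{1..int N}" and ?I' = "{1..int N - 1}"
  define c where "c = u / real N"
  have u: "real N * c = u" "real N * - c = - u" "real N * c\<^sup>2 = u\<^sup>2 / real N"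
    using N by (simp_all add: c_def power2_eq_square)
  let ?F = "\<lambda>y. W1 0 ?I (\<lambda>i. plane_point N s y i + c)"
  let ?G = "\<lambda>y. W1 0 ?I (\<lambda>i. plane_point N s y i + - c) * exp (K1 * (real N * c\<^sup>2))"
  have pos: "0 < W1 0 ?I x" for x by (rule W1_pos) simp
  have F: "0 < ?F y" and G: "0 < ?G y" for y using pos by simp_all
  have meas: "(\<lambda>y. W1 0 ?I (\<lambda>i. plane_point N s y i + c)) \<in> borel_measurable (Leb ?I')" for c
  proof -
    have "(\<lambda>y. W1 0 ?I (plane_point N (s + real N * c) (\<lambda>i\<in>?I'. c + 1 * y i))) \<in> borel_measurable (Leb ?I')"
      by (rule measurable_compose[OF _ plane_weight_measurable']) measurable
    moreover have "W1 0 ?I (plane_point N (s + real N * c) (\<lambda>i\<in>?I'. c + 1 * y i)) = W1 0 ?I (\<lambda>i. plane_point N s y i + c)" for y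
      by (intro W1_cong plane_point_translate N) auto
    ultimately show ?thesis by simp
  qed
  have [measurable]: "?F \<in> borel_measurable (Leb ?I')" by (rule meas)
  have [measurable]: "(\<lambda>y. W1 0 ?I (\<lambda>i. plane_point N s y i + - c)) \<in> borel_measurable (Leb ?I')" by (rule meas)
  have le: "W1 0 ?I (plane_point N s y) \<le> sqrt (?F y) * sqrt (?G y)" for y
  proof -
    have "(W1 0 ?I (plane_point N s y))\<^sup>2 \<le> ?F y * ?G y"
      using W1_midpoint[of N "plane_point N s y" c] by (simp add: mult.assoc)
    then show ?thesis using pos[of "plane_point N s y"]
      by (subst real_sqrt_mult[symmetric]) (intro real_le_rsqrt)
  qed
  have "ennreal ((canonical N s)\<^sup>2) = (\<integral>\<^sup>+y. ennreal (W1 0 ?I (plane_point N s y)) \<partial>Leb ?I')\<^sup>2"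
    using canonical_pos[OF N, of s] by (simp add: nn_integral_plane_weight[OF N] ennreal_power less_imp_le)
  also have "\<dots> \<le> (\<integral>\<^sup>+y. ennreal (sqrt (?F y)) * ennreal (sqrt (?G y)) \<partial>Leb ?I')\<^sup>2"
    using le F G by (intro power_mono nn_integral_mono) (auto simp: ennreal_mult[symmetric] less_imp_le)
  also have "\<dots> \<le> (\<integral>\<^sup>+y. (ennreal (sqrt (?F y)))\<^sup>2 \<partial>Leb ?I') * (\<integral>\<^sup>+y. (ennreal (sqrt (?G y)))\<^sup>2 \<partial>Leb ?I')"
    by (rule Cauchy_Schwarz_nn_integral) measurable
  also have "\<dots> = (\<integral>\<^sup>+y. ennreal (?F y) \<partial>Leb ?I') * (\<integral>\<^sup>+y. ennreal (?G y) \<partial>Leb ?I')"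
    using F G by (simp add: ennreal_power less_imp_le)
  also have "(\<integral>\<^sup>+y. ennreal (?F y) \<partial>Leb ?I') = ennreal (canonical N (s + u))"
    unfolding nn_integral_plane_weight_translate[OF N] u ..
  also have "(\<integral>\<^sup>+y. ennreal (?G y) \<partial>Leb ?I') = ennreal (canonical N (s - u)) * ennreal (exp (K1 * (real N * c\<^sup>2)))"
    using less_imp_le[OF pos] nn_integral_plane_weight_translate[OF N, of s "- c"] meas[of "- c"] u
    by (simp add: ennreal_mult nn_integral_multc)
  finally show ?thesis
    using canonical_pos[OF N] by (simp add: ennreal_mult[symmetric] less_imp_le u mult.assoc)
qed

section \<open>Two-sided bounds for the tilted density\<close>

definition tilted :: "nat \<Rightarrow> real \<Rightarrow> real \<Rightarrow> real" where
  "tilted N \<sigma> s = exp (\<sigma> * s) * canonical N s"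

lemma tilted_measurable [measurable]: "tilted N \<sigma> \<in> borel_measurable borel"
  unfolding tilted_def by measurable

lemma tilted_pos: "1 \<le> N \<Longrightarrow> 0 < tilted N \<sigma> s"
  by (simp add: tilted_def canonical_pos)

lemma tilted_midpoint:
  assumes "1 \<le> N"
  shows "(tilted N \<sigma> s)\<^sup>2 \<le> tilted N \<sigma> (s + u) * tilted N \<sigma> (s - u) * exp (K1 * u\<^sup>2 / real N)"
proof -
  have e: "exp (\<sigma> * (s + u)) * exp (\<sigma> * (s - u)) = (exp (\<sigma> * s))\<^sup>2"
    by (simp add: exp_add[symmetric] exp_double[symmetric] algebra_simps)
  have "(tilted N \<sigma> s)\<^sup>2 \<le> (exp (\<sigma> * s))\<^sup>2 * (canonical N (s + u) * canonical N (s - u) * exp (K1 * u\<^sup>2 / real N))"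
    unfolding tilted_def power_mult_distrib using canonical_midpoint[OF assms] by (intro mult_left_mono) auto
  then show ?thesis unfolding e[symmetric] tilted_def by (simp only: mult_ac)
qed

lemma nn_integral_tilted:
  "1 \<le> N \<Longrightarrow> (\<integral>\<^sup>+s. ennreal (tilted N \<sigma> s) \<partial>lborel) = ennreal (Z1 \<sigma> {1..int N})"
  unfolding tilted_def by (rule nn_integral_canonical_Z)

text \<open>The midpoint inequality says that q(s) exp (- K1 u^2 / (2 N)) is at most the mean of q(s
  + u) and q(s - u). Integrating over u gives a Gaussian of width sqrt N on the left and the total
  mass on the right.\<close>

lemma tilted_upper:
  assumes N: "1 \<le> N"
  shows "tilted N \<sigma> s * sqrt (2 * pi * real N / K1) \<le> Z1 \<sigma> {1..int N}"
proof -
  define a where "a = K1 / (2 * real N)"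
  have a: "0 < a" "pi / a = 2 * pi * real N / K1" using K1_pos N by (simp_all add: a_def)
  let ?q = "tilted N \<sigma>" and ?Z = "Z1 \<sigma> {1..int N}"
  have pos: "0 < ?q x" for x by (rule tilted_pos[OF N])
  have Z: "0 < ?Z" by (rule Z1_pos) simp
  have le: "?q s * exp (- (a * (u - 0)\<^sup>2)) \<le> 1/2 * ?q (s + 1 * u) + 1/2 * ?q (s + (-1) * u)" for u
  proof (rule power2_le_imp_le)
    have "(?q s * exp (- (a * (u - 0)\<^sup>2)))\<^sup>2 = (?q s)\<^sup>2 * exp (- (K1 * u\<^sup>2 / real N))"
      using N by (simp add: power_mult_distrib exp_double[symmetric] a_def)
    also have "\<dots> \<le> ?q (s + u) * ?q (s - u) * exp (K1 * u\<^sup>2 / real N) * exp (- (K1 * u\<^sup>2 / real N))"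
      by (intro mult_right_mono tilted_midpoint N) auto
    also have "\<dots> = ?q (s + u) * ?q (s - u)" by (simp add: mult.assoc exp_add[symmetric])
    also have "\<dots> \<le> (1/2 * ?q (s + u) + 1/2 * ?q (s - u))\<^sup>2"
      using zero_le_power2[of "?q (s + u) - ?q (s - u)"] by (simp add: power2_sum power2_diff power_mult_distrib power2_eq_square field_simps)
    finally show "(?q s * exp (- (a * (u - 0)\<^sup>2)))\<^sup>2 \<le> (1/2 * ?q (s + 1 * u) + 1/2 * ?q (s + (-1) * u))\<^sup>2" by simp
    show "0 \<le> 1/2 * ?q (s + 1 * u) + 1/2 * ?q (s + (-1) * u)" using pos by (intro add_nonneg_nonneg) (auto simp: less_imp_le)
  qed
  have half: "(\<integral>\<^sup>+u. ennreal (1/2 * ?q (s + c * u)) \<partial>lborel) = ennreal (1/2 * ?Z)" if c: "\<bar>c\<bar> = 1" for c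
  proof -
    have "(\<integral>\<^sup>+x. ennreal (1/2 * ?q x) \<partial>lborel) = ennreal \<bar>c\<bar> * (\<integral>\<^sup>+u. ennreal (1/2 * ?q (s + c * u)) \<partial>lborel)"
      using c by (intro nn_integral_real_affine) auto
    moreover have "(\<integral>\<^sup>+x. ennreal (1/2 * ?q x) \<partial>lborel) = ennreal (1/2 * ?Z)"
      using pos nn_integral_tilted[OF N, of \<sigma>] Z by (simp add: ennreal_mult less_imp_le nn_integral_cmult del: times_divide_eq_left)
    ultimately show ?thesis using c by simp
  qed
  have "ennreal (?q s * sqrt (2 * pi * real N / K1)) = (\<integral>\<^sup>+u. ennreal (?q s * exp (- (a * (u - 0)\<^sup>2))) \<partial>lborel)"
    using nn_integral_gaussian[OF a(1), of 0] less_imp_le[OF pos] K1_pos a(2)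
    by (simp add: ennreal_mult'[OF less_imp_le[OF pos]] nn_integral_cmult)
  also have "\<dots> \<le> (\<integral>\<^sup>+u. ennreal (1/2 * ?q (s + 1 * u)) + ennreal (1/2 * ?q (s + (-1) * u)) \<partial>lborel)"
    using le pos by (intro nn_integral_mono) (simp add: ennreal_plus[symmetric] less_imp_le del: ennreal_plus)
  also have "\<dots> = (\<integral>\<^sup>+u. ennreal (1/2 * ?q (s + 1 * u)) \<partial>lborel) + (\<integral>\<^sup>+u. ennreal (1/2 * ?q (s + (-1) * u)) \<partial>lborel)"
    by (intro nn_integral_add) auto
  also have "\<dots> = ennreal ?Z"
    using half[of 1] half[of "-1"] Z by (simp add: ennreal_plus[symmetric] del: ennreal_plus)
  finally show ?thesis using Z by (simp add: ennreal_le_iff)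
qed

text \<open>With v = |cv| + 1: the square root comes from \<open>tilted_upper\<close>, the
  exponential from the midpoint inequality with u^2 / N <= 2 v, and 32 v from (4 \<rho>)^2 with
  \<rho>^2 = 2 v N.\<close>

definition "c_low = sqrt (2 * pi / K1) * exp (- (2 * (\<bar>cv\<bar> + 1) * K1)) / (32 * (\<bar>cv\<bar> + 1))"

lemma c_low_pos: "0 < c_low"
  using K1_pos by (simp add: c_low_def)

text \<open>
  By Chebyshev's inequality the tilted density is of order \<open>1 / \<surd>N\<close> somewhere within distance of order
  \<open>\<surd>N\<close> of the mean; the midpoint inequality and the upper bound carry this over to the mean.
\<close>

lemma tilted_lower:
  assumes N: "1 \<le> N" and s: "E1 \<sigma> {1..int N} (\<lambda>x. \<Sum>i\<in>{1..int N}. x i) = s"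
  shows "c_low * Z1 \<sigma> {1..int N} \<le> sqrt (real N) * tilted N \<sigma> s"
proof -
  let ?I = "{1..int N}"
  interpret G: gibbs ?I "coupling R h" "\<lambda>_. \<sigma>" V V' "\<delta> / 2" B B1 by (rule gibbs_single) simp
  let ?q = "tilted N \<sigma>" and ?S = "\<lambda>x. \<Sum>i\<in>?I. x i :: real"
  have pos: "0 < ?q x" for x by (rule tilted_pos[OF N])
  note Z = G.Z_pos
  define v where "v = \<bar>cv\<bar> + 1"
  have v: "1 \<le> v" "cv < v" by (auto simp: v_def)
  have cl: "c_low = sqrt (2 * pi / K1) * exp (- (2 * v * K1)) / (32 * v)" by (simp only: c_low_def v_def)
  \<comment> \<open>Twice a strict upper bound v N of the variance, so that less than half of the
    mass lies farther than \<rho> from the mean.\<close>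
  define \<rho> where "\<rho> = sqrt (2 * v * real N)"
  have \<rho>: "0 < \<rho>" "\<rho>\<^sup>2 = 2 * v * real N" using v N by (simp_all add: \<rho>_def)
  have int: "integrable (Leb ?I) (\<lambda>x. (?S x - s)\<^sup>2 * G.W x)"
  proof -
    have "integrable (Leb ?I) (\<lambda>x. (?S x)\<^sup>2 * G.W x - 2 * s * (?S x * G.W x) + s\<^sup>2 * G.W x)"
      using integrable_S_sq[of ?I \<sigma>] G.integrable_W
      by (intro Bochner_Integration.integrable_add Bochner_Integration.integrable_diff integrable_mult_right) auto
    moreover have "(\<lambda>x. (?S x)\<^sup>2 * G.W x - 2 * s * (?S x * G.W x) + s\<^sup>2 * G.W x) = (\<lambda>x. (?S x - s)\<^sup>2 * G.W x)"
      by (auto simp: power2_diff algebra_simps)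
    ultimately show ?thesis by simp
  qed
  have nn: "(\<integral>\<^sup>+x. ennreal ((x - s)\<^sup>2 * ?q x) \<partial>lborel) = ennreal (G.E (\<lambda>x. (?S x - s)\<^sup>2) * G.Z)"
    unfolding tilted_def by (rule nn_integral_canonical[OF N _ _ int]) auto
  have var: "G.E (\<lambda>x. (?S x - s)\<^sup>2) \<le> cv * real N"
    using variance_sum_le[of ?I \<sigma>] unfolding s by simp
  \<comment> \<open>If the density stayed below Z / (4 \<rho>) on the interval of length 2 \<rho>,
    that interval would carry at most half of the mass, and Chebyshev leaves less than half for the
    rest.\<close>
  have "\<exists>b. \<bar>b - s\<bar> \<le> \<rho> \<and> G.Z / (4 * \<rho>) \<le> ?q b"
  proof (rule ccontr)
    assume "\<not> ?thesis"
    then have small: "?q b \<le> G.Z / (4 * \<rho>)" if "\<bar>b - s\<bar> \<le> \<rho>" for b using that by (meson less_imp_le not_le)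
    have "ennreal G.Z = (\<integral>\<^sup>+x. ennreal (?q x) \<partial>lborel)" by (rule nn_integral_tilted[OF N, symmetric])
    also have "\<dots> \<le> (\<integral>\<^sup>+x. ennreal (G.Z / (4 * \<rho>)) * indicator {s - \<rho>..s + \<rho>} x + ennreal (1 / \<rho>\<^sup>2) * ennreal ((x - s)\<^sup>2 * ?q x) \<partial>lborel)"
    proof (rule nn_integral_mono)
      fix x
      show "ennreal (?q x) \<le> ennreal (G.Z / (4 * \<rho>)) * indicator {s - \<rho>..s + \<rho>} x + ennreal (1 / \<rho>\<^sup>2) * ennreal ((x - s)\<^sup>2 * ?q x)"
      proof (cases "\<bar>x - s\<bar> \<le> \<rho>")
        case True
        then have "ennreal (?q x) \<le> ennreal (G.Z / (4 * \<rho>))" by (intro ennreal_leI small)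
        moreover have "x \<in> {s - \<rho>..s + \<rho>}" using True by (auto simp: abs_le_iff)
        ultimately show ?thesis by (simp add: add_increasing2)
      next
        case False
        then have "\<rho>\<^sup>2 \<le> \<bar>x - s\<bar>\<^sup>2" using \<rho>(1) by (intro power_mono) auto
        then have "1 * ?q x \<le> (x - s)\<^sup>2 / \<rho>\<^sup>2 * ?q x"
          using \<rho>(1) less_imp_le[OF pos] by (intro mult_right_mono) auto
        then have "ennreal (?q x) \<le> ennreal (1 / \<rho>\<^sup>2 * ((x - s)\<^sup>2 * ?q x))" by (intro ennreal_leI) simp
        also have "\<dots> = ennreal (1 / \<rho>\<^sup>2) * ennreal ((x - s)\<^sup>2 * ?q x)"
          using less_imp_le[OF pos] by (intro ennreal_mult) auto
        finally show ?thesis by (simp add: add_increasing)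
      qed
    qed
    also have "\<dots> = ennreal (G.Z / (4 * \<rho>)) * emeasure lborel {s - \<rho>..s + \<rho>} + ennreal (1 / \<rho>\<^sup>2) * ennreal (G.E (\<lambda>x. (?S x - s)\<^sup>2) * G.Z)"
      by (subst nn_integral_add) (auto simp: nn_integral_cmult nn)
    also have "\<dots> \<le> ennreal (G.Z / (4 * \<rho>)) * ennreal (2 * \<rho>) + ennreal (1 / \<rho>\<^sup>2) * ennreal (\<bar>cv\<bar> * real N * G.Z)"
    proof (intro add_mono mult_left_mono ennreal_leI)
      have "cv * real N \<le> \<bar>cv\<bar> * real N" by (intro mult_right_mono) auto
      then show "G.E (\<lambda>x. (?S x - s)\<^sup>2) * G.Z \<le> \<bar>cv\<bar> * real N * G.Z" using var Z by (intro mult_right_mono) auto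
      show "emeasure lborel {s - \<rho>..s + \<rho>} \<le> ennreal (2 * \<rho>)" using \<rho>(1) by simp
    qed auto
    also have "\<dots> = ennreal (G.Z / (4 * \<rho>) * (2 * \<rho>) + 1 / \<rho>\<^sup>2 * (\<bar>cv\<bar> * real N * G.Z))"
      using \<rho>(1) Z by (simp add: ennreal_mult[symmetric] ennreal_plus[symmetric] del: ennreal_plus)
    finally have "G.Z \<le> G.Z / (4 * \<rho>) * (2 * \<rho>) + 1 / \<rho>\<^sup>2 * (\<bar>cv\<bar> * real N * G.Z)"
      using Z \<rho>(1) by (subst (asm) ennreal_le_iff) auto
    also have "\<dots> = G.Z / 2 + \<bar>cv\<bar> * G.Z / (2 * v)" unfolding \<rho>(2) using \<rho>(1) v N by (simp add: field_simps)
    also have "\<dots> < G.Z"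
    proof -
      have "\<bar>cv\<bar> * G.Z < v * G.Z" using Z by (simp add: v_def)
      then have "\<bar>cv\<bar> * G.Z / (2 * v) < G.Z / 2" using v(1) by (simp add: field_simps)
      then show ?thesis by linarith
    qed
    finally show False by simp
  qed
  then obtain b where b: "\<bar>b - s\<bar> \<le> \<rho>" "G.Z / (4 * \<rho>) \<le> ?q b" by blast
  let ?r = "sqrt (2 * pi * real N / K1)"
  have r: "0 < ?r" "sqrt (real N) * ?r = real N * sqrt (2 * pi / K1)"
    using K1_pos N by (simp_all add: real_sqrt_mult real_sqrt_divide)
  have "\<bar>s - b\<bar>\<^sup>2 \<le> \<rho>\<^sup>2" using b(1) by (intro power_mono) auto
  then have "(s - b)\<^sup>2 / real N \<le> 2 * v" unfolding \<rho>(2) using N by (simp add: field_simps)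
  then have "K1 * ((s - b)\<^sup>2 / real N) \<le> K1 * (2 * v)" using K1_pos by (intro mult_left_mono) auto
  then have ee: "exp (K1 * (s - b)\<^sup>2 / real N) \<le> exp (2 * v * K1)" by (simp add: mult_ac)
  \<comment> \<open>The midpoint inequality is centred at b with step s - b: one endpoint is s, the
    other is 2 b - s, where the density is controlled by \<open>tilted_upper\<close>.\<close>
  have "(G.Z / (4 * \<rho>))\<^sup>2 \<le> (?q b)\<^sup>2" using b(2) Z \<rho>(1) by (intro power_mono) auto
  also have "\<dots> \<le> ?q (b + (s - b)) * ?q (b - (s - b)) * exp (K1 * (s - b)\<^sup>2 / real N)"
    by (rule tilted_midpoint[OF N])
  also have "\<dots> \<le> ?q s * (G.Z / ?r) * exp (2 * v * K1)"
    using tilted_upper[OF N, of \<sigma> "b - (s - b)"] r(1) less_imp_le[OF pos] ee Z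
    by (intro mult_mono mult_nonneg_nonneg) (auto simp: field_simps)
  finally have "G.Z * G.Z / (16 * (2 * v * real N)) \<le> ?q s * (G.Z / ?r) * exp (2 * v * K1)"
    by (simp add: power_divide power_mult_distrib \<rho>(2)[symmetric] power2_eq_square)
  then have "G.Z * (G.Z / (16 * (2 * v * real N))) \<le> G.Z * (?q s * exp (2 * v * K1) / ?r)" by (simp add: mult_ac)
  then have "G.Z / (16 * (2 * v * real N)) \<le> ?q s * exp (2 * v * K1) / ?r" using Z by (simp only: mult_le_cancel_left_pos)
  then have "sqrt (real N) * (?r * exp (- (2 * v * K1))) * (G.Z / (16 * (2 * v * real N)))
     \<le> sqrt (real N) * (?r * exp (- (2 * v * K1))) * (?q s * exp (2 * v * K1) / ?r)"
    using r(1) by (intro mult_left_mono) auto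
  also have "\<dots> = sqrt (real N) * ?q s" using N K1_pos by (simp add: exp_minus)
  also have "sqrt (real N) * (?r * exp (- (2 * v * K1))) * (G.Z / (16 * (2 * v * real N)))
    = (sqrt (real N) * ?r) * exp (- (2 * v * K1)) * (G.Z / (16 * (2 * v * real N)))" by (simp only: mult.assoc)
  also have "\<dots> = c_low * G.Z" unfolding r(2) cl using N v(1) by (simp add: field_simps)
  finally show ?thesis .
qed

text \<open>A one-sided expansion with a remainder quadratic in t. It suffices for a first-order
  condition at a minimum, so \<open>D\<close> may depend on N and \<sigma>.\<close>

lemma Z1_second_order:
  "\<exists>D. \<forall>t. \<bar>t\<bar> \<le> 1 \<longrightarrow> Z1 (\<sigma> + t) {1..int N}
    \<le> Z1 \<sigma> {1..int N} * (1 + t * E1 \<sigma> {1..int N} (\<lambda>x. \<Sum>i\<in>{1..int N}. x i)) + t\<^sup>2 * D"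
proof (intro exI allI impI)
  let ?I = "{1..int N}"
  fix t :: real assume t: "\<bar>t\<bar> \<le> 1"
  interpret G: gibbs ?I "coupling R h" "\<lambda>_. \<sigma>" V V' "\<delta> / 2" B B1 by (rule gibbs_single) simp
  interpret Gt: gibbs ?I "coupling R h" "\<lambda>_. \<sigma> + t" V V' "\<delta> / 2" B B1 by (rule gibbs_single) simp
  let ?S = "\<lambda>x. \<Sum>i\<in>?I. x i :: real"
  let ?D = "\<integral>x. (?S x)\<^sup>2 * W1 (\<sigma> + 1) ?I x + (?S x)\<^sup>2 * W1 (\<sigma> + -1) ?I x \<partial>Leb ?I"
  note iS = integrable_S_sq[of ?I, OF finite_atLeastAtMost_int]
  have "Gt.Z \<le> (\<integral>x. (G.W x + t * (?S x * G.W x)) + t\<^sup>2 * ((?S x)\<^sup>2 * W1 (\<sigma> + 1) ?I x + (?S x)\<^sup>2 * W1 (\<sigma> + -1) ?I x) \<partial>Leb ?I)"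
    unfolding Gt.Z_def
  proof (rule integral_mono[OF Gt.integrable_W])
    show "integrable (Leb ?I) (\<lambda>x. (G.W x + t * (?S x * G.W x)) + t\<^sup>2 * ((?S x)\<^sup>2 * W1 (\<sigma> + 1) ?I x + (?S x)\<^sup>2 * W1 (\<sigma> + -1) ?I x))"
      by (intro Bochner_Integration.integrable_add integrable_mult_right iS G.integrable_W)
    fix x
    define y where "y = ?S x"
    \<comment> \<open>Lagrange's remainder. Since |t| <= 1, exp r is at most exp y + exp (- y), that
      is, the remainder is dominated by second moments at the fields \<sigma> + 1 and \<sigma> -
      1.\<close>
    obtain r where r: "\<bar>r\<bar> \<le> \<bar>t * y\<bar>" "exp (t * y) = (\<Sum>m<2. (t * y) ^ m / fact m) + exp r / fact 2 * (t * y) ^ 2"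
      using Maclaurin_exp_le by blast
    have "\<bar>t * y\<bar> \<le> \<bar>y\<bar>" using t by (simp add: abs_mult mult_left_le_one_le)
    then have "exp r \<le> exp \<bar>y\<bar>" using r(1) by simp
    also have "\<dots> \<le> exp y + exp (- y)" by (cases "0 \<le> y") auto
    also have "\<dots> \<le> 2 * (exp y + exp (- y))" by (simp add: add_nonneg_nonneg)
    finally have "exp r / 2 * (t * y)\<^sup>2 \<le> (exp y + exp (- y)) * (t * y)\<^sup>2" by (intro mult_right_mono) auto
    then have "exp (t * y) \<le> 1 + t * y + (exp y + exp (- y)) * (t * y)\<^sup>2"
      unfolding r(2) by (simp add: numeral_2_eq_2)
    then have "exp (t * y) * G.W x \<le> (1 + t * y + (exp y + exp (- y)) * (t * y)\<^sup>2) * G.W x"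
      using G.W_pos[of x] by (intro mult_right_mono) auto
    moreover have "exp (t * y) * G.W x = Gt.W x" "exp y * G.W x = W1 (\<sigma> + 1) ?I x" "exp (- y) * G.W x = W1 (\<sigma> + -1) ?I x"
      using W1_tilt[of ?I "\<sigma> + t" x \<sigma>] W1_tilt[of ?I "\<sigma> + 1" x \<sigma>] W1_tilt[of ?I "\<sigma> + -1" x \<sigma>] by (simp_all add: y_def)
    moreover have "(1 + t * y + (exp y + exp (- y)) * (t * y)\<^sup>2) * G.W x
      = (G.W x + t * (y * G.W x)) + t\<^sup>2 * (y\<^sup>2 * (exp y * G.W x) + y\<^sup>2 * (exp (- y) * G.W x))"
      by (simp add: power_mult_distrib algebra_simps)
    ultimately show "Gt.W x \<le> (G.W x + t * (?S x * G.W x)) + t\<^sup>2 * ((?S x)\<^sup>2 * W1 (\<sigma> + 1) ?I x + (?S x)\<^sup>2 * W1 (\<sigma> + -1) ?I x)"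
      unfolding y_def[symmetric] by (simp only:)
  qed
  also have "\<dots> = (\<integral>x. G.W x + t * (?S x * G.W x) \<partial>Leb ?I) + t\<^sup>2 * ?D"
    by (subst Bochner_Integration.integral_add)
      (intro Bochner_Integration.integrable_add integrable_mult_right iS G.integrable_W | simp)+
  also have "(\<integral>x. G.W x + t * (?S x * G.W x) \<partial>Leb ?I) = G.Z + t * (\<integral>x. ?S x * G.W x \<partial>Leb ?I)"
    unfolding G.Z_def by (subst Bochner_Integration.integral_add) (intro integrable_mult_right iS G.integrable_W | simp)+
  also have "\<dots> = G.Z * (1 + t * G.E ?S)" unfolding G.E_def using G.Z_pos by (simp add: field_simps)
  finally show "Gt.Z \<le> G.Z * (1 + t * G.E ?S) + t\<^sup>2 * ?D" .
qed

end

text \<open>Convexity supplies continuity; quadratic growth and the value at 0 confine the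
  minimiser. The explicit bound, linear in |m|, is what turns 1 + \<sigma>^2 into m^2 + 1 in the
  rate.\<close>

lemma coercive_convex_minimum:
  fixes f :: "real \<Rightarrow> real"
  assumes cvx: "convex_on UNIV f" and coer: "\<And>\<sigma>. \<sigma>\<^sup>2 / 4 - b \<le> f \<sigma>" and zero: "f 0 \<le> c"
  shows "\<exists>\<sigma>. \<bar>\<sigma>\<bar> \<le> 4 * (\<bar>m\<bar> + \<bar>b\<bar> + \<bar>c\<bar> + 1) \<and> (\<forall>\<sigma>'. f \<sigma> - \<sigma> * m \<le> f \<sigma>' - \<sigma>' * m)"
proof -
  \<comment> \<open>Beyond L the term \<sigma>'^2 / 4 exceeds \<sigma>' m by at least |b| + |c| + 1,
    so the function is already above its value at 0.\<close>
  define L where "L = 4 * (\<bar>m\<bar> + \<bar>b\<bar> + \<bar>c\<bar> + 1)"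
  have L: "4 \<le> L" by (simp add: L_def)
  have "continuous_on UNIV f" using cvx by (intro convex_on_continuous) auto
  then have "continuous_on {-L..L} (\<lambda>\<sigma>. f \<sigma> - \<sigma> * m)"
    by (intro continuous_intros) (rule continuous_on_subset, auto)
  moreover have "{-L..L} \<noteq> {}" using L by simp
  ultimately have "\<exists>\<sigma>\<in>{-L..L}. \<forall>\<sigma>'\<in>{-L..L}. f \<sigma> - \<sigma> * m \<le> f \<sigma>' - \<sigma>' * m"
    by (intro continuous_attains_inf) auto
  then obtain \<sigma> where \<sigma>: "\<sigma> \<in> {-L..L}" "\<And>\<sigma>'. \<sigma>' \<in> {-L..L} \<Longrightarrow> f \<sigma> - \<sigma> * m \<le> f \<sigma>' - \<sigma>' * m"
    by blast
  have "f \<sigma> - \<sigma> * m \<le> f \<sigma>' - \<sigma>' * m" for \<sigma>'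
  proof (cases "\<sigma>' \<in> {-L..L}")
    case False
    then have large: "L \<le> \<bar>\<sigma>'\<bar>" by auto
    have "\<bar>\<sigma>'\<bar> * L \<le> \<bar>\<sigma>'\<bar> * \<bar>\<sigma>'\<bar>" using large by (intro mult_left_mono) auto
    then have "\<bar>\<sigma>'\<bar> * (\<bar>m\<bar> + (\<bar>b\<bar> + \<bar>c\<bar> + 1)) \<le> \<sigma>'\<^sup>2 / 4" by (simp add: L_def power2_eq_square algebra_simps)
    moreover have "1 * (\<bar>b\<bar> + \<bar>c\<bar> + 1) \<le> \<bar>\<sigma>'\<bar> * (\<bar>b\<bar> + \<bar>c\<bar> + 1)" using large L by (intro mult_right_mono) auto
    moreover have "\<sigma>' * m \<le> \<bar>\<sigma>'\<bar> * \<bar>m\<bar>" using abs_ge_self[of "\<sigma>' * m"] by (simp add: abs_mult)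
    ultimately have "\<sigma>' * m + \<bar>b\<bar> + \<bar>c\<bar> + 1 \<le> \<sigma>'\<^sup>2 / 4" by (simp add: distrib_left)
    then have "c \<le> f \<sigma>' - \<sigma>' * m" using coer[of \<sigma>'] by linarith
    moreover have "f \<sigma> - \<sigma> * m \<le> c" using \<sigma>(2)[of 0] zero L by simp
    ultimately show ?thesis by linarith
  qed (rule \<sigma>(2))
  then show ?thesis using \<sigma>(1) by (intro exI[of _ \<sigma>]) (auto simp: L_def abs_le_iff)
qed

text \<open>The required field minimises log Z / N - \<sigma> m. Coercivity gives it a bound that
  does not depend on N, and stationarity says that the mean spin is N m.\<close>

lemma (in chain) tilt_exists:
  assumes N: "1 \<le> N"
  shows "\<exists>\<sigma>. \<bar>\<sigma>\<bar> \<le> 4 * (\<bar>m\<bar> + \<bar>B\<bar> + \<bar>cZ\<bar> + 1) \<and> E1 \<sigma> {1..int N} (\<lambda>x. \<Sum>i\<in>{1..int N}. x i) = real N * m"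
proof -
  have Zp: "0 < Z1 \<sigma> {1..int N}" for \<sigma> by (rule Z1_pos) simp
  let ?f = "\<lambda>\<sigma>. 1 / real N * logZ \<sigma> N"
  have "convex_on UNIV ?f" by (rule convex_on_cmul) (auto intro: convex_logZ)
  moreover have "\<sigma>\<^sup>2 / 4 - B \<le> ?f \<sigma>" for \<sigma>
  proof -
    have "ln (exp (real N * (\<sigma>\<^sup>2 / 4 - B))) \<le> logZ \<sigma> N"
      unfolding logZ_def using Z1_ge Zp by (subst ln_le_cancel_iff) auto
    then show ?thesis using N by (simp add: field_simps)
  qed
  moreover have "?f 0 \<le> cZ"
  proof -
    have "logZ 0 N \<le> ln (exp (real N * cZ))"
      unfolding logZ_def using Z1_zero_le Zp by (subst ln_le_cancel_iff) auto
    then show ?thesis using N by (simp add: field_simps)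
  qed
  ultimately obtain \<sigma> where \<sigma>: "\<bar>\<sigma>\<bar> \<le> 4 * (\<bar>m\<bar> + \<bar>B\<bar> + \<bar>cZ\<bar> + 1)"
    and min: "\<And>\<sigma>'. ?f \<sigma> - \<sigma> * m \<le> ?f \<sigma>' - \<sigma>' * m"
    using coercive_convex_minimum[of ?f B cZ m] by blast
  let ?Z = "Z1 \<sigma> {1..int N}" and ?e = "E1 \<sigma> {1..int N} (\<lambda>x. \<Sum>i\<in>{1..int N}. x i)"
  obtain D where D: "\<And>t. \<bar>t\<bar> \<le> 1 \<Longrightarrow> Z1 (\<sigma> + t) {1..int N} \<le> ?Z * (1 + t * ?e) + t\<^sup>2 * D"
    using Z1_second_order by blast
  \<comment> \<open>Minimality combined with the second-order upper bound. Dividing by small t of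
    either sign shows that the linear coefficient vanishes.\<close>
  have first: "t * (?Z * (real N * m - ?e)) \<le> t\<^sup>2 * D" if t: "\<bar>t\<bar> \<le> 1" for t
  proof -
    have "real N * (?f \<sigma> - \<sigma> * m) \<le> real N * (?f (\<sigma> + t) - (\<sigma> + t) * m)" using min by (intro mult_left_mono) auto
    then have "logZ \<sigma> N + t * (real N * m) \<le> logZ (\<sigma> + t) N"
      using N by (simp add: right_diff_distrib distrib_right distrib_left mult_ac)
    then have "ln (?Z * exp (t * (real N * m))) \<le> ln (Z1 (\<sigma> + t) {1..int N})"
      using Zp[of \<sigma>] by (simp add: ln_mult logZ_def)
    then have "?Z * exp (t * (real N * m)) \<le> Z1 (\<sigma> + t) {1..int N}"
      using Zp by (subst (asm) ln_le_cancel_iff) auto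
    moreover have "?Z * (1 + t * (real N * m)) \<le> ?Z * exp (t * (real N * m))"
      using Zp[of \<sigma>] by (intro mult_left_mono) auto
    ultimately have "?Z * (1 + t * (real N * m)) \<le> ?Z * (1 + t * ?e) + t\<^sup>2 * D" using D[OF t] by linarith
    then show ?thesis by (simp add: algebra_simps)
  qed
  have zero: "w \<le> 0" if "\<And>t. 0 < t \<Longrightarrow> t \<le> 1 \<Longrightarrow> w \<le> t * D" for w :: real
  proof (rule ccontr)
    assume "\<not> w \<le> 0"
    define t where "t = min 1 (w / (2 * (\<bar>D\<bar> + 1)))"
    have t: "0 < t" "t \<le> 1" "t \<le> w / (2 * (\<bar>D\<bar> + 1))" using \<open>\<not> w \<le> 0\<close> by (auto simp: t_def)
    have "t * D \<le> t * (\<bar>D\<bar> + 1)" using t(1) by (intro mult_left_mono) auto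
    also have "\<dots> \<le> w / (2 * (\<bar>D\<bar> + 1)) * (\<bar>D\<bar> + 1)" using t(3) by (intro mult_right_mono) auto
    also have "\<dots> = w / 2"
    proof -
      have "\<bar>D\<bar> + 1 \<noteq> 0" by linarith
      then show ?thesis by (simp add: field_simps)
    qed
    finally show False using that[OF t(1,2)] \<open>\<not> w \<le> 0\<close> by linarith
  qed
  let ?w = "?Z * (real N * m - ?e)"
  have "?w \<le> 0"
  proof (rule zero)
    fix t :: real assume that: "0 < t" "t \<le> 1"
    have "t * ?w \<le> t * (t * D)" using first[of t] that by (simp add: power2_eq_square mult.assoc)
    then show "?w \<le> t * D" using that(1) by (simp only: mult_le_cancel_left_pos)
  qed
  moreover have "- ?w \<le> 0"
  proof (rule zero)
    fix t :: real assume that: "0 < t" "t \<le> 1"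
    have "- t * ?w \<le> (- t)\<^sup>2 * D" using that by (intro first) auto
    then have "t * - ?w \<le> t * (t * D)" by (simp add: power2_eq_square mult.assoc)
    then show "- ?w \<le> t * D" using that(1) by (simp only: mult_le_cancel_left_pos)
  qed
  ultimately have "?w = 0" by linarith
  then have "?e = real N * m" using Zp[of \<sigma>] by simp
  then show ?thesis using \<sigma> by blast
qed

section \<open>Convergence of the coarse-grained Hamiltonian\<close>

lemma has_derivative_of_quadratic_error:
  fixes f :: "real \<Rightarrow> real"
  assumes "\<And>u. \<bar>f (x + u) - f x - d * u\<bar> \<le> K * u\<^sup>2"
  shows "(f has_real_derivative d) (at x)"
  unfolding DERIV_def
proof (rule LIM_zero_cancel, rule Lim_null_comparison)
  show "\<forall>\<^sub>F u in at 0. norm ((f (x + u) - f x) / u - d) \<le> K * \<bar>u\<bar>"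
  proof (rule eventually_at_filter[THEN iffD2], rule always_eventually, intro allI impI)
    fix u :: real assume u: "u \<noteq> 0"
    then have "(f (x + u) - f x) / u - d = (f (x + u) - f x - d * u) / u" by (simp add: field_simps)
    then have "norm ((f (x + u) - f x) / u - d) = \<bar>f (x + u) - f x - d * u\<bar> / \<bar>u\<bar>" by (simp add: abs_divide)
    also have "\<dots> \<le> K * u\<^sup>2 / \<bar>u\<bar>" using assms by (intro divide_right_mono) auto
    also have "\<dots> = K * \<bar>u\<bar>" using u by (simp add: power2_eq_square abs_if)
    finally show "norm ((f (x + u) - f x) / u - d) \<le> K * \<bar>u\<bar>" .
  qed
  have "((\<lambda>u. K * \<bar>u\<bar>) \<longlongrightarrow> K * \<bar>0\<bar>) (at (0 :: real))" by (intro tendsto_intros)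
  then show "((\<lambda>u. K * \<bar>u\<bar>) \<longlongrightarrow> 0) (at (0 :: real))" by simp
qed

context chain
begin

definition "coarse N m = - (1 / real N) * ln (sqrt (real N) * canonical N (real N * m))"

lemma coarse_eq:
  assumes "1 \<le> N"
  shows "real N * coarse N m = \<sigma> * (real N * m) - ln (sqrt (real N) * tilted N \<sigma> (real N * m))"
  using assms canonical_pos[OF assms, of "real N * m"] by (simp add: coarse_def tilted_def ln_mult)

text \<open>Available for every field, because the upper bound on the tilted density holds at every
  point. The factors sqrt N cancel, which leaves a constant.\<close>

lemma coarse_ge:
  assumes N: "1 \<le> N"
  shows "\<sigma> * (real N * m) - logZ \<sigma> N - \<bar>ln (sqrt (K1 / (2 * pi)))\<bar> \<le> real N * coarse N m"
proof -
  let ?r = "sqrt (K1 / (2 * pi))" and ?Z = "Z1 \<sigma> {1..int N}" and ?q = "tilted N \<sigma> (real N * m)"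
  have Z: "0 < ?Z" by (rule Z1_pos) simp
  have q: "0 < ?q" by (rule tilted_pos[OF N])
  have r: "0 < ?r" using K1_pos by simp
  have "sqrt (2 * pi * real N / K1) * ?r = sqrt (real N)"
    using K1_pos by (simp add: real_sqrt_mult[symmetric])
  then have "sqrt (real N) * ?q = ?q * sqrt (2 * pi * real N / K1) * ?r" by (metis mult.assoc mult.commute)
  also have "\<dots> \<le> ?Z * ?r" using tilted_upper[OF N] less_imp_le[OF r] by (rule mult_right_mono)
  finally have "ln (sqrt (real N) * ?q) \<le> ln (?Z * ?r)" using N q Z r by (subst ln_le_cancel_iff) auto
  then have "ln (sqrt (real N) * ?q) \<le> logZ \<sigma> N + ln ?r" by (simp only: ln_mult_pos[OF Z r] logZ_def)
  then show ?thesis unfolding coarse_eq[OF N, of m \<sigma>] by linarith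
qed

text \<open>The lower bound on the density holds at the mean only, so here the field has to match
  m.\<close>

lemma coarse_le:
  assumes N: "1 \<le> N" and e: "E1 \<sigma> {1..int N} (\<lambda>x. \<Sum>i\<in>{1..int N}. x i) = real N * m"
  shows "real N * coarse N m \<le> \<sigma> * (real N * m) - logZ \<sigma> N + \<bar>ln c_low\<bar>"
proof -
  let ?Z = "Z1 \<sigma> {1..int N}"
  have Z: "0 < ?Z" by (rule Z1_pos) simp
  have "ln (c_low * ?Z) \<le> ln (sqrt (real N) * tilted N \<sigma> (real N * m))"
    using tilted_lower[OF N e] N Z c_low_pos tilted_pos[OF N] by (subst ln_le_cancel_iff) auto
  then have "ln c_low + logZ \<sigma> N \<le> ln (sqrt (real N) * tilted N \<sigma> (real N * m))"
    using Z c_low_pos by (simp add: ln_mult logZ_def)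
  then show ?thesis unfolding coarse_eq[OF N, of m \<sigma>] by linarith
qed

lemma coarse_midpoint:
  assumes N: "1 \<le> N"
  shows "coarse N (m + u) + coarse N (m - u) - 2 * coarse N m \<le> K1 * u\<^sup>2"
proof -
  let ?z = "\<lambda>m. sqrt (real N) * canonical N (real N * m)"
  have z: "0 < ?z m" for m using canonical_pos[OF N] N by simp
  have "(canonical N (real N * m))\<^sup>2
    \<le> canonical N (real N * (m + u)) * canonical N (real N * (m - u)) * exp (K1 * (real N * u)\<^sup>2 / real N)"
    using canonical_midpoint[OF N, of "real N * m" "real N * u"] by (simp only: distrib_left right_diff_distrib)
  also have "(real N * u)\<^sup>2 = real N * (real N * u\<^sup>2)" by (simp add: power2_eq_square)
  also have "K1 * (real N * (real N * u\<^sup>2)) / real N = real N * (K1 * u\<^sup>2)" using N by simp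
  finally have "(sqrt (real N))\<^sup>2 * (canonical N (real N * m))\<^sup>2
    \<le> (sqrt (real N))\<^sup>2 * (canonical N (real N * (m + u)) * canonical N (real N * (m - u)) * exp (real N * (K1 * u\<^sup>2)))"
    by (intro mult_left_mono) auto
  then have "?z m * ?z m \<le> ?z (m + u) * ?z (m - u) * exp (real N * (K1 * u\<^sup>2))"
    by (simp only: power2_eq_square mult_ac)
  then have "ln (?z m * ?z m) \<le> ln (?z (m + u) * ?z (m - u) * exp (real N * (K1 * u\<^sup>2)))"
    by (subst ln_le_cancel_iff) (intro mult_pos_pos z exp_gt_zero | assumption)+
  also have "\<dots> = ln (?z (m + u)) + ln (?z (m - u)) + real N * (K1 * u\<^sup>2)"
    by (simp only: ln_mult_pos[OF mult_pos_pos[OF z z] exp_gt_zero] ln_mult_pos[OF z z] ln_exp)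
  also have "ln (?z m * ?z m) = 2 * ln (?z m)" by (simp only: ln_mult_pos[OF z z])
  finally have "2 * ln (?z m) - ln (?z (m + u)) - ln (?z (m - u)) \<le> real N * (K1 * u\<^sup>2)" by linarith
  then have "1 / real N * (2 * ln (?z m) - ln (?z (m + u)) - ln (?z (m - u))) \<le> 1 / real N * (real N * (K1 * u\<^sup>2))"
    by (intro mult_left_mono) auto
  also have "\<dots> = K1 * u\<^sup>2" using N by simp
  finally show ?thesis by (simp add: coarse_def right_diff_distrib)
qed

text \<open>Here \<sigma>^2 <= 16 (|m| + d)^2 <= 32 (m^2 + d^2), and the factor 4 / \<delta>^2 of
  \<open>m2\<close> makes this 128 / \<delta>^2.\<close>

lemma m2_le:
  assumes "\<bar>\<sigma>\<bar> \<le> 4 * (\<bar>m\<bar> + d)" "0 \<le> d"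
  shows "m2 \<sigma> \<le> (c1 + 128 / \<delta>\<^sup>2 * (1 + d\<^sup>2)) * (m\<^sup>2 + 1)"
proof -
  have "\<sigma>\<^sup>2 \<le> (4 * (\<bar>m\<bar> + d))\<^sup>2" using assms(1) power_mono[OF assms(1), of 2] by simp
  also have "\<dots> = 16 * (\<bar>m\<bar> + d)\<^sup>2" by (simp only: power_mult_distrib) simp
  also have "(\<bar>m\<bar> + d)\<^sup>2 \<le> 2 * (m\<^sup>2 + d\<^sup>2)"
    using zero_le_power2[of "\<bar>m\<bar> - d"] by (simp add: power2_sum power2_diff)
  also have "m\<^sup>2 + d\<^sup>2 \<le> (1 + d\<^sup>2) * (m\<^sup>2 + 1)" by (simp add: algebra_simps)
  finally have "\<sigma>\<^sup>2 \<le> 32 * ((1 + d\<^sup>2) * (m\<^sup>2 + 1))" by simp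
  then have "4 / \<delta>\<^sup>2 * \<sigma>\<^sup>2 \<le> 4 / \<delta>\<^sup>2 * (32 * ((1 + d\<^sup>2) * (m\<^sup>2 + 1)))" by (intro mult_left_mono) auto
  moreover have "c1 * 1 \<le> c1 * (m\<^sup>2 + 1)" using \<delta>_pos by (intro mult_left_mono) (auto simp: c1_def)
  ultimately show ?thesis by (simp add: m2_def distrib_right mult.assoc)
qed

text \<open>The two bounds use different fields: the lower one the optimiser \<open>T m\<close> of
  the limiting Legendre problem, the upper one the field matching m at size N. The latter need not
  be optimal in the limit, but any field gives at most \<phi> m.\<close>

theorem coarse_convergence:
  "\<exists>\<phi>. (\<forall>m. \<phi> differentiable (at m)) \<and> (\<forall>m. (\<lambda>N. coarse N m) \<longlonglongrightarrow> \<phi> m) \<and>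
     (\<exists>C>0. \<forall>N\<ge>1. \<forall>m. \<bar>coarse N m - \<phi> m\<bar> \<le> C * ((m\<^sup>2 + 1) / real N))"
proof -
  obtain A where A: "\<And>\<sigma> N. \<bar>logZ \<sigma> N - real N * A \<sigma>\<bar> \<le> real R * m2 \<sigma>" "convex_on UNIV A"
    "\<And>\<sigma>. \<sigma>\<^sup>2 / 4 - B \<le> A \<sigma>" "A 0 \<le> cZ"
    using free_energy_exists by blast
  define d where "d = \<bar>B\<bar> + \<bar>cZ\<bar> + 1"
  have d: "0 \<le> d" by (simp add: d_def)
  have "\<exists>\<sigma>. \<bar>\<sigma>\<bar> \<le> 4 * (\<bar>m\<bar> + d) \<and> (\<forall>\<sigma>'. A \<sigma> - \<sigma> * m \<le> A \<sigma>' - \<sigma>' * m)" for m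
    using coercive_convex_minimum[OF A(2,3,4), of m] by (simp add: d_def add.assoc)
  then obtain T where T: "\<And>m. \<bar>T m\<bar> \<le> 4 * (\<bar>m\<bar> + d)" "\<And>m \<sigma>. A (T m) - T m * m \<le> A \<sigma> - \<sigma> * m"
    by metis
  define \<phi> where "\<phi> m = T m * m - A (T m)" for m
  have sup: "\<sigma> * m - A \<sigma> \<le> \<phi> m" for \<sigma> m using T(2)[of m \<sigma>] by (simp add: \<phi>_def)
  define c where "c = real R * (c1 + 128 / \<delta>\<^sup>2 * (1 + d\<^sup>2))"
  have c: "real R * m2 \<sigma> \<le> c * (m\<^sup>2 + 1)" if "\<bar>\<sigma>\<bar> \<le> 4 * (\<bar>m\<bar> + d)" for \<sigma> m
    using mult_left_mono[OF m2_le[OF that d], of "real R"] by (simp add: c_def mult.assoc)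
  \<comment> \<open>The constants of the local bounds; the summand 1 makes C positive.\<close>
  define k where "k = \<bar>ln (sqrt (K1 / (2 * pi)))\<bar> + \<bar>ln c_low\<bar> + 1"
  have k: "k \<le> k * (m\<^sup>2 + 1)" for m :: real
    using mult_left_mono[of 1 "m\<^sup>2 + 1" k] by (simp add: k_def)
  define C where "C = c + k"
  have "0 < C"
  proof -
    have "0 \<le> c" using \<delta>_pos by (simp add: c_def c1_def)
    then show ?thesis by (simp add: C_def k_def)
  qed
  have main: "\<bar>real N * coarse N m - real N * \<phi> m\<bar> \<le> C * (m\<^sup>2 + 1)" if N: "1 \<le> N" for N m
  proof -
    have C: "c * (m\<^sup>2 + 1) + k \<le> C * (m\<^sup>2 + 1)" using k[of m] by (simp add: C_def distrib_right)
    have "real N * \<phi> m = T m * (real N * m) - real N * A (T m)" by (simp add: \<phi>_def right_diff_distrib)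
    then have lower: "real N * \<phi> m - (c * (m\<^sup>2 + 1) + k) \<le> real N * coarse N m"
      using coarse_ge[OF N, of "T m" m] A(1)[of "T m" N] c[OF T(1)[of m]] unfolding k_def by linarith
    \<comment> \<open>This field depends on N, but its bound does not, so replacing log Z by N A
      costs the same multiple of m^2 + 1.\<close>
    obtain \<sigma> where \<sigma>: "\<bar>\<sigma>\<bar> \<le> 4 * (\<bar>m\<bar> + d)" "E1 \<sigma> {1..int N} (\<lambda>x. \<Sum>i\<in>{1..int N}. x i) = real N * m"
      using tilt_exists[OF N, of m] by (auto simp: d_def add.assoc)
    have "real N * (\<sigma> * m - A \<sigma>) \<le> real N * \<phi> m" by (intro mult_left_mono sup) simp
    moreover have "real N * (\<sigma> * m - A \<sigma>) = \<sigma> * (real N * m) - real N * A \<sigma>" by (simp add: right_diff_distrib)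
    ultimately have "real N * coarse N m \<le> real N * \<phi> m + (c * (m\<^sup>2 + 1) + k)"
      using coarse_le[OF N \<sigma>(2)] A(1)[of \<sigma> N] c[OF \<sigma>(1)] unfolding k_def by linarith
    then show ?thesis using lower C by linarith
  qed
  have rate: "\<bar>coarse N m - \<phi> m\<bar> \<le> C * ((m\<^sup>2 + 1) / real N)" if N: "1 \<le> N" for N m
  proof -
    have "real N * \<bar>coarse N m - \<phi> m\<bar> = \<bar>real N * coarse N m - real N * \<phi> m\<bar>"
      by (simp add: right_diff_distrib[symmetric] abs_mult)
    then show ?thesis using main[OF N, of m] N by (simp add: field_simps)
  qed
  have lim: "(\<lambda>N. coarse N m) \<longlonglongrightarrow> \<phi> m" for m
  proof (rule LIM_zero_cancel, rule Lim_null_comparison)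
    show "\<forall>\<^sub>F N in sequentially. norm (coarse N m - \<phi> m) \<le> C * (m\<^sup>2 + 1) / real N"
      using eventually_ge_at_top[of 1] by eventually_elim (use rate in auto)
    show "(\<lambda>N. C * (m\<^sup>2 + 1) / real N) \<longlonglongrightarrow> 0" by (rule lim_const_over_n)
  qed
  have "(\<phi> has_real_derivative T m) (at m)" for m
  \<comment> \<open>\<open>T m\<close> is the slope of a supporting line of \<phi> at m, which gives
    the lower bound 0 for the error. The midpoint inequality in the limit, with the supporting line
    at - u, gives the upper bound K1 u^2.\<close>
  proof (rule has_derivative_of_quadratic_error)
    fix u
    have sub: "T m * u \<le> \<phi> (m + u) - \<phi> m" for u
      using sup[of "T m" "m + u"] by (simp add: \<phi>_def distrib_left)
    have "\<phi> (m + u) + \<phi> (m - u) - 2 * \<phi> m \<le> K1 * u\<^sup>2"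
    proof (rule LIMSEQ_le_const2)
      show "(\<lambda>N. coarse N (m + u) + coarse N (m - u) - 2 * coarse N m) \<longlonglongrightarrow> \<phi> (m + u) + \<phi> (m - u) - 2 * \<phi> m"
        by (intro tendsto_intros lim)
      show "\<exists>N. \<forall>n\<ge>N. coarse n (m + u) + coarse n (m - u) - 2 * coarse n m \<le> K1 * u\<^sup>2"
        using coarse_midpoint by blast
    qed
    then show "\<bar>\<phi> (m + u) - \<phi> m - T m * u\<bar> \<le> K1 * u\<^sup>2"
      using sub[of u] sub[of "- u"] by simp
  qed
  then have "\<phi> differentiable (at m)" for m using real_differentiable_def by blast
  then show ?thesis using lim rate \<open>0 < C\<close> by blast
qed

section \<open>Identification with the stated Hamiltonian\<close>

lemma hamiltonian_eq:
  assumes \<psi>: "\<And>z. \<psi> z = 1/2 * z\<^sup>2 + V z" and x: "\<And>j. j \<notin> {1..int N} \<Longrightarrow> x j = 0"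
  shows "exp (- hamiltonian R h \<psi> N x) = W1 0 {1..int N} x"
proof -
  let ?I = "{1..int N}"
  interpret G: gibbs ?I "coupling R h" "\<lambda>_. 0" V V' "\<delta> / 2" B B1 by (rule gibbs_single) simp
  \<comment> \<open>Neighbours outside the chain contribute 0 because the configuration vanishes
    there; sites of the chain out of range contribute 0 because \<open>J\<close> does.\<close>
  have "(\<Sum>j\<in>neighbours R i. coupling R h i j * x i * x j) = (\<Sum>j\<in>?I. J i j * x i * x j)" for i
  proof (rule sum.mono_neutral_cong)
    show "finite (neighbours R i)"
      by (rule finite_subset[of _ "{i - int R..i + int R}"]) (auto simp: neighbours_def)
    show "J i j * x i * x j = 0" if "j \<in> ?I - neighbours R i" for j
      using that J_far[of i j] by (cases "i = j") (auto simp: neighbours_def J_def abs_minus_commute)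
    show "coupling R h i j * x i * x j = J i j * x i * x j" if "j \<in> neighbours R i \<inter> ?I" for j
      using that by (auto simp: neighbours_def J_def)
  qed (use x in auto)
  then have "hamiltonian R h \<psi> N x = G.H x"
    unfolding hamiltonian_def H1_eq[OF finite_atLeastAtMost_int] \<psi>
    by (simp add: sum.distrib sum_distrib_left)
  then show ?thesis by (simp add: G.W_def)
qed

lemma coarse_hamiltonian_eq:
  assumes N: "1 \<le> N" and \<psi>: "\<And>z. \<psi> z = 1/2 * z\<^sup>2 + V z"
  shows "coarse_hamiltonian R h \<psi> N m = coarse N m"
proof -
  have eq: "exp (- hamiltonian R h \<psi> N (plane_point N s y)) = W1 0 {1..int N} (plane_point N s y)" for s y
    using N by (intro hamiltonian_eq \<psi>) (auto simp: plane_point_def)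
  have "(\<integral>x. exp (- hamiltonian R h \<psi> N x) \<partial>hausdorff_measure (eucl_dist N) (hyperplane N m) (N - 1))
    = sqrt (real N) * canonical N (real N * m)"
    unfolding canonical_def eq[symmetric]
    by (rule integral_hyperplane[OF N]) (simp only: eq plane_weight_measurable')
  then show ?thesis by (simp add: coarse_hamiltonian_def coarse_def)
qed

end

theorem proposition3p8:
  fixes R :: nat and \<delta> :: real and h :: "int \<Rightarrow> real" and \<psi>\<^sub>b \<psi> :: "real \<Rightarrow> real"
  assumes "\<delta> > 0"
    and "\<And>k. -1 < h k \<and> h k < 1"
    and "\<And>z. \<psi>\<^sub>b differentiable (at z)"
    and "\<And>z. deriv \<psi>\<^sub>b differentiable (at z)"
    and "bounded (range \<psi>\<^sub>b)"
    and "bounded (range (deriv \<psi>\<^sub>b))"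
    and "bounded (range (deriv (deriv \<psi>\<^sub>b)))"
    and "\<And>z. \<psi> z = 1/2 * z\<^sup>2 + \<psi>\<^sub>b z"
    and "\<And>(N::nat) i. i \<in> {1..int N} \<Longrightarrow>
           (\<Sum>j\<in>neighbours R i. \<bar>coupling R h i j\<bar>) + \<delta> \<le> 1"
  shows "\<exists>\<phi> :: real \<Rightarrow> real.
           (\<forall>m. \<phi> differentiable (at m)) \<and>
           (\<forall>m. (\<lambda>N. coarse_hamiltonian R h \<psi> N m) \<longlonglongrightarrow> \<phi> m) \<and>
           (\<exists>C>0. \<forall>N\<ge>1. \<forall>m.
              \<bar>coarse_hamiltonian R h \<psi> N m - \<phi> m\<bar> \<le> C * ((m\<^sup>2 + 1) / real N))"
proof -
  let ?V' = "deriv \<psi>\<^sub>b" and ?V'' = "deriv (deriv \<psi>\<^sub>b)"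
  obtain B B1 B2 where B: "\<And>t. \<bar>\<psi>\<^sub>b t\<bar> \<le> B" "\<And>t. \<bar>?V' t\<bar> \<le> B1" "\<And>t. \<bar>?V'' t\<bar> \<le> B2"
    using assms(5-7) unfolding bounded_iff by auto
  have D: "(\<psi>\<^sub>b has_real_derivative ?V' t) (at t)" "(?V' has_real_derivative ?V'' t) (at t)" for t
    using assms(3)[of t] assms(4)[of t] by (simp_all add: DERIV_deriv_iff_real_differentiable)
  \<comment> \<open>The bound on the second derivative enters through the mean value inequality, so
    continuity of that derivative plays no part.\<close>
  have lip: "\<bar>?V' t - ?V' u\<bar> \<le> B2 * \<bar>t - u\<bar>" for t u
    using field_differentiable_bound[of UNIV ?V' ?V'' B2 t u] D(2) B(3) by simp
  interpret chain R \<delta> h \<psi>\<^sub>b ?V' B B1 B2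
  proof
    show "(\<Sum>j\<in>neighbours R 1. \<bar>coupling R h 1 j\<bar>) + \<delta> \<le> 1" using assms(9)[of 1 1] by simp
    show "isCont ?V' t" for t using D(2) by (rule DERIV_isCont)
  qed (use assms(1) B D lip in auto)
  obtain \<phi> C where \<phi>: "\<And>m. \<phi> differentiable (at m)" "\<And>m. (\<lambda>N. coarse N m) \<longlonglongrightarrow> \<phi> m"
    "0 < C" "\<And>N m. 1 \<le> N \<Longrightarrow> \<bar>coarse N m - \<phi> m\<bar> \<le> C * ((m\<^sup>2 + 1) / real N)"
    using coarse_convergence by blast
  have eq: "coarse_hamiltonian R h \<psi> N m = coarse N m" if "1 \<le> N" for N m
    using that assms(8) by (rule coarse_hamiltonian_eq)
  have "(\<lambda>N. coarse_hamiltonian R h \<psi> N m) \<longlonglongrightarrow> \<phi> m" for m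
    \<comment> \<open>The two sequences are identified from N = 1 on; the value at N = 0, with its
      divisions by zero, does not affect the limit.\<close>
    by (rule Lim_transform_eventually[OF \<phi>(2)])
      (use eventually_ge_at_top[of 1] in eventually_elim, simp add: eq)
  then show ?thesis using \<phi> eq by (intro exI[of _ \<phi>] conjI exI[of _ C]) auto
qed

end
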